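(* The forgetful functor $\Pi^W_{\mathbb Q}:\mathrm{MHS}_{\mathbb Q}\to\mathcal F\mathrm{Vect}_{\mathbb Q}$ given by $(V,W,F)\mapsto(V,W)$ admits a factorization $\Pi^W_{\mathbb Q}=U^{fil}\circ G$, with $G:\mathrm{MHS}_{\mathbb Q}\to gr\mathrm{Vect}_{\mathbb Q}$ and $U^{fil}:gr\mathrm{Vect}_{\mathbb Q}\to\mathcal F\mathrm{Vect}_{\mathbb Q}$, into lax symmetric monoidal functors. In particular, there is an isomorphism of functors $U^{fil}\circ gr\circ\Pi^W_{\mathbb Q}\cong\Pi^W_{\mathbb Q}$, where $gr:\mathcal F\mathrm{Vect}_{\mathbb Q}\to gr\mathrm{Vect}_{\mathbb Q}$ is the graded functor given by $gr(V_{\mathbb Q},W)^p=Gr^W_pV_{\mathbb Q}$.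
   Context: $\mathrm{MHS}_{\mathbb Q}$ is the category of mixed Hodge structures on finite-dimensional $\mathbb Q$-vector spaces: triples $(V,W,F)$ with $W$ an increasing filtration of $V$ and $F$ a decreasing filtration of $V\otimes\mathbb C$ such that $F$ induces on each $Gr_m^WV=W_mV/W_{m-1}V$ ($m\in\mathbb Z$) a pure Hodge structure of weight $m$; morphisms are linear maps preserving $W$ and $F$; tensor product is given by the filtered tensor product. Filtrations are exhaustive and of finite length. $\mathcal F\mathrm{Vect}_{\mathbb Q}$ is the symmetric monoidal category of $\mathbb Q$-vector spaces with increasing filtration, $W_p(A\otimes B)=\sum_{i+j=p}\mathrm{Im}(W_iA\otimes W_jB\to A\otimes B)$. $gr\mathrm{Vect}_{\mathbb Q}$ is the symmetric monoidal category of $\mathbb Z$-graded $\mathbb Q$-vector spaces (no signs in the symmetry; here only objects with finitely many non-zero pieces occur). $U^{fil}$ sends $\bigoplus_nV^n$ to $(V,W)$ with $W_mV=\bigoplus_{n\le m}V^n$. The factorization is understood up to isomorphism of lax symmetric monoidal functors. *)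

theory Defs
  imports "HOL-Algebra.AbelCoset" "HOL-Algebra.Module" "HOL-Library.Poly_Mapping" "HOL-Library.Infinite_Typeclass"
begin

text \<open>
  A \<open>\<rat>\<close>-vector space is a module (in the sense of HOL-Algebra) over the field \<open>rat\<close>.  The type
  variable \<open>'u::infinite\<close> plays the role of a universe: the categories below consist of all vector
  spaces whose carrier is a subset of \<open>'u\<close>.  As \<open>'u\<close> is infinite, tensor products and finitely
  supported direct sums of such spaces again fit into \<open>'u\<close>; they are constructed on their natural
  carrier and then moved into \<open>'u\<close> along a chosen injection (\<open>embed\<close>, \<open>copy\<close>).
\<close>

section \<open>Symmetric monoidal categories and lax symmetric monoidal functors\<close>

record ('o, 'a) category =
  Obj :: "'o set"
  Arr :: "'a set"
  Dom :: "'a \<Rightarrow> 'o"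
  Cod :: "'a \<Rightarrow> 'o"
  ident :: "'o \<Rightarrow> 'a"
  Comp :: "'a \<Rightarrow> 'a \<Rightarrow> 'a"  (infixr \<open>\<cdot>\<index>\<close> 65)

record ('o, 'a) smc = "('o, 'a) category" +
  tens_obj :: "'o \<Rightarrow> 'o \<Rightarrow> 'o"  (infixr \<open>\<boxtimes>\<index>\<close> 70)
  tens_arr :: "'a \<Rightarrow> 'a \<Rightarrow> 'a"  (infixr \<open>\<boxdot>\<index>\<close> 70)
  unit_obj :: "'o"
  assoc :: "'o \<Rightarrow> 'o \<Rightarrow> 'o \<Rightarrow> 'a"
  lunit :: "'o \<Rightarrow> 'a"
  runit :: "'o \<Rightarrow> 'a"
  braid :: "'o \<Rightarrow> 'o \<Rightarrow> 'a"

definition hom_set :: "('o, 'a, 'z) category_scheme \<Rightarrow> 'o \<Rightarrow> 'o \<Rightarrow> 'a set" where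
  "hom_set C A B = {f \<in> Arr C. Dom C f = A \<and> Cod C f = B}"

definition iso_arr :: "('o, 'a, 'z) category_scheme \<Rightarrow> 'a \<Rightarrow> bool" where
  "iso_arr C f \<longleftrightarrow> f \<in> Arr C \<and>
     (\<exists>g \<in> hom_set C (Cod C f) (Dom C f).
        g \<cdot>\<^bsub>C\<^esub> f = ident C (Dom C f) \<and> f \<cdot>\<^bsub>C\<^esub> g = ident C (Cod C f))"

locale category =
  fixes C :: "('o, 'a, 'z) category_scheme" (structure)
  assumes dom_cod: "f \<in> Arr C \<Longrightarrow> Dom C f \<in> Obj C \<and> Cod C f \<in> Obj C"
    and ident_hom: "A \<in> Obj C \<Longrightarrow> ident C A \<in> hom_set C A A"
    and comp_hom: "\<lbrakk>f \<in> hom_set C A B; g \<in> hom_set C B D\<rbrakk> \<Longrightarrow> g \<cdot> f \<in> hom_set C A D"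
    and ident_left: "f \<in> hom_set C A B \<Longrightarrow> ident C B \<cdot> f = f"
    and ident_right: "f \<in> hom_set C A B \<Longrightarrow> f \<cdot> ident C A = f"
    and comp_assoc: "\<lbrakk>f \<in> hom_set C A B; g \<in> hom_set C B D; h \<in> hom_set C D E\<rbrakk>
      \<Longrightarrow> (h \<cdot> g) \<cdot> f = h \<cdot> (g \<cdot> f)"

locale symmetric_monoidal_category = category C
  for C :: "('o, 'a, 'z) smc_scheme" (structure) +
  assumes tens_obj: "\<lbrakk>A \<in> Obj C; B \<in> Obj C\<rbrakk> \<Longrightarrow> A \<boxtimes> B \<in> Obj C"
    and tens_arr: "\<lbrakk>f \<in> hom_set C A A'; g \<in> hom_set C B B'\<rbrakk>
      \<Longrightarrow> f \<boxdot> g \<in> hom_set C (A \<boxtimes> B) (A' \<boxtimes> B')"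
    and tens_ident: "\<lbrakk>A \<in> Obj C; B \<in> Obj C\<rbrakk>
      \<Longrightarrow> ident C A \<boxdot> ident C B = ident C (A \<boxtimes> B)"
    and tens_comp: "\<lbrakk>f \<in> hom_set C A A'; f' \<in> hom_set C A' A'';
        g \<in> hom_set C B B'; g' \<in> hom_set C B' B''\<rbrakk>
      \<Longrightarrow> (f' \<cdot> f) \<boxdot> (g' \<cdot> g) = (f' \<boxdot> g') \<cdot> (f \<boxdot> g)"
    and unit_obj: "unit_obj C \<in> Obj C"
    and assoc_hom: "\<lbrakk>A \<in> Obj C; B \<in> Obj C; D \<in> Obj C\<rbrakk>
      \<Longrightarrow> assoc C A B D \<in> hom_set C ((A \<boxtimes> B) \<boxtimes> D) (A \<boxtimes> (B \<boxtimes> D))"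
    and assoc_iso: "\<lbrakk>A \<in> Obj C; B \<in> Obj C; D \<in> Obj C\<rbrakk> \<Longrightarrow> iso_arr C (assoc C A B D)"
    and assoc_natural: "\<lbrakk>f \<in> hom_set C A A'; g \<in> hom_set C B B'; h \<in> hom_set C D D'\<rbrakk>
      \<Longrightarrow> assoc C A' B' D' \<cdot> ((f \<boxdot> g) \<boxdot> h) = (f \<boxdot> (g \<boxdot> h)) \<cdot> assoc C A B D"
    and lunit_hom: "A \<in> Obj C \<Longrightarrow> lunit C A \<in> hom_set C (unit_obj C \<boxtimes> A) A"
    and lunit_iso: "A \<in> Obj C \<Longrightarrow> iso_arr C (lunit C A)"
    and lunit_natural: "f \<in> hom_set C A A'
      \<Longrightarrow> lunit C A' \<cdot> (ident C (unit_obj C) \<boxdot> f) = f \<cdot> lunit C A"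
    and runit_hom: "A \<in> Obj C \<Longrightarrow> runit C A \<in> hom_set C (A \<boxtimes> unit_obj C) A"
    and runit_iso: "A \<in> Obj C \<Longrightarrow> iso_arr C (runit C A)"
    and runit_natural: "f \<in> hom_set C A A'
      \<Longrightarrow> runit C A' \<cdot> (f \<boxdot> ident C (unit_obj C)) = f \<cdot> runit C A"
    and braid_hom: "\<lbrakk>A \<in> Obj C; B \<in> Obj C\<rbrakk> \<Longrightarrow> braid C A B \<in> hom_set C (A \<boxtimes> B) (B \<boxtimes> A)"
    and braid_natural: "\<lbrakk>f \<in> hom_set C A A'; g \<in> hom_set C B B'\<rbrakk>
      \<Longrightarrow> braid C A' B' \<cdot> (f \<boxdot> g) = (g \<boxdot> f) \<cdot> braid C A B"
    and braid_symmetric: "\<lbrakk>A \<in> Obj C; B \<in> Obj C\<rbrakk>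
      \<Longrightarrow> braid C B A \<cdot> braid C A B = ident C (A \<boxtimes> B)"
    and pentagon: "\<lbrakk>A \<in> Obj C; B \<in> Obj C; D \<in> Obj C; E \<in> Obj C\<rbrakk>
      \<Longrightarrow> (ident C A \<boxdot> assoc C B D E) \<cdot> assoc C A (B \<boxtimes> D) E \<cdot> (assoc C A B D \<boxdot> ident C E)
          = assoc C A B (D \<boxtimes> E) \<cdot> assoc C (A \<boxtimes> B) D E"
    and triangle: "\<lbrakk>A \<in> Obj C; B \<in> Obj C\<rbrakk>
      \<Longrightarrow> (ident C A \<boxdot> lunit C B) \<cdot> assoc C A (unit_obj C) B = runit C A \<boxdot> ident C B"
    and hexagon: "\<lbrakk>A \<in> Obj C; B \<in> Obj C; D \<in> Obj C\<rbrakk>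
      \<Longrightarrow> assoc C B D A \<cdot> braid C A (B \<boxtimes> D) \<cdot> assoc C A B D
          = (ident C B \<boxdot> braid C A D) \<cdot> assoc C B A D \<cdot> (braid C A B \<boxdot> ident C D)"

record ('o, 'a, 'p, 'b) functor_data =
  on_obj :: "'o \<Rightarrow> 'p"
  on_arr :: "'a \<Rightarrow> 'b"

text \<open>\<open>lax_mult F A B : F A \<otimes> F B \<rightarrow> F (A \<otimes> B)\<close> and \<open>lax_unit F : 1 \<rightarrow> F 1\<close>.\<close>

record ('o, 'a, 'p, 'b) lax_functor_data = "('o, 'a, 'p, 'b) functor_data" +
  lax_mult :: "'o \<Rightarrow> 'o \<Rightarrow> 'b"
  lax_unit :: "'b"

locale functor_between = C: category C + D: category D
  for C :: "('o, 'a, 'y) category_scheme" and D :: "('p, 'b, 'z) category_scheme" +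
  fixes F :: "('o, 'a, 'p, 'b, 'w) functor_data_scheme"
  assumes on_obj: "A \<in> Obj C \<Longrightarrow> on_obj F A \<in> Obj D"
    and on_arr: "f \<in> hom_set C A B \<Longrightarrow> on_arr F f \<in> hom_set D (on_obj F A) (on_obj F B)"
    and on_ident: "A \<in> Obj C \<Longrightarrow> on_arr F (ident C A) = ident D (on_obj F A)"
    and on_comp: "\<lbrakk>f \<in> hom_set C A B; g \<in> hom_set C B E\<rbrakk>
      \<Longrightarrow> on_arr F (g \<cdot>\<^bsub>C\<^esub> f) = on_arr F g \<cdot>\<^bsub>D\<^esub> on_arr F f"

locale lax_symmetric_monoidal_functor =
  functor_between C D F + C: symmetric_monoidal_category C + D: symmetric_monoidal_category D
  for C :: "('o, 'a, 'y) smc_scheme" and D :: "('p, 'b, 'z) smc_scheme"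
    and F :: "('o, 'a, 'p, 'b, 'w) lax_functor_data_scheme" +
  assumes mult_hom: "\<lbrakk>A \<in> Obj C; B \<in> Obj C\<rbrakk> \<Longrightarrow>
      lax_mult F A B \<in> hom_set D (on_obj F A \<boxtimes>\<^bsub>D\<^esub> on_obj F B) (on_obj F (A \<boxtimes>\<^bsub>C\<^esub> B))"
    and mult_natural: "\<lbrakk>f \<in> hom_set C A A'; g \<in> hom_set C B B'\<rbrakk> \<Longrightarrow>
      lax_mult F A' B' \<cdot>\<^bsub>D\<^esub> (on_arr F f \<boxdot>\<^bsub>D\<^esub> on_arr F g)
        = on_arr F (f \<boxdot>\<^bsub>C\<^esub> g) \<cdot>\<^bsub>D\<^esub> lax_mult F A B"
    and lax_unit_hom: "lax_unit F \<in> hom_set D (unit_obj D) (on_obj F (unit_obj C))"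
    and mult_assoc: "\<lbrakk>A \<in> Obj C; B \<in> Obj C; E \<in> Obj C\<rbrakk> \<Longrightarrow>
      on_arr F (assoc C A B E) \<cdot>\<^bsub>D\<^esub> lax_mult F (A \<boxtimes>\<^bsub>C\<^esub> B) E
          \<cdot>\<^bsub>D\<^esub> (lax_mult F A B \<boxdot>\<^bsub>D\<^esub> ident D (on_obj F E))
        = lax_mult F A (B \<boxtimes>\<^bsub>C\<^esub> E) \<cdot>\<^bsub>D\<^esub> (ident D (on_obj F A) \<boxdot>\<^bsub>D\<^esub> lax_mult F B E)
          \<cdot>\<^bsub>D\<^esub> assoc D (on_obj F A) (on_obj F B) (on_obj F E)"
    and mult_lunit: "A \<in> Obj C \<Longrightarrow>
      on_arr F (lunit C A) \<cdot>\<^bsub>D\<^esub> lax_mult F (unit_obj C) A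
          \<cdot>\<^bsub>D\<^esub> (lax_unit F \<boxdot>\<^bsub>D\<^esub> ident D (on_obj F A))
        = lunit D (on_obj F A)"
    and mult_runit: "A \<in> Obj C \<Longrightarrow>
      on_arr F (runit C A) \<cdot>\<^bsub>D\<^esub> lax_mult F A (unit_obj C)
          \<cdot>\<^bsub>D\<^esub> (ident D (on_obj F A) \<boxdot>\<^bsub>D\<^esub> lax_unit F)
        = runit D (on_obj F A)"
    and mult_braid: "\<lbrakk>A \<in> Obj C; B \<in> Obj C\<rbrakk> \<Longrightarrow>
      on_arr F (braid C A B) \<cdot>\<^bsub>D\<^esub> lax_mult F A B
        = lax_mult F B A \<cdot>\<^bsub>D\<^esub> braid D (on_obj F A) (on_obj F B)"

definition comp_functor ::
  "('p, 'b, 'q, 'c, 'w) functor_data_scheme \<Rightarrow> ('o, 'a, 'p, 'b, 'v) functor_data_scheme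
     \<Rightarrow> ('o, 'a, 'q, 'c) functor_data" where
  "comp_functor G F = \<lparr>on_obj = on_obj G \<circ> on_obj F, on_arr = on_arr G \<circ> on_arr F\<rparr>"

definition comp_lax ::
  "('q, 'c, 'z) smc_scheme \<Rightarrow> ('p, 'b, 'q, 'c, 'w) lax_functor_data_scheme
     \<Rightarrow> ('o, 'a, 'p, 'b, 'v) lax_functor_data_scheme \<Rightarrow> ('o, 'a, 'q, 'c) lax_functor_data" where
  "comp_lax E G F = \<lparr>on_obj = on_obj G \<circ> on_obj F, on_arr = on_arr G \<circ> on_arr F,
     lax_mult = (\<lambda>A B. on_arr G (lax_mult F A B) \<cdot>\<^bsub>E\<^esub> lax_mult G (on_obj F A) (on_obj F B)),
     lax_unit = on_arr G (lax_unit F) \<cdot>\<^bsub>E\<^esub> lax_unit G\<rparr>"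

definition natural_iso ::
  "('o, 'a, 'y) category_scheme \<Rightarrow> ('p, 'b, 'z) category_scheme
     \<Rightarrow> ('o, 'a, 'p, 'b, 'v) functor_data_scheme \<Rightarrow> ('o, 'a, 'p, 'b, 'w) functor_data_scheme
     \<Rightarrow> ('o \<Rightarrow> 'b) \<Rightarrow> bool" where
  "natural_iso C D F G \<alpha> \<longleftrightarrow>
     (\<forall>A \<in> Obj C. \<alpha> A \<in> hom_set D (on_obj F A) (on_obj G A) \<and> iso_arr D (\<alpha> A)) \<and>
     (\<forall>A B. \<forall>f \<in> hom_set C A B. \<alpha> B \<cdot>\<^bsub>D\<^esub> on_arr F f = on_arr G f \<cdot>\<^bsub>D\<^esub> \<alpha> A)"

definition monoidal_natural_iso ::
  "('o, 'a, 'y) smc_scheme \<Rightarrow> ('p, 'b, 'z) smc_scheme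
     \<Rightarrow> ('o, 'a, 'p, 'b, 'v) lax_functor_data_scheme
     \<Rightarrow> ('o, 'a, 'p, 'b, 'w) lax_functor_data_scheme \<Rightarrow> ('o \<Rightarrow> 'b) \<Rightarrow> bool" where
  "monoidal_natural_iso C D F G \<alpha> \<longleftrightarrow> natural_iso C D F G \<alpha> \<and>
     (\<forall>A \<in> Obj C. \<forall>B \<in> Obj C.
        \<alpha> (A \<boxtimes>\<^bsub>C\<^esub> B) \<cdot>\<^bsub>D\<^esub> lax_mult F A B = lax_mult G A B \<cdot>\<^bsub>D\<^esub> (\<alpha> A \<boxdot>\<^bsub>D\<^esub> \<alpha> B)) \<and>
     \<alpha> (unit_obj C) \<cdot>\<^bsub>D\<^esub> lax_unit F = lax_unit G"


section \<open>Linear algebra over a field given by a type\<close>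

definition type_ring :: "'k::field ring" where
  "type_ring = \<lparr>carrier = UNIV, mult = (*), one = 1, zero = 0, add = (+)\<rparr>"

abbreviation vec_space :: "('k::field, 'v) module \<Rightarrow> bool" where
  "vec_space V \<equiv> Module.module type_ring V"

abbreviation subspace_of :: "'v set \<Rightarrow> ('k::field, 'v) module \<Rightarrow> bool" where
  "subspace_of N V \<equiv> submodule N type_ring V"

definition linear_span :: "('k::field, 'v) module \<Rightarrow> 'v set \<Rightarrow> 'v set" where
  "linear_span V S = \<Inter>{N. subspace_of N V \<and> S \<subseteq> N}"

definition fin_dim :: "('k::field, 'v) module \<Rightarrow> bool" where
  "fin_dim V \<longleftrightarrow> (\<exists>B. finite B \<and> B \<subseteq> carrier V \<and> linear_span V B = carrier V)"

definition sub :: "('k, 'v) module \<Rightarrow> 'v set \<Rightarrow> ('k, 'v) module" where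
  "sub V N = V\<lparr>carrier := N\<rparr>"

text \<open>Linear maps are extensional functions on the carrier, so that they are equal as soon as they
  agree on it.\<close>

definition lin :: "('k::field, 'v) module \<Rightarrow> ('k, 'w) module \<Rightarrow> ('v \<Rightarrow> 'w) set" where
  "lin V W = {f \<in> carrier V \<rightarrow>\<^sub>E carrier W.
     (\<forall>x \<in> carrier V. \<forall>y \<in> carrier V. f (x \<oplus>\<^bsub>V\<^esub> y) = f x \<oplus>\<^bsub>W\<^esub> f y) \<and>
     (\<forall>c. \<forall>x \<in> carrier V. f (c \<odot>\<^bsub>V\<^esub> x) = c \<odot>\<^bsub>W\<^esub> f x)}"

definition bilin ::
  "('k::field, 'v) module \<Rightarrow> ('k, 'w) module \<Rightarrow> ('k, 'x) module \<Rightarrow> ('v \<Rightarrow> 'w \<Rightarrow> 'x) set" where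
  "bilin V W X = {\<beta> \<in> carrier V \<rightarrow>\<^sub>E lin W X.
     \<forall>y \<in> carrier W. (\<lambda>x \<in> carrier V. \<beta> x y) \<in> lin V X}"

definition quot :: "('k, 'v) module \<Rightarrow> 'v set \<Rightarrow> ('k, 'v set) module" where
  "quot V N = \<lparr>carrier = a_rcosets\<^bsub>V\<^esub> N, mult = undefined, one = undefined,
     zero = N, add = set_add V, smult = (\<lambda>c X. \<Union>x \<in> X. N +>\<^bsub>V\<^esub> (c \<odot>\<^bsub>V\<^esub> x))\<rparr>"

definition direct_sum :: "('i \<Rightarrow> ('k, 'v) module) \<Rightarrow> ('k, 'i \<Rightarrow> 'v) module" where
  "direct_sum X =
     \<lparr>carrier = {s. (\<forall>i. s i \<in> carrier (X i)) \<and> finite {i. s i \<noteq> \<zero>\<^bsub>X i\<^esub>}},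
      mult = undefined, one = undefined, zero = (\<lambda>i. \<zero>\<^bsub>X i\<^esub>),
      add = (\<lambda>s t i. s i \<oplus>\<^bsub>X i\<^esub> t i), smult = (\<lambda>c s i. c \<odot>\<^bsub>X i\<^esub> s i)\<rparr>"

text \<open>A field of characteristic zero as a \<open>\<rat>\<close>-vector space; used for \<open>\<rat>\<close> and \<open>\<complex>\<close>.\<close>

definition field_space :: "(rat, 'l::field_char_0) module" where
  "field_space = \<lparr>carrier = UNIV, mult = (*), one = 1, zero = 0, add = (+),
     smult = (\<lambda>q z. of_rat q * z)\<rparr>"


subsection \<open>Tensor products over \<open>\<rat>\<close>\<close>

definition free_space :: "'x set \<Rightarrow> (rat, 'x \<Rightarrow>\<^sub>0 rat) module" where
  "free_space X = \<lparr>carrier = {p. Poly_Mapping.keys p \<subseteq> X}, mult = undefined, one = undefined,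
     zero = 0, add = (+), smult = (\<lambda>c. Poly_Mapping.map ((*) c))\<rparr>"

abbreviation gen :: "'x \<Rightarrow> ('x \<Rightarrow>\<^sub>0 rat)" where
  "gen x \<equiv> Poly_Mapping.single x 1"

definition tensor_relations ::
  "(rat, 'a) module \<Rightarrow> (rat, 'b) module \<Rightarrow> ('a \<times> 'b \<Rightarrow>\<^sub>0 rat) set" where
  "tensor_relations A B = linear_span (free_space (carrier A \<times> carrier B))
     ({gen (x \<oplus>\<^bsub>A\<^esub> x', y) - gen (x, y) - gen (x', y) | x x' y.
          x \<in> carrier A \<and> x' \<in> carrier A \<and> y \<in> carrier B} \<union>
      {gen (x, y \<oplus>\<^bsub>B\<^esub> y') - gen (x, y) - gen (x, y') | x y y'.
          x \<in> carrier A \<and> y \<in> carrier B \<and> y' \<in> carrier B} \<union>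
      {gen (c \<odot>\<^bsub>A\<^esub> x, y) - Poly_Mapping.single (x, y) c | c x y.
          x \<in> carrier A \<and> y \<in> carrier B} \<union>
      {gen (x, c \<odot>\<^bsub>B\<^esub> y) - Poly_Mapping.single (x, y) c | c x y.
          x \<in> carrier A \<and> y \<in> carrier B})"

definition tens ::
  "(rat, 'a) module \<Rightarrow> (rat, 'b) module \<Rightarrow> (rat, ('a \<times> 'b \<Rightarrow>\<^sub>0 rat) set) module" where
  "tens A B = quot (free_space (carrier A \<times> carrier B)) (tensor_relations A B)"

definition pure ::
  "(rat, 'a) module \<Rightarrow> (rat, 'b) module \<Rightarrow> 'a \<Rightarrow> 'b \<Rightarrow> ('a \<times> 'b \<Rightarrow>\<^sub>0 rat) set" where
  "pure A B x y = tensor_relations A B +>\<^bsub>free_space (carrier A \<times> carrier B)\<^esub> gen (x, y)"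

definition tens_map ::
  "(rat, 'a) module \<Rightarrow> (rat, 'b) module \<Rightarrow> (rat, 'c) module \<Rightarrow> (rat, 'd) module
     \<Rightarrow> ('a \<Rightarrow> 'c) \<Rightarrow> ('b \<Rightarrow> 'd) \<Rightarrow> ('a \<times> 'b \<Rightarrow>\<^sub>0 rat) set \<Rightarrow> ('c \<times> 'd \<Rightarrow>\<^sub>0 rat) set" where
  "tens_map A B A' B' f g = (THE h. h \<in> lin (tens A B) (tens A' B') \<and>
     (\<forall>x \<in> carrier A. \<forall>y \<in> carrier B. h (pure A B x y) = pure A' B' (f x) (g y)))"


subsection \<open>Complexification\<close>

type_synonym 'v cplx = "('v \<times> complex \<Rightarrow>\<^sub>0 rat) set"

definition complexify :: "(rat, 'v) module \<Rightarrow> (complex, 'v cplx) module" where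
  "complexify V = (let T = tens V (field_space :: (rat, complex) module) in
     \<lparr>carrier = carrier T, mult = undefined, one = undefined, zero = zero T, add = add T,
      smult = (\<lambda>c. tens_map V field_space V field_space (\<lambda>x. x) (\<lambda>z. c * z))\<rparr>)"

definition conj_map :: "(rat, 'v) module \<Rightarrow> 'v cplx \<Rightarrow> 'v cplx" where
  "conj_map V = tens_map V field_space V field_space (\<lambda>x. x) cnj"

definition complexify_map ::
  "(rat, 'v) module \<Rightarrow> (rat, 'w) module \<Rightarrow> ('v \<Rightarrow> 'w) \<Rightarrow> 'v cplx \<Rightarrow> 'w cplx" where
  "complexify_map V W f = tens_map V field_space W field_space f (\<lambda>z. z)"


subsection \<open>The symmetric monoidal structure inside the universe \<open>'u\<close>\<close>

definition embed :: "('k, 'v) module \<Rightarrow> 'v \<Rightarrow> 'u" where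
  "embed X = (SOME e. inj_on e (carrier X))"

definition unembed :: "('k, 'v) module \<Rightarrow> 'u \<Rightarrow> 'v" where
  "unembed X = inv_into (carrier X) (embed X)"

definition copy :: "('k, 'v) module \<Rightarrow> ('k, 'u) module" where
  "copy X = \<lparr>carrier = embed X ` carrier X, mult = undefined, one = undefined,
     zero = embed X (zero X),
     add = (\<lambda>a b. embed X (unembed X a \<oplus>\<^bsub>X\<^esub> unembed X b)),
     smult = (\<lambda>c a. embed X (c \<odot>\<^bsub>X\<^esub> unembed X a))\<rparr>"

type_synonym 'u qvs = "(rat, 'u) module"

definition tensor :: "'u qvs \<Rightarrow> 'u qvs \<Rightarrow> 'u qvs" where
  "tensor A B = copy (tens A B)"

definition tpure :: "'u qvs \<Rightarrow> 'u qvs \<Rightarrow> 'u \<Rightarrow> 'u \<Rightarrow> 'u" where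
  "tpure A B x y = embed (tens A B) (pure A B x y)"

definition tensor_map ::
  "'u qvs \<Rightarrow> 'u qvs \<Rightarrow> 'u qvs \<Rightarrow> 'u qvs \<Rightarrow> ('u \<Rightarrow> 'u) \<Rightarrow> ('u \<Rightarrow> 'u) \<Rightarrow> 'u \<Rightarrow> 'u" where
  "tensor_map A B A' B' f g = (THE h. h \<in> lin (tensor A B) (tensor A' B') \<and>
     (\<forall>x \<in> carrier A. \<forall>y \<in> carrier B. h (tpure A B x y) = tpure A' B' (f x) (g y)))"

definition unit_space :: "'u qvs" where
  "unit_space = copy (field_space :: (rat, rat) module)"

definition assoc_map :: "'u qvs \<Rightarrow> 'u qvs \<Rightarrow> 'u qvs \<Rightarrow> 'u \<Rightarrow> 'u" where
  "assoc_map A B C = (THE h. h \<in> lin (tensor (tensor A B) C) (tensor A (tensor B C)) \<and>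
     (\<forall>x \<in> carrier A. \<forall>y \<in> carrier B. \<forall>z \<in> carrier C.
        h (tpure (tensor A B) C (tpure A B x y) z) = tpure A (tensor B C) x (tpure B C y z)))"

definition lunit_map :: "'u qvs \<Rightarrow> 'u \<Rightarrow> 'u" where
  "lunit_map A = (THE h. h \<in> lin (tensor unit_space A) A \<and>
     (\<forall>q. \<forall>x \<in> carrier A.
        h (tpure unit_space A (embed (field_space :: (rat, rat) module) q) x) = q \<odot>\<^bsub>A\<^esub> x))"

definition runit_map :: "'u qvs \<Rightarrow> 'u \<Rightarrow> 'u" where
  "runit_map A = (THE h. h \<in> lin (tensor A unit_space) A \<and>
     (\<forall>q. \<forall>x \<in> carrier A.
        h (tpure A unit_space x (embed (field_space :: (rat, rat) module) q)) = q \<odot>\<^bsub>A\<^esub> x))"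

definition braid_map :: "'u qvs \<Rightarrow> 'u qvs \<Rightarrow> 'u \<Rightarrow> 'u" where
  "braid_map A B = (THE h. h \<in> lin (tensor A B) (tensor B A) \<and>
     (\<forall>x \<in> carrier A. \<forall>y \<in> carrier B. h (tpure A B x y) = tpure B A y x))"

record ('o, 'm) arrow =
  Src :: "'o"
  Trg :: "'o"
  Fun :: "'m"

text \<open>The three categories differ only in the additional structure carried by a vector space.  Their
  arrows are linear maps of the underlying spaces \<open>us A\<close> satisfying a predicate \<open>pres\<close>, and all
  structure maps are those of the underlying spaces.\<close>

definition vs_smc ::
  "'o set \<Rightarrow> ('o \<Rightarrow> 'u qvs) \<Rightarrow> ('o \<Rightarrow> 'o \<Rightarrow> ('u \<Rightarrow> 'u) \<Rightarrow> bool) \<Rightarrow> ('o \<Rightarrow> 'o \<Rightarrow> 'o) \<Rightarrow> 'o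
     \<Rightarrow> ('o, ('o, 'u \<Rightarrow> 'u) arrow) smc" where
  "vs_smc X us pres T I =
     \<lparr>Obj = X,
      Arr = {f. Src f \<in> X \<and> Trg f \<in> X \<and> Fun f \<in> lin (us (Src f)) (us (Trg f))
               \<and> pres (Src f) (Trg f) (Fun f)},
      Dom = Src,
      Cod = Trg,
      ident = (\<lambda>A. \<lparr>Src = A, Trg = A, Fun = (\<lambda>x \<in> carrier (us A). x)\<rparr>),
      Comp = (\<lambda>g f. \<lparr>Src = Src f, Trg = Trg g,
                      Fun = compose (carrier (us (Src f))) (Fun g) (Fun f)\<rparr>),
      tens_obj = T,
      tens_arr = (\<lambda>f g. \<lparr>Src = T (Src f) (Src g), Trg = T (Trg f) (Trg g),
                    Fun = tensor_map (us (Src f)) (us (Src g)) (us (Trg f)) (us (Trg g))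
                            (Fun f) (Fun g)\<rparr>),
      unit_obj = I,
      assoc = (\<lambda>A B C. \<lparr>Src = T (T A B) C, Trg = T A (T B C),
                         Fun = assoc_map (us A) (us B) (us C)\<rparr>),
      lunit = (\<lambda>A. \<lparr>Src = T I A, Trg = A, Fun = lunit_map (us A)\<rparr>),
      runit = (\<lambda>A. \<lparr>Src = T A I, Trg = A, Fun = runit_map (us A)\<rparr>),
      braid = (\<lambda>A B. \<lparr>Src = T A B, Trg = T B A, Fun = braid_map (us A) (us B)\<rparr>)\<rparr>"

text \<open>\<open>\<Sum>\<^bsub>i+j=p\<^esub> Im (P\<^sub>i \<otimes> Q\<^sub>j \<rightarrow> A \<otimes> B)\<close>; both the filtration and the grading of a tensor product
  are given by this formula.\<close>

definition tensor_family ::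
  "'u qvs \<Rightarrow> 'u qvs \<Rightarrow> (int \<Rightarrow> 'u set) \<Rightarrow> (int \<Rightarrow> 'u set) \<Rightarrow> int \<Rightarrow> 'u set" where
  "tensor_family A B P Q p = linear_span (tensor A B)
     {tpure A B x y | i j x y. i + j = p \<and> x \<in> P i \<and> y \<in> Q j}"


section \<open>Filtered vector spaces\<close>

definition inc_filtration :: "('k::field, 'v) module \<Rightarrow> (int \<Rightarrow> 'v set) \<Rightarrow> bool" where
  "inc_filtration V W \<longleftrightarrow> (\<forall>m. subspace_of (W m) V) \<and> mono W \<and>
     (\<exists>m. W m = {\<zero>\<^bsub>V\<^esub>}) \<and> (\<exists>m. W m = carrier V)"

definition dec_filtration :: "('k::field, 'v) module \<Rightarrow> (int \<Rightarrow> 'v set) \<Rightarrow> bool" where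
  "dec_filtration V F \<longleftrightarrow> (\<forall>p. subspace_of (F p) V) \<and> antimono F \<and>
     (\<exists>p. F p = carrier V) \<and> (\<exists>p. F p = {\<zero>\<^bsub>V\<^esub>})"

record 'u fvs =
  space :: "'u qvs"
  weight :: "int \<Rightarrow> 'u set"

definition fvs_tensor :: "'u fvs \<Rightarrow> 'u fvs \<Rightarrow> 'u fvs" where
  "fvs_tensor A B = \<lparr>space = tensor (space A) (space B),
     weight = tensor_family (space A) (space B) (weight A) (weight B)\<rparr>"

definition unit_weight :: "int \<Rightarrow> 'u set" where
  "unit_weight m = (if m < 0 then {\<zero>\<^bsub>unit_space\<^esub>} else carrier unit_space)"

definition fvs_unit :: "'u fvs" where
  "fvs_unit = \<lparr>space = unit_space, weight = unit_weight\<rparr>"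

type_synonym 'u fvs_cat = "('u fvs, ('u fvs, 'u \<Rightarrow> 'u) arrow) smc"

definition FVect :: "'u::infinite fvs_cat" where
  "FVect = vs_smc {A. vec_space (space A) \<and> inc_filtration (space A) (weight A)} space
     (\<lambda>A B f. \<forall>m. f ` weight A m \<subseteq> weight B m) fvs_tensor fvs_unit"


section \<open>Graded vector spaces\<close>

text \<open>A graded vector space \<open>\<Oplus>\<^sub>n V\<^sup>n\<close> is given by the total space and its homogeneous subspaces.\<close>

record 'u gvs =
  total :: "'u qvs"
  piece :: "int \<Rightarrow> 'u set"

definition is_grading :: "'u qvs \<Rightarrow> (int \<Rightarrow> 'u set) \<Rightarrow> bool" where
  "is_grading V P \<longleftrightarrow> (\<forall>n. subspace_of (P n) V) \<and> finite {n. P n \<noteq> {\<zero>\<^bsub>V\<^esub>}} \<and>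
     (\<forall>v \<in> carrier V. \<exists>!s. s \<in> (\<Pi>\<^sub>E n \<in> {n. P n \<noteq> {\<zero>\<^bsub>V\<^esub>}}. P n) \<and>
        v = (\<Oplus>\<^bsub>V\<^esub>n \<in> {n. P n \<noteq> {\<zero>\<^bsub>V\<^esub>}}. s n))"

definition gvs_tensor :: "'u gvs \<Rightarrow> 'u gvs \<Rightarrow> 'u gvs" where
  "gvs_tensor A B = \<lparr>total = tensor (total A) (total B),
     piece = tensor_family (total A) (total B) (piece A) (piece B)\<rparr>"

definition gvs_unit :: "'u gvs" where
  "gvs_unit = \<lparr>total = unit_space,
     piece = (\<lambda>n. if n = 0 then carrier unit_space else {\<zero>\<^bsub>unit_space\<^esub>})\<rparr>"

type_synonym 'u gvs_cat = "('u gvs, ('u gvs, 'u \<Rightarrow> 'u) arrow) smc"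

definition GrVect :: "'u::infinite gvs_cat" where
  "GrVect = vs_smc {A. vec_space (total A) \<and> is_grading (total A) (piece A)} total
     (\<lambda>A B f. \<forall>n. f ` piece A n \<subseteq> piece B n) gvs_tensor gvs_unit"


section \<open>Mixed Hodge structures\<close>

text \<open>A pure Hodge structure of weight \<open>m\<close> on \<open>H\<close>: a filtration \<open>F\<close> of \<open>H\<^sub>\<complex>\<close> with
  \<open>H\<^sub>\<complex> = F\<^sup>p \<oplus> conj (F\<^sup>q)\<close> whenever \<open>p + q = m + 1\<close>.\<close>

definition pure_hodge :: "int \<Rightarrow> (rat, 'v) module \<Rightarrow> (int \<Rightarrow> 'v cplx set) \<Rightarrow> bool" where
  "pure_hodge m H F \<longleftrightarrow> dec_filtration (complexify H) F \<and>
     (\<forall>p q. p + q = m + 1 \<longrightarrow>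
        F p <+>\<^bsub>complexify H\<^esub> (conj_map H ` F q) = carrier (complexify H) \<and>
        F p \<inter> conj_map H ` F q = {\<zero>\<^bsub>complexify H\<^esub>})"

definition Gr :: "('u, 'z) fvs_scheme \<Rightarrow> int \<Rightarrow> (rat, 'u set) module" where
  "Gr A m = quot (sub (space A) (weight A m)) (weight A (m - 1))"

record 'u mhs = "'u fvs" +
  hodge :: "int \<Rightarrow> 'u cplx set"

text \<open>The filtration induced by \<open>F\<close> on \<open>Gr\<^sub>m \<otimes> \<complex>\<close>: the image of \<open>F\<^sup>p \<inter> (W\<^sub>m \<otimes> \<complex>)\<close>.\<close>

definition hodge_on_Gr :: "'u mhs \<Rightarrow> int \<Rightarrow> int \<Rightarrow> 'u set cplx set" where
  "hodge_on_Gr A m p = (let Wm = sub (space A) (weight A m) in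
     complexify_map Wm (Gr A m) (\<lambda>x. weight A (m - 1) +>\<^bsub>space A\<^esub> x) `
       {\<xi> \<in> carrier (complexify Wm). complexify_map Wm (space A) (\<lambda>x. x) \<xi> \<in> hodge A p})"

definition is_mhs :: "'u mhs \<Rightarrow> bool" where
  "is_mhs A \<longleftrightarrow> vec_space (space A) \<and> fin_dim (space A) \<and>
     inc_filtration (space A) (weight A) \<and> dec_filtration (complexify (space A)) (hodge A) \<and>
     (\<forall>m. pure_hodge m (Gr A m) (hodge_on_Gr A m))"

text \<open>The canonical \<open>\<complex>\<close>-bilinear map \<open>A\<^sub>\<complex> \<times> B\<^sub>\<complex> \<rightarrow> (A \<otimes> B)\<^sub>\<complex>\<close>, which identifies
  \<open>(A \<otimes> B)\<^sub>\<complex>\<close> with \<open>A\<^sub>\<complex> \<otimes>\<^sub>\<complex> B\<^sub>\<complex>\<close>.\<close>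

definition cplx_tpure :: "'u qvs \<Rightarrow> 'u qvs \<Rightarrow> 'u cplx \<Rightarrow> 'u cplx \<Rightarrow> 'u cplx" where
  "cplx_tpure A B = (THE \<beta>.
     \<beta> \<in> bilin (complexify A) (complexify B) (complexify (tensor A B)) \<and>
     (\<forall>x \<in> carrier A. \<forall>y \<in> carrier B. \<forall>z w.
        \<beta> (pure A field_space x z) (pure B field_space y w)
          = pure (tensor A B) field_space (tpure A B x y) (z * w)))"

definition mhs_tensor :: "'u mhs \<Rightarrow> 'u mhs \<Rightarrow> 'u mhs" where
  "mhs_tensor A B = \<lparr>space = tensor (space A) (space B),
     weight = tensor_family (space A) (space B) (weight A) (weight B),
     hodge = (\<lambda>p. linear_span (complexify (tensor (space A) (space B)))
       {cplx_tpure (space A) (space B) x y | i j x y.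
          i + j = p \<and> x \<in> hodge A i \<and> y \<in> hodge B j})\<rparr>"

definition mhs_unit :: "'u mhs" where
  "mhs_unit = \<lparr>space = unit_space, weight = unit_weight,
     hodge = (\<lambda>p. if p \<le> 0 then carrier (complexify unit_space)
                   else {\<zero>\<^bsub>complexify unit_space\<^esub>})\<rparr>"

type_synonym 'u mhs_cat = "('u mhs, ('u mhs, 'u \<Rightarrow> 'u) arrow) smc"

definition MHS :: "'u::infinite mhs_cat" where
  "MHS = vs_smc {A. is_mhs A} space
     (\<lambda>A B f. (\<forall>m. f ` weight A m \<subseteq> weight B m) \<and>
              (\<forall>p. complexify_map (space A) (space B) f ` hodge A p \<subseteq> hodge B p))
     mhs_tensor mhs_unit"


section \<open>The functors\<close>

type_synonym ('o, 'p, 'u) vs_functor =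
  "('o, ('o, 'u \<Rightarrow> 'u) arrow, 'p, ('p, 'u \<Rightarrow> 'u) arrow) functor_data"

type_synonym ('o, 'p, 'u) vs_lax_functor =
  "('o, ('o, 'u \<Rightarrow> 'u) arrow, 'p, ('p, 'u \<Rightarrow> 'u) arrow) lax_functor_data"

definition forget_hodge :: "'u mhs \<Rightarrow> 'u fvs" where
  "forget_hodge A = \<lparr>space = space A, weight = weight A\<rparr>"

text \<open>The structure maps of \<open>Pi_W\<close> and \<open>U_fil\<close> are identities on the underlying spaces.\<close>

definition Pi_W :: "('u::infinite mhs, 'u fvs, 'u) vs_lax_functor" where
  "Pi_W = \<lparr>on_obj = forget_hodge,
     on_arr = (\<lambda>f. \<lparr>Src = forget_hodge (Src f), Trg = forget_hodge (Trg f), Fun = Fun f\<rparr>),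
     lax_mult = (\<lambda>A B. \<lparr>Src = fvs_tensor (forget_hodge A) (forget_hodge B),
                         Trg = forget_hodge (mhs_tensor A B),
                         Fun = (\<lambda>x \<in> carrier (tensor (space A) (space B)). x)\<rparr>),
     lax_unit = \<lparr>Src = fvs_unit, Trg = forget_hodge mhs_unit,
                 Fun = (\<lambda>x \<in> carrier unit_space. x)\<rparr>\<rparr>"

definition filtered_of_graded :: "'u gvs \<Rightarrow> 'u fvs" where
  "filtered_of_graded A = \<lparr>space = total A,
     weight = (\<lambda>m. linear_span (total A) (\<Union>n \<in> {..m}. piece A n))\<rparr>"

definition U_fil :: "('u::infinite gvs, 'u fvs, 'u) vs_lax_functor" where
  "U_fil = \<lparr>on_obj = filtered_of_graded,
     on_arr = (\<lambda>f. \<lparr>Src = filtered_of_graded (Src f), Trg = filtered_of_graded (Trg f),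
                     Fun = Fun f\<rparr>),
     lax_mult = (\<lambda>A B. \<lparr>Src = fvs_tensor (filtered_of_graded A) (filtered_of_graded B),
                         Trg = filtered_of_graded (gvs_tensor A B),
                         Fun = (\<lambda>x \<in> carrier (tensor (total A) (total B)). x)\<rparr>),
     lax_unit = \<lparr>Src = fvs_unit, Trg = filtered_of_graded gvs_unit,
                 Fun = (\<lambda>x \<in> carrier unit_space. x)\<rparr>\<rparr>"

definition graded_of_filtered :: "'u fvs \<Rightarrow> 'u gvs" where
  "graded_of_filtered A = \<lparr>total = copy (direct_sum (Gr A)),
     piece = (\<lambda>p. embed (direct_sum (Gr A)) `
                {s \<in> carrier (direct_sum (Gr A)). \<forall>q. q \<noteq> p \<longrightarrow> s q = \<zero>\<^bsub>Gr A q\<^esub>})\<rparr>"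

definition Gr_map :: "'u fvs \<Rightarrow> ('u \<Rightarrow> 'u) \<Rightarrow> int \<Rightarrow> 'u set \<Rightarrow> 'u set" where
  "Gr_map B f p X = (\<Union>x \<in> X. weight B (p - 1) +>\<^bsub>space B\<^esub> f x)"

definition gr_functor :: "('u::infinite fvs, 'u gvs, 'u) vs_functor" where
  "gr_functor = \<lparr>on_obj = graded_of_filtered,
     on_arr = (\<lambda>f. \<lparr>Src = graded_of_filtered (Src f), Trg = graded_of_filtered (Trg f),
        Fun = (\<lambda>u \<in> carrier (total (graded_of_filtered (Src f))).
                 embed (direct_sum (Gr (Trg f)))
                   (\<lambda>p. Gr_map (Trg f) (Fun f) p (unembed (direct_sum (Gr (Src f))) u p)))\<rparr>)\<rparr>"

end

theory Submission
  imports Defs "HOL-Library.Countable"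
begin

text \<open>
  On the complexification \<open>V\<^sub>\<complex>\<close> of a mixed Hodge structure put
  \<open>D k = \<Sum>\<^sub>n W\<^sub>n \<inter> conj (F\<^bsup>n-k\<^esup>)\<close> and \<open>J k = F\<^bsup>k\<^esup> \<inter> D k\<close>.  Opposedness of \<open>F\<close> and its conjugate
  on the graded pieces gives \<open>F\<^bsup>p\<^esup> = \<Oplus>\<^bsub>k\<ge>p\<^esub> J k\<close>.  Let \<open>P\<close> act on \<open>J k\<close> as multiplication by \<open>k\<close>.
  Then \<open>P\<close> respects the weight filtration and \<open>P + conj P conj\<close> acts on \<open>Gr\<^sub>n\<close> as multiplication by
  \<open>n\<close>; conversely, an operator with these properties forces opposedness.  As \<open>F\<close>, \<open>W\<close>, hence
  \<open>J\<close>, are multiplicative, \<open>P\<close> is a derivation for the tensor product.  This shows that the tensor product of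
  mixed Hodge structures is one.

  Composing \<open>P + conj P conj\<close> with a \<open>\<rat>\<close>-linear retraction of \<open>\<complex>\<close> onto \<open>\<rat>\<close> yields a natural derivation
  of the rational space \<open>V\<close> that is still multiplication by \<open>n\<close> on \<open>Gr\<^sub>n\<close>.  Its eigenspaces grade \<open>V\<close>, naturally
  and multiplicatively, and split the weight filtration: this is the functor \<open>G\<close>, and \<open>U_fil \<circ> G\<close>
  agrees with the forgetful functor on objects and morphisms.
\<close>

text \<open>Opposedness is awkward to carry over to a tensor product, whose graded pieces are
  quotients that would have to be identified first; an operator is carried over by the Leibniz rule.
  The space \<open>J k\<close> is the sum over \<open>q\<close> of Deligne's components of type
  \<open>(k, q)\<close>. It is formed from \<open>W\<close>, \<open>F\<close> and the conjugate of
  \<open>F\<close> by sums and intersections, so every morphism respects it.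

  The operator \<open>P + conj P conj\<close> commutes with conjugation and hence is real, but it
  need not preserve the rational space: on an extension of Q(0) by Q(1) with period \<open>z\<close>
  it involves twice the real part of \<open>z\<close>. The retraction repairs this because all
  requirements (commutation with rational maps, the Leibniz rule on rational tensors, the effect on
  graded pieces) are linear equations with rational coefficients, inhomogeneous only through the
  integers \<open>n\<close>, which the retraction fixes. It is a choice resting on Zorn's lemma, but
  one choice serves all spaces, and this keeps the result natural.\<close>

section \<open>Vector spaces, subspaces and complements\<close>

lemma type_ring_simps [simp]:
 "carrier type_ring = UNIV" "add type_ring = (+)" "mult type_ring = (*)"
 "one type_ring = 1" "zero type_ring = 0"
 by (simp_all add: type_ring_def)

lemma cring_type_ring: "cring (type_ring :: 'k::field ring)"
 by (rule cringI; (rule abelian_groupI comm_monoidI)?)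
  (auto simp: algebra_simps intro: exI[of _ "- x" for x])

locale vspace =
 fixes V :: "('k::field, 'v) module" (structure)
 assumes vs: "vec_space V"

lemmas vsI = vspace.intro

sublocale vspace \<subseteq> Module.module type_ring V
 by (rule vs)

text \<open>Multiplication by -1 supplies additive inverses, so that no separate existence axiom has
  to be discharged by the caller.\<close>

lemma vec_spaceI:
 fixes V :: "('k::field, 'v) module" (structure)
 assumes "\<And>x y. x \<in> carrier V ==> y \<in> carrier V ==> x \<oplus> y \<in> carrier V"
  and "\<zero> \<in> carrier V"
  and "\<And>c x. x \<in> carrier V ==> c \<odot> x \<in> carrier V"
  and "\<And>x y z. x \<in> carrier V ==> y \<in> carrier V ==> z \<in> carrier V ==> (x \<oplus> y) \<oplus> z = x \<oplus> (y \<oplus> z)"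
  and "\<And>x y. x \<in> carrier V ==> y \<in> carrier V ==> x \<oplus> y = y \<oplus> x"
  and "\<And>x. x \<in> carrier V ==> \<zero> \<oplus> x = x"
  and "\<And>x. x \<in> carrier V ==> (- 1) \<odot> x \<oplus> x = \<zero>"
  and "\<And>a b x. x \<in> carrier V ==> (a + b) \<odot> x = a \<odot> x \<oplus> b \<odot> x"
  and "\<And>a x y. x \<in> carrier V ==> y \<in> carrier V ==> a \<odot> (x \<oplus> y) = a \<odot> x \<oplus> a \<odot> y"
  and "\<And>a b x. x \<in> carrier V ==> (a * b) \<odot> x = a \<odot> (b \<odot> x)"
  and "\<And>x. x \<in> carrier V ==> 1 \<odot> x = x"
 shows "vec_space V"
proof (rule moduleI)
 show "abelian_group V"
 proof (intro abelian_groupI)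
  show "\<exists>y\<in>carrier V. y \<oplus> x = \<zero>" if "x \<in> carrier V" for x
   using that assms(3,7) by blast
 qed (use assms in auto)
qed (use assms in \<open>auto simp: cring_type_ring\<close>)

context vspace
begin

lemma smult_closed' [simp, intro]: "x \<in> carrier V ==> c \<odot> x \<in> carrier V"
 by simp

lemma smult_add_left: "x \<in> carrier V ==> (a + b) \<odot> x = a \<odot> x \<oplus> b \<odot> x"
 using smult_l_distr[of a b x] by simp

lemma smult_add_right: "x \<in> carrier V ==> y \<in> carrier V ==> a \<odot> (x \<oplus> y) = a \<odot> x \<oplus> a \<odot> y"
 using smult_r_distr[of a x y] by simp

lemma smult_smult: "x \<in> carrier V ==> a \<odot> (b \<odot> x) = (a * b) \<odot> x"
 using smult_assoc1[of a b x] by simp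

lemma smult_1 [simp]: "x \<in> carrier V ==> 1 \<odot> x = x"
 using smult_one[of x] by simp

lemma smult_0 [simp]: "x \<in> carrier V ==> 0 \<odot> x = \<zero>"
 using smult_l_null[of x] by simp

lemma smult_zero [simp]: "a \<odot> \<zero> = \<zero>"
 using smult_r_null[of a] by simp

lemma smult_m1: "x \<in> carrier V ==> (- 1) \<odot> x = \<ominus> x"
 by (metis M.minus_equality ab_left_minus smult_1 smult_add_left smult_closed' smult_0)

lemma smult_neg: "x \<in> carrier V ==> (- a) \<odot> x = \<ominus> (a \<odot> x)"
 by (metis mult_minus1 smult_closed' smult_m1 smult_smult)

lemma smult_minus_right: "x \<in> carrier V ==> a \<odot> (\<ominus> x) = \<ominus> (a \<odot> x)"
 using smult_r_minus by simp

lemma smult_diff_left: "x \<in> carrier V ==> (a - b) \<odot> x = a \<odot> x \<ominus> b \<odot> x"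
 using smult_add_left[of x a "- b"] by (simp add: smult_neg a_minus_def)

lemma smult_diff_right: "x \<in> carrier V ==> y \<in> carrier V ==> a \<odot> (x \<ominus> y) = a \<odot> x \<ominus> a \<odot> y"
 by (simp add: a_minus_def smult_add_right smult_minus_right)

lemma diff_self [simp]: "x \<in> carrier V ==> x \<ominus> x = \<zero>"
 by (simp add: a_minus_def M.r_neg)

lemma diff_zero [simp]: "x \<in> carrier V ==> x \<ominus> \<zero> = x"
 by (simp add: a_minus_def)

lemma add_diff_cancel: "x \<in> carrier V ==> y \<in> carrier V ==> (x \<oplus> y) \<ominus> y = x"
 by (simp add: a_minus_def M.a_assoc M.r_neg)

lemma add_diff_cancel': "x \<in> carrier V ==> y \<in> carrier V ==> (x \<oplus> y) \<ominus> x = y"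
 by (metis add_diff_cancel M.a_comm)

lemma diff_add_cancel: "x \<in> carrier V ==> y \<in> carrier V ==> (x \<ominus> y) \<oplus> y = x"
 by (simp add: a_minus_def M.a_assoc M.l_neg)

lemma diff_eq_zero [simp]: "x \<in> carrier V ==> y \<in> carrier V ==> x \<ominus> y = \<zero> \<longleftrightarrow> x = y"
 using diff_add_cancel[of x y] by auto

lemma add_diff_cancel_left: "x \<in> carrier V ==> y \<in> carrier V ==> y \<oplus> (x \<ominus> y) = x"
 by (metis diff_add_cancel M.a_comm M.minus_closed)

lemma add4: "[|a \<in> carrier V; b \<in> carrier V; c \<in> carrier V; d \<in> carrier V|]
  ==> (a \<oplus> b) \<oplus> (c \<oplus> d) = (a \<oplus> c) \<oplus> (b \<oplus> d)"
 by (simp add: M.a_ac)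

lemma subspaceI:
 assumes "N <= carrier V" "\<zero> \<in> N" "\<And>x y. x \<in> N ==> y \<in> N ==> x \<oplus> y \<in> N"
  "\<And>c x. x \<in> N ==> c \<odot> x \<in> N"
 shows "subspace_of N V"
 using assms smult_m1 by (intro submoduleI) (auto, metis subsetD)

context
 fixes N assumes N: "subspace_of N V"
begin

lemma sub_mem: "x \<in> N ==> x \<in> carrier V"
 using submoduleE(1)[OF N] by auto

lemma sub_le: "N <= carrier V"
 using submoduleE(1)[OF N] .

lemma sub_zero: "\<zero> \<in> N"
 using N by (simp add: submodule_def subgroup.one_closed[of N "add_monoid V", simplified])

lemma sub_add: "x \<in> N ==> y \<in> N ==> x \<oplus> y \<in> N"
 using submoduleE(5)[OF N] by auto

lemma sub_smult: "x \<in> N ==> c \<odot> x \<in> N"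
 using submoduleE(4)[OF N] by auto

lemma sub_minus: "x \<in> N ==> \<ominus> x \<in> N"
 using submoduleE(3)[OF N] by auto

lemma sub_diff: "x \<in> N ==> y \<in> N ==> x \<ominus> y \<in> N"
 by (simp add: a_minus_def sub_add sub_minus)

lemma sub_finsum: "finite I ==> (\<And>i. i \<in> I ==> f i \<in> N) ==> finsum V f I \<in> N"
proof (induction rule: finite_induct)
 case (insert i I)
 then have "f \<in> insert i I \<rightarrow> carrier V" using sub_mem by auto
 with insert show ?case by (subst M.finsum_insert) (auto intro: sub_add)
qed (simp add: sub_zero)

lemma sub_add_cancel: "x \<in> carrier V ==> y \<in> N ==> x \<oplus> y \<in> N \<longleftrightarrow> x \<in> N"
 by (metis add_diff_cancel sub_add sub_mem sub_diff)

lemma sub_swap: "x \<in> carrier V ==> y \<in> carrier V ==> x \<ominus> y \<in> N ==> y \<ominus> x \<in> N"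
 using sub_minus[of "x \<ominus> y"] by (simp add: a_minus_def M.minus_add M.a_comm)

lemma sub_mod: "x \<in> carrier V ==> y \<in> carrier V ==> x \<ominus> y \<in> N ==> x \<in> N \<longleftrightarrow> y \<in> N"
 by (metis add_diff_cancel_left diff_add_cancel sub_add sub_swap)

lemma vspace_sub: "vec_space (sub V N)"
 unfolding sub_def by (rule submodule.submodule_is_module[OF N vs])

end

lemma carrier_sub: "subspace_of (carrier V) V"
 by (rule carrier_is_submodule)

lemma zero_sub: "subspace_of {\<zero>} V"
 by (rule subspaceI) auto

lemma Int_subspace: "subspace_of N V ==> subspace_of M V ==> subspace_of (N \<inter> M) V"
 by (rule subspaceI) (auto simp: sub_mem sub_zero sub_add sub_smult)

lemma diff_trans:
 assumes "x \<in> carrier V" "y \<in> carrier V" "z \<in> carrier V"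
 shows "x \<ominus> z = (x \<ominus> y) \<oplus> (y \<ominus> z)"
 using assms by (metis M.a_assoc M.minus_closed a_minus_def diff_add_cancel M.a_inv_closed)

lemma diff_add_diff:
 assumes "x \<in> carrier V" "y \<in> carrier V" "x' \<in> carrier V" "y' \<in> carrier V"
 shows "(x \<oplus> y) \<ominus> (x' \<oplus> y') = (x \<ominus> x') \<oplus> (y \<ominus> y')"
 using assms by (simp add: a_minus_def M.minus_add M.a_ac)

lemma sub_trans:
 assumes "subspace_of N V" "x \<in> carrier V" "y \<in> carrier V" "z \<in> carrier V" "x \<ominus> y \<in> N" "y \<ominus> z \<in> N"
 shows "x \<ominus> z \<in> N"
 using assms by (metis diff_trans sub_add)

text \<open>If \<open>S\<close> leaves the carrier, no subspace contains it and the intersection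
  defining the span is the whole type; this is why inclusions in the carrier accompany the span
  throughout.\<close>

lemma span_sub: assumes "S <= carrier V" shows "subspace_of (linear_span V S) V"
proof (rule subspaceI)
 show "linear_span V S <= carrier V"
  unfolding linear_span_def using carrier_sub assms by auto
qed (auto simp: linear_span_def sub_zero sub_add sub_smult)

lemma span_superset: "S <= linear_span V S"
 by (auto simp: linear_span_def)

lemma span_base: "x \<in> S ==> x \<in> linear_span V S"
 by (auto simp: linear_span_def)

lemma span_least: "subspace_of N V ==> S <= N ==> linear_span V S <= N"
 by (auto simp: linear_span_def)

lemma span_mono: "S <= T ==> linear_span V S <= linear_span V T"
 by (auto simp: linear_span_def)

lemma span_carrier: "S <= carrier V ==> x \<in> linear_span V S ==> x \<in> carrier V"
 using span_sub sub_mem by auto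

lemma span_id: "subspace_of N V ==> linear_span V N = N"
 using span_least span_superset by blast

lemma span_induct [consumes 2, case_names zero base add smult]:
 assumes x: "x \<in> linear_span V S" and S: "S <= carrier V"
  and "P \<zero>" "\<And>x. x \<in> S ==> P x"
  and "\<And>x y. x \<in> carrier V ==> y \<in> carrier V ==> P x ==> P y ==> P (x \<oplus> y)"
  and "\<And>c x. x \<in> carrier V ==> P x ==> P (c \<odot> x)"
 shows "P x"
proof -
 have "subspace_of {x \<in> carrier V. P x} V"
  by (rule subspaceI) (use assms in auto)
 from span_least[OF this] x S assms(4) show ?thesis by blast
qed

text \<open>Zorn's lemma on the subspaces meeting \<open>N\<close> only in zero. Finite dimension is
  not assumed, because the complex numbers over the rationals are among the spaces to which this is
  applied.\<close>

lemma complement_exists: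
 assumes N: "subspace_of N V"
 obtains M where "subspace_of M V" "N \<inter> M = {\<zero>}"
  "\<And>x. x \<in> carrier V ==> \<exists>n\<in>N. \<exists>m\<in>M. x = n \<oplus> m"
proof -
 define A where "A = {M. subspace_of M V \<and> N \<inter> M = {\<zero>}}"
 have "\<exists>M\<in>A. \<forall>X\<in>A. M <= X --> X = M"
 proof (rule subset_Zorn_nonempty)
  show "A \<noteq> {}" using zero_sub sub_zero[OF N] unfolding A_def by fastforce
  fix C assume C: "C \<noteq> {}" "subset.chain A C"
  then have sub: "\<And>M. M \<in> C ==> subspace_of M V" and tr: "\<And>M. M \<in> C ==> N \<inter> M = {\<zero>}"
   by (auto simp: subset.chain_def A_def)
  have "subspace_of (\<Union>C) V"
  proof (rule subspaceI)
   fix x y assume "x \<in> \<Union>C" "y \<in> \<Union>C"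
   then obtain X Y where XY: "X \<in> C" "x \<in> X" "Y \<in> C" "y \<in> Y" by auto
   with C(2) have "X <= Y \<or> Y <= X" by (auto simp: subset.chain_def)
   with XY show "x \<oplus> y \<in> \<Union>C" using sub_add[OF sub] by blast
  qed (use sub C(1) sub_mem sub_zero sub_smult in blast)+
  with C(1) tr show "\<Union>C \<in> A" unfolding A_def by auto
 qed
 then obtain M where M: "M \<in> A" and max: "\<And>X. X \<in> A ==> M <= X ==> X = M" by blast
 then have Ms: "subspace_of M V" and NM: "N \<inter> M = {\<zero>}" by (auto simp: A_def)
 note cN = sub_mem[OF N]
 have "\<exists>n\<in>N. \<exists>m\<in>M. x = n \<oplus> m" if x: "x \<in> carrier V" for x
 proof (rule ccontr)
  assume no: "\<not> ?thesis"
  \<comment> \<open>If \<open>x\<close> is no sum, then \<open>M\<close> enlarged by the line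
    through \<open>x\<close> still meets \<open>N\<close> only in zero, against maximality.\<close>
  define X where "X = {c \<odot> x \<oplus> m | c m. m \<in> M}"
  have sX: "subspace_of X V"
  proof (rule subspaceI)
   show "X <= carrier V" using x sub_mem[OF Ms] by (auto simp: X_def)
   have "\<zero> = 0 \<odot> x \<oplus> \<zero>" using x by simp
   then show "\<zero> \<in> X" using sub_zero[OF Ms] unfolding X_def by blast
  next
   fix u v assume "u \<in> X" "v \<in> X"
   then obtain c m d n where "u = c \<odot> x \<oplus> m" "v = d \<odot> x \<oplus> n" "m \<in> M" "n \<in> M"
    by (auto simp: X_def)
   then have "u \<oplus> v = (c + d) \<odot> x \<oplus> (m \<oplus> n)" "m \<oplus> n \<in> M"
    using x sub_mem[OF Ms] sub_add[OF Ms] by (auto simp: smult_add_left M.a_ac)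
   then show "u \<oplus> v \<in> X" unfolding X_def by blast
  next
   fix a u assume "u \<in> X"
   then obtain c m where "u = c \<odot> x \<oplus> m" "m \<in> M" by (auto simp: X_def)
   then have "a \<odot> u = (a * c) \<odot> x \<oplus> a \<odot> m" "a \<odot> m \<in> M"
    using x sub_mem[OF Ms] sub_smult[OF Ms] by (auto simp: smult_add_right smult_smult)
   then show "a \<odot> u \<in> X" unfolding X_def by blast
  qed
  have "N \<inter> X = {\<zero>}"
  proof -
   have "u = \<zero>" if "u \<in> N" "u \<in> X" for u
   proof -
    from that obtain c m where u: "u = c \<odot> x \<oplus> m" "m \<in> M" by (auto simp: X_def)
    have m: "m \<in> carrier V" using u sub_mem[OF Ms] by auto
    show ?thesis
    proof (cases "c = 0")
     case True then show ?thesis using u that NM x m by auto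
    next
     case False
     \<comment> \<open>A relation with \<open>c \<noteq> 0\<close> can be solved for
       \<open>x\<close>, which would exhibit \<open>x\<close> as a sum after all.\<close>
     have "x = inverse c \<odot> (u \<ominus> m)"
      using u x m False by (simp add: add_diff_cancel smult_smult)
     also have "\<dots> = inverse c \<odot> u \<ominus> inverse c \<odot> m"
      using m cN[OF that(1)] by (rule smult_diff_right[rotated])
     also have "\<dots> = inverse c \<odot> u \<oplus> (- inverse c) \<odot> m"
      unfolding a_minus_def smult_neg[OF m] ..
     finally have eq: "x = inverse c \<odot> u \<oplus> (- inverse c) \<odot> m" .
     have "\<exists>n\<in>N. \<exists>m\<in>M. x = n \<oplus> m"
      by (rule bexI[where x = "inverse c \<odot> u"], rule bexI[where x = "(- inverse c) \<odot> m"], rule eq)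
       (rule sub_smult[OF Ms u(2)] sub_smult[OF N that(1)])+
     with no show ?thesis by (rule notE)
    qed
   qed
   then show ?thesis using sub_zero[OF N] sub_zero[OF sX] by blast
  qed
  then have "X \<in> A" using sX by (simp add: A_def)
  moreover have "M <= X"
  proof
   fix m assume "m \<in> M"
   then have "m = 0 \<odot> x \<oplus> m" using x sub_mem[OF Ms] by simp
   then show "m \<in> X" using \<open>m \<in> M\<close> unfolding X_def by blast
  qed
  ultimately have "X = M" using max by blast
  moreover have "x = 1 \<odot> x \<oplus> \<zero>" using x by simp
  then have "x \<in> X" using sub_zero[OF Ms] unfolding X_def by blast
  ultimately have "x \<in> M" by simp
  moreover have "x = \<zero> \<oplus> x" using x by simp
  ultimately show False using no sub_zero[OF N] by blast
 qed
 with Ms NM that show thesis by blast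
qed

end

section \<open>Linear maps and retractions\<close>

text \<open>Membership in \<open>lin\<close> without extensionality. Composites and pointwise sums
  then qualify as they stand, and restriction to the carrier is postponed to the moment when an
  arrow is built.\<close>

definition is_lin :: "('k::field, 'v) module => ('k, 'w) module => ('v => 'w) => bool" where
 "is_lin V W f \<longleftrightarrow> f \<in> carrier V \<rightarrow> carrier W \<and>
   (\<forall>x \<in> carrier V. \<forall>y \<in> carrier V. f (x \<oplus>\<^bsub>V\<^esub> y) = f x \<oplus>\<^bsub>W\<^esub> f y) \<and>
   (\<forall>c. \<forall>x \<in> carrier V. f (c \<odot>\<^bsub>V\<^esub> x) = c \<odot>\<^bsub>W\<^esub> f x)"

lemma lin_iff: "f \<in> lin V W \<longleftrightarrow> is_lin V W f \<and> f \<in> extensional (carrier V)"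
 by (auto simp: lin_def is_lin_def PiE_iff Pi_iff)

lemma is_linI:
 assumes "\<And>x. x \<in> carrier V ==> f x \<in> carrier W"
  "\<And>x y. x \<in> carrier V ==> y \<in> carrier V ==> f (x \<oplus>\<^bsub>V\<^esub> y) = f x \<oplus>\<^bsub>W\<^esub> f y"
  "\<And>c x. x \<in> carrier V ==> f (c \<odot>\<^bsub>V\<^esub> x) = c \<odot>\<^bsub>W\<^esub> f x"
 shows "is_lin V W f"
 using assms by (auto simp: is_lin_def)

lemma lin_restrict: "vec_space V ==> is_lin V W f ==> restrict f (carrier V) \<in> lin V W"
proof -
 assume "vec_space V" and f: "is_lin V W f"
 then interpret V: vspace V by (simp add: vspace_def)
 show ?thesis using f unfolding lin_iff is_lin_def by auto
qed

lemma lin_is_lin: "f \<in> lin V W ==> is_lin V W f"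
 by (simp add: lin_iff)

lemma lin_mem: "is_lin V W f ==> x \<in> carrier V ==> f x \<in> carrier W"
 by (auto simp: is_lin_def)

lemma is_lin_add: "is_lin V W f ==> x \<in> carrier V ==> y \<in> carrier V ==> f (x \<oplus>\<^bsub>V\<^esub> y) = f x \<oplus>\<^bsub>W\<^esub> f y"
 by (auto simp: is_lin_def)

lemma is_lin_smult: "is_lin V W f ==> x \<in> carrier V ==> f (c \<odot>\<^bsub>V\<^esub> x) = c \<odot>\<^bsub>W\<^esub> f x"
 by (auto simp: is_lin_def)

lemma is_lin_id: "is_lin V V (\<lambda>x. x)"
 by (auto simp: is_lin_def)

lemma is_lin_comp: "is_lin U V f ==> is_lin V W g ==> is_lin U W (\<lambda>x. g (f x))"
 by (auto simp: is_lin_def Pi_iff)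

lemma is_lin_cong: "is_lin V W f ==> (\<And>x. x \<in> carrier V ==> f x = g x) ==> vec_space V ==> is_lin V W g"
proof -
 assume f: "is_lin V W f" and fg: "\<And>x. x \<in> carrier V ==> f x = g x" and "vec_space V"
 then interpret V: vspace V by (simp add: vspace_def)
 show ?thesis using f fg[symmetric] unfolding is_lin_def by (auto simp: Pi_iff)
qed

locale vpair = V: vspace V + W: vspace W
 for V :: "('k::field, 'v) module" and W :: "('k, 'w) module"
begin

lemma is_lin_zero: "is_lin V W f ==> f \<zero>\<^bsub>V\<^esub> = \<zero>\<^bsub>W\<^esub>"
 by (metis V.M.zero_closed V.smult_0 W.smult_0 lin_mem is_lin_smult)

lemma is_lin_minus: "is_lin V W f ==> x \<in> carrier V ==> f (\<ominus>\<^bsub>V\<^esub> x) = \<ominus>\<^bsub>W\<^esub> f x"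
 by (metis V.smult_m1 W.smult_m1 lin_mem is_lin_smult)

lemma is_lin_diff: "is_lin V W f ==> x \<in> carrier V ==> y \<in> carrier V ==> f (x \<ominus>\<^bsub>V\<^esub> y) = f x \<ominus>\<^bsub>W\<^esub> f y"
 by (simp add: a_minus_def is_lin_minus is_lin_add)

lemma is_lin_zero_map: "is_lin V W (\<lambda>x. \<zero>\<^bsub>W\<^esub>)"
 by (auto simp: is_lin_def)

lemma is_lin_plus: "is_lin V W f ==> is_lin V W g ==> is_lin V W (\<lambda>x. f x \<oplus>\<^bsub>W\<^esub> g x)"
 by (rule is_linI)
  (auto simp: lin_mem is_lin_add is_lin_smult W.smult_add_right W.add4)

lemma is_lin_scale: "is_lin V W f ==> is_lin V W (\<lambda>x. c \<odot>\<^bsub>W\<^esub> f x)"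
 by (rule is_linI)
  (auto simp: lin_mem is_lin_add is_lin_smult W.smult_add_right W.smult_smult mult.commute)

lemma is_lin_minus_map: "is_lin V W f ==> is_lin V W g ==> is_lin V W (\<lambda>x. f x \<ominus>\<^bsub>W\<^esub> g x)"
 by (rule is_linI)
  (auto simp: lin_mem is_lin_add is_lin_smult W.smult_diff_right W.diff_add_diff)

lemma is_lin_finsum:
 assumes f: "is_lin V W f" and "finite I" and s: "s \<in> I \<rightarrow> carrier V"
 shows "f (finsum V s I) = finsum W (\<lambda>i. f (s i)) I"
 using assms(2,3)
proof (induction rule: finite_induct)
 case empty then show ?case by (simp add: is_lin_zero[OF f])
next
 case (insert i I)
 then show ?case
  using f by (subst V.M.finsum_insert W.M.finsum_insert; auto simp: lin_mem is_lin_add Pi_iff)+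
qed

lemma preimage_sub:
 assumes f: "is_lin V W f" and N: "subspace_of N W"
 shows "subspace_of {x \<in> carrier V. f x \<in> N} V"
 by (rule V.subspaceI)
  (auto simp: is_lin_zero[OF f] W.sub_zero[OF N] is_lin_add[OF f] is_lin_smult[OF f]
    W.sub_add[OF N] W.sub_smult[OF N])

lemma image_sub:
 assumes f: "is_lin V W f" and N: "subspace_of N V"
 shows "subspace_of (f ` N) W"
proof (rule W.subspaceI)
 show "f ` N <= carrier W" using lin_mem[OF f] V.sub_mem[OF N] by auto
 show "\<zero>\<^bsub>W\<^esub> \<in> f ` N" using is_lin_zero[OF f] V.sub_zero[OF N] by force
next
 fix x y assume "x \<in> f ` N" "y \<in> f ` N"
 then obtain a b where ab: "a \<in> N" "b \<in> N" "x = f a" "y = f b" by auto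
 then have "x \<oplus>\<^bsub>W\<^esub> y = f (a \<oplus>\<^bsub>V\<^esub> b)" using is_lin_add[OF f] V.sub_mem[OF N] by auto
 then show "x \<oplus>\<^bsub>W\<^esub> y \<in> f ` N" using V.sub_add[OF N] ab by auto
next
 fix c x assume "x \<in> f ` N"
 then obtain a where a: "a \<in> N" "x = f a" by auto
 then have "c \<odot>\<^bsub>W\<^esub> x = f (c \<odot>\<^bsub>V\<^esub> a)" using is_lin_smult[OF f] V.sub_mem[OF N] by auto
 then show "c \<odot>\<^bsub>W\<^esub> x \<in> f ` N" using V.sub_smult[OF N] a by auto
qed

lemma span_image_sub:
 assumes f: "is_lin V W f" and N: "subspace_of N W" and S: "S <= carrier V" and "f ` S <= N"
 shows "f ` linear_span V S <= N"
 using V.span_least[OF preimage_sub[OF f N], of S] S assms(4) by auto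

lemma lin_eq_on_span:
 assumes f: "is_lin V W f" and g: "is_lin V W g" and S: "S <= carrier V"
  and eq: "\<And>x. x \<in> S ==> f x = g x" and x: "x \<in> linear_span V S"
 shows "f x = g x"
 using x S
proof (induction rule: V.span_induct)
 case zero show ?case by (simp add: is_lin_zero f g)
qed (use f g eq in \<open>auto simp: is_lin_add is_lin_smult\<close>)

lemma lin_ext:
 assumes "f \<in> lin V W" "g \<in> lin V W" "S <= carrier V" "linear_span V S = carrier V"
  and "\<And>x. x \<in> S ==> f x = g x"
 shows "f = g"
proof (rule extensionalityI[of _ "carrier V"])
 show "f x = g x" if "x \<in> carrier V" for x
  using lin_eq_on_span[of f g S x] assms that by (simp add: lin_iff)
qed (use assms in \<open>auto simp: lin_iff\<close>)

lemma inj_linI: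
 assumes f: "is_lin V W f" and "\<And>x. x \<in> carrier V ==> f x = \<zero>\<^bsub>W\<^esub> ==> x = \<zero>\<^bsub>V\<^esub>"
 shows "inj_on f (carrier V)"
proof (rule inj_onI)
 fix x y assume "x \<in> carrier V" "y \<in> carrier V" "f x = f y"
 then have "x \<ominus>\<^bsub>V\<^esub> y = \<zero>\<^bsub>V\<^esub>" using assms by (simp add: is_lin_diff[OF f] lin_mem[OF f])
 then show "x = y" using \<open>x \<in> carrier V\<close> \<open>y \<in> carrier V\<close> by (simp add: V.diff_eq_zero)
qed

lemma inv_lin:
 assumes f: "is_lin V W f" and b: "bij_betw f (carrier V) (carrier W)"
 shows "is_lin W V (inv_into (carrier V) f)"
proof (rule is_linI)
 have i: "inj_on f (carrier V)" and s: "f ` carrier V = carrier W"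
  using b by (auto simp: bij_betw_def)
 show "inv_into (carrier V) f x \<in> carrier V" if "x \<in> carrier W" for x
  using that s by (simp add: inv_into_into)
 show "inv_into (carrier V) f (x \<oplus>\<^bsub>W\<^esub> y) = inv_into (carrier V) f x \<oplus>\<^bsub>V\<^esub> inv_into (carrier V) f y"
  if "x \<in> carrier W" "y \<in> carrier W" for x y
  using that s i f by (intro inv_into_f_eq) (auto simp: inv_into_into f_inv_into_f is_lin_add)
 show "inv_into (carrier V) f (c \<odot>\<^bsub>W\<^esub> x) = c \<odot>\<^bsub>V\<^esub> inv_into (carrier V) f x"
  if "x \<in> carrier W" for c x
  using that s i f by (intro inv_into_f_eq) (auto simp: inv_into_into f_inv_into_f is_lin_smult)
qed

end

lemma vpairI: "vec_space V ==> vec_space W ==> vpair V W"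
 by (simp add: vpair_def vspace_def)

text \<open>Projection along a complement. Its later purpose is exactness of complexification: a
  retraction stays a retraction after tensoring with the complex numbers.\<close>

lemma (in vspace) retraction_exists:
 assumes N: "subspace_of N V"
 obtains r where "is_lin V V r" "\<And>x. x \<in> carrier V ==> r x \<in> N" "\<And>x. x \<in> N ==> r x = x"
proof -
 obtain M where M: "subspace_of M V" and NM: "N \<inter> M = {\<zero>}"
  and ex: "\<And>x. x \<in> carrier V ==> \<exists>n\<in>N. \<exists>m\<in>M. x = n \<oplus> m"
  using complement_exists[OF N] by blast
 note cN = sub_mem[OF N] and cM = sub_mem[OF M]
 have uniq: "n = n'" if "n \<in> N" "m \<in> M" "n' \<in> N" "m' \<in> M" "n \<oplus> m = n' \<oplus> m'" for n m n' m'
 proof -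
  have "n \<ominus> n' = (n \<oplus> m) \<ominus> (n' \<oplus> m)"
   using that(1-4) cN cM by (simp add: diff_add_diff)
  also have "\<dots> = (n' \<oplus> m') \<ominus> (n' \<oplus> m)" by (simp only: that(5))
  also have "\<dots> = m' \<ominus> m"
   using that(2-4) cN cM diff_add_diff[of n' m' n' m] by simp
  finally have "n \<ominus> n' \<in> N \<inter> M"
   using sub_diff[OF N that(1,3)] sub_diff[OF M that(4,2)] by auto
  then show ?thesis using NM that cN by auto
 qed
 define r where "r x = (THE n. n \<in> N \<and> (\<exists>m\<in>M. x = n \<oplus> m))" for x
 have r: "r (n \<oplus> m) = n" if "n \<in> N" "m \<in> M" for n m
  unfolding r_def by (rule the_equality) (use that uniq in blast)+
 show thesis
 proof (rule that)
  show "is_lin V V r"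
  proof (rule is_linI)
   fix x assume "x \<in> carrier V"
   then show "r x \<in> carrier V" using ex r cN by metis
  next
   fix x y assume "x \<in> carrier V" "y \<in> carrier V"
   then obtain n m n' m' where *: "n \<in> N" "m \<in> M" "x = n \<oplus> m" "n' \<in> N" "m' \<in> M" "y = n' \<oplus> m'"
    using ex by metis
   then have "x \<oplus> y = (n \<oplus> n') \<oplus> (m \<oplus> m')" using cN cM by (simp add: add4)
   then show "r (x \<oplus> y) = r x \<oplus> r y" using * r sub_add[OF N] sub_add[OF M] by simp
  next
   fix c x assume "x \<in> carrier V"
   then obtain n m where *: "n \<in> N" "m \<in> M" "x = n \<oplus> m" using ex by metis
   then have "c \<odot> x = c \<odot> n \<oplus> c \<odot> m" using cN cM by (simp add: smult_add_right)
   then show "r (c \<odot> x) = c \<odot> r x" using * r sub_smult[OF N] sub_smult[OF M] by simp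
  qed
  show "r x \<in> N" if "x \<in> carrier V" for x using ex[OF that] r by auto
  show "r x = x" if "x \<in> N" for x using r[of x \<zero>] that sub_zero[OF M] cN by auto
 qed
qed

text \<open>\<open>is_lin\<close> asks nothing of its target, so the axioms can be pushed forward
  along a surjection. Quotients and copies in the universe become vector spaces in this way.\<close>

lemma vec_surj:
 assumes "vec_space V" and f: "is_lin V W f" and sur: "f ` carrier V = carrier W" and z: "f \<zero>\<^bsub>V\<^esub> = \<zero>\<^bsub>W\<^esub>"
 shows "vec_space W"
proof -
 interpret V: vspace V by (rule vsI, rule assms)
 have ex: "\<exists>a\<in>carrier V. x = f a" if "x \<in> carrier W" for x using that sur by auto
 note fa = is_lin_add[OF f, symmetric] and fs = is_lin_smult[OF f, symmetric] and fc = lin_mem[OF f]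
 show ?thesis
 proof (rule vec_spaceI)
  fix x y assume "x \<in> carrier W" "y \<in> carrier W"
  then obtain a b where ab: "a \<in> carrier V" "b \<in> carrier V" "x = f a" "y = f b" using ex by metis
  then show "x \<oplus>\<^bsub>W\<^esub> y \<in> carrier W" "x \<oplus>\<^bsub>W\<^esub> y = y \<oplus>\<^bsub>W\<^esub> x"
   by (simp_all add: fa fc V.M.a_comm)
  show "c \<odot>\<^bsub>W\<^esub> (x \<oplus>\<^bsub>W\<^esub> y) = c \<odot>\<^bsub>W\<^esub> x \<oplus>\<^bsub>W\<^esub> c \<odot>\<^bsub>W\<^esub> y" for c
   using ab by (simp add: fa fs fc V.smult_add_right)
  fix w assume "w \<in> carrier W"
  then obtain d where d: "d \<in> carrier V" "w = f d" using ex by metis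
  show "(x \<oplus>\<^bsub>W\<^esub> y) \<oplus>\<^bsub>W\<^esub> w = x \<oplus>\<^bsub>W\<^esub> (y \<oplus>\<^bsub>W\<^esub> w)"
   using ab d by (simp add: fa V.M.a_assoc)
 next
  show "\<zero>\<^bsub>W\<^esub> \<in> carrier W" using z sur V.M.zero_closed by force
 next
  fix x assume "x \<in> carrier W"
  then obtain a where a: "a \<in> carrier V" "x = f a" using ex by metis
  show "c \<odot>\<^bsub>W\<^esub> x \<in> carrier W" for c using a by (simp add: fs fc)
  show "\<zero>\<^bsub>W\<^esub> \<oplus>\<^bsub>W\<^esub> x = x" using a by (simp flip: z add: fa)
  show "- 1 \<odot>\<^bsub>W\<^esub> x \<oplus>\<^bsub>W\<^esub> x = \<zero>\<^bsub>W\<^esub>"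
   using a by (simp flip: z add: fa fs V.smult_m1 V.M.l_neg)
  show "(c + d) \<odot>\<^bsub>W\<^esub> x = c \<odot>\<^bsub>W\<^esub> x \<oplus>\<^bsub>W\<^esub> d \<odot>\<^bsub>W\<^esub> x" for c d
   using a by (simp add: fa fs V.smult_add_left)
  show "(c * d) \<odot>\<^bsub>W\<^esub> x = c \<odot>\<^bsub>W\<^esub> (d \<odot>\<^bsub>W\<^esub> x)" for c d
   using a by (simp add: fs V.smult_smult)
  show "1 \<odot>\<^bsub>W\<^esub> x = x" using a by (simp add: fs)
 qed
qed

section \<open>Quotients\<close>

context vspace
begin

context
 fixes N assumes N: "subspace_of N V"
begin

lemma sub_abelian_subgroup: "abelian_subgroup N V"
 using N by (intro abelian_subgroupI3)
  (simp_all add: additive_subgroup_def submodule_def M.abelian_group_axioms)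

lemma coset_mem: "x \<in> carrier V ==> y \<in> N +> x \<longleftrightarrow> y \<in> carrier V \<and> y \<ominus> x \<in> N"
 using abelian_subgroup.a_rcos_module[OF sub_abelian_subgroup, of x y]
  abelian_subgroup.a_elemrcos_carrier[OF sub_abelian_subgroup, of x y]
 by (auto simp: a_minus_def)

lemma coset_self: "x \<in> carrier V ==> x \<in> N +> x"
 by (simp add: coset_mem sub_zero[OF N])

lemma coset_eq_iff:
 assumes "x \<in> carrier V" "y \<in> carrier V"
 shows "N +> x = N +> y \<longleftrightarrow> x \<ominus> y \<in> N"
proof
 assume "N +> x = N +> y"
 then show "x \<ominus> y \<in> N" using coset_self[OF assms(1)] coset_mem[OF assms(2)] by auto
next
 assume *: "x \<ominus> y \<in> N"
 have "z \<ominus> x \<in> N \<longleftrightarrow> z \<ominus> y \<in> N" if "z \<in> carrier V" for z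
  using sub_trans[OF N that assms(1,2)] sub_trans[OF N that assms(2,1)] * sub_swap[OF N assms *]
  by blast
 then show "N +> x = N +> y"
  unfolding set_eq_iff coset_mem[OF assms(1)] coset_mem[OF assms(2)] by blast
qed

lemma coset_zero_eq: "N +> \<zero> = N"
 using coset_mem[of \<zero>] sub_mem[OF N] by auto

lemma quot_carrier: "carrier (quot V N) = (\<lambda>x. N +> x) ` carrier V"
 by (auto simp: quot_def A_RCOSETS_def')

lemma quot_add: "x \<in> carrier V ==> y \<in> carrier V ==> (N +> x) \<oplus>\<^bsub>quot V N\<^esub> (N +> y) = N +> (x \<oplus> y)"
 by (simp add: quot_def abelian_subgroup.a_rcos_sum[OF sub_abelian_subgroup])

lemma quot_smult: "x \<in> carrier V ==> c \<odot>\<^bsub>quot V N\<^esub> (N +> x) = N +> (c \<odot> x)"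
proof -
 assume x: "x \<in> carrier V"
 have "N +> (c \<odot> y) = N +> (c \<odot> x)" if "y \<in> N +> x" for y
 proof -
  have y: "y \<in> carrier V" "y \<ominus> x \<in> N" using that coset_mem[OF x] by auto
  show ?thesis
   using sub_smult[OF N y(2), of c] smult_diff_right[OF y(1) x]
   by (simp add: coset_eq_iff[OF smult_closed'[OF y(1)] smult_closed'[OF x]])
 qed
 then have "(\<Union>y\<in>N +> x. N +> (c \<odot> y)) = (\<Union>y\<in>N +> x. N +> (c \<odot> x))"
  by (rule SUP_cong[OF refl])
 also have "\<dots> = N +> (c \<odot> x)" using coset_self[OF x] by auto
 finally show ?thesis by (simp add: quot_def)
qed

lemma quot_zero: "\<zero>\<^bsub>quot V N\<^esub> = N"
 by (simp add: quot_def)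

lemma quot_proj_lin: "is_lin V (quot V N) (\<lambda>x. N +> x)"
 by (rule is_linI) (auto simp: quot_carrier quot_add quot_smult)

lemma vec_quot: "vec_space (quot V N)"
 by (rule vec_surj[OF vs quot_proj_lin]) (simp_all add: quot_carrier quot_zero coset_zero_eq)

lemma quot_lift:
 assumes f: "is_lin V X f" and X: "vec_space X" and k: "\<And>x. x \<in> N ==> f x = \<zero>\<^bsub>X\<^esub>"
 obtains h where "is_lin (quot V N) X h" "\<And>x. x \<in> carrier V ==> h (N +> x) = f x"
proof -
 interpret VX: vpair V X using X vs by (rule vpairI[rotated])
 \<comment> \<open>Evaluation at a chosen representative; independence of the choice is the
   vanishing of \<open>f\<close> on \<open>N\<close>.\<close>
 define h where "h Y = f (SOME y. y \<in> Y)" for Y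
 have h: "h (N +> x) = f x" if x: "x \<in> carrier V" for x
 proof -
  have "(SOME y. y \<in> N +> x) \<in> N +> x" using coset_self[OF x] by (rule someI)
  then have "f ((SOME y. y \<in> N +> x) \<ominus> x) = \<zero>\<^bsub>X\<^esub>" "(SOME y. y \<in> N +> x) \<in> carrier V"
   using k x by (auto simp: coset_mem)
  then show ?thesis unfolding h_def using x f
   by (simp add: VX.is_lin_diff VX.W.diff_eq_zero lin_mem)
 qed
 show thesis
 proof (rule that[OF _ h])
  show "is_lin (quot V N) X h"
   by (rule is_linI) (use f in \<open>auto simp: quot_carrier quot_add quot_smult h lin_mem is_lin_add is_lin_smult\<close>)
 qed
qed

end

end

unbundle cardinal_syntax

section \<open>Injections into the universe\<close>

lemma card_le_iff: "|A| \<le>o |B| \<longleftrightarrow> (\<exists>f. inj_on f A \<and> f ` A <= B)"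
 using card_of_ordLeq[of A B] by auto

lemma inj_into_infinite_times:
 "\<exists>f :: 'u::infinite \<times> 'u => 'u. inj f"
proof -
 have "|(UNIV :: 'u set) \<times> (UNIV :: 'u set)| \<le>o |UNIV :: 'u set|"
  using card_of_Times_infinite_simps(1)[OF infinite_UNIV[where 'a = 'u] UNIV_not_empty card_of_refl[THEN ordIso_imp_ordLeq]]
  by (rule ordIso_imp_ordLeq)
 then show ?thesis by (auto simp: card_le_iff)
qed

lemma inj_list_into_infinite: "\<exists>f :: 'u::infinite list => 'u. inj f"
proof -
 obtain g :: "'u \<times> 'u => 'u" where g: "inj g" using inj_into_infinite_times by blast
 obtain e :: "nat => 'u" where e: "inj e"
  using infinite_countable_subset[OF infinite_UNIV[where 'a = 'u]] by blast
 obtain a :: 'u where True by simp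
 define f :: "'u list => 'u" where "f = rec_list a (\<lambda>x xs r. g (x, r))"
 have "inj_on f {xs. length xs = n}" for n
 proof (induction n)
  case (Suc n)
  show ?case
  proof (rule inj_onI)
   fix xs ys assume "xs \<in> {xs. length xs = Suc n}" "ys \<in> {xs. length xs = Suc n}" and eq: "f xs = f ys"
   then obtain x xs' y ys' where "xs = x # xs'" "ys = y # ys'" "length xs' = n" "length ys' = n"
    by (auto simp: length_Suc_conv)
   moreover from this eq have "(x, f xs') = (y, f ys')"
    by (intro injD[OF g]) (simp add: f_def)
   ultimately show "xs = ys" using inj_onD[OF Suc.IH, of xs' ys'] by simp
  qed
 qed (auto intro: inj_onI)
 \<comment> \<open>\<open>f\<close> is injective only among lists of equal length, so the length is
   coded as well.\<close>
 then have "inj (\<lambda>xs. g (e (length xs), f xs))"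
  by (intro injI) (simp add: inj_eq[OF g] inj_eq[OF e] inj_on_def)
 then show ?thesis by blast
qed

lemma inj_countable_into_infinite:
 assumes "inj (h :: 'b => nat)"
 shows "\<exists>f :: 'b => 'u::infinite. inj f"
proof -
 obtain e :: "nat => 'u" where e: "inj e"
  using infinite_countable_subset[OF infinite_UNIV[where 'a = 'u]] by blast
 show ?thesis using inj_compose[OF e assms] by blast
qed

lemma inj_prod_into_infinite:
 assumes "inj (f :: 'a => 'u::infinite)" "inj (g :: 'b => 'u)"
 shows "\<exists>h :: 'a \<times> 'b => 'u. inj h"
proof -
 obtain k :: "'u \<times> 'u => 'u" where k: "inj k" using inj_into_infinite_times by blast
 have "inj (\<lambda>(x, y). k (f x, g y))"
  by (intro injI) (simp add: inj_eq[OF k] inj_eq[OF assms(1)] inj_eq[OF assms(2)] split: prod.splits)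
 then show ?thesis by blast
qed

lemma inj_finite_sets_into_infinite:
 assumes "inj (f :: 'a => 'u::infinite)"
 shows "\<exists>h :: 'a set => 'u. inj_on h {S. finite S}"
proof -
 obtain k :: "'u list => 'u" where k: "inj k" using inj_list_into_infinite by blast
 define l :: "'a set => 'a list" where "l S = (SOME xs. set xs = S)" for S
 have l: "set (l S) = S" if "finite S" for S
  unfolding l_def using finite_list[OF that] by (rule someI_ex)
 have "inj_on (\<lambda>S. k (map f (l S))) {S. finite S}"
 proof (rule inj_onI)
  fix S T assume "S \<in> {S. finite S}" "T \<in> {S. finite S}" "k (map f (l S)) = k (map f (l T))"
  then have "l S = l T" using injD[OF k] injD[of "map f"] assms by (metis inj_map)
  then show "S = T" using l \<open>S \<in> _\<close> \<open>T \<in> _\<close> by (metis mem_Collect_eq)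
 qed
 then show ?thesis by blast
qed

text \<open>A finitely supported function is determined by the finite graph of its nonzero values,
  which is coded as a finite set of pairs.\<close>

lemma inj_poly_mapping_into_infinite:
 assumes "inj (f :: 'a => 'u::infinite)"
 shows "\<exists>h :: ('a \<Rightarrow>\<^sub>0 rat) => 'u. inj h"
proof -
 obtain r :: "rat => 'u" where "inj r" using inj_countable_into_infinite[OF inj_to_nat] by blast
 then obtain p :: "'a \<times> rat => 'u" where "inj p" using inj_prod_into_infinite assms by blast
 then obtain h :: "('a \<times> rat) set => 'u" where h: "inj_on h {S. finite S}"
  using inj_finite_sets_into_infinite by blast
 define graph :: "('a \<Rightarrow>\<^sub>0 rat) => ('a \<times> rat) set"
  where "graph q = (\<lambda>x. (x, Poly_Mapping.lookup q x)) ` Poly_Mapping.keys q" for q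
 have fin: "finite (graph q)" for q by (simp add: graph_def)
 have g: "(x, c) \<in> graph q \<longleftrightarrow> c \<noteq> 0 \<and> Poly_Mapping.lookup q x = c" for q x c
  by (auto simp: graph_def in_keys_iff)
 have "q = q'" if "graph q = graph q'" for q q'
 proof (rule poly_mapping_eqI)
  fix x show "Poly_Mapping.lookup q x = Poly_Mapping.lookup q' x"
   using g[of x _ q] g[of x _ q'] that by (metis (no_types))
 qed
 then have "inj (\<lambda>q. h (graph q))" using h fin by (auto simp: inj_on_def)
 then show ?thesis by blast
qed

section \<open>Copies\<close>

text \<open>The parameter \<open>e\<close> fixes the target type of the polymorphic
  \<open>embed X\<close>. Injectivity is assumed because \<open>embed X\<close> is an arbitrary
  choice unless some injection into the universe exists.\<close>

locale copyable = vspace X for X :: "('k::field, 'v) module" and e :: "'v => 'u" +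
 assumes inj: "inj_on e (carrier X)" and e_def: "e = embed X"
begin

abbreviation Y :: "('k, 'u) module" where "Y \<equiv> copy X"

lemma unembed_e: "x \<in> carrier X ==> unembed X (e x) = x"
 using inj by (simp add: unembed_def e_def)

lemma copy_carrier: "carrier Y = e ` carrier X"
 by (simp add: copy_def e_def)

lemma is_lin_embed: "is_lin X Y e"
 by (rule is_linI) (auto simp: copy_carrier unembed_e[unfolded e_def] copy_def e_def)

lemma vec_copy: "vec_space Y"
 by (rule vec_surj[OF vs is_lin_embed]) (simp_all add: copy_def e_def)

lemma bij_embed: "bij_betw e (carrier X) (carrier Y)"
 using inj by (simp add: bij_betw_def copy_carrier)

lemma is_lin_unembed: "is_lin Y X (unembed X)"
 unfolding unembed_def e_def[symmetric]
 by (intro vpair.inv_lin vpairI vs vec_copy is_lin_embed bij_embed)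

end

lemma copyableI:
 assumes "vec_space X" "inj_on (f :: 'v => 'u) (carrier X)"
 shows "copyable X (embed X :: 'v => 'u)"
 using assms someI[of "\<lambda>e. inj_on e (carrier X)" f]
 by (simp add: copyable_def vspace_def copyable_axioms_def embed_def)

section \<open>Free spaces\<close>

lemma free_space_simps [simp]:
 "carrier (free_space S) = {p. Poly_Mapping.keys p <= S}" "add (free_space S) = (+)"
 "zero (free_space S) = 0" "smult (free_space S) c = Poly_Mapping.map ((*) c)"
 by (simp_all add: free_space_def)

lemma lookup_scale [simp]: "Poly_Mapping.lookup (Poly_Mapping.map ((*) c) p) x = (c :: rat) * Poly_Mapping.lookup p x"
 by (simp add: Poly_Mapping.map.rep_eq when_def)

lemma keys_scale: "Poly_Mapping.keys (Poly_Mapping.map ((*) (c :: rat)) p) <= Poly_Mapping.keys p"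
 by (auto simp: in_keys_iff)

lemma vec_free: "vec_space (free_space S)"
proof (rule vec_spaceI)
 show "x \<oplus>\<^bsub>free_space S\<^esub> y \<in> carrier (free_space S)"
  if "x \<in> carrier (free_space S)" "y \<in> carrier (free_space S)" for x y
  using that keys_add[of x y] by auto
 show "c \<odot>\<^bsub>free_space S\<^esub> x \<in> carrier (free_space S)" if "x \<in> carrier (free_space S)" for c x
  using that keys_scale[of c x] by auto
qed (auto intro!: poly_mapping_eqI simp: lookup_add algebra_simps)

lemma free_diff: "p \<in> carrier (free_space S) ==> q \<in> carrier (free_space S) ==> p \<ominus>\<^bsub>free_space S\<^esub> q = p - q"
proof -
 interpret vspace "free_space S" by (rule vsI, rule vec_free)
 assume *: "p \<in> carrier (free_space S)" "q \<in> carrier (free_space S)"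
 then have c: "p - q \<in> carrier (free_space S)" using keys_diff[of p q] by auto
 have "p = (p - q) \<oplus>\<^bsub>free_space S\<^esub> q" by simp
 then show ?thesis using add_diff_cancel[OF c *(2)] by simp
qed

lemma free_span: "linear_span (free_space S) (gen ` S) = carrier (free_space S)"
proof
 interpret vspace "free_space S" by (rule vsI, rule vec_free)
 have sub: "gen ` S <= carrier (free_space S)" by auto
 show "linear_span (free_space S) (gen ` S) <= carrier (free_space S)"
  using span_carrier[OF sub] by blast
 have "p \<in> linear_span (free_space S) (gen ` S)" if "finite K" "Poly_Mapping.keys p <= K" "K <= S" for K p
  using that
 proof (induction arbitrary: p rule: finite_induct)
  case empty
  then have "p = \<zero>\<^bsub>free_space S\<^esub>" by simp
  then show ?case by (simp only: sub_zero[OF span_sub[OF sub]])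
 next
  case (insert k K)
  let ?p = "p - Poly_Mapping.single k (Poly_Mapping.lookup p k)"
  have "Poly_Mapping.keys ?p <= K"
   using insert.prems(1) by (auto simp: in_keys_iff lookup_minus lookup_single when_def split: if_splits)
  then have 1: "?p \<in> linear_span (free_space S) (gen ` S)" using insert by auto
  have "Poly_Mapping.single k (Poly_Mapping.lookup p k) = Poly_Mapping.lookup p k \<odot>\<^bsub>free_space S\<^esub> gen k"
   by (auto intro!: poly_mapping_eqI simp: lookup_single when_def)
  moreover have "gen k \<in> linear_span (free_space S) (gen ` S)" using insert.prems by (intro span_base) auto
  ultimately have 2: "Poly_Mapping.single k (Poly_Mapping.lookup p k) \<in> linear_span (free_space S) (gen ` S)"
   by (simp only: sub_smult[OF span_sub[OF sub]])
  show ?case using sub_add[OF span_sub[OF sub] 1 2] by simp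
 qed
 from this[OF finite_keys subset_refl]
 show "carrier (free_space S) <= linear_span (free_space S) (gen ` S)" by auto
qed

lemma free_lift:
 assumes "vec_space X" and \<beta>: "\<And>x. x \<in> S ==> \<beta> x \<in> carrier X"
 obtains h where "is_lin (free_space S) X h" "\<And>x. x \<in> S ==> h (gen x) = \<beta> x"
proof -
 interpret X: vspace X by (rule vsI, rule assms)
 define h where "h p = (\<Oplus>\<^bsub>X\<^esub>x\<in>Poly_Mapping.keys p. Poly_Mapping.lookup p x \<odot>\<^bsub>X\<^esub> \<beta> x)" for p
 \<comment> \<open>The sum may be taken over any finite set containing the support, so that
   \<open>p\<close>, \<open>q\<close> and \<open>p + q\<close> can be compared over one index
   set.\<close>
 have h: "h p = (\<Oplus>\<^bsub>X\<^esub>x\<in>K. Poly_Mapping.lookup p x \<odot>\<^bsub>X\<^esub> \<beta> x)"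
  if "finite K" "Poly_Mapping.keys p <= K" "K <= S" for p K
  unfolding h_def using that \<beta>
  by (intro X.M.add.finprod_mono_neutral_cong_left) (auto simp: in_keys_iff)
 show thesis
 proof (rule that)
  show "is_lin (free_space S) X h"
  proof (rule is_linI)
   fix p assume "p \<in> carrier (free_space S)"
   then show "h p \<in> carrier X" unfolding h_def using \<beta> by (intro X.M.finsum_closed) auto
  next
   fix p q assume "p \<in> carrier (free_space S)" "q \<in> carrier (free_space S)"
   then have K: "Poly_Mapping.keys p \<union> Poly_Mapping.keys q <= S" by auto
   show "h (p \<oplus>\<^bsub>free_space S\<^esub> q) = h p \<oplus>\<^bsub>X\<^esub> h q"
    using K keys_add[of p q] \<beta>
    by (subst (1 2 3) h[OF _ _ K])
     (auto simp: lookup_add X.smult_add_left subset_eq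
       intro!: trans[OF X.M.finsum_cong' X.M.finsum_addf])
  next
   fix c p assume "p \<in> carrier (free_space S)"
   then have K: "Poly_Mapping.keys p <= S" by auto
   show "h (c \<odot>\<^bsub>free_space S\<^esub> p) = c \<odot>\<^bsub>X\<^esub> h p"
    using K keys_scale[of c p] \<beta>
    by (subst (1 2) h[OF _ _ K]) (auto simp: X.smult_smult subset_eq X.finsum_smult_ldistr intro!: X.M.finsum_cong')
  qed
  show "h (gen x) = \<beta> x" if "x \<in> S" for x
   unfolding h_def using that \<beta> by (simp add: X.M.finsum_insert X.M.finsum_singleton)
 qed
qed

section \<open>Tensor products\<close>

text \<open>Related to \<open>bilin\<close> as \<open>is_lin\<close> is to \<open>lin\<close>:
  bilinearity without extensionality.\<close>

definition bil :: "('k::field, 'a) module => ('k, 'b) module => ('k, 'x) module => ('a => 'b => 'x) => bool" where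
 "bil A B X \<beta> \<longleftrightarrow> (\<forall>x \<in> carrier A. is_lin B X (\<beta> x)) \<and> (\<forall>y \<in> carrier B. is_lin A X (\<lambda>x. \<beta> x y))"

lemma bilI:
 assumes "\<And>x. x \<in> carrier A ==> is_lin B X (\<beta> x)" "\<And>y. y \<in> carrier B ==> is_lin A X (\<lambda>x. \<beta> x y)"
 shows "bil A B X \<beta>"
 using assms by (simp add: bil_def)

lemma bil_closed: "bil A B X \<beta> ==> x \<in> carrier A ==> y \<in> carrier B ==> \<beta> x y \<in> carrier X"
 by (auto simp: bil_def lin_mem)

lemma bil_left: "bil A B X \<beta> ==> y \<in> carrier B ==> is_lin A X (\<lambda>x. \<beta> x y)"
 by (simp add: bil_def)

lemma bil_right: "bil A B X \<beta> ==> x \<in> carrier A ==> is_lin B X (\<beta> x)"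
 by (simp add: bil_def)

lemma bil_comp: "bil A B X \<beta> ==> is_lin X Y f ==> bil A B Y (\<lambda>x y. f (\<beta> x y))"
 by (auto simp: bil_def intro: is_lin_comp)

lemma bil_comp2: "bil A B X \<beta> ==> is_lin A' A f ==> is_lin B' B g ==> bil A' B' X (\<lambda>x y. \<beta> (f x) (g y))"
 unfolding bil_def by (auto dest: lin_mem intro: is_lin_comp[where g = "\<beta> _"] is_lin_comp[where g = "\<lambda>x. \<beta> x _"])

lemma bil_swap: "bil A B X \<beta> ==> bil B A X (\<lambda>y x. \<beta> x y)"
 by (auto simp: bil_def)

lemma bil_eq_on_span:
 assumes "bil A B X \<beta>" "bil A B X \<gamma>" "vec_space A" "vec_space B" "vec_space X"
  and S: "S <= carrier A" and T: "T <= carrier B"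
  and eq: "\<And>x y. x \<in> S ==> y \<in> T ==> \<beta> x y = \<gamma> x y"
  and x: "x \<in> linear_span A S" and y: "y \<in> linear_span B T"
 shows "\<beta> x y = \<gamma> x y"
proof -
 interpret AX: vpair A X using assms by (simp add: vpairI)
 interpret BX: vpair B X using assms by (simp add: vpairI)
 have yc: "y \<in> carrier B" using BX.V.span_carrier[OF T y] .
 have "\<beta> a y = \<gamma> a y" if "a \<in> S" for a
  using BX.lin_eq_on_span[OF bil_right[OF assms(1)] bil_right[OF assms(2)] T eq y] that S by blast
 then show ?thesis
  using AX.lin_eq_on_span[OF bil_left[OF assms(1) yc] bil_left[OF assms(2) yc] S _ x] by blast
qed

lemma bil_span_into:
 assumes \<beta>: "bil A B X \<beta>" and "vec_space A" "vec_space B" "vec_space X" and N: "subspace_of N X"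
  and S: "S <= carrier A" and T: "T <= carrier B"
  and N': "\<And>x y. x \<in> S ==> y \<in> T ==> \<beta> x y \<in> N"
  and x: "x \<in> linear_span A S" and y: "y \<in> linear_span B T"
 shows "\<beta> x y \<in> N"
proof -
 interpret AX: vpair A X using assms by (simp add: vpairI)
 interpret BX: vpair B X using assms by (simp add: vpairI)
 have yc: "y \<in> carrier B" using BX.V.span_carrier[OF T y] .
 have "\<beta> a y \<in> N" if "a \<in> S" for a
 proof -
  have "\<beta> a ` T <= N" using N' that by auto
  then show ?thesis
   using BX.span_image_sub[OF bil_right[OF \<beta>] N T] that S y by blast
 qed
 then have "(\<lambda>a. \<beta> a y) ` S <= N" by auto
 then show ?thesis using AX.span_image_sub[OF bil_left[OF \<beta> yc] N S] x by blast
qed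

text \<open>The common shape of the maps that are prescribed on pure tensors by \<open>THE\<close>.
  The parameter \<open>\<tau>\<close> lets the same facts serve \<open>tens\<close> and its copy
  \<open>tensor\<close>.\<close>

definition tlift :: "('k::field, 'a) module => ('k, 'b) module => ('k, 't) module => ('a => 'b => 't)
  => ('k, 'x) module => ('a => 'b => 'x) => 't => 'x" where
 "tlift A B T \<tau> X \<beta> = (THE h. h \<in> lin T X \<and> (\<forall>x \<in> carrier A. \<forall>y \<in> carrier B. h (\<tau> x y) = \<beta> x y))"

locale tens_spaces = A: vspace A + B: vspace B
 for A :: "(rat, 'a) module" and B :: "(rat, 'b) module"
begin

abbreviation "FS \<equiv> free_space (carrier A \<times> carrier B)"
abbreviation "RS \<equiv> tensor_relations A B"

sublocale F: vspace FS by (rule vsI, rule vec_free)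

lemma gen_carrier: "x \<in> carrier A ==> y \<in> carrier B ==> gen (x, y) \<in> carrier FS"
 by simp

lemma rel_sub: "subspace_of RS FS"
 unfolding tensor_relations_def
proof (rule F.span_sub, safe)
 have d: "p - q \<in> carrier FS" if "p \<in> carrier FS" "q \<in> carrier FS" for p q
  using that keys_diff[of p q] by auto
 have s: "Poly_Mapping.single (x, y) c \<in> carrier FS" if "x \<in> carrier A" "y \<in> carrier B" for x y and c :: rat
  using that by simp
 fix x x' y y' and c :: rat
 show "gen (x \<oplus>\<^bsub>A\<^esub> x', y) - gen (x, y) - gen (x', y) \<in> carrier FS"
  if "x \<in> carrier A" "x' \<in> carrier A" "y \<in> carrier B"
  by (intro d gen_carrier) (use that in auto)
 show "gen (x, y \<oplus>\<^bsub>B\<^esub> y') - gen (x, y) - gen (x, y') \<in> carrier FS"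
  if "x \<in> carrier A" "y \<in> carrier B" "y' \<in> carrier B"
  by (intro d gen_carrier) (use that in auto)
 show "gen (c \<odot>\<^bsub>A\<^esub> x, y) - Poly_Mapping.single (x, y) c \<in> carrier FS"
  if "x \<in> carrier A" "y \<in> carrier B"
  by (intro d s gen_carrier) (use that in auto)
 show "gen (x, c \<odot>\<^bsub>B\<^esub> y) - Poly_Mapping.single (x, y) c \<in> carrier FS"
  if "x \<in> carrier A" "y \<in> carrier B"
  by (intro d s gen_carrier) (use that in auto)
qed

lemma vec_tens: "vec_space (tens A B)"
 unfolding tens_def by (rule F.vec_quot[OF rel_sub])

lemma pure_eqI:
 assumes "p \<in> carrier FS" "q \<in> carrier FS" "p - q \<in> RS"
 shows "RS +>\<^bsub>FS\<^esub> p = RS +>\<^bsub>FS\<^esub> q"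
 using F.coset_eq_iff[OF rel_sub assms(1,2)] assms free_diff[OF assms(1,2)] by simp

lemma single_scale: "Poly_Mapping.single xy c = c \<odot>\<^bsub>FS\<^esub> gen xy"
 by (auto intro!: poly_mapping_eqI simp: lookup_single when_def)

lemma tensor_rels:
 "x \<in> carrier A ==> x' \<in> carrier A ==> y \<in> carrier B ==> gen (x \<oplus>\<^bsub>A\<^esub> x', y) - gen (x, y) - gen (x', y) \<in> RS"
 "x \<in> carrier A ==> y \<in> carrier B ==> y' \<in> carrier B ==> gen (x, y \<oplus>\<^bsub>B\<^esub> y') - gen (x, y) - gen (x, y') \<in> RS"
 "x \<in> carrier A ==> y \<in> carrier B ==> gen (c \<odot>\<^bsub>A\<^esub> x, y) - Poly_Mapping.single (x, y) c \<in> RS"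
 "x \<in> carrier A ==> y \<in> carrier B ==> gen (x, c \<odot>\<^bsub>B\<^esub> y) - Poly_Mapping.single (x, y) c \<in> RS"
 unfolding tensor_relations_def by (rule F.span_base, blast)+

lemma bil_pure: "bil A B (tens A B) (pure A B)"
proof -
 note qa = F.quot_add[OF rel_sub] and qs = F.quot_smult[OF rel_sub]
 have pc: "pure A B x y \<in> carrier (tens A B)" if "x \<in> carrier A" "y \<in> carrier B" for x y
  using gen_carrier[OF that] by (auto simp: pure_def tens_def F.quot_carrier[OF rel_sub])
 have add: "pure A B x y \<oplus>\<^bsub>tens A B\<^esub> pure A B x' y' = RS +>\<^bsub>FS\<^esub> (gen (x, y) + gen (x', y'))"
  if "x \<in> carrier A" "y \<in> carrier B" "x' \<in> carrier A" "y' \<in> carrier B" for x y x' y'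
  unfolding pure_def tens_def using qa[OF gen_carrier gen_carrier] that by simp
 have sm: "c \<odot>\<^bsub>tens A B\<^esub> pure A B x y = RS +>\<^bsub>FS\<^esub> (Poly_Mapping.single (x, y) c)"
  if "x \<in> carrier A" "y \<in> carrier B" for x y c
  unfolding pure_def tens_def using qs[OF gen_carrier] that by (simp only: single_scale[of _ c])
 have pl: "p + q \<in> carrier FS" if "p \<in> carrier FS" "q \<in> carrier FS" for p q
  using that keys_add[of p q] by auto
 have s: "Poly_Mapping.single (x, y) c \<in> carrier FS" if "x \<in> carrier A" "y \<in> carrier B" for x y c
  using that by simp
 show ?thesis
 proof (intro bilI is_linI pc)
  fix x y y' assume *: "x \<in> carrier A" "y \<in> carrier B" "y' \<in> carrier B"
  from tensor_rels(2)[OF *] have "RS +>\<^bsub>FS\<^esub> gen (x, y \<oplus>\<^bsub>B\<^esub> y') = RS +>\<^bsub>FS\<^esub> (gen (x, y) + gen (x, y'))"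
   by (intro pure_eqI gen_carrier pl) (use * in \<open>simp_all add: diff_diff_eq del: free_space_simps\<close>)
  then show "pure A B x (y \<oplus>\<^bsub>B\<^esub> y') = pure A B x y \<oplus>\<^bsub>tens A B\<^esub> pure A B x y'"
   using * by (simp only: add) (simp only: pure_def)
 next
  fix x x' y assume *: "x \<in> carrier A" "x' \<in> carrier A" "y \<in> carrier B"
  from tensor_rels(1)[OF *] have "RS +>\<^bsub>FS\<^esub> gen (x \<oplus>\<^bsub>A\<^esub> x', y) = RS +>\<^bsub>FS\<^esub> (gen (x, y) + gen (x', y))"
   by (intro pure_eqI gen_carrier pl) (use * in \<open>simp_all add: diff_diff_eq del: free_space_simps\<close>)
  then show "pure A B (x \<oplus>\<^bsub>A\<^esub> x') y = pure A B x y \<oplus>\<^bsub>tens A B\<^esub> pure A B x' y"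
   using * by (simp only: add) (simp only: pure_def)
 next
  fix x y c assume *: "x \<in> carrier A" "y \<in> carrier B"
  from tensor_rels(4)[OF *] have "RS +>\<^bsub>FS\<^esub> gen (x, c \<odot>\<^bsub>B\<^esub> y) = RS +>\<^bsub>FS\<^esub> Poly_Mapping.single (x, y) c"
   by (intro pure_eqI gen_carrier s) (use * in \<open>simp_all del: free_space_simps\<close>)
  then show "pure A B x (c \<odot>\<^bsub>B\<^esub> y) = c \<odot>\<^bsub>tens A B\<^esub> pure A B x y"
   using * by (simp only: sm) (simp only: pure_def)
  from tensor_rels(3)[OF *] have "RS +>\<^bsub>FS\<^esub> gen (c \<odot>\<^bsub>A\<^esub> x, y) = RS +>\<^bsub>FS\<^esub> Poly_Mapping.single (x, y) c"
   by (intro pure_eqI gen_carrier s) (use * in \<open>simp_all del: free_space_simps\<close>)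
  then show "pure A B (c \<odot>\<^bsub>A\<^esub> x) y = c \<odot>\<^bsub>tens A B\<^esub> pure A B x y"
   using * by (simp only: sm) (simp only: pure_def)
 qed auto
qed

lemma tens_span: "linear_span (tens A B) {pure A B x y | x y. x \<in> carrier A \<and> y \<in> carrier B} = carrier (tens A B)"
proof -
 interpret T: vpair FS "tens A B" using vec_free vec_tens by (rule vpairI)
 have p: "is_lin FS (tens A B) (\<lambda>p. RS +>\<^bsub>FS\<^esub> p)"
  unfolding tens_def by (rule F.quot_proj_lin[OF rel_sub])
 let ?S = "{pure A B x y | x y. x \<in> carrier A \<and> y \<in> carrier B}"
 have sub: "?S <= carrier (tens A B)" using bil_closed[OF bil_pure] by auto
 have "(\<lambda>p. RS +>\<^bsub>FS\<^esub> p) ` linear_span FS (gen ` (carrier A \<times> carrier B)) <= linear_span (tens A B) ?S"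
 proof (rule T.span_image_sub[OF p T.W.span_sub[OF sub]])
  show "(\<lambda>p. RS +>\<^bsub>FS\<^esub> p) ` gen ` (carrier A \<times> carrier B) <= linear_span (tens A B) ?S"
  proof (clarify, rule T.W.span_base)
   fix x y assume "x \<in> carrier A" "y \<in> carrier B"
   then show "RS +>\<^bsub>FS\<^esub> gen (x, y) \<in> ?S" unfolding pure_def by blast
  qed
 qed auto
 moreover have "carrier (tens A B) = (\<lambda>p. RS +>\<^bsub>FS\<^esub> p) ` carrier FS"
  unfolding tens_def by (rule F.quot_carrier[OF rel_sub])
 ultimately have "carrier (tens A B) <= linear_span (tens A B) ?S"
  unfolding free_span by (simp only:)
 then show ?thesis using T.W.sub_le[OF T.W.span_sub[OF sub]] by (rule subset_antisym[rotated])
qed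

text \<open>Universal property: the map is extended linearly over the free space, and bilinearity
  kills the defining relations.\<close>

lemma tens_lift:
 assumes X: "vec_space X" and \<beta>: "bil A B X \<beta>"
 obtains h where "is_lin (tens A B) X h" "\<And>x y. x \<in> carrier A ==> y \<in> carrier B ==> h (pure A B x y) = \<beta> x y"
proof -
 interpret FX: vpair FS X using vec_free X by (rule vpairI)
 have "\<And>xy. xy \<in> carrier A \<times> carrier B ==> case_prod \<beta> xy \<in> carrier X"
  using bil_closed[OF \<beta>] by auto
 then obtain f where f: "is_lin FS X f"
  and fg: "\<And>xy. xy \<in> carrier A \<times> carrier B ==> f (gen xy) = case_prod \<beta> xy"
  using free_lift[OF X, of "carrier A \<times> carrier B" "case_prod \<beta>"] by blast
 have fs: "f (Poly_Mapping.single (x, y) c) = c \<odot>\<^bsub>X\<^esub> \<beta> x y" if "x \<in> carrier A" "y \<in> carrier B" for x y c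
  unfolding single_scale[of _ c] using is_lin_smult[OF f gen_carrier[OF that]] fg that by simp
 have fb: "f (gen (x, y)) = \<beta> x y" if "x \<in> carrier A" "y \<in> carrier B" for x y
  using fg[of "(x, y)"] that by simp
 have fd: "f (p - q) = f p \<ominus>\<^bsub>X\<^esub> f q" if "p \<in> carrier FS" "q \<in> carrier FS" for p q
  using FX.is_lin_diff[OF f that] free_diff[OF that] by simp
 have d: "p - q \<in> carrier FS" if "p \<in> carrier FS" "q \<in> carrier FS" for p q
  using that keys_diff[of p q] by auto
 have s: "Poly_Mapping.single (x, y) c \<in> carrier FS" if "x \<in> carrier A" "y \<in> carrier B" for x y and c :: rat
  using that by simp
 note bl = bil_left[OF \<beta>] and br = bil_right[OF \<beta>] and bc = bil_closed[OF \<beta>]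
 \<comment> \<open>The kernel of \<open>f\<close> is a subspace, so it contains \<open>RS\<close> as
   soon as it contains the four kinds of generators.\<close>
 have "RS <= {p \<in> carrier FS. f p \<in> {\<zero>\<^bsub>X\<^esub>}}"
  unfolding tensor_relations_def
 proof (rule F.span_least[OF FX.preimage_sub[OF f FX.W.zero_sub]], safe)
  fix x x' y y' and c :: rat
  show "f (gen (x \<oplus>\<^bsub>A\<^esub> x', y) - gen (x, y) - gen (x', y)) = \<zero>\<^bsub>X\<^esub>"
   if *: "x \<in> carrier A" "x' \<in> carrier A" "y \<in> carrier B"
  proof -
   have "f (gen (x \<oplus>\<^bsub>A\<^esub> x', y) - gen (x, y) - gen (x', y)) = f (gen (x \<oplus>\<^bsub>A\<^esub> x', y)) \<ominus>\<^bsub>X\<^esub> f (gen (x, y)) \<ominus>\<^bsub>X\<^esub> f (gen (x', y))"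
    using * A.M.a_closed by (simp only: fd d gen_carrier)
   also have "\<dots> = (\<beta> x y \<oplus>\<^bsub>X\<^esub> \<beta> x' y) \<ominus>\<^bsub>X\<^esub> \<beta> x y \<ominus>\<^bsub>X\<^esub> \<beta> x' y"
    using * A.M.a_closed by (simp only: fb is_lin_add[OF bl[OF *(3)]])
   finally show ?thesis using * by (simp add: FX.W.add_diff_cancel' bc)
  qed
  show "f (gen (x, y \<oplus>\<^bsub>B\<^esub> y') - gen (x, y) - gen (x, y')) = \<zero>\<^bsub>X\<^esub>"
   if *: "x \<in> carrier A" "y \<in> carrier B" "y' \<in> carrier B"
  proof -
   have "f (gen (x, y \<oplus>\<^bsub>B\<^esub> y') - gen (x, y) - gen (x, y')) = f (gen (x, y \<oplus>\<^bsub>B\<^esub> y')) \<ominus>\<^bsub>X\<^esub> f (gen (x, y)) \<ominus>\<^bsub>X\<^esub> f (gen (x, y'))"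
    using * B.M.a_closed by (simp only: fd d gen_carrier)
   also have "\<dots> = (\<beta> x y \<oplus>\<^bsub>X\<^esub> \<beta> x y') \<ominus>\<^bsub>X\<^esub> \<beta> x y \<ominus>\<^bsub>X\<^esub> \<beta> x y'"
    using * B.M.a_closed by (simp only: fb is_lin_add[OF br[OF *(1)]])
   finally show ?thesis using * by (simp add: FX.W.add_diff_cancel' bc)
  qed
  show "f (gen (c \<odot>\<^bsub>A\<^esub> x, y) - Poly_Mapping.single (x, y) c) = \<zero>\<^bsub>X\<^esub>"
   if *: "x \<in> carrier A" "y \<in> carrier B"
  proof -
   have "f (gen (c \<odot>\<^bsub>A\<^esub> x, y) - Poly_Mapping.single (x, y) c) = \<beta> (c \<odot>\<^bsub>A\<^esub> x) y \<ominus>\<^bsub>X\<^esub> c \<odot>\<^bsub>X\<^esub> \<beta> x y"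
    using * A.smult_closed' by (simp only: fd s gen_carrier fb fs[of _ _ c])
   then show ?thesis using is_lin_smult[OF bl[OF *(2)] *(1)] bc * by simp
  qed
  show "f (gen (x, c \<odot>\<^bsub>B\<^esub> y) - Poly_Mapping.single (x, y) c) = \<zero>\<^bsub>X\<^esub>"
   if *: "x \<in> carrier A" "y \<in> carrier B"
  proof -
   have "f (gen (x, c \<odot>\<^bsub>B\<^esub> y) - Poly_Mapping.single (x, y) c) = \<beta> x (c \<odot>\<^bsub>B\<^esub> y) \<ominus>\<^bsub>X\<^esub> c \<odot>\<^bsub>X\<^esub> \<beta> x y"
    using * B.smult_closed' by (simp only: fd s gen_carrier fb fs[of _ _ c])
   then show ?thesis using is_lin_smult[OF br[OF *(1)] *(2)] bc * by simp
  qed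
 qed (rule F.sub_mem[OF rel_sub], rule tensor_rels, assumption+)+
 then have "\<And>p. p \<in> RS ==> f p = \<zero>\<^bsub>X\<^esub>" by auto
 then obtain h where h: "is_lin (quot FS RS) X h" "\<And>p. p \<in> carrier FS ==> h (RS +>\<^bsub>FS\<^esub> p) = f p"
  using F.quot_lift[OF rel_sub f X] by blast
 show thesis
 proof (rule that)
  show "is_lin (tens A B) X h" using h(1) by (simp add: tens_def)
  show "h (pure A B x y) = \<beta> x y" if "x \<in> carrier A" "y \<in> carrier B" for x y
   using h(2)[OF gen_carrier[OF that]] fg that by (simp add: pure_def)
 qed
qed

end

text \<open>A tensor product up to an isomorphism \<open>e\<close> matching pure tensors. With the
  identity it is \<open>tens\<close>, with an embedding it is \<open>tensor\<close>; what follows is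
  proved once for both.\<close>

locale tprod = tens_spaces A B + T: vspace T
 for A :: "(rat, 'a) module" and B :: "(rat, 'b) module"
  and T :: "(rat, 't) module" and \<tau> :: "'a => 'b => 't" +
 fixes e
 assumes e_lin: "is_lin (tens A B) T e" and e_bij: "bij_betw e (carrier (tens A B)) (carrier T)"
  and e_pure: "\<And>x y. x \<in> carrier A ==> y \<in> carrier B ==> \<tau> x y = e (pure A B x y)"
begin

lemma bil_\<tau>: "bil A B T \<tau>"
proof -
 have b: "bil A B T (\<lambda>x y. e (pure A B x y))" by (rule bil_comp[OF bil_pure e_lin])
 show ?thesis
 proof (rule bilI)
  show "is_lin B T (\<tau> x)" if x: "x \<in> carrier A" for x
   by (rule is_lin_cong[OF bil_right[OF b x] _ B.vs]) (simp add: e_pure x)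
  show "is_lin A T (\<lambda>x. \<tau> x y)" if y: "y \<in> carrier B" for y
   by (rule is_lin_cong[OF bil_left[OF b y] _ A.vs]) (simp add: e_pure y)
 qed
qed

lemmas \<tau>_closed = bil_closed[OF bil_\<tau>]
lemmas \<tau>_left = bil_left[OF bil_\<tau>]
lemmas \<tau>_right = bil_right[OF bil_\<tau>]

lemma \<tau>_smult:
 assumes "x \<in> carrier A" "y \<in> carrier B"
 shows "\<tau> (c \<odot>\<^bsub>A\<^esub> x) y = c \<odot>\<^bsub>T\<^esub> \<tau> x y" "\<tau> x (c \<odot>\<^bsub>B\<^esub> y) = c \<odot>\<^bsub>T\<^esub> \<tau> x y"
 using is_lin_smult[OF \<tau>_left] is_lin_smult[OF \<tau>_right] assms by auto

lemma \<tau>_zero: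
 "y \<in> carrier B ==> \<tau> \<zero>\<^bsub>A\<^esub> y = \<zero>\<^bsub>T\<^esub>" "x \<in> carrier A ==> \<tau> x \<zero>\<^bsub>B\<^esub> = \<zero>\<^bsub>T\<^esub>"
 using \<tau>_smult(1)[of "\<zero>\<^bsub>A\<^esub>" y 0] \<tau>_smult(2)[of x "\<zero>\<^bsub>B\<^esub>" 0] \<tau>_closed by simp_all

abbreviation "pures \<equiv> {\<tau> x y | x y. x \<in> carrier A \<and> y \<in> carrier B}"

lemma pures_carrier: "pures <= carrier T"
 using \<tau>_closed by auto

lemma \<tau>_span: "linear_span T pures = carrier T"
proof
 show "linear_span T pures <= carrier T" using T.span_carrier[OF pures_carrier] by auto
 interpret P: vpair "tens A B" T using vec_tens T.vs by (rule vpairI)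
 have "e ` linear_span (tens A B) {pure A B x y | x y. x \<in> carrier A \<and> y \<in> carrier B} <= linear_span T pures"
 proof (rule P.span_image_sub[OF e_lin T.span_sub[OF pures_carrier]])
  show "{pure A B x y | x y. x \<in> carrier A \<and> y \<in> carrier B} <= carrier (tens A B)"
   using bil_closed[OF bil_pure] by auto
  show "e ` {pure A B x y | x y. x \<in> carrier A \<and> y \<in> carrier B} <= linear_span T pures"
  proof (clarify, rule T.span_base)
   fix x y assume "x \<in> carrier A" "y \<in> carrier B"
   then show "e (pure A B x y) \<in> pures" using e_pure[symmetric, of x y] by blast
  qed
 qed
 then show "carrier T <= linear_span T pures"
  unfolding tens_span using e_bij by (simp add: bij_betw_def)
qed

lemma ext2:
 assumes "vec_space X" "is_lin T X f" "is_lin T X g"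
  and "\<And>x y. x \<in> carrier A ==> y \<in> carrier B ==> f (\<tau> x y) = g (\<tau> x y)" and "t \<in> carrier T"
 shows "f t = g t"
proof -
 interpret P: vpair T X using assms(1) T.vs by (rule vpairI[rotated])
 show ?thesis
  by (rule P.lin_eq_on_span[OF assms(2,3) pures_carrier]) (use assms \<tau>_span in auto)
qed

lemma induct2 [consumes 1, case_names pure add]:
 assumes "t \<in> carrier T"
  and pure: "\<And>x y. x \<in> carrier A ==> y \<in> carrier B ==> P (\<tau> x y)"
  and add: "\<And>s t. s \<in> carrier T ==> t \<in> carrier T ==> P s ==> P t ==> P (s \<oplus>\<^bsub>T\<^esub> t)"
 shows "P t"
proof -
 \<comment> \<open>Strengthened to all scalar multiples. Those of a pure tensor are pure again,
   which is why the induction rule has no case for scalars.\<close>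
 define Q where "Q t \<longleftrightarrow> (\<forall>c. P (c \<odot>\<^bsub>T\<^esub> t))" for t
 have "t \<in> linear_span T pures" using assms(1) \<tau>_span by simp
 then have "Q t" using pures_carrier
 proof (induction rule: T.span_induct)
  case zero
  show ?case using pure[of "\<zero>\<^bsub>A\<^esub>" "\<zero>\<^bsub>B\<^esub>"] \<tau>_zero by (simp add: Q_def)
 next
  case (base t)
  then obtain x y where "t = \<tau> x y" "x \<in> carrier A" "y \<in> carrier B" by auto
  then show ?case using pure[of "_ \<odot>\<^bsub>A\<^esub> x" y] by (simp add: Q_def \<tau>_smult)
 next
  case (add x y)
  then show ?case using assms(3) by (simp add: Q_def T.smult_add_right)
 next
  case (smult c x)
  then show ?case by (simp add: Q_def T.smult_smult)
 qed
 then have "P (1 \<odot>\<^bsub>T\<^esub> t)" unfolding Q_def by blast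
 then show ?thesis using assms(1) by simp
qed

context
 fixes X :: "(rat, 'x) module" and \<beta>
 assumes X: "vec_space X" and \<beta>: "bil A B X \<beta>"
begin

lemma tlift_ex1: "\<exists>!h. h \<in> lin T X \<and> (\<forall>x \<in> carrier A. \<forall>y \<in> carrier B. h (\<tau> x y) = \<beta> x y)"
proof -
 obtain h where h: "is_lin (tens A B) X h"
  "\<And>x y. x \<in> carrier A ==> y \<in> carrier B ==> h (pure A B x y) = \<beta> x y"
  using tens_lift[OF X \<beta>] by blast
 let ?i = "inv_into (carrier (tens A B)) e"
 interpret P: vpair "tens A B" T using vec_tens T.vs by (rule vpairI)
 interpret TX: vpair T X using T.vs X by (rule vpairI)
 have l: "is_lin T X (\<lambda>t. h (?i t))" by (rule is_lin_comp[OF P.inv_lin[OF e_lin e_bij] h(1)])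
 have v: "h (?i (\<tau> x y)) = \<beta> x y" if "x \<in> carrier A" "y \<in> carrier B" for x y
  using that e_bij h(2) bil_closed[OF bil_pure] by (simp add: e_pure bij_betw_def)
 show ?thesis
 proof (rule ex1I[of _ "restrict (\<lambda>t. h (?i t)) (carrier T)"])
  show "restrict (\<lambda>t. h (?i t)) (carrier T) \<in> lin T X \<and>
   (\<forall>x\<in>carrier A. \<forall>y\<in>carrier B. restrict (\<lambda>t. h (?i t)) (carrier T) (\<tau> x y) = \<beta> x y)"
   using lin_restrict[OF T.vs l] v \<tau>_closed by simp
  show "g = restrict (\<lambda>t. h (?i t)) (carrier T)"
   if "g \<in> lin T X \<and> (\<forall>x\<in>carrier A. \<forall>y\<in>carrier B. g (\<tau> x y) = \<beta> x y)" for g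
   by (rule TX.lin_ext[OF _ lin_restrict[OF T.vs l] pures_carrier \<tau>_span])
    (use that v \<tau>_closed in auto)
 qed
qed

lemma tlift_lin: "tlift A B T \<tau> X \<beta> \<in> lin T X"
 using theI'[OF tlift_ex1] by (simp add: tlift_def)

lemma tlift_is_lin: "is_lin T X (tlift A B T \<tau> X \<beta>)"
 using tlift_lin by (rule lin_is_lin)

lemma tlift_pure: "x \<in> carrier A ==> y \<in> carrier B ==> tlift A B T \<tau> X \<beta> (\<tau> x y) = \<beta> x y"
 using theI'[OF tlift_ex1] by (simp add: tlift_def)

lemma tlift_unique:
 assumes "is_lin T X h" "\<And>x y. x \<in> carrier A ==> y \<in> carrier B ==> h (\<tau> x y) = \<beta> x y" "t \<in> carrier T"
 shows "tlift A B T \<tau> X \<beta> t = h t"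
 by (rule ext2[OF X tlift_is_lin assms(1)]) (use assms tlift_pure in auto)

end

text \<open>For each fixed third argument the map lifts over the first two; uniqueness of lifts
  makes the result linear in the third argument.\<close>

lemma tri_lift_left:
 assumes C: "vec_space C" and X: "vec_space X"
  and b: "\<And>z. z \<in> carrier C ==> bil A B X (\<lambda>x y. \<gamma> x y z)"
  and l: "\<And>x y. x \<in> carrier A ==> y \<in> carrier B ==> is_lin C X (\<gamma> x y)"
 shows "bil T C X (\<lambda>t z. tlift A B T \<tau> X (\<lambda>x y. \<gamma> x y z) t)"
proof (rule bilI)
 interpret C: vspace C by (rule vsI, rule C)
 interpret TX: vpair T X using T.vs X by (rule vpairI)
 fix t assume t: "t \<in> carrier T"
 show "is_lin C X (\<lambda>z. tlift A B T \<tau> X (\<lambda>x y. \<gamma> x y z) t)"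
 proof (rule is_linI)
  fix z assume z: "z \<in> carrier C"
  show "tlift A B T \<tau> X (\<lambda>x y. \<gamma> x y z) t \<in> carrier X"
   using lin_mem[OF tlift_is_lin[OF X b] t] z .
  show "tlift A B T \<tau> X (\<lambda>x y. \<gamma> x y (c \<odot>\<^bsub>C\<^esub> z)) t = c \<odot>\<^bsub>X\<^esub> tlift A B T \<tau> X (\<lambda>x y. \<gamma> x y z) t" for c
   using tlift_pure[OF X b] z is_lin_smult[OF l]
   by (intro tlift_unique[OF X b _ _ t] TX.is_lin_scale tlift_is_lin[OF X b]) auto
  fix w assume w: "w \<in> carrier C"
  show "tlift A B T \<tau> X (\<lambda>x y. \<gamma> x y (z \<oplus>\<^bsub>C\<^esub> w)) t
    = tlift A B T \<tau> X (\<lambda>x y. \<gamma> x y z) t \<oplus>\<^bsub>X\<^esub> tlift A B T \<tau> X (\<lambda>x y. \<gamma> x y w) t"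
   using tlift_pure[OF X b] z w is_lin_add[OF l]
   by (intro tlift_unique[OF X b _ _ t] TX.is_lin_plus tlift_is_lin[OF X b]) auto
 qed
qed (rule tlift_is_lin[OF X b])

end

lemma tprod_tens: "vec_space A ==> vec_space B ==> tprod A B (tens A B) (pure A B) (\<lambda>t. t)"
 using tens_spaces.vec_tens[of A B]
 by (simp add: tprod_def tens_spaces_def vspace_def tprod_axioms_def is_lin_id bij_betw_def)

text \<open>A class is coded by a chosen representative, a finitely supported rational function on
  pairs; such functions inject into any infinite universe.\<close>

lemma copyable_tens:
 fixes A B :: "'u::infinite qvs"
 assumes "vec_space A" "vec_space B"
 shows "copyable (tens A B) (embed (tens A B) :: _ => 'u)"
proof -
 interpret tens_spaces A B using assms by (simp add: tens_spaces_def vspace_def)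
 obtain p :: "'u \<times> 'u => 'u" where "inj p" using inj_into_infinite_times by blast
 then obtain h :: "('u \<times> 'u \<Rightarrow>\<^sub>0 rat) => 'u" where h: "inj h" using inj_poly_mapping_into_infinite by blast
 have *: "(SOME p. p \<in> X) \<in> X" "(SOME p. p \<in> X) \<in> carrier FS" "X = RS +>\<^bsub>FS\<^esub> (SOME p. p \<in> X)"
  if "X \<in> carrier (tens A B)" for X
 proof -
  obtain q where q: "q \<in> carrier FS" "X = RS +>\<^bsub>FS\<^esub> q"
   using \<open>X \<in> _\<close> by (auto simp: tens_def F.quot_carrier[OF rel_sub])
  show 1: "(SOME p. p \<in> X) \<in> X"
   unfolding q(2) by (rule someI, rule F.coset_self[OF rel_sub q(1)])
  then show 2: "(SOME p. p \<in> X) \<in> carrier FS" using F.coset_mem[OF rel_sub q(1)] q(2) by blast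
  have "(SOME p. p \<in> X) \<ominus>\<^bsub>FS\<^esub> q \<in> RS"
   using 1 F.coset_mem[OF rel_sub q(1)] q(2) by blast
  then show "X = RS +>\<^bsub>FS\<^esub> (SOME p. p \<in> X)"
   using F.coset_eq_iff[OF rel_sub 2 q(1)] q(2) by simp
 qed
 have "inj_on (\<lambda>X. h (SOME p. p \<in> X)) (carrier (tens A B))"
  by (rule inj_onI) (metis *(3) injD[OF h])
 then show ?thesis by (rule copyableI[OF vec_tens])
qed

lemma tprod_tensor:
 fixes A B :: "'u::infinite qvs"
 assumes "vec_space A" "vec_space B"
 shows "tprod A B (tensor A B) (tpure A B) (embed (tens A B))"
proof -
 interpret copyable "tens A B" "embed (tens A B) :: _ => 'u" using assms by (rule copyable_tens)
 show ?thesis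
  using assms vec_copy is_lin_embed bij_embed
  by (simp add: tprod_def tens_spaces_def vspace_def tprod_axioms_def tensor_def tpure_def)
qed

lemma vec_tensor: "vec_space (A :: 'u::infinite qvs) ==> vec_space B ==> vec_space (tensor A B)"
 using tprod_tensor[of A B] by (simp add: tprod_def vspace_def)

section \<open>The monoidal structure of vector spaces\<close>

lemma lin_compose:
 assumes "vec_space U" "f \<in> lin U V" "g \<in> lin V W"
 shows "compose (carrier U) g f \<in> lin U W"
 unfolding compose_def
 by (rule lin_restrict[OF assms(1) is_lin_comp[OF lin_is_lin[OF assms(2)] lin_is_lin[OF assms(3)]]])

lemma lin_id: "vec_space U ==> (\<lambda>x\<in>carrier U. x) \<in> lin U U"
 by (rule lin_restrict[OF _ is_lin_id])

lemma lin_closed: "f \<in> lin U V ==> x \<in> carrier U ==> f x \<in> carrier V"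
 by (auto simp: lin_iff lin_mem)

lemma lin_eqI: "f \<in> lin U V ==> g \<in> lin U V ==> (\<And>x. x \<in> carrier U ==> f x = g x) ==> f = g"
 by (rule extensionalityI[of _ "carrier U"]) (auto simp: lin_iff)

lemma copyable_field: "copyable (field_space :: (rat, rat) module) (embed (field_space :: (rat, rat) module) :: rat => 'u::infinite)"
proof -
 have v: "vec_space (field_space :: (rat, rat) module)"
  by (rule vec_spaceI) (auto simp: field_space_def algebra_simps)
 obtain f :: "rat => 'u" where "inj f" using inj_countable_into_infinite[OF inj_to_nat] by blast
 then show ?thesis by (intro copyableI[OF v, of f]) (simp add: field_space_def)
qed

abbreviation rat_embed :: "rat => 'u::infinite" where
 "rat_embed \<equiv> embed (field_space :: (rat, rat) module)"

lemma field_space_simps [simp]: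
 "carrier field_space = UNIV" "x \<oplus>\<^bsub>field_space\<^esub> y = x + y" "\<zero>\<^bsub>field_space\<^esub> = 0"
 "c \<odot>\<^bsub>field_space\<^esub> x = of_rat c * x"
 by (simp_all add: field_space_def)

lemma vec_field: "vec_space (field_space :: (rat, 'l::field_char_0) module)"
 by (rule vec_spaceI) (auto simp: algebra_simps of_rat_add of_rat_mult of_rat_minus)

lemma vec_unit: "vec_space (unit_space :: 'u::infinite qvs)"
 unfolding unit_space_def by (rule copyable.vec_copy[OF copyable_field])

lemma unit_carrier: "carrier (unit_space :: 'u::infinite qvs) = range rat_embed"
 unfolding unit_space_def copyable.copy_carrier[OF copyable_field] by simp

lemma rat_embed_carrier [simp]: "(rat_embed q :: 'u::infinite) \<in> carrier unit_space"
 by (simp add: unit_carrier)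

lemma is_lin_rat_embed: "is_lin field_space (unit_space :: 'u::infinite qvs) rat_embed"
 unfolding unit_space_def by (rule copyable.is_lin_embed[OF copyable_field])

lemma is_lin_unembed_unit: "is_lin (unit_space :: 'u::infinite qvs) field_space (unembed (field_space :: (rat, rat) module))"
 unfolding unit_space_def by (rule copyable.is_lin_unembed[OF copyable_field])

lemma unembed_rat_embed [simp]: "unembed (field_space :: (rat, rat) module) (rat_embed q :: 'u::infinite) = q"
 by (rule copyable.unembed_e[OF copyable_field]) simp

lemma bil_scalar:
 fixes f :: "'u => rat"
 assumes "vec_space A" "is_lin U field_space f"
 shows "bil U A A (\<lambda>u x. f u \<odot>\<^bsub>A\<^esub> x)"
proof -
 interpret A: vspace A by (rule vsI, rule assms)
 show ?thesis
  by (intro bilI is_linI)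
   (simp_all add: is_lin_add[OF assms(2)] is_lin_smult[OF assms(2)] A.smult_add_right A.smult_add_left
    A.smult_smult mult.commute)
qed

lemmas bil_tpure = tprod.bil_\<tau>[OF tprod_tensor]
lemmas tpure_closed = tprod.\<tau>_closed[OF tprod_tensor]
lemmas tpure_left = tprod.\<tau>_left[OF tprod_tensor]
lemmas tpure_right = tprod.\<tau>_right[OF tprod_tensor]
lemmas tpure_zero = tprod.\<tau>_zero[OF tprod_tensor]
lemmas tpure_smult = tprod.\<tau>_smult[OF tprod_tensor]
lemmas tensor_ext2 = tprod.ext2[OF tprod_tensor]
lemmas tensor_span = tprod.\<tau>_span[OF tprod_tensor]
lemmas tensor_lift_lin = tprod.tlift_lin[OF tprod_tensor]
lemmas tensor_lift_is_lin = tprod.tlift_is_lin[OF tprod_tensor]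
lemmas tensor_lift_pure = tprod.tlift_pure[OF tprod_tensor]

lemma tensor_ext3:
 fixes A B C :: "'u::infinite qvs"
 assumes v: "vec_space A" "vec_space B" "vec_space C" "vec_space X"
  and f: "is_lin (tensor (tensor A B) C) X f" and g: "is_lin (tensor (tensor A B) C) X g"
  and eq: "\<And>x y z. x \<in> carrier A ==> y \<in> carrier B ==> z \<in> carrier C ==>
   f (tpure (tensor A B) C (tpure A B x y) z) = g (tpure (tensor A B) C (tpure A B x y) z)"
  and t: "t \<in> carrier (tensor (tensor A B) C)"
 shows "f t = g t"
proof (rule tensor_ext2[OF vec_tensor[OF v(1,2)] v(3,4) f g _ t])
 fix s z assume s: "s \<in> carrier (tensor A B)" and z: "z \<in> carrier C"
 note l = tpure_left[OF vec_tensor[OF v(1,2)] v(3) z]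
 show "f (tpure (tensor A B) C s z) = g (tpure (tensor A B) C s z)"
  by (rule tensor_ext2[OF v(1,2,4) is_lin_comp[OF l f] is_lin_comp[OF l g] _ s])
   (rule eq[OF _ _ z])
qed

lemma tensor_ext3':
 fixes A B C :: "'u::infinite qvs"
 assumes v: "vec_space A" "vec_space B" "vec_space C" "vec_space X"
  and f: "is_lin (tensor A (tensor B C)) X f" and g: "is_lin (tensor A (tensor B C)) X g"
  and eq: "\<And>x y z. x \<in> carrier A ==> y \<in> carrier B ==> z \<in> carrier C ==>
   f (tpure A (tensor B C) x (tpure B C y z)) = g (tpure A (tensor B C) x (tpure B C y z))"
  and t: "t \<in> carrier (tensor A (tensor B C))"
 shows "f t = g t"
proof (rule tensor_ext2[OF v(1) vec_tensor[OF v(2,3)] v(4) f g _ t])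
 fix x s assume x: "x \<in> carrier A" and s: "s \<in> carrier (tensor B C)"
 note l = tpure_right[OF v(1) vec_tensor[OF v(2,3)] x]
 show "f (tpure A (tensor B C) x s) = g (tpure A (tensor B C) x s)"
  by (rule tensor_ext2[OF v(2-4) is_lin_comp[OF l f] is_lin_comp[OF l g] _ s])
   (rule eq[OF x])
qed

lemma tensor_ext4:
 fixes A B C D :: "'u::infinite qvs"
 assumes v: "vec_space A" "vec_space B" "vec_space C" "vec_space D" "vec_space X"
  and f: "is_lin (tensor (tensor (tensor A B) C) D) X f"
  and g: "is_lin (tensor (tensor (tensor A B) C) D) X g"
  and eq: "\<And>x y z w. x \<in> carrier A ==> y \<in> carrier B ==> z \<in> carrier C ==> w \<in> carrier D ==>
   f (tpure (tensor (tensor A B) C) D (tpure (tensor A B) C (tpure A B x y) z) w)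
    = g (tpure (tensor (tensor A B) C) D (tpure (tensor A B) C (tpure A B x y) z) w)"
  and t: "t \<in> carrier (tensor (tensor (tensor A B) C) D)"
 shows "f t = g t"
proof (rule tensor_ext3[OF vec_tensor[OF v(1,2)] v(3-5) f g _ t])
 fix s z w assume s: "s \<in> carrier (tensor A B)" and z: "z \<in> carrier C" and w: "w \<in> carrier D"
 note l = is_lin_comp[OF tpure_left[OF vec_tensor[OF v(1,2)] v(3) z]
   tpure_left[OF vec_tensor[OF vec_tensor[OF v(1,2)] v(3)] v(4) w]]
 show "f (tpure (tensor (tensor A B) C) D (tpure (tensor A B) C s z) w)
   = g (tpure (tensor (tensor A B) C) D (tpure (tensor A B) C s z) w)"
  by (rule tensor_ext2[OF v(1,2,5) is_lin_comp[OF l f] is_lin_comp[OF l g] _ s])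
   (rule eq[OF _ _ z w])
qed

text \<open>The coherence laws are equations between extensional linear maps. This lemma and its
  analogues for more factors reduce them to computations on decomposable tensors.\<close>

lemma tensor_lin_ext2:
 fixes A B :: "'u::infinite qvs"
 assumes v: "vec_space A" "vec_space B" and f: "f \<in> lin (tensor A B) X" and g: "g \<in> lin (tensor A B) X"
  and X: "vec_space X" and eq: "\<And>x y. x \<in> carrier A ==> y \<in> carrier B ==> f (tpure A B x y) = g (tpure A B x y)"
 shows "f = g"
 by (rule lin_eqI[OF f g tensor_ext2[OF v X lin_is_lin[OF f] lin_is_lin[OF g] eq]])

lemma tensor_lin_ext3:
 fixes A B C :: "'u::infinite qvs"
 assumes v: "vec_space A" "vec_space B" "vec_space C" and f: "f \<in> lin (tensor (tensor A B) C) X" and g: "g \<in> lin (tensor (tensor A B) C) X"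
  and X: "vec_space X" and eq: "\<And>x y z. x \<in> carrier A ==> y \<in> carrier B ==> z \<in> carrier C ==> f (tpure (tensor A B) C (tpure A B x y) z) = g (tpure (tensor A B) C (tpure A B x y) z)"
 shows "f = g"
 by (rule lin_eqI[OF f g tensor_ext3[OF v X lin_is_lin[OF f] lin_is_lin[OF g] eq]])

lemma tensor_lin_ext3':
 fixes A B C :: "'u::infinite qvs"
 assumes v: "vec_space A" "vec_space B" "vec_space C" and f: "f \<in> lin (tensor A (tensor B C)) X" and g: "g \<in> lin (tensor A (tensor B C)) X"
  and X: "vec_space X" and eq: "\<And>x y z. x \<in> carrier A ==> y \<in> carrier B ==> z \<in> carrier C ==> f (tpure A (tensor B C) x (tpure B C y z)) = g (tpure A (tensor B C) x (tpure B C y z))"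
 shows "f = g"
 by (rule lin_eqI[OF f g tensor_ext3'[OF v X lin_is_lin[OF f] lin_is_lin[OF g] eq]])

lemma tensor_lin_ext4:
 fixes A B C D :: "'u::infinite qvs"
 assumes v: "vec_space A" "vec_space B" "vec_space C" "vec_space D" and f: "f \<in> lin (tensor (tensor (tensor A B) C) D) X" and g: "g \<in> lin (tensor (tensor (tensor A B) C) D) X"
  and X: "vec_space X" and eq: "\<And>x y z w. x \<in> carrier A ==> y \<in> carrier B ==> z \<in> carrier C ==> w \<in> carrier D ==> f (tpure (tensor (tensor A B) C) D (tpure (tensor A B) C (tpure A B x y) z) w) = g (tpure (tensor (tensor A B) C) D (tpure (tensor A B) C (tpure A B x y) z) w)"
 shows "f = g"
 by (rule lin_eqI[OF f g tensor_ext4[OF v X lin_is_lin[OF f] lin_is_lin[OF g] eq]])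

lemma
 fixes A B A' B' :: "'u::infinite qvs"
 assumes v: "vec_space A" "vec_space B" "vec_space A'" "vec_space B'"
  and f: "is_lin A A' f" and g: "is_lin B B' g"
 shows tensor_map_lin: "tensor_map A B A' B' f g \<in> lin (tensor A B) (tensor A' B')"
  and tensor_map_pure: "x \<in> carrier A ==> y \<in> carrier B ==>
   tensor_map A B A' B' f g (tpure A B x y) = tpure A' B' (f x) (g y)"
proof -
 note b = bil_comp2[OF bil_tpure[OF v(3,4)] f g]
 note l = tensor_lift_lin[OF v(1,2) vec_tensor[OF v(3,4)] b]
  tensor_lift_pure[OF v(1,2) vec_tensor[OF v(3,4)] b]
 show "tensor_map A B A' B' f g \<in> lin (tensor A B) (tensor A' B')"
  using l(1) by (simp add: tensor_map_def tlift_def)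
 show "x \<in> carrier A ==> y \<in> carrier B ==>
   tensor_map A B A' B' f g (tpure A B x y) = tpure A' B' (f x) (g y)"
  using l(2) by (simp add: tensor_map_def tlift_def)
qed

text \<open>Two successive lifts, first over \<open>A\<close> and \<open>B\<close> with the third
  entry fixed, then over \<open>C\<close>. This is the unique existence behind
  \<open>assoc_map\<close>.\<close>

lemma tensor_tri_lift:
 fixes A B C :: "'u::infinite qvs"
 assumes v: "vec_space A" "vec_space B" "vec_space C" "vec_space X"
  and b: "\<And>z. z \<in> carrier C ==> bil A B X (\<lambda>x y. \<gamma> x y z)"
  and l: "\<And>x y. x \<in> carrier A ==> y \<in> carrier B ==> is_lin C X (\<gamma> x y)"
 shows "\<exists>!h. h \<in> lin (tensor (tensor A B) C) X \<and> (\<forall>x \<in> carrier A. \<forall>y \<in> carrier B. \<forall>z \<in> carrier C.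
  h (tpure (tensor A B) C (tpure A B x y) z) = \<gamma> x y z)"
proof -
 note vT = vec_tensor[OF v(1,2)]
 note b2 = tprod.tri_lift_left[OF tprod_tensor[OF v(1,2)] v(3,4) b l]
 show ?thesis
 proof (rule ex1I, intro conjI ballI)
  show "tlift (tensor A B) C (tensor (tensor A B) C) (tpure (tensor A B) C) X
   (\<lambda>t z. tlift A B (tensor A B) (tpure A B) X (\<lambda>x y. \<gamma> x y z) t) \<in> lin (tensor (tensor A B) C) X" (is "?h \<in> _")
   by (rule tensor_lift_lin[OF vT v(3,4) b2])
  show hv: "?h (tpure (tensor A B) C (tpure A B x y) z) = \<gamma> x y z"
   if *: "x \<in> carrier A" "y \<in> carrier B" "z \<in> carrier C" for x y z
   using tensor_lift_pure[OF vT v(3,4) b2 tpure_closed[OF v(1,2) *(1,2)] *(3)]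
    tensor_lift_pure[OF v(1,2,4) b[OF *(3)] *(1,2)] by simp
  show "g = ?h" if g: "g \<in> lin (tensor (tensor A B) C) X \<and> (\<forall>x \<in> carrier A. \<forall>y \<in> carrier B. \<forall>z \<in> carrier C.
    g (tpure (tensor A B) C (tpure A B x y) z) = \<gamma> x y z)" for g
  proof (rule lin_eqI[OF conjunct1[OF g] tensor_lift_lin[OF vT v(3,4) b2]])
   fix t assume t: "t \<in> carrier (tensor (tensor A B) C)"
   have gl: "is_lin (tensor (tensor A B) C) X g" using g by (simp add: lin_is_lin)
   show "g t = ?h t"
   proof (rule tensor_ext3[OF v gl tensor_lift_is_lin[OF vT v(3,4) b2] _ t])
    fix x y z assume c: "x \<in> carrier A" "y \<in> carrier B" "z \<in> carrier C"
    have 1: "g (tpure (tensor A B) C (tpure A B x y) z) = \<gamma> x y z" using g c by blast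
    show "g (tpure (tensor A B) C (tpure A B x y) z) = ?h (tpure (tensor A B) C (tpure A B x y) z)"
     unfolding 1 by (rule hv[OF c, symmetric])
   qed
  qed
 qed
qed

lemma assoc_map_ex1:
 fixes A B C :: "'u::infinite qvs"
 assumes v: "vec_space A" "vec_space B" "vec_space C"
 shows "\<exists>!h. h \<in> lin (tensor (tensor A B) C) (tensor A (tensor B C)) \<and>
   (\<forall>x \<in> carrier A. \<forall>y \<in> carrier B. \<forall>z \<in> carrier C.
    h (tpure (tensor A B) C (tpure A B x y) z) = tpure A (tensor B C) x (tpure B C y z))"
proof -
 note vT = vec_tensor[OF v(2,3)]
 show ?thesis
 proof (rule tensor_tri_lift[OF v vec_tensor[OF v(1) vT]])
  show "bil A B (tensor A (tensor B C)) (\<lambda>x y. tpure A (tensor B C) x (tpure B C y z))" if "z \<in> carrier C" for z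
   by (rule bil_comp2[OF bil_tpure[OF v(1) vT] is_lin_id tpure_left[OF v(2,3) that]])
  show "is_lin C (tensor A (tensor B C)) (\<lambda>z. tpure A (tensor B C) x (tpure B C y z))"
   if "x \<in> carrier A" "y \<in> carrier B" for x y
   by (rule is_lin_comp[OF tpure_right[OF v(2,3) that(2)] tpure_right[OF v(1) vT that(1)]])
 qed
qed

lemma
 fixes A B C :: "'u::infinite qvs"
 assumes v: "vec_space A" "vec_space B" "vec_space C"
 shows assoc_map_lin: "assoc_map A B C \<in> lin (tensor (tensor A B) C) (tensor A (tensor B C))"
  and assoc_map_pure: "x \<in> carrier A ==> y \<in> carrier B ==> z \<in> carrier C ==>
   assoc_map A B C (tpure (tensor A B) C (tpure A B x y) z) = tpure A (tensor B C) x (tpure B C y z)"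
 using theI'[OF assoc_map_ex1[OF v]] by (simp_all add: assoc_map_def)

lemma
 fixes A :: "'u::infinite qvs"
 assumes v: "vec_space A"
 shows lunit_map_lin: "lunit_map A \<in> lin (tensor unit_space A) A"
  and lunit_map_pure: "x \<in> carrier A ==> lunit_map A (tpure unit_space A (rat_embed q) x) = q \<odot>\<^bsub>A\<^esub> x"
proof -
 note b = bil_scalar[OF v is_lin_unembed_unit]
 have "\<exists>!h. h \<in> lin (tensor unit_space A) A \<and>
   (\<forall>q. \<forall>x \<in> carrier A. h (tpure unit_space A (rat_embed q) x) = q \<odot>\<^bsub>A\<^esub> x)"
  using tprod.tlift_ex1[OF tprod_tensor[OF vec_unit v] v b] by (simp add: unit_carrier)
 from theI'[OF this]
 show "lunit_map A \<in> lin (tensor unit_space A) A"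
  and "x \<in> carrier A ==> lunit_map A (tpure unit_space A (rat_embed q) x) = q \<odot>\<^bsub>A\<^esub> x"
  by (simp_all add: lunit_map_def)
qed

lemma
 fixes A :: "'u::infinite qvs"
 assumes v: "vec_space A"
 shows runit_map_lin: "runit_map A \<in> lin (tensor A unit_space) A"
  and runit_map_pure: "x \<in> carrier A ==> runit_map A (tpure A unit_space x (rat_embed q)) = q \<odot>\<^bsub>A\<^esub> x"
proof -
 note b = bil_swap[OF bil_scalar[OF v is_lin_unembed_unit]]
 have swap: "(\<forall>x \<in> carrier A. \<forall>q. P q x) \<longleftrightarrow> (\<forall>q. \<forall>x \<in> carrier A. P q x)" for P :: "rat => 'u => bool"
  by blast
 have "\<exists>!h. h \<in> lin (tensor A unit_space) A \<and>
   (\<forall>x \<in> carrier A. \<forall>q. h (tpure A unit_space x (rat_embed q)) = q \<odot>\<^bsub>A\<^esub> x)"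
  using tprod.tlift_ex1[OF tprod_tensor[OF v vec_unit] v b] by (simp add: unit_carrier)
 then have "\<exists>!h. h \<in> lin (tensor A unit_space) A \<and>
   (\<forall>q. \<forall>x \<in> carrier A. h (tpure A unit_space x (rat_embed q)) = q \<odot>\<^bsub>A\<^esub> x)"
  unfolding swap .
 from theI'[OF this]
 show "runit_map A \<in> lin (tensor A unit_space) A"
  and "x \<in> carrier A ==> runit_map A (tpure A unit_space x (rat_embed q)) = q \<odot>\<^bsub>A\<^esub> x"
  by (simp_all add: runit_map_def)
qed

definition lunit_inv :: "'u::infinite qvs => 'u => 'u" where
 "lunit_inv A = (\<lambda>x \<in> carrier A. tpure unit_space A (rat_embed 1) x)"

lemma lunit_inv_lin: "vec_space A ==> lunit_inv A \<in> lin A (tensor unit_space A)"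
 unfolding lunit_inv_def by (rule lin_restrict, assumption, rule tpure_right[OF vec_unit]) auto

lemma
 fixes A B :: "'u::infinite qvs"
 assumes v: "vec_space A" "vec_space B"
 shows braid_map_lin: "braid_map A B \<in> lin (tensor A B) (tensor B A)"
  and braid_map_pure: "x \<in> carrier A ==> y \<in> carrier B ==> braid_map A B (tpure A B x y) = tpure B A y x"
proof -
 note b = bil_swap[OF bil_tpure[OF v(2,1)]]
 note l = tensor_lift_lin[OF v vec_tensor[OF v(2,1)] b]
  tensor_lift_pure[OF v vec_tensor[OF v(2,1)] b]
 show "braid_map A B \<in> lin (tensor A B) (tensor B A)"
  using l(1) by (simp add: braid_map_def tlift_def)
 show "x \<in> carrier A ==> y \<in> carrier B ==> braid_map A B (tpure A B x y) = tpure B A y x"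
  using l(2) by (simp add: braid_map_def tlift_def)
qed

lemmas lin_rules = lin_compose tensor_map_lin assoc_map_lin lunit_map_lin runit_map_lin
 lunit_inv_lin braid_map_lin lin_id lin_is_lin vec_tensor vec_unit

lemmas pure_simps = compose_eq tensor_map_pure assoc_map_pure lunit_map_pure runit_map_pure
 braid_map_pure tpure_closed vec_tensor vec_unit lin_is_lin lin_closed lin_id
 assoc_map_lin lunit_map_lin runit_map_lin lunit_inv_lin braid_map_lin tensor_map_lin

lemma compose_id_left: "f \<in> lin U V ==> compose (carrier U) (\<lambda>x\<in>carrier V. x) f = f"
 by (rule ext) (auto simp: compose_def lin_iff extensional_def lin_mem)

lemma compose_id_right: "f \<in> lin U V ==> compose (carrier U) f (\<lambda>x\<in>carrier U. x) = f"
 by (rule ext) (auto simp: compose_def lin_iff extensional_def)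

lemma compose_compose:
 "f \<in> lin U V ==> compose (carrier U) (compose (carrier V) h g) f = compose (carrier U) h (compose (carrier U) g f)"
 by (rule ext) (auto simp: compose_def lin_closed)

text \<open>The inverse of the associator is a composite of braidings and associators, and the right unit
 constraint is the left one after a braiding; only braidings, associators and left unit constraints
 have to be checked for compatibility with additional structure.\<close>

definition assoc_inv :: "'u::infinite qvs => 'u qvs => 'u qvs => 'u => 'u" where
 "assoc_inv A B C = (let T = carrier (tensor A (tensor B C)) in
   compose T (braid_map C (tensor A B)) (compose T (assoc_map C A B)
    (compose T (braid_map B (tensor C A)) (compose T (assoc_map B C A) (braid_map A (tensor B C))))))"

definition runit_inv :: "'u::infinite qvs => 'u => 'u" where
 "runit_inv A = compose (carrier A) (braid_map unit_space A) (lunit_inv A)"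

lemma assoc_inv_lin: "vec_space A ==> vec_space B ==> vec_space C ==> assoc_inv A B C \<in> lin (tensor A (tensor B C)) (tensor (tensor A B) C)"
 unfolding assoc_inv_def Let_def by (assumption | rule lin_rules)+

lemma runit_inv_lin: "vec_space A ==> runit_inv A \<in> lin A (tensor A unit_space)"
 unfolding runit_inv_def by (assumption | rule lin_rules)+

lemma runit_map_eq:
 fixes A :: "'u::infinite qvs"
 assumes v: "vec_space A"
 shows "runit_map A = compose (carrier (tensor A unit_space)) (lunit_map A) (braid_map A unit_space)"
 by (rule tensor_lin_ext2[OF v vec_unit], (rule v lin_rules)+) (auto simp: pure_simps v unit_carrier)

lemma tensor_map_id:
 fixes A B :: "'u::infinite qvs"
 assumes v: "vec_space A" "vec_space B"
 shows "tensor_map A B A B (\<lambda>x\<in>carrier A. x) (\<lambda>x\<in>carrier B. x) = (\<lambda>x\<in>carrier (tensor A B). x)" (is "?l = ?r")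
by (rule tensor_lin_ext2[OF v], (rule v lin_rules)+) (simp add: pure_simps v)

lemma tensor_map_comp:
 fixes A B :: "'u::infinite qvs"
 assumes v: "vec_space A" "vec_space B" "vec_space A'" "vec_space B'" "vec_space A''" "vec_space B''"
  and f: "f \<in> lin A A'" "f' \<in> lin A' A''" "g \<in> lin B B'" "g' \<in> lin B' B''"
 shows "tensor_map A B A'' B'' (compose (carrier A) f' f) (compose (carrier B) g' g)
  = compose (carrier (tensor A B)) (tensor_map A' B' A'' B'' f' g') (tensor_map A B A' B' f g)" (is "?l = ?r")
proof (rule tensor_lin_ext2[OF v(1,2)], (rule v f lin_rules)+)
 fix x y assume xy: "x \<in> carrier A" "y \<in> carrier B"
 have fl: "is_lin A A'' (compose (carrier A) f' f)" "is_lin B B'' (compose (carrier B) g' g)"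
  by (rule v f lin_rules)+
 show "?l (tpure A B x y) = ?r (tpure A B x y)"
  using xy f v by (simp add: pure_simps fl lin_closed[OF f(1)] lin_closed[OF f(3)])
qed

lemma assoc_inverse:
 fixes A B C :: "'u::infinite qvs"
 assumes v: "vec_space A" "vec_space B" "vec_space C"
 shows "compose (carrier (tensor (tensor A B) C)) (assoc_inv A B C) (assoc_map A B C)
   = (\<lambda>x\<in>carrier (tensor (tensor A B) C). x)" (is "?l = ?r")
  and "compose (carrier (tensor A (tensor B C))) (assoc_map A B C) (assoc_inv A B C)
   = (\<lambda>x\<in>carrier (tensor A (tensor B C)). x)" (is "?l' = ?r'")
proof -
 show "?l = ?r"
 by (rule tensor_lin_ext3[OF v], (rule v lin_rules assoc_inv_lin)+) (simp add: pure_simps v assoc_inv_def Let_def)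
 show "?l' = ?r'"
 by (rule tensor_lin_ext3'[OF v], (rule v lin_rules assoc_inv_lin)+) (simp add: pure_simps v assoc_inv_def Let_def)
qed

lemma assoc_map_natural:
 fixes A B C :: "'u::infinite qvs"
 assumes v: "vec_space A" "vec_space B" "vec_space C" "vec_space A'" "vec_space B'" "vec_space C'"
  and f: "f \<in> lin A A'" "g \<in> lin B B'" "h \<in> lin C C'"
 shows "compose (carrier (tensor (tensor A B) C)) (assoc_map A' B' C')
   (tensor_map (tensor A B) C (tensor A' B') C' (tensor_map A B A' B' f g) h)
  = compose (carrier (tensor (tensor A B) C))
   (tensor_map A (tensor B C) A' (tensor B' C') f (tensor_map B C B' C' g h)) (assoc_map A B C)" (is "?l = ?r")
by (rule tensor_lin_ext3[OF v(1-3)], (rule v f lin_rules)+) (simp add: pure_simps v f lin_closed[OF f(1)] lin_closed[OF f(2)] lin_closed[OF f(3)])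

lemma lunit_map_natural:
 fixes A :: "'u::infinite qvs"
 assumes v: "vec_space A" "vec_space A'" and f: "f \<in> lin A A'"
 shows "compose (carrier (tensor unit_space A)) (lunit_map A')
   (tensor_map unit_space A unit_space A' (\<lambda>x\<in>carrier unit_space. x) f)
  = compose (carrier (tensor unit_space A)) f (lunit_map A)" (is "?l = ?r")
proof (rule tensor_lin_ext2[OF vec_unit v(1)], (rule v f lin_rules)+)
 fix x y :: 'u assume "x \<in> carrier unit_space" "y \<in> carrier A"
 moreover from this obtain q where "x = rat_embed q" by (auto simp: unit_carrier)
 ultimately show "?l (tpure unit_space A x y) = ?r (tpure unit_space A x y)"
  by (simp add: pure_simps v f lin_closed[OF f] is_lin_smult[OF lin_is_lin[OF f]])
qed

lemma runit_map_natural: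
 fixes A :: "'u::infinite qvs"
 assumes v: "vec_space A" "vec_space A'" and f: "f \<in> lin A A'"
 shows "compose (carrier (tensor A unit_space)) (runit_map A')
   (tensor_map A unit_space A' unit_space f (\<lambda>x\<in>carrier unit_space. x))
  = compose (carrier (tensor A unit_space)) f (runit_map A)" (is "?l = ?r")
proof (rule tensor_lin_ext2[OF v(1) vec_unit], (rule v f lin_rules)+)
 fix y x :: 'u assume "x \<in> carrier unit_space" "y \<in> carrier A"
 moreover from this obtain q where "x = rat_embed q" by (auto simp: unit_carrier)
 ultimately show "?l (tpure A unit_space y x) = ?r (tpure A unit_space y x)"
  by (simp add: pure_simps v f lin_closed[OF f] is_lin_smult[OF lin_is_lin[OF f]])
qed

lemma lunit_inverse:
 fixes A :: "'u::infinite qvs"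
 assumes v: "vec_space A"
 shows "compose (carrier (tensor unit_space A)) (lunit_inv A) (lunit_map A) = (\<lambda>x\<in>carrier (tensor unit_space A). x)" (is "?l = ?r")
  and "compose (carrier A) (lunit_map A) (lunit_inv A) = (\<lambda>x\<in>carrier A. x)" (is "?l' = ?r'")
proof -
 interpret A: vspace A by (rule vsI, rule v)
 show "?l = ?r"
 proof (rule tensor_lin_ext2[OF vec_unit v], (rule v lin_rules)+)
  fix x y :: 'u assume x: "x \<in> carrier unit_space" and y: "y \<in> carrier A"
  then obtain q where q: "x = rat_embed q" by (auto simp: unit_carrier)
  \<comment> \<open>Every element of the unit space is a rational multiple of
    \<open>rat_embed 1\<close>, and the scalar can be moved to the other factor.\<close>
  have u: "rat_embed q = q \<odot>\<^bsub>unit_space\<^esub> rat_embed 1"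
   using is_lin_smult[OF is_lin_rat_embed, of 1 q] by simp
  have "tpure unit_space A x y = tpure unit_space A (rat_embed 1) (q \<odot>\<^bsub>A\<^esub> y)"
   unfolding q u using y by (simp only: tpure_smult[OF vec_unit v rat_embed_carrier])
  then show "?l (tpure unit_space A x y) = ?r (tpure unit_space A x y)"
   using y by (simp add: pure_simps v lunit_inv_def q)
 qed
 show "?l' = ?r'"
  by (rule ext) (simp add: compose_def lunit_inv_def lunit_map_pure[OF v] restrict_def)
qed

lemma runit_inverse:
 fixes A :: "'u::infinite qvs"
 assumes v: "vec_space A"
 shows "compose (carrier (tensor A unit_space)) (runit_inv A) (runit_map A) = (\<lambda>x\<in>carrier (tensor A unit_space). x)" (is "?l = ?r")
  and "compose (carrier A) (runit_map A) (runit_inv A) = (\<lambda>x\<in>carrier A. x)" (is "?l' = ?r'")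
proof -
 interpret A: vspace A by (rule vsI, rule v)
 show "?l = ?r"
 proof (rule tensor_lin_ext2[OF v vec_unit], (rule v lin_rules runit_inv_lin)+)
  fix y x :: 'u assume y: "y \<in> carrier A" and x: "x \<in> carrier unit_space"
  then obtain q where q: "x = rat_embed q" by (auto simp: unit_carrier)
  have u: "rat_embed q = q \<odot>\<^bsub>unit_space\<^esub> rat_embed 1"
   using is_lin_smult[OF is_lin_rat_embed, of 1 q] by simp
  have "tpure A unit_space y x = tpure A unit_space (q \<odot>\<^bsub>A\<^esub> y) (rat_embed 1)"
   unfolding q u using y by (simp only: tpure_smult[OF v vec_unit _ rat_embed_carrier])
  then show "?l (tpure A unit_space y x) = ?r (tpure A unit_space y x)"
   using y by (simp add: pure_simps v runit_inv_def lunit_inv_def q)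
 qed
 show "?l' = ?r'"
  by (rule ext) (simp add: compose_def runit_inv_def lunit_inv_def braid_map_pure v vec_unit unit_carrier runit_map_pure[OF v] restrict_def)
qed

lemma braid_map_natural:
 fixes A B :: "'u::infinite qvs"
 assumes v: "vec_space A" "vec_space B" "vec_space A'" "vec_space B'"
  and f: "f \<in> lin A A'" "g \<in> lin B B'"
 shows "compose (carrier (tensor A B)) (braid_map A' B') (tensor_map A B A' B' f g)
  = compose (carrier (tensor A B)) (tensor_map B A B' A' g f) (braid_map A B)" (is "?l = ?r")
by (rule tensor_lin_ext2[OF v(1,2)], (rule v f lin_rules)+) (simp add: pure_simps v f lin_closed[OF f(1)] lin_closed[OF f(2)])

lemma braid_map_symmetric:
 fixes A B :: "'u::infinite qvs"
 assumes v: "vec_space A" "vec_space B"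
 shows "compose (carrier (tensor A B)) (braid_map B A) (braid_map A B) = (\<lambda>x\<in>carrier (tensor A B). x)" (is "?l = ?r")
by (rule tensor_lin_ext2[OF v(1,2)], (rule v lin_rules)+) (simp add: pure_simps v)

lemma pentagon_identity:
 fixes A B C D :: "'u::infinite qvs"
 assumes v: "vec_space A" "vec_space B" "vec_space C" "vec_space D"
 shows "compose (carrier (tensor (tensor (tensor A B) C) D))
   (tensor_map A (tensor (tensor B C) D) A (tensor B (tensor C D)) (\<lambda>x\<in>carrier A. x) (assoc_map B C D))
   (compose (carrier (tensor (tensor (tensor A B) C) D)) (assoc_map A (tensor B C) D)
    (tensor_map (tensor (tensor A B) C) D (tensor A (tensor B C)) D (assoc_map A B C) (\<lambda>x\<in>carrier D. x)))
  = compose (carrier (tensor (tensor (tensor A B) C) D)) (assoc_map A B (tensor C D)) (assoc_map (tensor A B) C D)" (is "?l = ?r")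
by (rule tensor_lin_ext4[OF v], (rule v lin_rules)+) (simp add: pure_simps v)

lemma triangle_identity:
 fixes A B :: "'u::infinite qvs"
 assumes v: "vec_space A" "vec_space B"
 shows "compose (carrier (tensor (tensor A unit_space) B))
   (tensor_map A (tensor unit_space B) A B (\<lambda>x\<in>carrier A. x) (lunit_map B)) (assoc_map A unit_space B)
  = tensor_map (tensor A unit_space) B A B (runit_map A) (\<lambda>x\<in>carrier B. x)" (is "?l = ?r")
proof (rule tensor_lin_ext3[OF v(1) vec_unit v(2)], (rule v lin_rules)+)
 fix x u y :: 'u assume xy: "x \<in> carrier A" "y \<in> carrier B" and u: "u \<in> carrier unit_space"
 then obtain q where q: "u = rat_embed q" by (auto simp: unit_carrier)
 interpret A: vspace A by (rule vsI, rule v)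
 interpret B: vspace B by (rule vsI, rule v)
 show "?l (tpure (tensor A unit_space) B (tpure A unit_space x u) y) = ?r (tpure (tensor A unit_space) B (tpure A unit_space x u) y)"
  using xy by (simp add: pure_simps v q tpure_smult)
qed

lemma hexagon_identity:
 fixes A B C :: "'u::infinite qvs"
 assumes v: "vec_space A" "vec_space B" "vec_space C"
 shows "compose (carrier (tensor (tensor A B) C)) (assoc_map B C A)
   (compose (carrier (tensor (tensor A B) C)) (braid_map A (tensor B C)) (assoc_map A B C))
  = compose (carrier (tensor (tensor A B) C))
   (tensor_map B (tensor A C) B (tensor C A) (\<lambda>x\<in>carrier B. x) (braid_map A C))
   (compose (carrier (tensor (tensor A B) C)) (assoc_map B A C)
    (tensor_map (tensor A B) C (tensor B A) C (braid_map A B) (\<lambda>x\<in>carrier C. x)))" (is "?l = ?r")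
by (rule tensor_lin_ext3[OF v], (rule v lin_rules)+) (simp add: pure_simps v)

section \<open>Categories of vector spaces with additional structure\<close>

text \<open>The axioms of a symmetric monoidal category hold for linear maps already; what depends
  on the additional structure is that it passes to tensor products and that the structure maps
  satisfy \<open>pres\<close>. The locale collects exactly this.\<close>

locale structured_spaces =
 fixes X :: "'o set" and us :: "'o => 'u::infinite qvs" and pres :: "'o => 'o => ('u => 'u) => bool"
  and T :: "'o => 'o => 'o" and I :: 'o
 assumes us_vec: "A \<in> X ==> vec_space (us A)"
  and T_closed: "A \<in> X ==> B \<in> X ==> T A B \<in> X"
  and us_T: "us (T A B) = tensor (us A) (us B)"
  and I_closed: "I \<in> X"
  and us_I: "us I = unit_space"
  and pres_id: "A \<in> X ==> pres A A (\<lambda>x\<in>carrier (us A). x)"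
  and pres_comp: "[|A \<in> X; B \<in> X; C \<in> X; f \<in> lin (us A) (us B); g \<in> lin (us B) (us C); pres A B f; pres B C g|]
   ==> pres A C (compose (carrier (us A)) g f)"
  and pres_tensor: "[|A \<in> X; B \<in> X; A' \<in> X; B' \<in> X; f \<in> lin (us A) (us A'); g \<in> lin (us B) (us B');
    pres A A' f; pres B B' g|]
   ==> pres (T A B) (T A' B') (tensor_map (us A) (us B) (us A') (us B') f g)"
  and pres_assoc: "[|A \<in> X; B \<in> X; C \<in> X|] ==> pres (T (T A B) C) (T A (T B C)) (assoc_map (us A) (us B) (us C))"
  and pres_lunit: "A \<in> X ==> pres (T I A) A (lunit_map (us A))"
  and pres_lunit_inv: "A \<in> X ==> pres A (T I A) (lunit_inv (us A))"
  and pres_braid: "[|A \<in> X; B \<in> X|] ==> pres (T A B) (T B A) (braid_map (us A) (us B))"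
begin

definition arrow :: "'o => 'o => ('u => 'u) => bool" where
 "arrow A B f \<longleftrightarrow> A \<in> X \<and> B \<in> X \<and> f \<in> lin (us A) (us B) \<and> pres A B f"

lemma arrow_comp: "arrow A B f ==> arrow B C g ==> arrow A C (compose (carrier (us A)) g f)"
 using lin_compose[OF us_vec, of A f "us B" g "us C"] pres_comp[of A B C f g] by (simp add: arrow_def)

lemma arrow_braid: "A \<in> X ==> B \<in> X ==> arrow (T A B) (T B A) (braid_map (us A) (us B))"
 by (simp add: arrow_def T_closed us_T braid_map_lin us_vec pres_braid)

lemma arrow_assoc: "A \<in> X ==> B \<in> X ==> C \<in> X ==> arrow (T (T A B) C) (T A (T B C)) (assoc_map (us A) (us B) (us C))"
 by (simp add: arrow_def T_closed us_T assoc_map_lin us_vec pres_assoc)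

text \<open>The inverse associator is reached by rotating the factors: A(BC), (BC)A, B(CA), (CA)B,
  C(AB), (AB)C, with braidings and associators alternating.\<close>

lemma pres_assoc_inv:
 assumes A: "A \<in> X" and B: "B \<in> X" and C: "C \<in> X"
 shows "pres (T A (T B C)) (T (T A B) C) (assoc_inv (us A) (us B) (us C))"
 using arrow_comp[OF arrow_comp[OF arrow_comp[OF arrow_comp[OF arrow_braid[OF A T_closed[OF B C]] arrow_assoc[OF B C A]]
  arrow_braid[OF B T_closed[OF C A]]] arrow_assoc[OF C A B]] arrow_braid[OF C T_closed[OF A B]]]
 by (simp add: assoc_inv_def Let_def us_T arrow_def)

lemma pres_runit:
 assumes A: "A \<in> X" shows "pres (T A I) A (runit_map (us A))"
proof -
 have "arrow (T I A) A (lunit_map (us A))" by (simp add: arrow_def A T_closed I_closed us_T us_I us_vec lunit_map_lin pres_lunit)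
 from arrow_comp[OF arrow_braid[OF A I_closed] this] show ?thesis
  by (simp add: runit_map_eq us_vec A us_T us_I arrow_def)
qed

lemma pres_runit_inv:
 assumes A: "A \<in> X" shows "pres A (T A I) (runit_inv (us A))"
proof -
 have "arrow A (T I A) (lunit_inv (us A))" by (simp add: arrow_def A T_closed I_closed us_T us_I us_vec lunit_inv_lin pres_lunit_inv)
 from arrow_comp[OF this arrow_braid[OF I_closed A]] show ?thesis by (simp add: runit_inv_def us_I arrow_def)
qed

abbreviation "CC \<equiv> vs_smc X us pres T I"

lemma hom_iff: "f \<in> hom_set CC A B \<longleftrightarrow>
  A \<in> X \<and> B \<in> X \<and> Fun f \<in> lin (us A) (us B) \<and> pres A B (Fun f) \<and> Src f = A \<and> Trg f = B"
 by (auto simp: hom_set_def vs_smc_def)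

lemma arr_iff: "f \<in> Arr CC \<longleftrightarrow> f \<in> hom_set CC (Src f) (Trg f)"
 by (auto simp: hom_set_def vs_smc_def)

lemma CC_simps:
 "Obj CC = X" "Dom CC = Src" "Cod CC = Trg"
 "ident CC A = \<lparr>Src = A, Trg = A, Fun = (\<lambda>x \<in> carrier (us A). x)\<rparr>"
 "Comp CC g f = \<lparr>Src = Src f, Trg = Trg g, Fun = compose (carrier (us (Src f))) (Fun g) (Fun f)\<rparr>"
 "tens_obj CC = T" "unit_obj CC = I"
 "tens_arr CC f g = \<lparr>Src = T (Src f) (Src g), Trg = T (Trg f) (Trg g),
          Fun = tensor_map (us (Src f)) (us (Src g)) (us (Trg f)) (us (Trg g)) (Fun f) (Fun g)\<rparr>"
 "assoc CC A B C = \<lparr>Src = T (T A B) C, Trg = T A (T B C), Fun = assoc_map (us A) (us B) (us C)\<rparr>"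
 "lunit CC A = \<lparr>Src = T I A, Trg = A, Fun = lunit_map (us A)\<rparr>"
 "runit CC A = \<lparr>Src = T A I, Trg = A, Fun = runit_map (us A)\<rparr>"
 "braid CC A B = \<lparr>Src = T A B, Trg = T B A, Fun = braid_map (us A) (us B)\<rparr>"
 by (simp_all add: vs_smc_def)

lemma iso_arrI:
 assumes "f \<in> hom_set CC A B" "g \<in> hom_set CC B A"
  and "compose (carrier (us A)) (Fun g) (Fun f) = (\<lambda>x\<in>carrier (us A). x)"
  and "compose (carrier (us B)) (Fun f) (Fun g) = (\<lambda>x\<in>carrier (us B). x)"
 shows "iso_arr CC f"
 unfolding iso_arr_def using assms
 by (intro conjI bexI[of _ g]) (auto simp: arr_iff hom_iff CC_simps)

lemma category: "category CC"
proof
 fix f assume "f \<in> Arr CC"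
 then show "Dom CC f \<in> Obj CC \<and> Cod CC f \<in> Obj CC"
  unfolding arr_iff hom_iff by (simp add: CC_simps)
next
 fix A assume A: "A \<in> Obj CC"
 then show "ident CC A \<in> hom_set CC A A"
  by (simp add: hom_iff CC_simps lin_id us_vec pres_id)
next
 fix f g A B D assume "f \<in> hom_set CC A B" "g \<in> hom_set CC B D"
 then show "g \<cdot>\<^bsub>CC\<^esub> f \<in> hom_set CC A D"
  by (auto simp: hom_iff CC_simps intro: lin_compose us_vec pres_comp)
next
 fix f A B assume "f \<in> hom_set CC A B"
 then show "ident CC B \<cdot>\<^bsub>CC\<^esub> f = f" "f \<cdot>\<^bsub>CC\<^esub> ident CC A = f"
  by (auto simp: hom_iff CC_simps compose_id_left compose_id_right)
next
 fix f g h A B D E assume "f \<in> hom_set CC A B" "g \<in> hom_set CC B D" "h \<in> hom_set CC D E"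
 then show "(h \<cdot>\<^bsub>CC\<^esub> g) \<cdot>\<^bsub>CC\<^esub> f = h \<cdot>\<^bsub>CC\<^esub> (g \<cdot>\<^bsub>CC\<^esub> f)"
  by (auto simp: hom_iff CC_simps compose_compose)
qed

lemma smc: "symmetric_monoidal_category CC"
proof (rule symmetric_monoidal_category.intro[OF category], rule symmetric_monoidal_category_axioms.intro)
 note [simp] = us_T us_I
 note v = us_vec
 fix A B assume "A \<in> Obj CC" "B \<in> Obj CC"
 then have AB: "A \<in> X" "B \<in> X" by (simp_all add: CC_simps)
 show "A \<boxtimes>\<^bsub>CC\<^esub> B \<in> Obj CC" using AB by (simp add: CC_simps T_closed)
 show "ident CC A \<boxdot>\<^bsub>CC\<^esub> ident CC B = ident CC (A \<boxtimes>\<^bsub>CC\<^esub> B)"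
  using AB by (simp add: CC_simps tensor_map_id v)
 show "braid CC A B \<in> hom_set CC (A \<boxtimes>\<^bsub>CC\<^esub> B) (B \<boxtimes>\<^bsub>CC\<^esub> A)"
  using AB by (simp add: CC_simps hom_iff T_closed braid_map_lin v pres_braid)
 show "braid CC B A \<cdot>\<^bsub>CC\<^esub> braid CC A B = ident CC (A \<boxtimes>\<^bsub>CC\<^esub> B)"
  using AB by (simp add: CC_simps braid_map_symmetric v)
 show "(ident CC A \<boxdot>\<^bsub>CC\<^esub> lunit CC B) \<cdot>\<^bsub>CC\<^esub> assoc CC A (unit_obj CC) B = runit CC A \<boxdot>\<^bsub>CC\<^esub> ident CC B"
  using AB by (simp add: CC_simps triangle_identity v)
 show "lunit CC A \<in> hom_set CC (unit_obj CC \<boxtimes>\<^bsub>CC\<^esub> A) A"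
  using AB by (simp add: CC_simps hom_iff T_closed I_closed lunit_map_lin v pres_lunit)
 then show "iso_arr CC (lunit CC A)"
  by (rule iso_arrI[where g = "\<lparr>Src = A, Trg = T I A, Fun = lunit_inv (us A)\<rparr>"])
   (use AB in \<open>simp_all add: CC_simps hom_iff T_closed I_closed lunit_inv_lin v pres_lunit_inv lunit_inverse\<close>)
 show "runit CC A \<in> hom_set CC (A \<boxtimes>\<^bsub>CC\<^esub> unit_obj CC) A"
  using AB by (simp add: CC_simps hom_iff T_closed I_closed runit_map_lin v pres_runit)
 then show "iso_arr CC (runit CC A)"
  by (rule iso_arrI[where g = "\<lparr>Src = A, Trg = T A I, Fun = runit_inv (us A)\<rparr>"])
   (use AB in \<open>simp_all add: CC_simps hom_iff T_closed I_closed runit_inv_lin v pres_runit_inv runit_inverse\<close>)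
 fix D assume "D \<in> Obj CC"
 then have D: "D \<in> X" by (simp add: CC_simps)
 show "assoc CC A B D \<in> hom_set CC ((A \<boxtimes>\<^bsub>CC\<^esub> B) \<boxtimes>\<^bsub>CC\<^esub> D) (A \<boxtimes>\<^bsub>CC\<^esub> (B \<boxtimes>\<^bsub>CC\<^esub> D))"
  using AB D by (simp add: CC_simps hom_iff T_closed assoc_map_lin v pres_assoc)
 then show "iso_arr CC (assoc CC A B D)"
  by (rule iso_arrI[where g = "\<lparr>Src = T A (T B D), Trg = T (T A B) D, Fun = assoc_inv (us A) (us B) (us D)\<rparr>"])
   (use AB D in \<open>simp_all add: CC_simps hom_iff T_closed assoc_inv_lin v pres_assoc_inv assoc_inverse\<close>)
 show "assoc CC B D A \<cdot>\<^bsub>CC\<^esub> braid CC A (B \<boxtimes>\<^bsub>CC\<^esub> D) \<cdot>\<^bsub>CC\<^esub> assoc CC A B D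
   = (ident CC B \<boxdot>\<^bsub>CC\<^esub> braid CC A D) \<cdot>\<^bsub>CC\<^esub> assoc CC B A D \<cdot>\<^bsub>CC\<^esub> (braid CC A B \<boxdot>\<^bsub>CC\<^esub> ident CC D)"
  using AB D by (simp add: CC_simps hexagon_identity v)
 fix E assume "E \<in> Obj CC"
 then have E: "E \<in> X" by (simp add: CC_simps)
 show "(ident CC A \<boxdot>\<^bsub>CC\<^esub> assoc CC B D E) \<cdot>\<^bsub>CC\<^esub> assoc CC A (B \<boxtimes>\<^bsub>CC\<^esub> D) E \<cdot>\<^bsub>CC\<^esub> (assoc CC A B D \<boxdot>\<^bsub>CC\<^esub> ident CC E)
   = assoc CC A B (D \<boxtimes>\<^bsub>CC\<^esub> E) \<cdot>\<^bsub>CC\<^esub> assoc CC (A \<boxtimes>\<^bsub>CC\<^esub> B) D E"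
  using AB D E by (simp add: CC_simps pentagon_identity v)
next
 note [simp] = us_T us_I
 note v = us_vec
 fix f A A' assume f: "f \<in> hom_set CC A A'"
 show "lunit CC A' \<cdot>\<^bsub>CC\<^esub> (ident CC (unit_obj CC) \<boxdot>\<^bsub>CC\<^esub> f) = f \<cdot>\<^bsub>CC\<^esub> lunit CC A"
  using f by (auto simp: CC_simps hom_iff lunit_map_natural v)
 show "runit CC A' \<cdot>\<^bsub>CC\<^esub> (f \<boxdot>\<^bsub>CC\<^esub> ident CC (unit_obj CC)) = f \<cdot>\<^bsub>CC\<^esub> runit CC A"
  using f by (auto simp: CC_simps hom_iff runit_map_natural v)
 fix g B B' assume g: "g \<in> hom_set CC B B'"
 show "f \<boxdot>\<^bsub>CC\<^esub> g \<in> hom_set CC (A \<boxtimes>\<^bsub>CC\<^esub> B) (A' \<boxtimes>\<^bsub>CC\<^esub> B')"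
  using f g by (auto simp: CC_simps hom_iff T_closed v pres_tensor intro!: tensor_map_lin lin_is_lin)
 show "braid CC A' B' \<cdot>\<^bsub>CC\<^esub> (f \<boxdot>\<^bsub>CC\<^esub> g) = (g \<boxdot>\<^bsub>CC\<^esub> f) \<cdot>\<^bsub>CC\<^esub> braid CC A B"
  using f g by (auto simp: CC_simps hom_iff braid_map_natural v)
 show "assoc CC A' B' D' \<cdot>\<^bsub>CC\<^esub> ((f \<boxdot>\<^bsub>CC\<^esub> g) \<boxdot>\<^bsub>CC\<^esub> h) = (f \<boxdot>\<^bsub>CC\<^esub> (g \<boxdot>\<^bsub>CC\<^esub> h)) \<cdot>\<^bsub>CC\<^esub> assoc CC A B D"
  if "h \<in> hom_set CC D D'" for h D D'
  using f g that by (auto simp: CC_simps hom_iff assoc_map_natural v)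
 show "(f' \<cdot>\<^bsub>CC\<^esub> f) \<boxdot>\<^bsub>CC\<^esub> (g' \<cdot>\<^bsub>CC\<^esub> g) = (f' \<boxdot>\<^bsub>CC\<^esub> g') \<cdot>\<^bsub>CC\<^esub> (f \<boxdot>\<^bsub>CC\<^esub> g)"
  if "f' \<in> hom_set CC A' A''" "g' \<in> hom_set CC B' B''" for f' g' A'' B''
  using f g that by (auto simp: CC_simps hom_iff intro!: tensor_map_comp v)
next
 show "unit_obj CC \<in> Obj CC" by (simp add: CC_simps I_closed)
qed

end

text \<open>Allows the weight condition and the Hodge condition on morphisms to be verified
  independently of each other.\<close>

lemma structured_spaces_conj:
 "structured_spaces X us p T I ==> structured_spaces X us q T I ==> structured_spaces X us (\<lambda>A B f. p A B f \<and> q A B f) T I"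
 by (simp add: structured_spaces_def)

section \<open>Functors that change only the additional structure\<close>

text \<open>The common form of \<open>Pi_W\<close>, \<open>U_fil\<close> and the functor
  \<open>G\<close> constructed at the end: the underlying space stays, and all structure maps are
  identities on it.\<close>

definition restructure ::
 "('o => 'o => 'o) => 'o => ('o => 'u::infinite qvs) => ('p => 'p => 'p) => 'p => ('o => 'p) => ('o, 'p, 'u) vs_lax_functor" where
 "restructure T I us T' I' \<phi> = \<lparr>on_obj = \<phi>,
   on_arr = (\<lambda>f. \<lparr>Src = \<phi> (Src f), Trg = \<phi> (Trg f), Fun = Fun f\<rparr>),
   lax_mult = (\<lambda>A B. \<lparr>Src = T' (\<phi> A) (\<phi> B), Trg = \<phi> (T A B), Fun = (\<lambda>x \<in> carrier (tensor (us A) (us B)). x)\<rparr>),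
   lax_unit = \<lparr>Src = I', Trg = \<phi> I, Fun = (\<lambda>x \<in> carrier unit_space. x)\<rparr>\<rparr>"

locale restructuring = C: structured_spaces X us pres T I + D: structured_spaces X' us' pres' T' I'
 for X :: "'o set" and us :: "'o => 'u::infinite qvs" and pres T I
  and X' :: "'p set" and us' :: "'p => 'u qvs" and pres' T' I' +
 fixes \<phi> :: "'o => 'p"
 assumes \<phi>_closed: "A \<in> X ==> \<phi> A \<in> X'"
  and us_\<phi>: "us' (\<phi> A) = us A"
  and pres_\<phi>: "[|A \<in> X; B \<in> X; f \<in> lin (us A) (us B); pres A B f|] ==> pres' (\<phi> A) (\<phi> B) f"
  and pres_mult: "[|A \<in> X; B \<in> X|] ==> pres' (T' (\<phi> A) (\<phi> B)) (\<phi> (T A B)) (\<lambda>x \<in> carrier (tensor (us A) (us B)). x)"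
  and pres_unit: "pres' I' (\<phi> I) (\<lambda>x \<in> carrier unit_space. x)"
begin

text \<open>With identities as structure maps every coherence diagram collapses to unit laws of
  composition. The content lies in \<open>pres_mult\<close> and \<open>pres_unit\<close>, that these
  identities are morphisms at all.\<close>

lemma restructure_lax: "lax_symmetric_monoidal_functor C.CC D.CC (restructure T I us T' I' \<phi>)" (is "lax_symmetric_monoidal_functor _ _ ?F")
proof (intro lax_symmetric_monoidal_functor.intro functor_between.intro C.category D.category C.smc D.smc
  functor_between_axioms.intro lax_symmetric_monoidal_functor_axioms.intro)
 note [simp] = us_\<phi> C.us_T D.us_T C.us_I D.us_I
 note v = C.us_vec
 note s = restructure_def C.CC_simps D.CC_simps
 note id = compose_id_left compose_id_right tensor_map_id
 note l = lin_id assoc_map_lin lunit_map_lin runit_map_lin braid_map_lin vec_tensor vec_unit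
 {
  fix A assume "A \<in> Obj C.CC"
  then have A: "A \<in> X" by (simp add: s)
  show "on_obj ?F A \<in> Obj D.CC" using A by (simp add: s \<phi>_closed)
  show "on_arr ?F (ident C.CC A) = ident D.CC (on_obj ?F A)" by (simp add: s)
  show "on_arr ?F (lunit C.CC A) \<cdot>\<^bsub>D.CC\<^esub> lax_mult ?F (unit_obj C.CC) A
     \<cdot>\<^bsub>D.CC\<^esub> (lax_unit ?F \<boxdot>\<^bsub>D.CC\<^esub> ident D.CC (on_obj ?F A)) = lunit D.CC (on_obj ?F A)"
   using A by (simp add: s v id l compose_id_right[OF lunit_map_lin])
  show "on_arr ?F (runit C.CC A) \<cdot>\<^bsub>D.CC\<^esub> lax_mult ?F A (unit_obj C.CC)
     \<cdot>\<^bsub>D.CC\<^esub> (ident D.CC (on_obj ?F A) \<boxdot>\<^bsub>D.CC\<^esub> lax_unit ?F) = runit D.CC (on_obj ?F A)"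
   using A by (simp add: s v id l compose_id_right[OF runit_map_lin])
  fix B assume "B \<in> Obj C.CC"
  then have B: "B \<in> X" by (simp add: s)
  show "lax_mult ?F A B \<in> hom_set D.CC (on_obj ?F A \<boxtimes>\<^bsub>D.CC\<^esub> on_obj ?F B) (on_obj ?F (A \<boxtimes>\<^bsub>C.CC\<^esub> B))"
   using A B by (simp add: s D.hom_iff \<phi>_closed C.T_closed D.T_closed pres_mult l v)
  show "on_arr ?F (braid C.CC A B) \<cdot>\<^bsub>D.CC\<^esub> lax_mult ?F A B
    = lax_mult ?F B A \<cdot>\<^bsub>D.CC\<^esub> braid D.CC (on_obj ?F A) (on_obj ?F B)"
   using A B by (simp add: s v compose_id_left[OF braid_map_lin] compose_id_right[OF braid_map_lin])
  fix E assume "E \<in> Obj C.CC"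
  then have E: "E \<in> X" by (simp add: s)
  show "on_arr ?F (assoc C.CC A B E) \<cdot>\<^bsub>D.CC\<^esub> lax_mult ?F (A \<boxtimes>\<^bsub>C.CC\<^esub> B) E
     \<cdot>\<^bsub>D.CC\<^esub> (lax_mult ?F A B \<boxdot>\<^bsub>D.CC\<^esub> ident D.CC (on_obj ?F E))
    = lax_mult ?F A (B \<boxtimes>\<^bsub>C.CC\<^esub> E) \<cdot>\<^bsub>D.CC\<^esub> (ident D.CC (on_obj ?F A) \<boxdot>\<^bsub>D.CC\<^esub> lax_mult ?F B E)
     \<cdot>\<^bsub>D.CC\<^esub> assoc D.CC (on_obj ?F A) (on_obj ?F B) (on_obj ?F E)"
   using A B E by (simp add: s v l tensor_map_id compose_id_left[OF assoc_map_lin] compose_id_right[OF assoc_map_lin] compose_id_left[OF lin_id])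
 }
 {
  fix f A B assume f: "f \<in> hom_set C.CC A B"
  then show "on_arr ?F f \<in> hom_set D.CC (on_obj ?F A) (on_obj ?F B)"
   by (auto simp: s C.hom_iff D.hom_iff \<phi>_closed pres_\<phi>)
  show "on_arr ?F (g \<cdot>\<^bsub>C.CC\<^esub> f) = on_arr ?F g \<cdot>\<^bsub>D.CC\<^esub> on_arr ?F f" if "g \<in> hom_set C.CC B E" for g E
   by (simp add: s)
  fix g A' B' assume g: "g \<in> hom_set C.CC A' B'"
  have t: "tensor_map (us A) (us A') (us B) (us B') (Fun f) (Fun g) \<in> lin (tensor (us A) (us A')) (tensor (us B) (us B'))"
   using f g by (intro tensor_map_lin lin_is_lin) (auto simp: C.hom_iff v)
  show "lax_mult ?F B B' \<cdot>\<^bsub>D.CC\<^esub> (on_arr ?F f \<boxdot>\<^bsub>D.CC\<^esub> on_arr ?F g)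
    = on_arr ?F (f \<boxdot>\<^bsub>C.CC\<^esub> g) \<cdot>\<^bsub>D.CC\<^esub> lax_mult ?F A A'"
   using f g by (auto simp: s C.hom_iff compose_id_left[OF t] compose_id_right[OF t])
 }
 show "lax_unit ?F \<in> hom_set D.CC (unit_obj D.CC) (on_obj ?F (unit_obj C.CC))"
  by (simp add: s D.hom_iff D.I_closed \<phi>_closed C.I_closed pres_unit l)
qed

end

section \<open>Eigenspaces and gradings\<close>

text \<open>\<open>T\<close> minus the scalar \<open>a\<close> removes the component with eigenvalue
  \<open>a\<close> and multiplies the others by nonzero integers, so induction on the index set
  applies; characteristic zero keeps distinct integers distinct in the field. The lemma is the
  source both of independence of eigenspaces and of the compatibility of eigencomponents with
  filtrations.\<close>

lemma eigen_components:
 fixes V :: "('k::field_char_0, 'v) module"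
 assumes v: "vec_space V" and T: "is_lin V V T" and K: "subspace_of K V" and TK: "\<And>x. x \<in> K ==> T x \<in> K"
  and S: "finite S" and s: "\<And>i. i \<in> S ==> s i \<in> carrier V"
  and e: "\<And>i. i \<in> S ==> T (s i) = of_int i \<odot>\<^bsub>V\<^esub> s i" and sum: "finsum V s S \<in> K"
 shows "\<forall>i\<in>S. s i \<in> K"
 using S s e sum
proof (induction arbitrary: s rule: finite_induct)
 case (insert a S)
 interpret vspace V by (rule vsI, rule v)
 interpret VV: vpair V V using v v by (rule vpairI)
 define D where "D x = T x \<ominus>\<^bsub>V\<^esub> of_int a \<odot>\<^bsub>V\<^esub> x" for x
 have D: "is_lin V V D"
  unfolding D_def by (rule VV.is_lin_minus_map[OF T VV.is_lin_scale[OF is_lin_id]])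
 have c: "s \<in> S \<rightarrow> carrier V" and ca: "s a \<in> carrier V" using insert.prems(1) by auto
 have De: "D (s i) = of_int (i - a) \<odot>\<^bsub>V\<^esub> s i" if "i \<in> insert a S" for i
  using insert.prems(1,2)[OF that] by (simp add: D_def smult_diff_left)
 have x: "finsum V s (insert a S) = s a \<oplus>\<^bsub>V\<^esub> finsum V s S"
  by (rule M.finsum_insert[OF insert.hyps c ca])
 have sc: "finsum V s S \<in> carrier V" by (rule M.finsum_closed[OF c])
 have "D (finsum V s (insert a S)) = D (s a) \<oplus>\<^bsub>V\<^esub> D (finsum V s S)"
  unfolding x by (rule is_lin_add[OF D ca sc])
 also have "D (s a) = \<zero>\<^bsub>V\<^esub>" using De[of a] ca by simp
 also have "D (finsum V s S) = finsum V (\<lambda>i. D (s i)) S"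
  by (rule VV.is_lin_finsum[OF D insert.hyps(1) c])
 also have "\<dots> = finsum V (\<lambda>i. of_int (i - a) \<odot>\<^bsub>V\<^esub> s i) S"
  by (rule M.finsum_cong') (use De c in auto)
 also have "\<zero>\<^bsub>V\<^esub> \<oplus>\<^bsub>V\<^esub> \<dots> = \<dots>" by (rule M.l_zero, rule M.finsum_closed) (use c in auto)
 finally have y: "D (finsum V s (insert a S)) = finsum V (\<lambda>i. of_int (i - a) \<odot>\<^bsub>V\<^esub> s i) S" .
 have "D (finsum V s (insert a S)) \<in> K"
  unfolding D_def by (intro sub_diff[OF K] sub_smult[OF K] TK insert.prems(3))
 then have ih: "\<forall>i\<in>S. of_int (i - a) \<odot>\<^bsub>V\<^esub> s i \<in> K"
 proof (intro insert.IH)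
  fix i assume i: "i \<in> S"
  show "of_int (i - a) \<odot>\<^bsub>V\<^esub> s i \<in> carrier V" using i c by auto
  show "T (of_int (i - a) \<odot>\<^bsub>V\<^esub> s i) = of_int i \<odot>\<^bsub>V\<^esub> (of_int (i - a) \<odot>\<^bsub>V\<^esub> s i)"
   using insert.prems(1,2)[of i] i is_lin_smult[OF T] by (simp add: smult_smult mult.commute)
 qed (simp add: y)
 have "s i \<in> K" if i: "i \<in> S" for i
 proof -
  have "of_int (i - a) \<noteq> (0 :: 'k)" using i insert.hyps(2) by auto
  then have "s i = inverse (of_int (i - a)) \<odot>\<^bsub>V\<^esub> (of_int (i - a) \<odot>\<^bsub>V\<^esub> s i)"
   using funcset_mem[OF c i] by (simp add: smult_smult)
  then show ?thesis using sub_smult[OF K] ih i by metis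
 qed
 moreover from this have "finsum V s S \<in> K" by (intro sub_finsum[OF K] insert.hyps)
 then have "s a \<in> K" using insert.prems(3) unfolding x
  by (metis ca sub_add_cancel[OF K])
 ultimately show ?case by simp
qed simp

section \<open>Independent families and decompositions\<close>

definition independent_family :: "('k::field, 'v) module => (int => 'v set) => bool" where
 "independent_family V J \<longleftrightarrow> (\<forall>S s. finite S --> (\<forall>i\<in>S. s i \<in> J i) --> finsum V s S = \<zero>\<^bsub>V\<^esub> --> (\<forall>i\<in>S. s i = \<zero>\<^bsub>V\<^esub>))"

text \<open>The case of the zero subspace in \<open>eigen_components\<close>.\<close>

lemma independent_if_eigen:
 fixes V :: "('k::field_char_0, 'v) module"
 assumes v: "vec_space V" and J: "\<And>i. subspace_of (J i) V" and T: "is_lin V V T"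
  and e: "\<And>i x. x \<in> J i ==> T x = of_int i \<odot>\<^bsub>V\<^esub> x"
 shows "independent_family V J"
 unfolding independent_family_def
proof (intro allI impI)
 interpret vspace V by (rule vsI, rule v)
 interpret VV: vpair V V using v v by (rule vpairI)
 fix S and s :: "int => 'v" assume S: "finite S" and s: "\<forall>i\<in>S. s i \<in> J i" and sum: "finsum V s S = \<zero>\<^bsub>V\<^esub>"
 have "\<forall>i\<in>S. s i \<in> {\<zero>\<^bsub>V\<^esub>}"
 proof (rule eigen_components[OF v T zero_sub _ S])
  show "T x \<in> {\<zero>\<^bsub>V\<^esub>}" if "x \<in> {\<zero>\<^bsub>V\<^esub>}" for x using that VV.is_lin_zero[OF T] by simp
  show "s i \<in> carrier V" if "i \<in> S" for i using s that sub_mem[OF J] by blast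
  show "T (s i) = of_int i \<odot>\<^bsub>V\<^esub> s i" if "i \<in> S" for i using s that e by blast
 qed (simp add: sum)
 then show "\<forall>i\<in>S. s i = \<zero>\<^bsub>V\<^esub>" by simp
qed

locale family = vspace V for V :: "('k::field, 'v) module" (structure) +
 fixes J :: "int => 'v set"
 assumes J: "\<And>i. subspace_of (J i) V"
begin

text \<open>The component function is total and vanishes off \<open>S\<close>, so that
  decompositions with different supports can be compared as functions.\<close>

definition dec :: "int set => (int => 'v) => 'v => bool" where
 "dec S s v \<longleftrightarrow> finite S \<and> (\<forall>i. s i \<in> J i) \<and> (\<forall>i. i \<notin> S --> s i = \<zero>) \<and> v = finsum V s S"

lemma dec_carrier: "dec S s v ==> s i \<in> carrier V"
 using sub_mem[OF J] by (auto simp: dec_def)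

lemma finsum_superset:
 assumes "finite S'" "S <= S'" "\<And>i. i \<in> S' - S ==> f i = \<zero>" "\<And>i. i \<in> S' ==> f i \<in> carrier V"
 shows "finsum V f S = finsum V f S'"
 using assms by (intro M.add.finprod_mono_neutral_cong_left) auto

lemma dec_superset: "dec S s v ==> finite S' ==> S <= S' ==> dec S' s v"
 using finsum_superset[of S' S s] dec_carrier[of S s v] unfolding dec_def by blast

lemma dec_add: assumes "dec S s v" "dec S' s' v'" shows "dec (S \<union> S') (\<lambda>i. s i \<oplus> s' i) (v \<oplus> v')"
proof -
 have f: "finite (S \<union> S')" using assms by (simp add: dec_def)
 have d: "dec (S \<union> S') s v" "dec (S \<union> S') s' v'" using dec_superset f assms by blast+
 then have "finsum V (\<lambda>i. s i \<oplus> s' i) (S \<union> S') = v \<oplus> v'"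
  using dec_carrier[OF d(1)] dec_carrier[OF d(2)] M.finsum_addf[of s "S \<union> S'" s'] by (auto simp: dec_def)
 then show ?thesis using d sub_add[OF J] by (auto simp: dec_def)
qed

lemma dec_smult: assumes "dec S s v" shows "dec S (\<lambda>i. c \<odot> s i) (c \<odot> v)"
proof -
 have "c \<odot> v = finsum V (\<lambda>i. c \<odot> s i) S"
  using assms dec_carrier[OF assms] finsum_smult_ldistr[of S c s] by (auto simp: dec_def)
 then show ?thesis using assms sub_smult[OF J] by (auto simp: dec_def)
qed

lemma J_subset: "(\<Union>i\<in>I. J i) <= carrier V"
 using sub_mem[OF J] by auto

lemma dec_single: "x \<in> J i ==> dec {i} (\<lambda>j. if j = i then x else \<zero>) x"
 using sub_mem[OF J] sub_zero[OF J] by (auto simp: dec_def M.finsum_insert M.finsum_empty)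

lemma dec_exists: assumes "v \<in> linear_span V (\<Union>i\<in>I. J i)"
 shows "\<exists>S s. dec S s v \<and> S <= I"
 using assms J_subset
proof (induction rule: span_induct)
 case zero
 have "dec {} (\<lambda>_. \<zero>) \<zero>" using sub_zero[OF J] by (simp add: dec_def M.finsum_empty)
 then show ?case by blast
next
 case (base x)
 then obtain i where "i \<in> I" "x \<in> J i" by auto
 then show ?case using dec_single[of x i] by blast
next
 case (add x y)
 then obtain S s S' s' where "dec S s x" "S <= I" "dec S' s' y" "S' <= I" by blast
 then have "dec (S \<union> S') (\<lambda>i. s i \<oplus> s' i) (x \<oplus> y)" "S \<union> S' <= I" using dec_add by auto
 then show ?case by blast
next
 case (smult c x)
 then obtain S s where "dec S s x" "S <= I" by blast
 then show ?case using dec_smult[of S s x c] by blast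
qed

lemma dec_in_span: assumes "dec S s v" "S <= I" shows "v \<in> linear_span V (\<Union>i\<in>I. J i)"
proof -
 have "finsum V s S \<in> linear_span V (\<Union>i\<in>I. J i)"
  using assms by (intro sub_finsum[OF span_sub[OF J_subset]] span_base) (auto simp: dec_def)
 then show ?thesis using assms by (simp add: dec_def)
qed

end

locale independent = family V J for V :: "('k::field, 'v) module" (structure) and J +
 assumes indep: "independent_family V J"
begin

lemma dec_unique: assumes "dec S s v" "dec S' s' v" shows "s = s'"
proof
 fix i
 have "dec S' (\<lambda>i. (- 1) \<odot> s' i) ((- 1) \<odot> v)" by (rule dec_smult[OF assms(2)])
 from dec_add[OF assms(1) this]
 have d: "dec (S \<union> S') (\<lambda>i. s i \<oplus> (- 1) \<odot> s' i) (v \<oplus> (- 1) \<odot> v)" .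
 have v: "v \<in> carrier V" using assms(1) dec_carrier[OF assms(1)] by (auto simp: dec_def)
 have "finsum V (\<lambda>i. s i \<oplus> (- 1) \<odot> s' i) (S \<union> S') = \<zero>"
  using d v by (simp add: dec_def smult_m1 M.r_neg)
 then have "\<forall>i\<in>S \<union> S'. s i \<oplus> (- 1) \<odot> s' i = \<zero>"
  using indep[unfolded independent_family_def, rule_format, of "S \<union> S'" "\<lambda>i. s i \<oplus> (- 1) \<odot> s' i"] d
  by (simp add: dec_def)
 moreover have c: "s i \<in> carrier V" "s' i \<in> carrier V"
  using dec_carrier[OF assms(1)] dec_carrier[OF assms(2)] by blast+
 ultimately have "s i \<ominus> s' i = \<zero>" if "i \<in> S \<union> S'"
  using that by (metis smult_m1 a_minus_def)
 then have "s i = s' i" if "i \<in> S \<union> S'"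
  using that diff_eq_zero[OF c] by blast
 then show "s i = s' i" using assms by (cases "i \<in> S \<union> S'") (auto simp: dec_def)
qed

definition comp :: "'v => int => 'v" where
 "comp v = (THE s. \<exists>S. dec S s v)"

lemma comp_eq: "dec S s v ==> comp v = s"
 unfolding comp_def by (rule the_equality) (auto intro: dec_unique)

end

text \<open>The scalars are left free for two uses: integers give degree operators, whose
  eigenspaces are the given subspaces, and the values 0 and 1 give projections.\<close>

lemma operator_exists:
 fixes V :: "('k::field, 'v) module" and c :: "int => 'k"
 assumes v: "vec_space V" and J: "\<And>i. subspace_of (J i) V" and ind: "independent_family V J"
  and sp: "linear_span V (\<Union>i. J i) = carrier V"
 shows "\<exists>T. is_lin V V T \<and> (\<forall>i. \<forall>x\<in>J i. T x = c i \<odot>\<^bsub>V\<^esub> x)"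
proof -
 interpret independent V J using v J ind
  by (simp add: independent_def family_def vspace_def family_axioms_def independent_axioms_def)
 define T where "T v = finsum V (\<lambda>i. c i \<odot>\<^bsub>V\<^esub> comp v i) {i. comp v i \<noteq> \<zero>\<^bsub>V\<^esub>}" for v
 have T: "T v = finsum V (\<lambda>i. c i \<odot>\<^bsub>V\<^esub> s i) S" if d: "dec S s v" for S s v
  unfolding T_def comp_eq[OF d]
  by (rule finsum_superset) (use d dec_carrier[OF d] in \<open>auto simp: dec_def\<close>)
 have ex: "\<exists>S s. dec S s x" if "x \<in> carrier V" for x
  using dec_exists[of x UNIV] that sp by auto
 have "is_lin V V T"
 proof (rule is_linI)
  fix x assume x: "x \<in> carrier V"
  then obtain S s where d: "dec S s x" using ex by blast
  show "T x \<in> carrier V" unfolding T[OF d]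
   by (rule M.finsum_closed) (use dec_carrier[OF d] in auto)
  show "T (a \<odot>\<^bsub>V\<^esub> x) = a \<odot>\<^bsub>V\<^esub> T x" for a
  proof -
   have "a \<odot>\<^bsub>V\<^esub> T x = finsum V (\<lambda>i. a \<odot>\<^bsub>V\<^esub> (c i \<odot>\<^bsub>V\<^esub> s i)) S"
    unfolding T[OF d] by (rule finsum_smult_ldistr) (use d dec_carrier[OF d] in \<open>auto simp: dec_def\<close>)
   then show ?thesis unfolding T[OF dec_smult[OF d]]
    using dec_carrier[OF d] by (simp add: smult_smult mult.commute)
  qed
  fix y assume y: "y \<in> carrier V"
  then obtain S' s' where d': "dec S' s' y" using ex by blast
  have f: "finite (S \<union> S')" using d d' by (simp add: dec_def)
  have e: "dec (S \<union> S') s x" "dec (S \<union> S') s' y" using dec_superset f d d' by blast+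
  show "T (x \<oplus>\<^bsub>V\<^esub> y) = T x \<oplus>\<^bsub>V\<^esub> T y"
   unfolding T[OF dec_add[OF d d']] T[OF e(1)] T[OF e(2)]
   using dec_carrier[OF d] dec_carrier[OF d']
   by (subst M.finsum_addf[symmetric]) (auto simp: smult_add_right)
 qed
 moreover have "T x = c i \<odot>\<^bsub>V\<^esub> x" if "x \<in> J i" for i x
  using T[OF dec_single[OF that]] sub_mem[OF J that]
  by (simp add: M.finsum_insert M.finsum_empty)
 ultimately show ?thesis by blast
qed

text \<open>The definition counts extensional families over the nonzero pieces. Spanning and
  independence are what operators deliver, so gradings are verified and used in this form.\<close>

lemma is_grading_iff:
 fixes V :: "'u qvs"
 assumes v: "vec_space V"
 shows "is_grading V P \<longleftrightarrow> (\<forall>n. subspace_of (P n) V) \<and> finite {n. P n \<noteq> {\<zero>\<^bsub>V\<^esub>}} \<and>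
  linear_span V (\<Union>n. P n) = carrier V \<and> independent_family V P"
proof -
 let ?S = "{n. P n \<noteq> {\<zero>\<^bsub>V\<^esub>}}"
 have "(\<forall>v \<in> carrier V. \<exists>!s. s \<in> (\<Pi>\<^sub>E n \<in> ?S. P n) \<and> v = finsum V s ?S)
   \<longleftrightarrow> linear_span V (\<Union>n. P n) = carrier V \<and> independent_family V P" (is "?l \<longleftrightarrow> ?r")
  if sub: "\<forall>n. subspace_of (P n) V" and fin: "finite ?S"
 proof -
  interpret family V P using v sub by (simp add: family_def vspace_def family_axioms_def)
  have decR: "restrict s ?S \<in> (\<Pi>\<^sub>E n \<in> ?S. P n) \<and> w = finsum V (restrict s ?S) ?S" if d: "dec S s w" for S s w
  proof -
   have d': "dec (S \<union> ?S) s w" using dec_superset[OF d] d fin by (simp add: dec_def)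
   have "s i = \<zero>\<^bsub>V\<^esub>" if "i \<notin> ?S" for i using that d by (auto simp: dec_def)
   then have "finsum V s ?S = finsum V s (S \<union> ?S)"
    using d d' fin dec_carrier[OF d] by (intro finsum_superset) (auto simp: dec_def)
   moreover have "finsum V (restrict s ?S) ?S = finsum V s ?S"
    by (rule M.finsum_cong') (use dec_carrier[OF d] in auto)
   ultimately have "w = finsum V (restrict s ?S) ?S" using d' by (simp add: dec_def)
   moreover have "restrict s ?S \<in> (\<Pi>\<^sub>E n \<in> ?S. P n)" using d by (auto simp: dec_def)
   ultimately show ?thesis by blast
  qed
  have Rdec: "dec ?S (\<lambda>i. if i \<in> ?S then s i else \<zero>\<^bsub>V\<^esub>) (finsum V s ?S)" if "s \<in> (\<Pi>\<^sub>E n \<in> ?S. P n)" for s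
  proof -
   have m: "s i \<in> P i" if "i \<in> ?S" for i using PiE_mem[OF \<open>s \<in> _\<close> that] .
   have "finsum V s ?S = finsum V (\<lambda>i. if i \<in> ?S then s i else \<zero>\<^bsub>V\<^esub>) ?S"
    by (rule M.finsum_cong'[symmetric]) (use sub_mem[OF J m] in \<open>auto simp del: mem_Collect_eq\<close>)
   then show ?thesis unfolding dec_def using m fin sub_zero[OF J] by (simp del: mem_Collect_eq)
  qed
  show ?thesis
  proof
   assume l: ?l
   have "linear_span V (\<Union>n. P n) = carrier V"
   proof
    show "linear_span V (\<Union>n. P n) <= carrier V" using span_carrier[OF J_subset] by blast
    show "carrier V <= linear_span V (\<Union>n. P n)"
    proof
     fix w assume "w \<in> carrier V"
     then obtain s where "s \<in> (\<Pi>\<^sub>E n \<in> ?S. P n)" "w = finsum V s ?S" using l by blast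
     then show "w \<in> linear_span V (\<Union>n. P n)" using dec_in_span[OF Rdec[of s]] by simp
    qed
   qed
   moreover have "independent_family V P"
    unfolding independent_family_def
   proof (intro allI impI ballI)
    fix S and s :: "int => 'u" and i
    assume S: "finite S" and s: "\<forall>i\<in>S. s i \<in> P i" and z: "finsum V s S = \<zero>\<^bsub>V\<^esub>" and i: "i \<in> S"
    define t where "t j = (if j \<in> S then s j else \<zero>\<^bsub>V\<^esub>)" for j
    have "finsum V t S = finsum V s S"
     by (rule M.finsum_cong') (use s sub_mem[OF J] in \<open>auto simp: t_def\<close>)
    then have d: "dec S t \<zero>\<^bsub>V\<^esub>" using S s z sub_zero[OF J] by (auto simp: dec_def t_def)
    have t0: "t j = \<zero>\<^bsub>V\<^esub>" if "j \<notin> ?S" for j using that d by (auto simp: dec_def)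
    \<comment> \<open>The empty decomposition is the competitor: uniqueness for the zero vector
      forces every term of the given relation to vanish.\<close>
    have "dec {} (\<lambda>_. \<zero>\<^bsub>V\<^esub>) \<zero>\<^bsub>V\<^esub>" using sub_zero[OF J] by (simp add: dec_def M.finsum_empty)
    note 2 = decR[OF this]
    have "\<exists>!s. s \<in> (\<Pi>\<^sub>E n \<in> ?S. P n) \<and> \<zero>\<^bsub>V\<^esub> = finsum V s ?S"
     by (rule bspec[OF l M.zero_closed])
    then obtain z where z: "\<And>y. y \<in> (\<Pi>\<^sub>E n \<in> ?S. P n) \<and> \<zero>\<^bsub>V\<^esub> = finsum V y ?S ==> y = z"
     by (elim ex1E) (erule meta_allE, blast)
    have eq: "restrict t ?S = (\<lambda>i\<in>?S. \<zero>\<^bsub>V\<^esub>)"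
     unfolding z[OF decR[OF d]] z[OF 2] ..
    have "t i = \<zero>\<^bsub>V\<^esub>"
    proof (cases "i \<in> ?S")
     case True
     then show ?thesis using fun_cong[OF eq, of i] by (simp only: restrict_apply if_True)
    qed (rule t0)
    then show "s i = \<zero>\<^bsub>V\<^esub>" using i by (simp add: t_def)
   qed
   ultimately show ?r by blast
  next
   assume r: ?r
   then interpret independent V P by unfold_locales auto
   show ?l
   proof (intro ballI ex_ex1I)
    fix w assume w: "w \<in> carrier V"
    then show "\<exists>s. s \<in> (\<Pi>\<^sub>E n \<in> ?S. P n) \<and> w = finsum V s ?S"
     using dec_exists[of w UNIV] r decR by (metis UNIV_I)
    fix s t assume s: "s \<in> (\<Pi>\<^sub>E n \<in> ?S. P n) \<and> w = finsum V s ?S"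
     and t: "t \<in> (\<Pi>\<^sub>E n \<in> ?S. P n) \<and> w = finsum V t ?S"
    have "(\<lambda>i. if i \<in> ?S then s i else \<zero>\<^bsub>V\<^esub>) = (\<lambda>i. if i \<in> ?S then t i else \<zero>\<^bsub>V\<^esub>)"
     using dec_unique[OF Rdec[of s]] Rdec[of t] s t by simp
    then have "s i = t i" if "i \<in> ?S" for i using that by (metis (no_types, lifting))
    then show "s = t" using s t by (blast intro: PiE_ext)
   qed
  qed
 qed
 then show ?thesis unfolding is_grading_def by blast
qed

section \<open>Families of subspaces of tensor products\<close>

lemma tensor_family_gens: "{tpure A B x y | i j x y. i + j = p \<and> x \<in> P i \<and> y \<in> Q j} <= N \<longleftrightarrow>
  (\<forall>i j x y. i + j = p --> x \<in> P i --> y \<in> Q j --> tpure A B x y \<in> N)"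
 by blast

lemma tensor_family_pure:
 "x \<in> P i ==> y \<in> Q j ==> i + j = p ==> tpure A B x y \<in> tensor_family A B P Q p"
proof -
 assume "x \<in> P i" "y \<in> Q j" "i + j = p"
 then have "tpure A B x y \<in> {tpure A B x y | i j x y. i + j = p \<and> x \<in> P i \<and> y \<in> Q j}" by blast
 then show ?thesis unfolding tensor_family_def linear_span_def by blast
qed

context
 fixes A B :: "'u::infinite qvs" and P Q :: "int => 'u set"
 assumes A: "vec_space A" and B: "vec_space B"
  and P: "\<And>i. subspace_of (P i) A" and Q: "\<And>i. subspace_of (Q i) B"
begin

interpretation A: vspace A by (rule vsI, rule A)
interpretation B: vspace B by (rule vsI, rule B)
interpretation AB: vspace "tensor A B" by (rule vsI, rule vec_tensor[OF A B])

lemma tensor_family_gens_sub: "{tpure A B x y | i j x y. i + j = p \<and> x \<in> P i \<and> y \<in> Q j} <= carrier (tensor A B)"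
 unfolding tensor_family_gens
 using tpure_closed[OF A B A.sub_mem[OF P] B.sub_mem[OF Q]] by blast

lemma tensor_family_sub: "subspace_of (tensor_family A B P Q p) (tensor A B)"
 unfolding tensor_family_def by (rule AB.span_sub[OF tensor_family_gens_sub])

lemma tensor_family_least:
 assumes "subspace_of N (tensor A B)" "\<And>i j x y. i + j = p ==> x \<in> P i ==> y \<in> Q j ==> tpure A B x y \<in> N"
 shows "tensor_family A B P Q p <= N"
 unfolding tensor_family_def by (rule AB.span_least[OF assms(1)]) (use assms(2) in blast)

lemma tensor_family_image:
 assumes Z: "vec_space Z" and f: "is_lin (tensor A B) Z f" and N: "subspace_of N Z"
  and "\<And>i j x y. i + j = p ==> x \<in> P i ==> y \<in> Q j ==> f (tpure A B x y) \<in> N"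
  and t: "t \<in> tensor_family A B P Q p"
 shows "f t \<in> N"
proof -
 interpret Z: vpair "tensor A B" Z using vec_tensor[OF A B] Z by (rule vpairI)
 have "tensor_family A B P Q p <= {t \<in> carrier (tensor A B). f t \<in> N}"
  by (rule tensor_family_least[OF Z.preimage_sub[OF f N]])
   (use assms(4) tpure_closed[OF A B A.sub_mem[OF P] B.sub_mem[OF Q]] in blast)
 with t show ?thesis by blast
qed

lemma tensor_family_eq_zero:
 assumes "\<And>i j. i + j = p ==> P i = {\<zero>\<^bsub>A\<^esub>} \<or> Q j = {\<zero>\<^bsub>B\<^esub>}"
 shows "tensor_family A B P Q p = {\<zero>\<^bsub>tensor A B\<^esub>}"
proof
 show "tensor_family A B P Q p <= {\<zero>\<^bsub>tensor A B\<^esub>}"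
 proof (rule tensor_family_least[OF AB.zero_sub])
  fix i j x y assume "i + j = p" and x: "x \<in> P i" and y: "y \<in> Q j"
  then consider "x = \<zero>\<^bsub>A\<^esub>" | "y = \<zero>\<^bsub>B\<^esub>" using assms[of i j] by auto
  then show "tpure A B x y \<in> {\<zero>\<^bsub>tensor A B\<^esub>}"
   using tpure_zero(1)[OF A B B.sub_mem[OF Q y]] tpure_zero(2)[OF A B A.sub_mem[OF P x]]
   by cases simp_all
 qed
 show "{\<zero>\<^bsub>tensor A B\<^esub>} <= tensor_family A B P Q p"
  using AB.sub_zero[OF tensor_family_sub] by blast
qed

lemma tensor_family_span:
 assumes "linear_span A (\<Union>i. P i) = carrier A" "linear_span B (\<Union>i. Q i) = carrier B"
 shows "linear_span (tensor A B) (\<Union>p. tensor_family A B P Q p) = carrier (tensor A B)"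
proof -
 have sub: "(\<Union>p. tensor_family A B P Q p) <= carrier (tensor A B)"
  using AB.sub_le[OF tensor_family_sub] by blast
 have "tpure A B x y \<in> linear_span (tensor A B) (\<Union>p. tensor_family A B P Q p)"
  if "x \<in> carrier A" "y \<in> carrier B" for x y
 proof (rule bil_span_into[OF bil_tpure[OF A B] A B vec_tensor[OF A B] AB.span_sub[OF sub]])
  show "(\<Union>i. P i) <= carrier A" "(\<Union>i. Q i) <= carrier B"
   using A.sub_le[OF P] B.sub_le[OF Q] by auto
  show "x \<in> linear_span A (\<Union>i. P i)" "y \<in> linear_span B (\<Union>i. Q i)" using that assms by auto
  fix a b assume "a \<in> (\<Union>i. P i)" "b \<in> (\<Union>i. Q i)"
  then obtain i j where "a \<in> P i" "b \<in> Q j" by blast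
  from tensor_family_pure[where P = P and Q = Q, OF this refl]
  show "tpure A B a b \<in> linear_span (tensor A B) (\<Union>p. tensor_family A B P Q p)"
   by (intro AB.span_base) blast
 qed
 then have "linear_span (tensor A B) {tpure A B x y | x y. x \<in> carrier A \<and> y \<in> carrier B}
   <= linear_span (tensor A B) (\<Union>p. tensor_family A B P Q p)"
  by (intro AB.span_least[OF AB.span_sub[OF sub]]) blast
 then show ?thesis
  unfolding tensor_span[OF A B] using AB.sub_le[OF AB.span_sub[OF sub]] by blast
qed

lemma braid_family: "t \<in> tensor_family A B P Q p ==> braid_map A B t \<in> tensor_family B A Q P p"
proof (erule tensor_family_image[OF vec_tensor[OF B A] lin_is_lin[OF braid_map_lin[OF A B]], rotated 2])
 interpret BA: vspace "tensor B A" by (rule vsI, rule vec_tensor[OF B A])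
 have gc: "{tpure B A x y | i j x y. i + j = p \<and> x \<in> Q i \<and> y \<in> P j} <= carrier (tensor B A)"
  unfolding tensor_family_gens
  using tpure_closed[OF B A B.sub_mem[OF Q] A.sub_mem[OF P]] by blast
 then show "subspace_of (tensor_family B A Q P p) (tensor B A)"
  unfolding tensor_family_def by (rule BA.span_sub)
 fix i j x y assume "i + j = p" and x: "x \<in> P i" and y: "y \<in> Q j"
 then have "tpure B A y x \<in> tensor_family B A Q P p"
  by (intro tensor_family_pure[of y Q j x P i]) (auto simp: add.commute)
 then show "braid_map A B (tpure A B x y) \<in> tensor_family B A Q P p"
  using braid_map_pure[OF A B A.sub_mem[OF P x] B.sub_mem[OF Q y]] by simp
qed

end

lemma tensor_map_family:
 fixes A B A' B' :: "'u::infinite qvs"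
 assumes v: "vec_space A" "vec_space B" "vec_space A'" "vec_space B'"
  and s: "\<And>i. subspace_of (P i) A" "\<And>i. subspace_of (Q i) B" "\<And>i. subspace_of (P' i) A'" "\<And>i. subspace_of (Q' i) B'"
  and f: "is_lin A A' f" "\<And>i. f ` P i <= P' i" and g: "is_lin B B' g" "\<And>i. g ` Q i <= Q' i"
  and t: "t \<in> tensor_family A B P Q p"
 shows "tensor_map A B A' B' f g t \<in> tensor_family A' B' P' Q' p"
proof (rule tensor_family_image[OF v(1,2) s(1,2) vec_tensor[OF v(3,4)] lin_is_lin[OF tensor_map_lin[OF v f(1) g(1)]]
   tensor_family_sub[OF v(3,4) s(3,4)] _ t])
 interpret A: vspace A by (rule vsI, rule v)
 interpret B: vspace B by (rule vsI, rule v)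
 fix i j x y assume "i + j = p" and x: "x \<in> P i" and y: "y \<in> Q j"
 then show "tensor_map A B A' B' f g (tpure A B x y) \<in> tensor_family A' B' P' Q' p"
  unfolding tensor_map_pure[OF v f(1) g(1) A.sub_mem[OF s(1) x] B.sub_mem[OF s(2) y]]
  using f(2) g(2) by (intro tensor_family_pure) blast+
qed

context
 fixes A B C :: "'u::infinite qvs" and P Q R :: "int => 'u set"
 assumes v: "vec_space A" "vec_space B" "vec_space C"
  and P: "\<And>i. subspace_of (P i) A" and Q: "\<And>i. subspace_of (Q i) B" and R: "\<And>i. subspace_of (R i) C"
begin

interpretation A: vspace A by (rule vsI, rule v)
interpretation B: vspace B by (rule vsI, rule v)
interpretation C: vspace C by (rule vsI, rule v)

lemma assoc_family:
 assumes t: "t \<in> tensor_family (tensor A B) C (tensor_family A B P Q) R p"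
 shows "assoc_map A B C t \<in> tensor_family A (tensor B C) P (tensor_family B C Q R) p"
proof -
 note vAB = vec_tensor[OF v(1,2)] and vBC = vec_tensor[OF v(2,3)]
 note sAB = tensor_family_sub[OF v(1,2) P Q] and sBC = tensor_family_sub[OF v(2,3) Q R]
 note l = lin_is_lin[OF assoc_map_lin[OF v]]
 note N = tensor_family_sub[OF v(1) vBC P sBC]
 show ?thesis
 proof (rule tensor_family_image[OF vAB v(3) sAB R vec_tensor[OF v(1) vBC] l N _ t])
  fix i j s z assume ij: "i + j = p" and s: "s \<in> tensor_family A B P Q i" and z: "z \<in> R j"
  note zc = C.sub_mem[OF R z]
  show "assoc_map A B C (tpure (tensor A B) C s z) \<in> tensor_family A (tensor B C) P (tensor_family B C Q R) p"
  proof (rule tensor_family_image[OF v(1,2) P Q vec_tensor[OF v(1) vBC] is_lin_comp[OF tpure_left[OF vAB v(3) zc] l] N _ s])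
   fix i' j' x y assume "i' + j' = i" and x: "x \<in> P i'" and y: "y \<in> Q j'"
   show "assoc_map A B C (tpure (tensor A B) C (tpure A B x y) z) \<in> tensor_family A (tensor B C) P (tensor_family B C Q R) p"
    unfolding assoc_map_pure[OF v A.sub_mem[OF P x] B.sub_mem[OF Q y] zc]
    by (rule tensor_family_pure[where P = P and Q = "tensor_family B C Q R", OF x
      tensor_family_pure[where P = Q and Q = R, OF y z refl]]) (use ij \<open>i' + j' = i\<close> in simp)
  qed
 qed
qed

end

text \<open>The alternative covers both structures on the unit. For a filtration \<open>U i\<close>
  is zero for negative \<open>i\<close>, and \<open>P\<close> grows for the other \<open>i\<close>;
  for a grading only \<open>U 0\<close> is nonzero, where nothing is shifted.\<close>

definition unit_acts :: "(int => 'u::infinite set) => (int => 'u set) => bool" where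
 "unit_acts U P \<longleftrightarrow> (\<forall>i. subspace_of (U i) (unit_space :: 'u qvs)) \<and> rat_embed 1 \<in> U 0 \<and>
   (\<forall>i j. U i = {\<zero>\<^bsub>(unit_space :: 'u qvs)\<^esub>} \<or> P j <= P (i + j))"

context
 fixes A :: "'u::infinite qvs" and P U :: "int => 'u set"
 assumes A: "vec_space A" and P: "\<And>i. subspace_of (P i) A" and ua: "unit_acts U P"
begin

interpretation A: vspace A by (rule vsI, rule A)
interpretation I: vspace "unit_space :: 'u qvs" by (rule vsI, rule vec_unit)

lemma unit_acts_sub: "subspace_of (U i) unit_space"
 using ua by (simp add: unit_acts_def)

lemma unit_acts_smult:
 assumes u: "u \<in> U i" and x: "x \<in> P j"
 obtains q where "u = rat_embed q" "q \<odot>\<^bsub>A\<^esub> x \<in> P (i + j)"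
proof -
 obtain q where q: "u = rat_embed q" using I.sub_mem[OF unit_acts_sub u] by (auto simp: unit_carrier)
 have z: "rat_embed 0 = \<zero>\<^bsub>(unit_space :: 'u qvs)\<^esub>"
  using vpair.is_lin_zero[OF vpairI[OF vec_field vec_unit] is_lin_rat_embed] by simp
 consider "u = \<zero>\<^bsub>unit_space\<^esub>" | "P j <= P (i + j)" using ua u unfolding unit_acts_def by blast
 then show thesis
 proof cases
  case 1
  then show ?thesis
   using that[of 0] z A.sub_mem[OF P x] A.sub_zero[OF P] by simp
 next
  case 2
  then show ?thesis using that[OF q] A.sub_smult[OF P] x by blast
 qed
qed

lemma lunit_family: "t \<in> tensor_family unit_space A U P p ==> lunit_map A t \<in> P p"
proof (erule tensor_family_image[OF vec_unit A unit_acts_sub P A lin_is_lin[OF lunit_map_lin[OF A]] P, rotated])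
 fix i j u x assume "i + j = p" and u: "u \<in> U i" and x: "x \<in> P j"
 then show "lunit_map A (tpure unit_space A u x) \<in> P p"
  using unit_acts_smult[OF u x] lunit_map_pure[OF A A.sub_mem[OF P x]] by metis
qed

lemma lunit_inv_family: "x \<in> P p ==> lunit_inv A x \<in> tensor_family unit_space A U P p"
 using tensor_family_pure[of "rat_embed 1" U 0 x P p p] ua A.sub_mem[OF P, of x p]
 by (simp add: lunit_inv_def unit_acts_def)

end

section \<open>Gradings and filtrations of tensor products\<close>

lemma bil_plus:
 assumes X: "vec_space X" and A: "vec_space A" and B: "vec_space B" and b: "bil A B X \<beta>" and c: "bil A B X \<gamma>"
 shows "bil A B X (\<lambda>x y. \<beta> x y \<oplus>\<^bsub>X\<^esub> \<gamma> x y)"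
proof (rule bilI)
 interpret AX: vpair A X using A X by (rule vpairI)
 interpret BX: vpair B X using B X by (rule vpairI)
 show "is_lin B X (\<lambda>y. \<beta> x y \<oplus>\<^bsub>X\<^esub> \<gamma> x y)" if "x \<in> carrier A" for x
  by (rule BX.is_lin_plus[OF bil_right[OF b that] bil_right[OF c that]])
 show "is_lin A X (\<lambda>x. \<beta> x y \<oplus>\<^bsub>X\<^esub> \<gamma> x y)" if "y \<in> carrier B" for y
  by (rule AX.is_lin_plus[OF bil_left[OF b that] bil_left[OF c that]])
qed

lemma derivation_exists:
 fixes A B :: "'u::infinite qvs"
 assumes A: "vec_space A" and B: "vec_space B" and f: "is_lin A A f" and g: "is_lin B B g"
 obtains D where "is_lin (tensor A B) (tensor A B) D"
  "\<And>x y. x \<in> carrier A ==> y \<in> carrier B ==> D (tpure A B x y) = tpure A B (f x) y \<oplus>\<^bsub>tensor A B\<^esub> tpure A B x (g y)"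
proof -
 note b = bil_plus[OF vec_tensor[OF A B] A B bil_comp2[OF bil_tpure[OF A B] f is_lin_id] bil_comp2[OF bil_tpure[OF A B] is_lin_id g]]
 show thesis
  by (rule that[OF tensor_lift_is_lin[OF A B vec_tensor[OF A B] b] tensor_lift_pure[OF A B vec_tensor[OF A B] b]])
qed

text \<open>Degree operators on the two factors add up to a derivation acting on the piece of degree
  \<open>n\<close> as multiplication by \<open>n\<close>. Independence of the pieces follows without
  a choice of bases.\<close>

lemma is_grading_tensor:
 fixes A B :: "'u::infinite qvs"
 assumes A: "vec_space A" and B: "vec_space B" and gP: "is_grading A P" and gQ: "is_grading B Q"
 shows "is_grading (tensor A B) (tensor_family A B P Q)"
proof -
 interpret A: vspace A by (rule vsI, rule A)
 interpret B: vspace B by (rule vsI, rule B)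
 interpret AB: vpair "tensor A B" "tensor A B" by (rule vpairI; rule vec_tensor[OF A B])
 have P: "\<And>i. subspace_of (P i) A" and spP: "linear_span A (\<Union>i. P i) = carrier A" and iP: "independent_family A P"
  and finP: "finite {n. P n \<noteq> {\<zero>\<^bsub>A\<^esub>}}"
  using gP is_grading_iff[OF A] by auto
 have Q: "\<And>i. subspace_of (Q i) B" and spQ: "linear_span B (\<Union>i. Q i) = carrier B" and iQ: "independent_family B Q"
  and finQ: "finite {n. Q n \<noteq> {\<zero>\<^bsub>B\<^esub>}}"
  using gQ is_grading_iff[OF B] by auto
 obtain f where f: "is_lin A A f" and fe: "\<And>i x. x \<in> P i ==> f x = of_int i \<odot>\<^bsub>A\<^esub> x"
  using operator_exists[OF A P iP spP, of of_int] by blast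
 obtain g where g: "is_lin B B g" and ge: "\<And>i x. x \<in> Q i ==> g x = of_int i \<odot>\<^bsub>B\<^esub> x"
  using operator_exists[OF B Q iQ spQ, of of_int] by blast
 obtain D where D: "is_lin (tensor A B) (tensor A B) D"
  and Dp: "\<And>x y. x \<in> carrier A ==> y \<in> carrier B ==> D (tpure A B x y) = tpure A B (f x) y \<oplus>\<^bsub>tensor A B\<^esub> tpure A B x (g y)"
  using derivation_exists[OF A B f g] by blast
 have De: "D t = of_int n \<odot>\<^bsub>tensor A B\<^esub> t" if "t \<in> tensor_family A B P Q n" for n t
 proof (rule AB.lin_eq_on_span[OF D AB.is_lin_scale[OF is_lin_id] tensor_family_gens_sub[OF A B P Q] _ that[unfolded tensor_family_def]])
  fix w assume "w \<in> {tpure A B x y | i j x y. i + j = n \<and> x \<in> P i \<and> y \<in> Q j}"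
  then obtain i j x y where w: "w = tpure A B x y" "i + j = n" and x: "x \<in> P i" and y: "y \<in> Q j" by blast
  note xc = A.sub_mem[OF P x] and yc = B.sub_mem[OF Q y]
  have "D w = (of_int i \<odot>\<^bsub>tensor A B\<^esub> w) \<oplus>\<^bsub>tensor A B\<^esub> (of_int j \<odot>\<^bsub>tensor A B\<^esub> w)"
   unfolding w Dp[OF xc yc] fe[OF x] ge[OF y] tpure_smult[OF A B xc yc] ..
  also have "\<dots> = of_int n \<odot>\<^bsub>tensor A B\<^esub> w"
   using tpure_closed[OF A B xc yc] w by (simp flip: w(2) AB.V.smult_add_left)
  finally show "D w = of_int n \<odot>\<^bsub>tensor A B\<^esub> w" .
 qed
 have "{n. tensor_family A B P Q n \<noteq> {\<zero>\<^bsub>tensor A B\<^esub>}} <= (\<lambda>(i, j). i + j) ` ({n. P n \<noteq> {\<zero>\<^bsub>A\<^esub>}} \<times> {n. Q n \<noteq> {\<zero>\<^bsub>B\<^esub>}})"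
 proof
  fix n assume "n \<in> {n. tensor_family A B P Q n \<noteq> {\<zero>\<^bsub>tensor A B\<^esub>}}"
  then have "\<not> (\<forall>i j. i + j = n --> P i = {\<zero>\<^bsub>A\<^esub>} \<or> Q j = {\<zero>\<^bsub>B\<^esub>})"
   using tensor_family_eq_zero[where P = P and Q = Q and p = n, OF A B P Q] by blast
  then show "n \<in> (\<lambda>(i, j). i + j) ` ({n. P n \<noteq> {\<zero>\<^bsub>A\<^esub>}} \<times> {n. Q n \<noteq> {\<zero>\<^bsub>B\<^esub>}})" by auto
 qed
 then have "finite {n. tensor_family A B P Q n \<noteq> {\<zero>\<^bsub>tensor A B\<^esub>}}"
  by (rule finite_subset) (intro finite_imageI finite_cartesian_product finP finQ)
 moreover have "independent_family (tensor A B) (tensor_family A B P Q)"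
  by (rule independent_if_eigen[OF vec_tensor[OF A B] tensor_family_sub[OF A B P Q] D De])
 moreover have "\<forall>n. subspace_of (tensor_family A B P Q n) (tensor A B)"
  by (rule allI, rule tensor_family_sub[OF A B P Q])
 moreover note tensor_family_span[OF A B P Q spP spQ]
 ultimately show ?thesis
  unfolding is_grading_iff[OF vec_tensor[OF A B]] by blast
qed

lemma inc_filtration_tensor:
 fixes A B :: "'u::infinite qvs"
 assumes A: "vec_space A" and B: "vec_space B" and P: "inc_filtration A P" and Q: "inc_filtration B Q"
 shows "inc_filtration (tensor A B) (tensor_family A B P Q)"
proof -
 interpret A: vspace A by (rule vsI, rule A)
 interpret B: vspace B by (rule vsI, rule B)
 interpret AB: vspace "tensor A B" by (rule vsI, rule vec_tensor[OF A B])
 have sP: "\<And>i. subspace_of (P i) A" and sQ: "\<And>i. subspace_of (Q i) B" and mP: "mono P" and mQ: "mono Q"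
  using P Q by (auto simp: inc_filtration_def)
 obtain i0 i1 j0 j1 where 0: "P i0 = {\<zero>\<^bsub>A\<^esub>}" "P i1 = carrier A" "Q j0 = {\<zero>\<^bsub>B\<^esub>}" "Q j1 = carrier B"
  using P Q unfolding inc_filtration_def by blast
 note ts = tensor_family_sub[OF A B sP sQ]
 have "mono (tensor_family A B P Q)"
 proof (rule monoI)
  fix p q :: int assume "p \<le> q"
  show "tensor_family A B P Q p \<le> tensor_family A B P Q q"
  proof (rule tensor_family_least[OF A B sP sQ ts])
   fix i j x y assume "i + j = p" "x \<in> P i" "y \<in> Q j"
   \<comment> \<open>The whole difference of the degrees is absorbed by the first factor.\<close>
   moreover have "P i <= P (i + (q - p))" using \<open>p \<le> q\<close> by (intro monoD[OF mP]) simp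
   ultimately show "tpure A B x y \<in> tensor_family A B P Q q"
    by (intro tensor_family_pure[of x P "i + (q - p)" y Q j]) auto
  qed
 qed
 moreover have "tensor_family A B P Q (i0 + j0) = {\<zero>\<^bsub>tensor A B\<^esub>}"
 proof (rule tensor_family_eq_zero[OF A B sP sQ])
  fix i j assume "i + j = i0 + j0"
  then have "i \<le> i0 \<or> j \<le> j0" by linarith
  then have "P i <= P i0 \<or> Q j <= Q j0" using monoD[OF mP] monoD[OF mQ] by blast
  then show "P i = {\<zero>\<^bsub>A\<^esub>} \<or> Q j = {\<zero>\<^bsub>B\<^esub>}"
   using 0 A.sub_zero[OF sP, of i] B.sub_zero[OF sQ, of j] by auto
 qed
 moreover have "tensor_family A B P Q (i1 + j1) = carrier (tensor A B)"
 proof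
  show "tensor_family A B P Q (i1 + j1) <= carrier (tensor A B)" by (rule AB.sub_le[OF ts])
  have "{tpure A B x y | x y. x \<in> carrier A \<and> y \<in> carrier B} <= tensor_family A B P Q (i1 + j1)"
   using tensor_family_pure[of _ P i1 _ Q j1 "i1 + j1"] 0 by blast
  from AB.span_least[OF ts this] show "carrier (tensor A B) <= tensor_family A B P Q (i1 + j1)"
   unfolding tensor_span[OF A B] .
 qed
 moreover have "\<forall>m. subspace_of (tensor_family A B P Q m) (tensor A B)" by (rule allI, rule ts)
 ultimately show ?thesis unfolding inc_filtration_def by blast
qed

lemma inc_filtration_unit: "inc_filtration (unit_space :: 'u::infinite qvs) unit_weight"
proof -
 interpret vspace "unit_space :: 'u qvs" by (rule vsI, rule vec_unit)
 have "subspace_of (unit_weight m) (unit_space :: 'u qvs)" for m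
  using zero_sub carrier_sub by (simp add: unit_weight_def)
 moreover have "mono (unit_weight :: int => 'u set)" by (rule monoI) (auto simp: unit_weight_def)
 moreover have "unit_weight (- 1) = {\<zero>\<^bsub>unit_space :: 'u qvs\<^esub>}" "unit_weight 0 = carrier (unit_space :: 'u qvs)"
  by (simp_all add: unit_weight_def)
 ultimately show ?thesis unfolding inc_filtration_def by blast
qed

lemma unit_acts_filtration:
 assumes "mono P" shows "unit_acts (unit_weight :: int => 'u::infinite set) P"
proof -
 have "\<And>i j. i \<ge> 0 ==> P j <= P (i + j)" by (rule monoD[OF assms]) simp
 then have "unit_weight i = {\<zero>\<^bsub>(unit_space :: 'u qvs)\<^esub>} \<or> P j <= P (i + j)" for i j
  by (cases "i < 0") (auto simp: unit_weight_def)
 moreover have "rat_embed 1 \<in> unit_weight 0" by (simp add: unit_weight_def)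
 ultimately show ?thesis
  using inc_filtration_unit unfolding unit_acts_def inc_filtration_def by blast
qed

lemma is_grading_unit: "is_grading (unit_space :: 'u::infinite qvs) (\<lambda>n. if n = 0 then carrier unit_space else {\<zero>\<^bsub>unit_space\<^esub>})" (is "is_grading ?U ?P")
proof -
 interpret vspace "unit_space :: 'u qvs" by (rule vsI, rule vec_unit)
 interpret VV: vpair "unit_space :: 'u qvs" "unit_space :: 'u qvs" by (rule vpairI vec_unit)+
 have s: "subspace_of (?P n) ?U" for n using zero_sub carrier_sub by simp
 have "independent_family ?U ?P"
  by (rule independent_if_eigen[OF vec_unit s VV.is_lin_zero_map]) (auto split: if_splits)
 moreover have "finite {n. ?P n \<noteq> {\<zero>\<^bsub>?U\<^esub>}}" by (rule finite_subset[of _ "{0}"]) auto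
 moreover have "(\<Union>n. ?P n) = carrier ?U" by auto
 then have "linear_span ?U (\<Union>n. ?P n) = carrier ?U" using span_id[OF carrier_sub] by simp
 ultimately show ?thesis unfolding is_grading_iff[OF vec_unit] using s by blast
qed

lemma unit_acts_grading: "unit_acts (\<lambda>n. if n = 0 then carrier unit_space else {\<zero>\<^bsub>unit_space\<^esub>}) (P :: int => 'u::infinite set)"
 using is_grading_unit[where 'u = 'u] unfolding unit_acts_def is_grading_iff[OF vec_unit] by auto

lemma preserves_family_compose:
 "f \<in> lin U V ==> (\<And>i. subspace_of (P i) U) ==> vec_space U ==> \<forall>i. f ` P i <= Q i ==> \<forall>i. g ` Q i <= R i
  ==> \<forall>i. compose (carrier U) g f ` P i <= R i"
proof (intro allI subsetI)
 fix i y assume "vec_space U" and P: "\<And>i. subspace_of (P i) U" and fQ: "\<forall>i. f ` P i <= Q i" and gR: "\<forall>i. g ` Q i <= R i"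
  and "y \<in> compose (carrier U) g f ` P i"
 then interpret vspace U by (simp add: vspace_def)
 obtain x where x: "x \<in> P i" "y = compose (carrier U) g f x" using \<open>y \<in> _\<close> by blast
 then have "y = g (f x)" using sub_mem[OF P x(1)] by (simp add: compose_eq)
 then show "y \<in> R i" using fQ gR x(1) by blast
qed

lemma preserves_family_id:
 assumes "vec_space U" "\<And>i. subspace_of (P i) U" "\<And>i. P i <= Q i"
 shows "\<forall>i. (\<lambda>x\<in>carrier U. x) ` P i <= Q i"
proof -
 interpret vspace U by (rule vsI, rule assms)
 show ?thesis using sub_mem[OF assms(2)] assms(3) by auto
qed

locale family_spaces =
 fixes X :: "'o set" and us :: "'o => 'u::infinite qvs" and fam :: "'o => int => 'u set"
  and T :: "'o => 'o => 'o" and I :: 'o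
 assumes vec: "A \<in> X ==> vec_space (us A)"
  and sub: "A \<in> X ==> subspace_of (fam A i) (us A)"
  and closed: "A \<in> X ==> B \<in> X ==> T A B \<in> X"
  and usT: "us (T A B) = tensor (us A) (us B)"
  and famT: "fam (T A B) = tensor_family (us A) (us B) (fam A) (fam B)"
  and IX: "I \<in> X"
  and usI: "us I = unit_space"
  and famI: "A \<in> X ==> unit_acts (fam I) (fam A)"
begin

lemma structured: "structured_spaces X us (\<lambda>A B f. \<forall>m. f ` fam A m <= fam B m) T I"
proof (rule structured_spaces.intro)
 note [simp] = usT usI famT
 show "A \<in> X ==> vec_space (us A)" "A \<in> X ==> B \<in> X ==> T A B \<in> X" "us (T A B) = tensor (us A) (us B)"
  "I \<in> X" "us I = unit_space" for A B
  using vec closed IX by auto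
 fix A assume A: "A \<in> X"
 note a = vec[OF A] sub[OF A]
 show "\<forall>m. (\<lambda>x\<in>carrier (us A). x) ` fam A m <= fam A m" by (rule preserves_family_id[OF a]) auto
 show "\<forall>m. lunit_map (us A) ` fam (T I A) m <= fam A m" using lunit_family[OF a famI[OF A]] by auto
 show "\<forall>m. lunit_inv (us A) ` fam A m <= fam (T I A) m" using lunit_inv_family[OF a famI[OF A]] by auto
 fix B assume B: "B \<in> X"
 note b = vec[OF B] sub[OF B]
 show "\<forall>m. braid_map (us A) (us B) ` fam (T A B) m <= fam (T B A) m"
  using braid_family[OF a(1) b(1) a(2) b(2)] by auto
 fix C assume C: "C \<in> X"
 note c = vec[OF C] sub[OF C]
 show "\<forall>m. assoc_map (us A) (us B) (us C) ` fam (T (T A B) C) m <= fam (T A (T B C)) m"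
  using assoc_family[OF a(1) b(1) c(1) a(2) b(2) c(2)] by auto
 show "\<forall>m. compose (carrier (us A)) g f ` fam A m <= fam C m"
  if "f \<in> lin (us A) (us B)" "\<forall>m. f ` fam A m <= fam B m" "\<forall>m. g ` fam B m <= fam C m" for f g
  by (rule preserves_family_compose[OF that(1) a(2) a(1) that(2,3)])
 fix D f g assume D: "D \<in> X"
  and f: "f \<in> lin (us A) (us C)" "\<forall>m. f ` fam A m <= fam C m"
  and g: "g \<in> lin (us B) (us D)" "\<forall>m. g ` fam B m <= fam D m"
 note d = vec[OF D] sub[OF D]
 show "\<forall>m. tensor_map (us A) (us B) (us C) (us D) f g ` fam (T A B) m <= fam (T C D) m"
  using tensor_map_family[OF a(1) b(1) c(1) d(1) a(2) b(2) c(2) d(2) lin_is_lin[OF f(1)] spec[OF f(2)] lin_is_lin[OF g(1)] spec[OF g(2)]]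
  by auto
qed

end

section \<open>Filtered and graded vector spaces\<close>

lemma inc_filtration_sub: "inc_filtration V W ==> subspace_of (W m) V"
 by (simp add: inc_filtration_def)

lemma inc_filtration_mono: "inc_filtration V W ==> mono W"
 by (simp add: inc_filtration_def)

lemma is_grading_sub: "is_grading V P ==> subspace_of (P m) V"
 by (simp add: is_grading_def)

lemma FVect_family: "family_spaces {A. vec_space (space A) \<and> inc_filtration (space A) (weight A)}
  space weight fvs_tensor (fvs_unit :: 'u::infinite fvs)"
 by (rule family_spaces.intro)
  (auto simp: fvs_tensor_def fvs_unit_def vec_tensor vec_unit inc_filtration_tensor inc_filtration_unit
   unit_acts_filtration inc_filtration_sub inc_filtration_mono)

lemma GrVect_family: "family_spaces {A. vec_space (total A) \<and> is_grading (total A) (piece A)}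
  total piece gvs_tensor (gvs_unit :: 'u::infinite gvs)"
 by (rule family_spaces.intro)
  (auto simp: gvs_tensor_def gvs_unit_def vec_tensor vec_unit is_grading_tensor is_grading_unit
   unit_acts_grading is_grading_sub)

interpretation FV: structured_spaces "{A. vec_space (space A) \<and> inc_filtration (space A) (weight A)}"
  space "\<lambda>A B f. \<forall>m. f ` weight A m <= weight B m" fvs_tensor "fvs_unit :: 'u::infinite fvs"
 by (rule family_spaces.structured[OF FVect_family])

interpretation GV: structured_spaces "{A. vec_space (total A) \<and> is_grading (total A) (piece A)}"
  total "\<lambda>A B f. \<forall>m. f ` piece A m <= piece B m" gvs_tensor "gvs_unit :: 'u::infinite gvs"
 by (rule family_spaces.structured[OF GrVect_family])

lemma inc_filtration_of_grading:
 fixes V :: "'u qvs"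
 assumes v: "vec_space V" and g: "is_grading V P"
 shows "inc_filtration V (\<lambda>m. linear_span V (\<Union>n\<in>{..m}. P n))"
proof -
 interpret vspace V by (rule vsI, rule v)
 have P: "\<And>i. subspace_of (P i) V" and sp: "linear_span V (\<Union>i. P i) = carrier V"
  and fin: "finite {n. P n \<noteq> {\<zero>\<^bsub>V\<^esub>}}"
  using g is_grading_iff[OF v] by auto
 have c: "(\<Union>n\<in>S. P n) <= carrier V" for S using sub_le[OF P] by blast
 \<comment> \<open>Inserting 0 keeps \<open>Min\<close> meaningful when all pieces vanish;
   subtracting 1 places \<open>a\<close> strictly below every nonzero piece.\<close>
 have "\<exists>a. \<forall>n\<in>{n. P n \<noteq> {\<zero>\<^bsub>V\<^esub>}}. a < n"
  using fin by (intro exI[of _ "Min (insert 0 {n. P n \<noteq> {\<zero>\<^bsub>V\<^esub>}}) - 1"]) (auto simp: diff_less_eq intro: le_imp_less_Suc Min_le zle_add1_eq_le[THEN iffD2])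
 then obtain a where a: "\<And>n. P n \<noteq> {\<zero>\<^bsub>V\<^esub>} ==> a < n" by blast
 have "\<exists>b. \<forall>n\<in>{n. P n \<noteq> {\<zero>\<^bsub>V\<^esub>}}. n \<le> b"
  using fin by (intro exI[of _ "Max (insert 0 {n. P n \<noteq> {\<zero>\<^bsub>V\<^esub>}})"]) (auto intro: Max_ge)
 then obtain b where b: "\<And>n. P n \<noteq> {\<zero>\<^bsub>V\<^esub>} ==> n \<le> b" by blast
 have "linear_span V (\<Union>n\<in>{..a}. P n) <= {\<zero>\<^bsub>V\<^esub>}"
  by (rule span_least[OF zero_sub]) (use a in force)
 then have "linear_span V (\<Union>n\<in>{..a}. P n) = {\<zero>\<^bsub>V\<^esub>}"
  using sub_zero[OF span_sub[OF c]] by blast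
 moreover have "(\<Union>n. P n) <= linear_span V (\<Union>n\<in>{..b}. P n)"
 proof safe
  fix n x assume x: "x \<in> P n"
  show "x \<in> linear_span V (\<Union>n\<in>{..b}. P n)"
  proof (cases "n \<le> b")
   case True then show ?thesis using x by (auto intro: span_base)
  next
   case False
   then have "x = \<zero>\<^bsub>V\<^esub>" using b[of n] x by auto
   then show ?thesis using sub_zero[OF span_sub[OF c]] by simp
  qed
 qed
 then have "carrier V <= linear_span V (\<Union>n\<in>{..b}. P n)"
  using span_least[OF span_sub[OF c]] sp by metis
 then have "linear_span V (\<Union>n\<in>{..b}. P n) = carrier V"
  using sub_le[OF span_sub[OF c]] by blast
 moreover have "mono (\<lambda>m. linear_span V (\<Union>n\<in>{..m}. P n))"
  by (intro monoI span_mono UN_mono) auto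
 ultimately show ?thesis unfolding inc_filtration_def using span_sub[OF c] by blast
qed

lemma U_fil_eq: "U_fil = restructure gvs_tensor gvs_unit total fvs_tensor fvs_unit filtered_of_graded"
 by (simp add: U_fil_def restructure_def)

lemma U_fil_restructuring: "restructuring {A. vec_space (total A) \<and> is_grading (total A) (piece A)}
  total (\<lambda>A B f. \<forall>m. f ` piece A m <= piece B m) gvs_tensor (gvs_unit :: 'u::infinite gvs)
  {A. vec_space (space A) \<and> inc_filtration (space A) (weight A)}
  space (\<lambda>A B f. \<forall>m. f ` weight A m <= weight B m) fvs_tensor (fvs_unit :: 'u fvs) filtered_of_graded"
proof (intro restructuring.intro restructuring_axioms.intro GV.structured_spaces_axioms FV.structured_spaces_axioms)
 let ?X = "{A :: 'u gvs. vec_space (total A) \<and> is_grading (total A) (piece A)}"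
 fix A :: "'u gvs"
 show "space (filtered_of_graded A) = total A" by (simp add: filtered_of_graded_def)
 assume A: "A \<in> ?X"
 then show "filtered_of_graded A \<in> {A. vec_space (space A) \<and> inc_filtration (space A) (weight A)}"
  by (simp add: filtered_of_graded_def inc_filtration_of_grading)
 interpret A: vspace "total A" using A by (auto intro: vsI)
 have sA: "\<And>i. subspace_of (piece A i) (total A)" using A by (simp add: is_grading_def)
 have cA: "(\<Union>n\<in>S. piece A n) <= carrier (total A)" for S using A.sub_le[OF sA] by blast
 fix B :: "'u gvs" assume B: "B \<in> ?X"
 interpret B: vspace "total B" using B by (auto intro: vsI)
 have sB: "\<And>i. subspace_of (piece B i) (total B)" using B by (simp add: is_grading_def)
 have cB: "(\<Union>n\<in>S. piece B n) <= carrier (total B)" for S using B.sub_le[OF sB] by blast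
 {
  fix f assume f: "f \<in> lin (total A) (total B)" and fp: "\<forall>m. f ` piece A m <= piece B m"
  interpret L: vpair "total A" "total B" using A.vs B.vs by (rule vpairI)
  have "f ` linear_span (total A) (\<Union>n\<in>{..m}. piece A n) <= linear_span (total B) (\<Union>n\<in>{..m}. piece B n)" for m
  proof (rule L.span_image_sub[OF lin_is_lin[OF f] B.span_sub[OF cB] cA], clarify)
   fix n x assume "n \<le> m" "x \<in> piece A n"
   then have "f x \<in> piece B n" using fp by blast
   then show "f x \<in> linear_span (total B) (\<Union>n\<in>{..m}. piece B n)" using \<open>n \<le> m\<close> by (intro B.span_base) blast
  qed
  then show "\<forall>m. f ` weight (filtered_of_graded A) m <= weight (filtered_of_graded B) m"
   by (simp add: filtered_of_graded_def)
 }
 have vT: "vec_space (tensor (total A) (total B))" by (rule vec_tensor[OF A.vs B.vs])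
 interpret T: vspace "tensor (total A) (total B)" by (rule vsI, rule vT)
 let ?L = "\<lambda>A m. linear_span (total A) (\<Union>n\<in>{..m}. piece A n)"
 let ?P = "tensor_family (total A) (total B) (piece A) (piece B)"
 have cT: "(\<Union>n\<in>S. ?P n) <= carrier (tensor (total A) (total B))" for S
  using T.sub_le[OF tensor_family_sub[where P = "piece A" and Q = "piece B", OF A.vs B.vs sA sB]] by blast
 have N: "subspace_of (linear_span (tensor (total A) (total B)) (\<Union>n\<in>{..m}. ?P n)) (tensor (total A) (total B))" for m
  by (rule T.span_sub[OF cT])
 \<comment> \<open>A lax structure map asks for this inclusion. By bilinearity it is tested on
   homogeneous elements, where degrees add.\<close>
 have "tensor_family (total A) (total B) (?L A) (?L B) m <= linear_span (tensor (total A) (total B)) (\<Union>n\<in>{..m}. ?P n)" for m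
 proof (rule tensor_family_least[OF A.vs B.vs A.span_sub[OF cA] B.span_sub[OF cB] N])
  fix i j x y assume ij: "i + j = m" and x: "x \<in> ?L A i" and y: "y \<in> ?L B j"
  show "tpure (total A) (total B) x y \<in> linear_span (tensor (total A) (total B)) (\<Union>n\<in>{..m}. ?P n)"
  proof (rule bil_span_into[OF bil_tpure[OF A.vs B.vs] A.vs B.vs vT N cA cB _ x y])
   fix a b assume "a \<in> (\<Union>n\<in>{..i}. piece A n)" "b \<in> (\<Union>n\<in>{..j}. piece B n)"
   then obtain k l where kl: "k \<le> i" "l \<le> j" "a \<in> piece A k" "b \<in> piece B l" by auto
   have "tpure (total A) (total B) a b \<in> ?P (k + l)"
    by (rule tensor_family_pure[where P = "piece A" and Q = "piece B", OF kl(3,4) refl])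
   then show "tpure (total A) (total B) a b \<in> linear_span (tensor (total A) (total B)) (\<Union>n\<in>{..m}. ?P n)"
    using kl ij by (intro T.span_base) force
  qed
 qed
 then show "\<forall>m. (\<lambda>x \<in> carrier (tensor (total A) (total B)). x) ` weight (fvs_tensor (filtered_of_graded A) (filtered_of_graded B)) m
   <= weight (filtered_of_graded (gvs_tensor A B)) m"
  by (auto simp: filtered_of_graded_def fvs_tensor_def gvs_tensor_def
   dest: T.sub_mem[OF tensor_family_sub[OF A.vs B.vs A.span_sub[OF cA] B.span_sub[OF cB]]])
next
 interpret vspace "unit_space :: 'u qvs" by (rule vsI, rule vec_unit)
 have "(\<Union>n\<in>{..m}. if n = 0 then carrier (unit_space :: 'u qvs) else {\<zero>\<^bsub>unit_space\<^esub>}) <= carrier unit_space" for m :: int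
  by auto
 then have s: "subspace_of (linear_span unit_space (\<Union>n\<in>{..m}. if n = 0 then carrier (unit_space :: 'u qvs) else {\<zero>\<^bsub>unit_space\<^esub>})) unit_space" for m :: int
  by (rule span_sub)
 have "unit_weight m <= linear_span unit_space (\<Union>n\<in>{..m}. if n = 0 then carrier (unit_space :: 'u qvs) else {\<zero>\<^bsub>unit_space\<^esub>})" for m
 proof (cases "m < 0")
  case True
  then have "unit_weight m = {\<zero>\<^bsub>unit_space :: 'u qvs\<^esub>}" by (simp add: unit_weight_def)
  then show ?thesis using sub_zero[OF s, of m] by (simp only: insert_subset empty_subsetI)
 next
  case False
  then have "unit_weight m <= (\<Union>n\<in>{..m}. if n = 0 then carrier (unit_space :: 'u qvs) else {\<zero>\<^bsub>unit_space\<^esub>})"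
   unfolding unit_weight_def by (intro subsetI UN_I[of 0]) simp_all
  then show ?thesis using span_superset by (rule subset_trans)
 qed
 then show "\<forall>m. (\<lambda>x \<in> carrier (unit_space :: 'u qvs). x) ` weight fvs_unit m <= weight (filtered_of_graded gvs_unit) m"
  unfolding filtered_of_graded_def fvs_unit_def gvs_unit_def fvs.simps gvs.simps
  by (rule preserves_family_id[OF vec_unit inc_filtration_sub[OF inc_filtration_unit]])
qed

lemma U_fil_lax: "lax_symmetric_monoidal_functor (GrVect :: 'u::infinite gvs_cat) FVect U_fil"
 unfolding GrVect_def FVect_def U_fil_eq by (rule restructuring.restructure_lax[OF U_fil_restructuring])

section \<open>Direct sums\<close>

lemma direct_sum_simps:
 "s \<in> carrier (direct_sum X) \<longleftrightarrow> (\<forall>i. s i \<in> carrier (X i)) \<and> finite {i. s i \<noteq> \<zero>\<^bsub>X i\<^esub>}"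
 "s \<oplus>\<^bsub>direct_sum X\<^esub> t = (\<lambda>i. s i \<oplus>\<^bsub>X i\<^esub> t i)" "\<zero>\<^bsub>direct_sum X\<^esub> = (\<lambda>i. \<zero>\<^bsub>X i\<^esub>)"
 "c \<odot>\<^bsub>direct_sum X\<^esub> s = (\<lambda>i. c \<odot>\<^bsub>X i\<^esub> s i)"
 by (simp_all add: direct_sum_def)

lemma vec_direct_sum:
 assumes v: "\<And>i. vec_space (X i)"
 shows "vec_space (direct_sum X)"
proof -
 interpret X: vspace "X i" for i by (rule vsI, rule v)
 show ?thesis
 proof (rule vec_spaceI)
  fix s t assume s: "s \<in> carrier (direct_sum X)" and t: "t \<in> carrier (direct_sum X)"
  have "finite ({i. s i \<noteq> \<zero>\<^bsub>X i\<^esub>} \<union> {i. t i \<noteq> \<zero>\<^bsub>X i\<^esub>})" using s t by (simp add: direct_sum_simps)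
  then have "finite {i. s i \<oplus>\<^bsub>X i\<^esub> t i \<noteq> \<zero>\<^bsub>X i\<^esub>}" by (rule rev_finite_subset) auto
  then show "s \<oplus>\<^bsub>direct_sum X\<^esub> t \<in> carrier (direct_sum X)" using s t by (simp add: direct_sum_simps)
  show "s \<oplus>\<^bsub>direct_sum X\<^esub> t = t \<oplus>\<^bsub>direct_sum X\<^esub> s"
   using s t by (simp add: direct_sum_simps X.M.a_comm)
  show "c \<odot>\<^bsub>direct_sum X\<^esub> (s \<oplus>\<^bsub>direct_sum X\<^esub> t) = c \<odot>\<^bsub>direct_sum X\<^esub> s \<oplus>\<^bsub>direct_sum X\<^esub> c \<odot>\<^bsub>direct_sum X\<^esub> t" for c
   using s t by (simp add: direct_sum_simps X.smult_add_right)
  show "(s \<oplus>\<^bsub>direct_sum X\<^esub> t) \<oplus>\<^bsub>direct_sum X\<^esub> r = s \<oplus>\<^bsub>direct_sum X\<^esub> (t \<oplus>\<^bsub>direct_sum X\<^esub> r)"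
   if "r \<in> carrier (direct_sum X)" for r
   using s t that by (simp add: direct_sum_simps X.M.a_assoc)
 next
  fix c s assume s: "s \<in> carrier (direct_sum X)"
  then have "finite {i. s i \<noteq> \<zero>\<^bsub>X i\<^esub>}" by (simp add: direct_sum_simps)
  then have "finite {i. c \<odot>\<^bsub>X i\<^esub> s i \<noteq> \<zero>\<^bsub>X i\<^esub>}" by (rule rev_finite_subset) auto
  then show "c \<odot>\<^bsub>direct_sum X\<^esub> s \<in> carrier (direct_sum X)" using s by (simp add: direct_sum_simps)
 next
  show "\<zero>\<^bsub>direct_sum X\<^esub> \<in> carrier (direct_sum X)" by (simp add: direct_sum_simps)
 qed (auto simp: direct_sum_simps X.smult_add_left X.smult_smult X.smult_m1 X.M.l_neg)
qed

lemma direct_sum_map_lin: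
 assumes v: "\<And>i. vec_space (X i)" "\<And>i. vec_space (Y i)" and g: "\<And>i. is_lin (X i) (Y i) (g i)"
 shows "is_lin (direct_sum X) (direct_sum Y) (\<lambda>s i. g i (s i))"
proof (rule is_linI)
 have z: "g i \<zero>\<^bsub>X i\<^esub> = \<zero>\<^bsub>Y i\<^esub>" for i
  by (rule vpair.is_lin_zero[OF vpairI[OF v] g])
 fix s assume s: "s \<in> carrier (direct_sum X)"
 then have "finite {i. s i \<noteq> \<zero>\<^bsub>X i\<^esub>}" by (simp add: direct_sum_simps)
 then have "finite {i. g i (s i) \<noteq> \<zero>\<^bsub>Y i\<^esub>}" by (rule rev_finite_subset) (auto simp: z)
 then show "(\<lambda>i. g i (s i)) \<in> carrier (direct_sum Y)"
  using s lin_mem[OF g] by (simp add: direct_sum_simps)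
qed (use g in \<open>auto simp: direct_sum_simps is_lin_add is_lin_smult fun_eq_iff\<close>)

text \<open>An element is coded by the finite set of its nonzero components, each tagged with its
  index.\<close>

lemma direct_sum_copyable:
 fixes X :: "int => ('k::field, 'v) module" and r :: "int => 'v => 'u::infinite"
 assumes v: "\<And>i. vec_space (X i)" and r: "\<And>i. inj_on (r i) (carrier (X i))"
 shows "copyable (direct_sum X) (embed (direct_sum X) :: _ => 'u)"
proof -
 obtain j :: "int => 'u" where "inj j" using inj_countable_into_infinite[OF inj_to_nat] by blast
 then obtain p :: "int \<times> 'u => 'u" where "inj p" using inj_prod_into_infinite[of j "\<lambda>x. x"] by auto
 then obtain h :: "(int \<times> 'u) set => 'u" where h: "inj_on h {S. finite S}"
  using inj_finite_sets_into_infinite by blast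
 define G where "G s = (\<lambda>i. (i, r i (s i))) ` {i. s i \<noteq> \<zero>\<^bsub>X i\<^esub>}" for s
 have "s = t" if s: "s \<in> carrier (direct_sum X)" and t: "t \<in> carrier (direct_sum X)" and eq: "G s = G t" for s t
 proof
  fix i
  have sc: "s i \<in> carrier (X i)" "t i \<in> carrier (X i)" using s t by (auto simp: direct_sum_simps)
  have "(i, r i (s i)) \<in> G s \<longleftrightarrow> s i \<noteq> \<zero>\<^bsub>X i\<^esub>" "(i, r i (t i)) \<in> G t \<longleftrightarrow> t i \<noteq> \<zero>\<^bsub>X i\<^esub>"
   by (auto simp: G_def)
  moreover have "(i, y) \<in> G s ==> y = r i (s i)" "(i, y) \<in> G t ==> y = r i (t i)" for y
   by (auto simp: G_def)
  ultimately show "s i = t i" using eq inj_onD[OF r _ sc] by metis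
 qed
 moreover have "finite (G s)" if "s \<in> carrier (direct_sum X)" for s
  using that by (simp add: G_def direct_sum_simps)
 ultimately have "inj_on (\<lambda>s. h (G s)) (carrier (direct_sum X))"
  using h by (auto simp: inj_on_def)
 then show ?thesis by (rule copyableI[OF vec_direct_sum[OF v]])
qed

definition summand :: "('i => ('k, 'v) module) => 'i => ('i => 'v) set" where
 "summand X p = {s \<in> carrier (direct_sum X). \<forall>q. q \<noteq> p --> s q = \<zero>\<^bsub>X q\<^esub>}"

lemma summand_subspace:
 assumes v: "\<And>i. vec_space (X i)"
 shows "subspace_of (summand X p) (direct_sum X)"
proof -
 interpret X: vspace "X i" for i by (rule vsI, rule v)
 interpret D: vspace "direct_sum X" by (rule vsI, rule vec_direct_sum[OF v])
 show ?thesis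
  by (rule D.subspaceI)
   (use D.M.zero_closed D.M.a_closed D.smult_closed' in \<open>auto simp: summand_def direct_sum_simps(2-4)\<close>)
qed

lemma direct_sum_span:
 assumes v: "\<And>i. vec_space (X i)"
 shows "linear_span (direct_sum X) (\<Union>p. summand X p) = carrier (direct_sum X)"
proof -
 interpret X: vspace "X i" for i by (rule vsI, rule v)
 interpret D: vspace "direct_sum X" by (rule vsI, rule vec_direct_sum[OF v])
 have c: "(\<Union>p. summand X p) <= carrier (direct_sum X)" by (auto simp: summand_def)
 note N = D.span_sub[OF c]
 have "s \<in> linear_span (direct_sum X) (\<Union>p. summand X p)"
  if "finite K" "s \<in> carrier (direct_sum X)" "{i. s i \<noteq> \<zero>\<^bsub>X i\<^esub>} <= K" for K s
  using that
 proof (induction arbitrary: s rule: finite_induct)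
  case empty
  then have "s = \<zero>\<^bsub>direct_sum X\<^esub>" by (auto simp: direct_sum_simps)
  then show ?case using D.sub_zero[OF N] by simp
 next
  case (insert k K)
  define a where "a i = (if i = k then \<zero>\<^bsub>X i\<^esub> else s i)" for i
  define b where "b i = (if i = k then s i else \<zero>\<^bsub>X i\<^esub>)" for i
  have fs: "finite {i. s i \<noteq> \<zero>\<^bsub>X i\<^esub>}" and sc: "\<And>i. s i \<in> carrier (X i)"
   using insert.prems(1) by (auto simp: direct_sum_simps)
  have "finite {i. a i \<noteq> \<zero>\<^bsub>X i\<^esub>}" by (rule finite_subset[OF _ fs]) (auto simp: a_def)
  then have a: "a \<in> carrier (direct_sum X)" using sc by (auto simp: direct_sum_simps a_def)
  have "finite {i. b i \<noteq> \<zero>\<^bsub>X i\<^esub>}" by (rule finite_subset[OF _ fs]) (auto simp: b_def)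
  then have b: "b \<in> summand X k" using sc by (auto simp: direct_sum_simps summand_def b_def)
  have "s = a \<oplus>\<^bsub>direct_sum X\<^esub> b" using sc by (auto simp: direct_sum_simps a_def b_def)
  moreover have "a \<in> linear_span (direct_sum X) (\<Union>p. summand X p)"
   using insert.prems by (intro insert.IH a) (auto simp: a_def)
  moreover have "b \<in> linear_span (direct_sum X) (\<Union>p. summand X p)" using b by (intro D.span_base) blast
  ultimately show ?case using D.sub_add[OF N] by simp
 qed
 then have "carrier (direct_sum X) <= linear_span (direct_sum X) (\<Union>p. summand X p)"
  by (auto simp: direct_sum_simps(1))
 then show ?thesis using D.sub_le[OF N] by blast
qed

lemma is_grading_copy:
 fixes X :: "int => (rat, 'v) module"
 assumes v: "\<And>i. vec_space (X i)" and cp: "copyable (direct_sum X) (embed (direct_sum X) :: _ => 'u::infinite)"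
  and fin: "finite {i. carrier (X i) \<noteq> {\<zero>\<^bsub>X i\<^esub>}}"
 shows "is_grading (copy (direct_sum X) :: 'u qvs) (\<lambda>p. embed (direct_sum X) ` summand X p)"
proof -
 interpret X: vspace "X i" for i by (rule vsI, rule v)
 interpret cp: copyable "direct_sum X" "embed (direct_sum X) :: _ => 'u" by (rule cp)
 interpret DC: vpair "direct_sum X" "copy (direct_sum X) :: 'u qvs"
  by (rule vpairI[OF cp.vs cp.vec_copy])
 interpret SS: vpair "X i" "X i" for i by (rule vpairI; rule v)
 have sub: "subspace_of (embed (direct_sum X) ` summand X p) (copy (direct_sum X) :: 'u qvs)" for p
  by (rule DC.image_sub[OF cp.is_lin_embed summand_subspace[OF v]])
 have sc: "summand X p <= carrier (direct_sum X)" for p by (auto simp: summand_def)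
 have "embed (direct_sum X) ` linear_span (direct_sum X) (\<Union>p. summand X p)
   <= linear_span (copy (direct_sum X)) (\<Union>p. embed (direct_sum X) ` summand X p :: 'u set)"
 proof (rule DC.span_image_sub[OF cp.is_lin_embed])
  show "subspace_of (linear_span (copy (direct_sum X)) (\<Union>p. embed (direct_sum X) ` summand X p :: 'u set)) (copy (direct_sum X))"
   by (rule DC.W.span_sub) (use DC.W.sub_le[OF sub] in blast)
  show "embed (direct_sum X) ` (\<Union>p. summand X p) <= linear_span (copy (direct_sum X)) (\<Union>p. embed (direct_sum X) ` summand X p :: 'u set)"
   by (intro image_subsetI DC.W.span_base) blast
 qed (use sc in blast)
 then have "linear_span (copy (direct_sum X)) (\<Union>p. embed (direct_sum X) ` summand X p :: 'u set) = carrier (copy (direct_sum X))"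
  unfolding direct_sum_span[OF v] cp.copy_carrier
  using DC.W.span_carrier[of "\<Union>p. embed (direct_sum X) ` summand X p"] sc cp.copy_carrier by blast
 moreover have "{p. embed (direct_sum X) ` summand X p \<noteq> {\<zero>\<^bsub>copy (direct_sum X) :: 'u qvs\<^esub>}} <= {i. carrier (X i) \<noteq> {\<zero>\<^bsub>X i\<^esub>}}"
 proof (rule subsetI, rule ccontr)
  fix p assume p: "p \<in> {p. embed (direct_sum X) ` summand X p \<noteq> {\<zero>\<^bsub>copy (direct_sum X) :: 'u qvs\<^esub>}}"
   and "p \<notin> {i. carrier (X i) \<noteq> {\<zero>\<^bsub>X i\<^esub>}}"
  then have "s = \<zero>\<^bsub>direct_sum X\<^esub>" if "s \<in> summand X p" for s
   using that unfolding summand_def direct_sum_simps by (intro ext) (metis (mono_tags, lifting) mem_Collect_eq singletonD)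
  moreover have "\<zero>\<^bsub>direct_sum X\<^esub> \<in> summand X p" by (rule cp.sub_zero[OF summand_subspace[OF v]])
  ultimately have "summand X p = {\<zero>\<^bsub>direct_sum X\<^esub>}" by blast
  then show False using p DC.is_lin_zero[OF cp.is_lin_embed] by simp
 qed
 then have "finite {p. embed (direct_sum X) ` summand X p \<noteq> {\<zero>\<^bsub>copy (direct_sum X) :: 'u qvs\<^esub>}}"
  by (rule finite_subset[OF _ fin])
 moreover have "independent_family (copy (direct_sum X) :: 'u qvs) (\<lambda>p. embed (direct_sum X) ` summand X p)"
 proof (rule independent_if_eigen[OF cp.vec_copy sub])
  \<comment> \<open>The degree operator, multiplication by \<open>p\<close> on the summand of index
    \<open>p\<close>, transported along \<open>embed\<close>.\<close>
  show "is_lin (copy (direct_sum X)) (copy (direct_sum X)) (\<lambda>u :: 'u. embed (direct_sum X) (\<lambda>p. of_int p \<odot>\<^bsub>X p\<^esub> unembed (direct_sum X) u p) :: 'u)"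
   by (rule is_lin_comp[OF is_lin_comp[OF cp.is_lin_unembed direct_sum_map_lin[OF v v SS.is_lin_scale[OF is_lin_id]]] cp.is_lin_embed])
  fix i u assume "u \<in> (embed (direct_sum X) ` summand X i :: 'u set)"
  then obtain s where s: "u = embed (direct_sum X) s" "s \<in> summand X i" by blast
  then have c: "s \<in> carrier (direct_sum X)" using sc by blast
  have "of_int p \<odot>\<^bsub>X p\<^esub> s p = of_int i \<odot>\<^bsub>X p\<^esub> s p" for p
   using s(2) by (cases "p = i") (auto simp: summand_def)
  then show "embed (direct_sum X) (\<lambda>p. of_int p \<odot>\<^bsub>X p\<^esub> unembed (direct_sum X) u p) = of_int i \<odot>\<^bsub>copy (direct_sum X)\<^esub> u"
   unfolding s(1) cp.unembed_e[OF c] is_lin_smult[OF cp.is_lin_embed c, symmetric] by (simp add: direct_sum_simps)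
 qed
 ultimately show ?thesis unfolding is_grading_iff[OF cp.vec_copy] using sub by blast
qed

section \<open>The associated graded space\<close>

locale filtered = vspace V for V :: "'u::infinite qvs" +
 fixes W :: "int => 'u set"
 assumes W: "inc_filtration V W"
begin

lemma sW: "subspace_of (W m) V"
 using W by (rule inc_filtration_sub)

lemma W_mono: "m \<le> n ==> W m <= W n"
 using W by (auto simp: inc_filtration_def dest: monoD)

definition GrW :: "int => (rat, 'u set) module" where
 "GrW m = quot (sub V (W m)) (W (m - 1))"

lemma vec_sub: "vec_space (sub V (W m))"
 by (rule vspace_sub[OF sW])

lemma sub_simps: "carrier (sub V N) = N" "x \<oplus>\<^bsub>sub V N\<^esub> y = x \<oplus>\<^bsub>V\<^esub> y" "\<zero>\<^bsub>sub V N\<^esub> = \<zero>\<^bsub>V\<^esub>" "c \<odot>\<^bsub>sub V N\<^esub> x = c \<odot>\<^bsub>V\<^esub> x"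
 by (simp_all add: sub_def)

lemma coset_sub: "N +>\<^bsub>sub V M\<^esub> x = N +>\<^bsub>V\<^esub> x"
 by (simp add: a_r_coset_def' sub_def)

lemma sub_sub: "subspace_of (W (m - 1)) (sub V (W m))"
proof -
 interpret S: vspace "sub V (W m)" by (rule vsI, rule vec_sub)
 show ?thesis
  by (rule S.subspaceI)
   (use W_mono[of "m - 1" m] sub_zero[OF sW] sub_add[OF sW] sub_smult[OF sW] in \<open>auto simp: sub_simps\<close>)
qed

lemma vec_GrW: "vec_space (GrW m)"
 unfolding GrW_def by (rule vspace.vec_quot[OF _ sub_sub]) (simp add: vspace_def vec_sub)

lemma GrW_carrier: "carrier (GrW m) = (\<lambda>x. W (m - 1) +>\<^bsub>V\<^esub> x) ` W m"
 using vspace.quot_carrier[OF _ sub_sub, of m] vec_sub by (simp add: GrW_def vspace_def coset_sub sub_simps)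

lemma GrW_proj_lin: "is_lin (sub V (W m)) (GrW m) (\<lambda>x. W (m - 1) +>\<^bsub>V\<^esub> x)"
 using vspace.quot_proj_lin[OF _ sub_sub, of m] vec_sub by (simp add: GrW_def vspace_def coset_sub)

lemma GrW_zero: "\<zero>\<^bsub>GrW m\<^esub> = W (m - 1)"
 by (simp add: GrW_def quot_def)

lemma GrW_proj_zero: "x \<in> carrier V ==> W (m - 1) +>\<^bsub>V\<^esub> x = \<zero>\<^bsub>GrW m\<^esub> \<longleftrightarrow> x \<in> W (m - 1)"
proof -
 assume x: "x \<in> carrier V"
 show ?thesis
  using coset_eq_iff[OF sW[of "m - 1"] x M.zero_closed]
  by (simp only: coset_zero_eq[OF sW] GrW_zero diff_zero[OF x])
qed

lemma GrW_finite: "finite {m. carrier (GrW m) \<noteq> {\<zero>\<^bsub>GrW m\<^esub>}}"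
proof -
 obtain a b where a: "W a = {\<zero>\<^bsub>V\<^esub>}" and b: "W b = carrier V" using W unfolding inc_filtration_def by blast
 have *: "carrier (GrW m) = {\<zero>\<^bsub>GrW m\<^esub>}" if m: "m \<le> a \<or> b < m" for m
 proof -
  have "W m <= W (m - 1)"
  proof (cases "m \<le> a")
   case True
   then have "W m <= {\<zero>\<^bsub>V\<^esub>}" using W_mono[of m a] a by simp
   then show ?thesis using sub_zero[OF sW, of "m - 1"] by blast
  next
   case False
   then have "carrier V <= W (m - 1)" using W_mono[of b "m - 1"] b m by simp
   then show ?thesis using sub_le[OF sW] by blast
  qed
  then have "W (m - 1) +>\<^bsub>V\<^esub> x = \<zero>\<^bsub>GrW m\<^esub>" if "x \<in> W m" for x
   using that GrW_proj_zero[of x m] sub_mem[OF sW] by blast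
  then show ?thesis unfolding GrW_carrier using sub_zero[OF sW, of m] by auto
 qed
 have "{m. carrier (GrW m) \<noteq> {\<zero>\<^bsub>GrW m\<^esub>}} <= {a..b}"
 proof
  fix m assume "m \<in> {m. carrier (GrW m) \<noteq> {\<zero>\<^bsub>GrW m\<^esub>}}"
  then have "\<not> (m \<le> a \<or> b < m)" using *[of m] by blast
  then show "m \<in> {a..b}" by simp
 qed
 then show ?thesis by (rule finite_subset) simp
qed

text \<open>Cosets are coded by chosen elements, and these already lie in the universe.\<close>

lemma GrW_copyable: "copyable (direct_sum GrW) (embed (direct_sum GrW) :: _ => 'u)"
proof (rule direct_sum_copyable[OF vec_GrW])
 fix m show "inj_on (\<lambda>Y. SOME y. y \<in> Y) (carrier (GrW m))"
 proof (rule inj_onI)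
  fix Y Z assume "Y \<in> carrier (GrW m)" "Z \<in> carrier (GrW m)" and eq: "(SOME y. y \<in> Y) = (SOME y. y \<in> Z)"
  then obtain y z where yz: "Y = W (m - 1) +>\<^bsub>V\<^esub> y" "Z = W (m - 1) +>\<^bsub>V\<^esub> z" "y \<in> carrier V" "z \<in> carrier V"
   using sub_mem[OF sW] unfolding GrW_carrier by blast
  have "(SOME y. y \<in> Y) \<in> Y" unfolding yz(1) by (rule someI, rule coset_self[OF sW yz(3)])
  moreover have "(SOME y. y \<in> Z) \<in> Z" unfolding yz(2) by (rule someI, rule coset_self[OF sW yz(4)])
  ultimately obtain w where "w \<in> carrier V" "w \<ominus>\<^bsub>V\<^esub> y \<in> W (m - 1)" "w \<ominus>\<^bsub>V\<^esub> z \<in> W (m - 1)"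
   using eq coset_mem[OF sW yz(3)] coset_mem[OF sW yz(4)] yz(1,2) by metis
  then show "Y = Z"
   unfolding yz(1,2) using coset_eq_iff[OF sW] yz(3,4) by metis
 qed
qed

lemma grading_GrW: "is_grading (copy (direct_sum GrW) :: 'u qvs) (\<lambda>p. embed (direct_sum GrW) ` summand GrW p)"
 by (rule is_grading_copy[OF vec_GrW GrW_copyable GrW_finite])

end

lemma Gr_eq_GrW: "filtered (space A) (weight A) ==> Gr A = filtered.GrW (space A) (weight A)"
 by (simp add: fun_eq_iff Gr_def filtered.GrW_def)

lemma graded_of_filtered_simps:
 "total (graded_of_filtered A) = copy (direct_sum (Gr A))"
 "piece (graded_of_filtered A) = (\<lambda>p. embed (direct_sum (Gr A)) ` summand (Gr A) p)"
 by (simp_all add: graded_of_filtered_def summand_def)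

section \<open>Functoriality of the associated graded space\<close>

locale filtered_map = A: filtered V W + B: filtered V' W'
 for V :: "'u::infinite qvs" and W and V' :: "'u qvs" and W' +
 fixes f :: "'u => 'u"
 assumes f: "is_lin V V' f" and fW: "\<And>m. f ` W m <= W' m"
begin

sublocale L: vpair V V'
 by (rule vpairI[OF A.vs B.vs])

definition grmap :: "int => 'u set => 'u set" where
 "grmap p X = (\<Union>x \<in> X. W' (p - 1) +>\<^bsub>V'\<^esub> f x)"

text \<open>All representatives of a class are sent into the same coset, since \<open>f\<close>
  respects the lower step of the filtration; the union in the definition is therefore a single
  coset.\<close>

lemma grmap_coset: assumes x: "x \<in> W p" shows "grmap p (W (p - 1) +>\<^bsub>V\<^esub> x) = W' (p - 1) +>\<^bsub>V'\<^esub> f x"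
proof -
 have xc: "x \<in> carrier V" by (rule A.sub_mem[OF A.sW x])
 have "W' (p - 1) +>\<^bsub>V'\<^esub> f y = W' (p - 1) +>\<^bsub>V'\<^esub> f x" if "y \<in> W (p - 1) +>\<^bsub>V\<^esub> x" for y
 proof -
  have y: "y \<in> carrier V" "y \<ominus>\<^bsub>V\<^esub> x \<in> W (p - 1)" using that A.coset_mem[OF A.sW xc] by auto
  then have "f y \<ominus>\<^bsub>V'\<^esub> f x \<in> W' (p - 1)" using fW L.is_lin_diff[OF f y(1) xc] by (metis image_subset_iff)
  then show ?thesis using B.coset_eq_iff[OF B.sW lin_mem[OF f y(1)] lin_mem[OF f xc]] by blast
 qed
 then have "grmap p (W (p - 1) +>\<^bsub>V\<^esub> x) = (\<Union>y\<in>W (p - 1) +>\<^bsub>V\<^esub> x. W' (p - 1) +>\<^bsub>V'\<^esub> f x)"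
  unfolding grmap_def by (rule SUP_cong[OF refl])
 then show ?thesis using A.coset_self[OF A.sW xc] by auto
qed

lemma grmap_lin: "is_lin (A.GrW p) (B.GrW p) (grmap p)"
proof (rule is_linI)
 have fp: "f x \<in> W' p" if "x \<in> W p" for x using fW that by blast
 note pa = is_lin_add[OF A.GrW_proj_lin, unfolded A.sub_simps] and ps = is_lin_smult[OF A.GrW_proj_lin, unfolded A.sub_simps]
 note pb = is_lin_add[OF B.GrW_proj_lin, unfolded B.sub_simps] and pt = is_lin_smult[OF B.GrW_proj_lin, unfolded B.sub_simps]
 fix X assume "X \<in> carrier (A.GrW p)"
 then obtain x where x: "X = W (p - 1) +>\<^bsub>V\<^esub> x" "x \<in> W p" unfolding A.GrW_carrier by blast
 note xc = A.sub_mem[OF A.sW x(2)]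
 show "grmap p X \<in> carrier (B.GrW p)"
  unfolding x(1) grmap_coset[OF x(2)] B.GrW_carrier using fp x(2) by blast
 show "grmap p (c \<odot>\<^bsub>A.GrW p\<^esub> X) = c \<odot>\<^bsub>B.GrW p\<^esub> grmap p X" for c
  unfolding x(1) ps[OF x(2), symmetric] grmap_coset[OF x(2)] grmap_coset[OF A.sub_smult[OF A.sW x(2)]]
   is_lin_smult[OF f xc] by (rule pt[OF fp[OF x(2)]])
 fix Y assume "Y \<in> carrier (A.GrW p)"
 then obtain y where y: "Y = W (p - 1) +>\<^bsub>V\<^esub> y" "y \<in> W p" unfolding A.GrW_carrier by blast
 note yc = A.sub_mem[OF A.sW y(2)]
 show "grmap p (X \<oplus>\<^bsub>A.GrW p\<^esub> Y) = grmap p X \<oplus>\<^bsub>B.GrW p\<^esub> grmap p Y"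
  unfolding x(1) y(1) pa[OF x(2) y(2), symmetric] grmap_coset[OF x(2)] grmap_coset[OF y(2)]
   grmap_coset[OF A.sub_add[OF A.sW x(2) y(2)]] is_lin_add[OF f xc yc] by (rule pb[OF fp[OF x(2)] fp[OF y(2)]])
qed

definition grtotal :: "'u => 'u" where
 "grtotal = (\<lambda>u \<in> carrier (copy (direct_sum A.GrW)). embed (direct_sum B.GrW) (\<lambda>p. grmap p (unembed (direct_sum A.GrW) u p)))"

lemma grtotal_lin: "grtotal \<in> lin (copy (direct_sum A.GrW)) (copy (direct_sum B.GrW))"
 unfolding grtotal_def
 by (rule lin_restrict[OF copyable.vec_copy[OF A.GrW_copyable]
  is_lin_comp[OF is_lin_comp[OF copyable.is_lin_unembed[OF A.GrW_copyable] direct_sum_map_lin[OF A.vec_GrW B.vec_GrW grmap_lin]]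
   copyable.is_lin_embed[OF B.GrW_copyable]]])

lemma grtotal_embed: "s \<in> carrier (direct_sum A.GrW) ==>
  grtotal (embed (direct_sum A.GrW) s) = embed (direct_sum B.GrW) (\<lambda>p. grmap p (s p))"
 by (simp add: grtotal_def copyable.copy_carrier[OF A.GrW_copyable] copyable.unembed_e[OF A.GrW_copyable])

lemma grtotal_piece: "grtotal ` embed (direct_sum A.GrW) ` summand A.GrW p <= embed (direct_sum B.GrW) ` summand B.GrW p"
proof safe
 fix s assume s: "s \<in> summand A.GrW p"
 have c: "s \<in> carrier (direct_sum A.GrW)" using s by (simp add: summand_def)
 have "grmap q (s q) = \<zero>\<^bsub>B.GrW q\<^esub>" if "q \<noteq> p" for q
  using s that vpair.is_lin_zero[OF vpairI[OF A.vec_GrW B.vec_GrW] grmap_lin] by (simp add: summand_def)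
 moreover have "(\<lambda>p. grmap p (s p)) \<in> carrier (direct_sum B.GrW)"
  by (rule lin_mem[OF direct_sum_map_lin[OF A.vec_GrW B.vec_GrW grmap_lin] c])
 ultimately show "grtotal (embed (direct_sum A.GrW) s) \<in> embed (direct_sum B.GrW) ` summand B.GrW p"
  unfolding grtotal_embed[OF c] by (auto simp: summand_def)
qed

end

lemma filtered_mapI:
 assumes "f \<in> hom_set (FVect :: 'u::infinite fvs_cat) A B"
 shows "filtered_map (space A) (weight A) (space B) (weight B) (Fun f)"
 using assms unfolding FVect_def FV.hom_iff
 by (auto simp: filtered_map_def filtered_def filtered_map_axioms_def filtered_axioms_def vspace_def lin_is_lin)

lemma gr_functor_Fun:
 assumes "f \<in> hom_set (FVect :: 'u::infinite fvs_cat) A B"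
 shows "Fun (on_arr gr_functor f) = filtered_map.grtotal (space A) (weight A) (space B) (weight B) (Fun f)"
proof -
 interpret filtered_map "space A" "weight A" "space B" "weight B" "Fun f" by (rule filtered_mapI[OF assms])
 have "Src f = A" "Trg f = B" using assms unfolding FVect_def FV.hom_iff by auto
 then show ?thesis
  by (simp add: gr_functor_def graded_of_filtered_simps grtotal_def Gr_eq_GrW A.filtered_axioms B.filtered_axioms Gr_map_def grmap_def)
qed

text \<open>By \<open>grmap_coset\<close> the induced maps are computed on representatives, so
  identities and composites are inherited from the maps below and carried through
  \<open>embed\<close>.\<close>

lemma gr_functor: "functor_between (FVect :: 'u::infinite fvs_cat) GrVect gr_functor"
proof (intro functor_between.intro functor_between_axioms.intro)
 show "category (FVect :: 'u fvs_cat)" unfolding FVect_def by (rule FV.category)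
 show "category (GrVect :: 'u gvs_cat)" unfolding GrVect_def by (rule GV.category)
next
 fix A :: "'u fvs" assume "A \<in> Obj FVect"
 then have A: "vec_space (space A)" "inc_filtration (space A) (weight A)"
  unfolding FVect_def FV.CC_simps by auto
 then interpret A: filtered "space A" "weight A" by (simp add: filtered_def filtered_axioms_def vspace_def)
 show "on_obj gr_functor A \<in> Obj GrVect"
  unfolding GrVect_def GV.CC_simps
  using A.grading_GrW copyable.vec_copy[OF A.GrW_copyable]
  by (simp add: gr_functor_def graded_of_filtered_simps Gr_eq_GrW A.filtered_axioms)
 have i: "ident FVect A \<in> hom_set FVect A A"
  using category.ident_hom[OF FV.category] A unfolding FVect_def FV.CC_simps by blast
 interpret I: filtered_map "space A" "weight A" "space A" "weight A" "Fun (ident FVect A)" by (rule filtered_mapI[OF i])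
 have g: "I.grmap p X = X" if X: "X \<in> carrier (A.GrW p)" for p X
 proof -
  obtain x where x: "X = weight A (p - 1) +>\<^bsub>space A\<^esub> x" "x \<in> weight A p" using X unfolding A.GrW_carrier by blast
  then show ?thesis using I.grmap_coset[OF x(2)] A.sub_mem[OF A.sW x(2)] by (simp add: FVect_def FV.CC_simps)
 qed
 have "I.grtotal = (\<lambda>u\<in>carrier (copy (direct_sum A.GrW)). u)"
  unfolding I.grtotal_def
 proof (rule restrict_ext)
  fix u :: 'u assume "u \<in> carrier (copy (direct_sum A.GrW))"
  then obtain s where s: "u = embed (direct_sum A.GrW) s" "s \<in> carrier (direct_sum A.GrW)"
   unfolding copyable.copy_carrier[OF A.GrW_copyable] by blast
  have "(\<lambda>p. I.grmap p (s p)) = s" using s(2) g by (auto simp: direct_sum_simps)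
  then show "embed (direct_sum A.GrW) (\<lambda>p. I.grmap p (unembed (direct_sum A.GrW) u p)) = u"
   using s copyable.unembed_e[OF A.GrW_copyable s(2)] by simp
 qed
 then have "Fun (on_arr gr_functor (ident FVect A)) = (\<lambda>u\<in>carrier (copy (direct_sum A.GrW)). u)"
  using gr_functor_Fun[OF i] by simp
 then show "on_arr gr_functor (ident FVect A) = ident GrVect (on_obj gr_functor A)"
  unfolding GrVect_def GV.CC_simps
  by (simp add: gr_functor_def FVect_def FV.CC_simps graded_of_filtered_simps Gr_eq_GrW A.filtered_axioms)
next
 fix f and A B :: "'u fvs" assume f: "f \<in> hom_set FVect A B"
 then have o: "A \<in> Obj FVect" "B \<in> Obj FVect" "Src f = A" "Trg f = B"
  unfolding FVect_def FV.hom_iff FV.CC_simps by auto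
 interpret F: filtered_map "space A" "weight A" "space B" "weight B" "Fun f" by (rule filtered_mapI[OF f])
 have r: "Src (on_arr gr_functor f) = graded_of_filtered A" "Trg (on_arr gr_functor f) = graded_of_filtered B"
  using o by (simp_all add: gr_functor_def)
 show "on_arr gr_functor f \<in> hom_set GrVect (on_obj gr_functor A) (on_obj gr_functor B)"
  unfolding GrVect_def GV.hom_iff gr_functor_Fun[OF f] r
  using F.A.grading_GrW F.B.grading_GrW copyable.vec_copy[OF F.A.GrW_copyable] copyable.vec_copy[OF F.B.GrW_copyable]
   F.grtotal_lin F.grtotal_piece
  by (simp add: gr_functor_def graded_of_filtered_simps Gr_eq_GrW F.A.filtered_axioms F.B.filtered_axioms)
 fix g and C :: "'u fvs" assume g: "g \<in> hom_set FVect B C"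
 then have o': "Src g = B" "Trg g = C" unfolding FVect_def FV.hom_iff by auto
 interpret G: filtered_map "space B" "weight B" "space C" "weight C" "Fun g" by (rule filtered_mapI[OF g])
 have gf: "g \<cdot>\<^bsub>FVect\<^esub> f \<in> hom_set FVect A C"
  using category.comp_hom[OF FV.category] f g unfolding FVect_def by blast
 interpret H: filtered_map "space A" "weight A" "space C" "weight C" "Fun (g \<cdot>\<^bsub>FVect\<^esub> f)" by (rule filtered_mapI[OF gf])
 have e: "H.grmap p X = G.grmap p (F.grmap p X)" if X: "X \<in> carrier (F.A.GrW p)" for p X
 proof -
  obtain x where x: "X = weight A (p - 1) +>\<^bsub>space A\<^esub> x" "x \<in> weight A p" using X unfolding F.A.GrW_carrier by blast
  have "Fun f x \<in> weight B p" using F.fW x(2) by blast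
  then show ?thesis
   using H.grmap_coset[OF x(2)] F.grmap_coset[OF x(2)] G.grmap_coset F.A.sub_mem[OF F.A.sW x(2)] x(1) o
   by (simp add: FVect_def FV.CC_simps compose_eq)
 qed
 have "H.grtotal = compose (carrier (copy (direct_sum F.A.GrW))) G.grtotal F.grtotal"
  unfolding compose_def H.grtotal_def
 proof (rule restrict_ext)
  fix u :: 'u assume "u \<in> carrier (copy (direct_sum F.A.GrW))"
  then obtain s where s: "u = embed (direct_sum F.A.GrW) s" "s \<in> carrier (direct_sum F.A.GrW)"
   unfolding copyable.copy_carrier[OF F.A.GrW_copyable] by blast
  have c: "(\<lambda>p. F.grmap p (s p)) \<in> carrier (direct_sum F.B.GrW)"
   by (rule lin_mem[OF direct_sum_map_lin[OF F.A.vec_GrW F.B.vec_GrW F.grmap_lin] s(2)])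
  have "(\<lambda>p. H.grmap p (s p)) = (\<lambda>p. G.grmap p (F.grmap p (s p)))"
   using s(2) e by (auto simp: direct_sum_simps)
  then show "embed (direct_sum G.B.GrW) (\<lambda>p. H.grmap p (unembed (direct_sum F.A.GrW) u p)) = G.grtotal (F.grtotal u)"
   unfolding s(1) F.grtotal_embed[OF s(2)] G.grtotal_embed[OF c] copyable.unembed_e[OF F.A.GrW_copyable s(2)] by simp
 qed
 then have "Fun (on_arr gr_functor (g \<cdot>\<^bsub>FVect\<^esub> f)) = compose (carrier (copy (direct_sum F.A.GrW))) (Fun (on_arr gr_functor g)) (Fun (on_arr gr_functor f))"
  unfolding gr_functor_Fun[OF gf] gr_functor_Fun[OF f] gr_functor_Fun[OF g] .
 then show "on_arr gr_functor (g \<cdot>\<^bsub>FVect\<^esub> f) = on_arr gr_functor g \<cdot>\<^bsub>GrVect\<^esub> on_arr gr_functor f"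
  unfolding GrVect_def GV.CC_simps
  by (simp add: gr_functor_def FVect_def FV.CC_simps graded_of_filtered_simps Gr_eq_GrW F.A.filtered_axioms o o')
qed

section \<open>Complexification\<close>

abbreviation cfield :: "(rat, complex) module" where "cfield \<equiv> field_space"

text \<open>Restriction of scalars from the complex to the rational numbers; it lets the universal
  property of rational tensor products be used with complex targets.\<close>

definition rscal :: "(complex, 'x) module => (rat, 'x) module" where
 "rscal X = \<lparr>carrier = carrier X, mult = undefined, one = undefined, zero = \<zero>\<^bsub>X\<^esub>, add = add X,
   smult = (\<lambda>q. smult X (of_rat q))\<rparr>"

lemma rscal_simps [simp]:
 "carrier (rscal X) = carrier X" "\<zero>\<^bsub>rscal X\<^esub> = \<zero>\<^bsub>X\<^esub>"
 "x \<oplus>\<^bsub>rscal X\<^esub> y = x \<oplus>\<^bsub>X\<^esub> y" "q \<odot>\<^bsub>rscal X\<^esub> x = of_rat q \<odot>\<^bsub>X\<^esub> x"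
 by (simp_all add: rscal_def)

lemma vec_restrict_scalars:
 assumes "vec_space X" shows "vec_space (rscal X)"
proof -
 interpret vspace X by (rule vsI, rule assms)
 show ?thesis
  by (rule vec_spaceI)
   (simp_all add: M.a_ac smult_add_left smult_add_right smult_smult of_rat_add of_rat_mult of_rat_minus
    smult_m1 M.l_neg M.r_neg)
qed

lemma is_lin_mult: "is_lin cfield cfield (\<lambda>z. c * z)"
 by (rule is_linI) (simp_all add: algebra_simps)

lemma is_lin_cnj: "is_lin cfield cfield cnj"
 by (rule is_linI) (simp_all add: of_rat_def complex_cnj_divide)

lemma tens_map_tlift: "tens_map A B A' B' f g = tlift A B (tens A B) (pure A B) (tens A' B') (\<lambda>x y. pure A' B' (f x) (g y))"
 by (simp add: tens_map_def tlift_def)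

lemma
 assumes v: "vec_space A" "vec_space B" "vec_space A'" "vec_space B'" and f: "is_lin A A' f" and g: "is_lin B B' g"
 shows tens_map_lin: "is_lin (tens A B) (tens A' B') (tens_map A B A' B' f g)"
  and tens_map_pure: "x \<in> carrier A ==> y \<in> carrier B ==> tens_map A B A' B' f g (pure A B x y) = pure A' B' (f x) (g y)"
proof -
 note t = tprod_tens[OF v(1,2)] and t' = tprod_tens[OF v(3,4)]
 have v': "vec_space (tens A' B')" using t' by (simp add: tprod_def vspace_def)
 note b = bil_comp2[OF tprod.bil_\<tau>[OF t'] f g]
 show "is_lin (tens A B) (tens A' B') (tens_map A B A' B' f g)"
  unfolding tens_map_tlift by (rule tprod.tlift_is_lin[OF t v' b])
 show "x \<in> carrier A ==> y \<in> carrier B ==> tens_map A B A' B' f g (pure A B x y) = pure A' B' (f x) (g y)"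
  unfolding tens_map_tlift by (rule tprod.tlift_pure[OF t v' b])
qed

text \<open>Complex-linear extension of a rational-linear map: the adjunction between extension and
  restriction of scalars.\<close>

definition clift :: "(rat, 'v) module => (complex, 'x) module => ('v => 'x) => 'v cplx => 'x" where
 "clift V X h0 = tlift V cfield (tens V cfield) (pure V cfield) (rscal X) (\<lambda>x z. z \<odot>\<^bsub>X\<^esub> h0 x)"

locale cspace = vspace V for V :: "(rat, 'v) module"
begin

abbreviation "T \<equiv> tens V cfield"
abbreviation "VC \<equiv> complexify V"
abbreviation "pr \<equiv> pure V cfield"

lemma tpT: "tprod V cfield T pr (\<lambda>t. t)"
 by (rule tprod_tens[OF vs vec_field])

lemma vT: "vec_space T"
 using tpT by (simp add: tprod_def vspace_def)

lemma VC_simps: "carrier VC = carrier T" "\<zero>\<^bsub>VC\<^esub> = \<zero>\<^bsub>T\<^esub>" "x \<oplus>\<^bsub>VC\<^esub> y = x \<oplus>\<^bsub>T\<^esub> y"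
 "c \<odot>\<^bsub>VC\<^esub> t = tens_map V cfield V cfield (\<lambda>x. x) (\<lambda>z. c * z) t"
 by (simp_all add: complexify_def Let_def)

lemma VC_smult_lin: "is_lin T T (\<lambda>t. c \<odot>\<^bsub>VC\<^esub> t)"
 unfolding VC_simps by (rule tens_map_lin[OF vs vec_field vs vec_field is_lin_id is_lin_mult])

lemma pure_closed: "x \<in> carrier V ==> pr x z \<in> carrier VC"
 unfolding VC_simps using tprod.\<tau>_closed[OF tpT] by simp

lemma VC_smult_pure: "x \<in> carrier V ==> c \<odot>\<^bsub>VC\<^esub> pr x z = pr x (c * z)"
 unfolding VC_simps by (rule tens_map_pure[OF vs vec_field vs vec_field is_lin_id is_lin_mult]) simp_all

lemma pure_add:
 "x \<in> carrier V ==> y \<in> carrier V ==> pr (x \<oplus>\<^bsub>V\<^esub> y) z = pr x z \<oplus>\<^bsub>VC\<^esub> pr y z"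
 "x \<in> carrier V ==> pr x (z + w) = pr x z \<oplus>\<^bsub>VC\<^esub> pr x w"
 using is_lin_add[OF tprod.\<tau>_left[OF tpT]] is_lin_add[OF tprod.\<tau>_right[OF tpT]] by (simp_all add: VC_simps)

lemma pure_rat: "x \<in> carrier V ==> pr (q \<odot>\<^bsub>V\<^esub> x) z = of_rat q \<odot>\<^bsub>VC\<^esub> pr x z"
 using tprod.\<tau>_smult[OF tpT, of x z q] by (simp add: VC_smult_pure)

lemma pure_zero: "x \<in> carrier V ==> pr x 0 = \<zero>\<^bsub>VC\<^esub>" "pr \<zero>\<^bsub>V\<^esub> z = \<zero>\<^bsub>VC\<^esub>"
 using tprod.\<tau>_zero[OF tpT] by (simp_all add: VC_simps)

lemma VC_induct [consumes 1, case_names pure add]: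
 assumes "t \<in> carrier VC"
  and "\<And>x z. x \<in> carrier V ==> P (pr x z)"
  and "\<And>s t. s \<in> carrier VC ==> t \<in> carrier VC ==> P s ==> P t ==> P (s \<oplus>\<^bsub>VC\<^esub> t)"
 shows "P t"
 using assms tprod.induct2[OF tpT, of t P] unfolding VC_simps by blast

text \<open>Complex scalars act through the second tensor factor, so the scalar axioms are evident
  on pure tensors and extend over sums.\<close>

lemma vec_VC: "vec_space VC"
proof -
 interpret T: vspace T by (rule vsI, rule vT)
 note c = lin_mem[OF VC_smult_lin] and a = is_lin_add[OF VC_smult_lin]
 have ind [consumes 1, case_names pure add]: "P t" if "t \<in> carrier T" "\<And>x z. x \<in> carrier V ==> P (pr x z)"
  "\<And>s t. s \<in> carrier T ==> t \<in> carrier T ==> P s ==> P t ==> P (s \<oplus>\<^bsub>T\<^esub> t)" for P t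
  using VC_induct[of t P] that unfolding VC_simps by blast
 have pc: "x \<in> carrier V ==> pr x z \<in> carrier T" for x z using pure_closed by (simp add: VC_simps)
 show ?thesis
 proof (rule vec_spaceI, unfold VC_simps(1-3))
  fix t assume t: "t \<in> carrier T"
  show "c \<odot>\<^bsub>VC\<^esub> t \<in> carrier T" for c by (rule c[OF t])
  show "\<zero>\<^bsub>T\<^esub> \<oplus>\<^bsub>T\<^esub> t = t" using t by simp
  show "(- 1) \<odot>\<^bsub>VC\<^esub> t \<oplus>\<^bsub>T\<^esub> t = \<zero>\<^bsub>T\<^esub>" using t
  proof (induction rule: ind)
   case (pure x z)
   then show ?case using pure_add(2)[of x "- z" z] by (simp add: VC_smult_pure pure_zero VC_simps(2,3))
  next
   case (add s t)
   then show ?case by (simp add: a T.add4 c)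
  qed
  show "(p + q) \<odot>\<^bsub>VC\<^esub> t = p \<odot>\<^bsub>VC\<^esub> t \<oplus>\<^bsub>T\<^esub> q \<odot>\<^bsub>VC\<^esub> t" for p q using t
  proof (induction rule: ind)
   case (pure x z)
   then show ?case using pure_add(2)[of x "p * z" "q * z"] by (simp add: VC_smult_pure VC_simps(3) algebra_simps)
  next
   case (add s t)
   then show ?case by (simp add: a T.add4 c)
  qed
  show "(p * q) \<odot>\<^bsub>VC\<^esub> t = p \<odot>\<^bsub>VC\<^esub> (q \<odot>\<^bsub>VC\<^esub> t)" for p q using t
  proof (induction rule: ind)
   case (pure x z)
   then show ?case by (simp add: VC_smult_pure algebra_simps)
  next
   case (add s t)
   then show ?case by (simp add: a c)
  qed
  show "1 \<odot>\<^bsub>VC\<^esub> t = t" using t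
  proof (induction rule: ind)
   case (pure x z)
   then show ?case by (simp add: VC_smult_pure)
  next
   case (add s t)
   then show ?case by (simp add: a c)
  qed
  fix s assume s: "s \<in> carrier T"
  show "t \<oplus>\<^bsub>T\<^esub> s = s \<oplus>\<^bsub>T\<^esub> t" using s t by (rule T.M.a_comm[rotated])
  show "t \<oplus>\<^bsub>T\<^esub> s \<in> carrier T" using s t by simp
  show "p \<odot>\<^bsub>VC\<^esub> (t \<oplus>\<^bsub>T\<^esub> s) = p \<odot>\<^bsub>VC\<^esub> t \<oplus>\<^bsub>T\<^esub> p \<odot>\<^bsub>VC\<^esub> s" for p by (rule a[OF t s])
  show "t \<oplus>\<^bsub>T\<^esub> s \<oplus>\<^bsub>T\<^esub> r = t \<oplus>\<^bsub>T\<^esub> (s \<oplus>\<^bsub>T\<^esub> r)" if "r \<in> carrier T" for r using t s that by (rule T.M.a_assoc)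
 qed simp
qed

lemma T_smult: "t \<in> carrier VC ==> q \<odot>\<^bsub>T\<^esub> t = of_rat q \<odot>\<^bsub>VC\<^esub> t"
proof (induction rule: VC_induct)
 case (pure x z)
 then show ?case using tprod.\<tau>_smult(2)[OF tpT, of x z q] by (simp add: VC_smult_pure)
next
 case (add s t)
 interpret T: vspace T by (rule vsI, rule vT)
 show ?case using add is_lin_add[OF VC_smult_lin] by (simp add: VC_simps(1-3) T.smult_add_right)
qed

lemma clin_rat: "is_lin VC X h ==> is_lin (rscal VC) (rscal X) h"
 unfolding is_lin_def by simp

lemma pure_rat_lin: "is_lin V (rscal VC) (\<lambda>x. pr x z)"
 by (rule is_linI) (simp_all add: pure_closed pure_add pure_rat)

text \<open>Every pure tensor is a complex multiple of one with second entry 1, so complex-linear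
  maps are determined by the rational points.\<close>

lemma VC_ext:
 assumes "vec_space X" and f: "is_lin VC X f" and g: "is_lin VC X g"
  and "\<And>x. x \<in> carrier V ==> f (pr x 1) = g (pr x 1)" and t: "t \<in> carrier VC"
 shows "f t = g t"
 using t
proof (induction rule: VC_induct)
 case (pure x z)
 then have "pr x z = z \<odot>\<^bsub>VC\<^esub> pr x 1" by (simp add: VC_smult_pure)
 then show ?case
  by (simp only: is_lin_smult[OF f pure_closed] is_lin_smult[OF g pure_closed] assms(4) pure)
next
 case (add s t)
 then show ?case by (simp only: is_lin_add[OF f] is_lin_add[OF g])
qed

lemma VC_span: "linear_span VC {pr x 1 | x. x \<in> carrier V} = carrier VC"
proof -
 interpret VC: vspace VC by (rule vsI, rule vec_VC)
 have sub: "{pr x 1 | x. x \<in> carrier V} <= carrier VC" using pure_closed by auto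
 note N = VC.span_sub[OF sub]
 have "t \<in> linear_span VC {pr x 1 | x. x \<in> carrier V}" if "t \<in> carrier VC" for t
  using that
 proof (induction rule: VC_induct)
  case (pure x z)
  then have eq: "z \<odot>\<^bsub>VC\<^esub> pr x 1 = pr x z" by (simp add: VC_smult_pure)
  have "pr x 1 \<in> linear_span VC {pr x 1 | x. x \<in> carrier V}" using pure by (intro VC.span_base) blast
  from VC.sub_smult[OF N this, of z] show ?case unfolding eq .
 qed (rule VC.sub_add[OF N])
 then show ?thesis using VC.sub_le[OF N] by blast
qed

lemma
 assumes X: "vec_space X" and h0: "is_lin V (rscal X) h0"
 shows clift_lin: "is_lin VC X (clift V X h0)"
  and clift_pure: "x \<in> carrier V ==> clift V X h0 (pr x z) = z \<odot>\<^bsub>X\<^esub> h0 x"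
proof -
 interpret X: vspace X by (rule vsI, rule X)
 have cl: "h0 x \<in> carrier X" if "x \<in> carrier V" for x using lin_mem[OF h0 that] by simp
 have b: "bil V cfield (rscal X) (\<lambda>x z. z \<odot>\<^bsub>X\<^esub> h0 x)"
  using is_lin_add[OF h0] is_lin_smult[OF h0]
  by (intro bilI is_linI) (simp_all add: cl X.smult_add_left X.smult_add_right X.smult_smult mult.commute)
 let ?h = "clift V X h0"
 note vX = vec_restrict_scalars[OF X]
 note hl = tprod.tlift_is_lin[OF tpT vX b, folded clift_def]
 have hp: "?h (pr x z) = z \<odot>\<^bsub>X\<^esub> h0 x" if "x \<in> carrier V" for x z
  using tprod.tlift_pure[OF tpT vX b that, of z] by (simp add: clift_def)
 then show "x \<in> carrier V ==> clift V X h0 (pr x z) = z \<odot>\<^bsub>X\<^esub> h0 x" .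
 show "is_lin VC X ?h"
 proof (rule is_linI)
  show "?h t \<in> carrier X" if "t \<in> carrier VC" for t
   using lin_mem[OF hl] that by (simp add: VC_simps(1))
  show add: "?h (s \<oplus>\<^bsub>VC\<^esub> t) = ?h s \<oplus>\<^bsub>X\<^esub> ?h t" if "s \<in> carrier VC" "t \<in> carrier VC" for s t
   using is_lin_add[OF hl, of s t] that by (simp add: VC_simps(1-3))
  interpret VC: vspace VC by (rule vsI, rule vec_VC)
  show "?h (c \<odot>\<^bsub>VC\<^esub> t) = c \<odot>\<^bsub>X\<^esub> ?h t" if "t \<in> carrier VC" for c t
   using that
  proof (induction rule: VC_induct)
   case (pure x z)
   then show ?case by (simp add: VC_smult_pure hp cl X.smult_smult)
  next
   case (add s t)
   have hc: "?h s \<in> carrier X" "?h t \<in> carrier X"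
    using lin_mem[OF hl] add by (simp_all add: VC_simps(1))
   have "?h (c \<odot>\<^bsub>VC\<^esub> (s \<oplus>\<^bsub>VC\<^esub> t)) = ?h (c \<odot>\<^bsub>VC\<^esub> s) \<oplus>\<^bsub>X\<^esub> ?h (c \<odot>\<^bsub>VC\<^esub> t)"
    unfolding VC.smult_add_right[OF add(1,2)] by (rule \<open>\<And>s t. _ ==> _ ==> ?h (s \<oplus>\<^bsub>VC\<^esub> t) = _\<close>) (use add in auto)
   also have "\<dots> = c \<odot>\<^bsub>X\<^esub> ?h (s \<oplus>\<^bsub>VC\<^esub> t)"
    using add hc is_lin_add[OF hl, of s t] by (simp add: VC_simps(1-3) X.smult_add_right)
   finally show ?case .
  qed
 qed
qed

lemma conj_map_lin: "is_lin T T (conj_map V)"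
 unfolding conj_map_def by (rule tens_map_lin[OF vs vec_field vs vec_field is_lin_id is_lin_cnj])

lemma conj_map_pure: "x \<in> carrier V ==> conj_map V (pr x z) = pr x (cnj z)"
 unfolding conj_map_def by (rule tens_map_pure[OF vs vec_field vs vec_field is_lin_id is_lin_cnj]) simp_all

lemma conj_mem: "t \<in> carrier VC ==> conj_map V t \<in> carrier VC"
 using lin_mem[OF conj_map_lin] by (simp add: VC_simps)

lemma conj_map_add: "s \<in> carrier VC ==> t \<in> carrier VC ==> conj_map V (s \<oplus>\<^bsub>VC\<^esub> t) = conj_map V s \<oplus>\<^bsub>VC\<^esub> conj_map V t"
 using is_lin_add[OF conj_map_lin] by (simp add: VC_simps(1-3))

lemma conj_map_smult: "t \<in> carrier VC ==> conj_map V (c \<odot>\<^bsub>VC\<^esub> t) = cnj c \<odot>\<^bsub>VC\<^esub> conj_map V t"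
proof (induction rule: VC_induct)
 case (pure x z)
 then show ?case by (simp add: VC_smult_pure conj_map_pure)
next
 case (add s t)
 interpret VC: vspace VC by (rule vsI, rule vec_VC)
 show ?case using add by (simp add: conj_map_add VC.smult_add_right conj_mem)
qed

lemma conj_map_conj: "t \<in> carrier VC ==> conj_map V (conj_map V t) = t"
 by (induction rule: VC_induct) (simp_all add: conj_map_pure conj_map_add conj_mem)

end

lemma cspaceI: "vec_space V ==> cspace V"
 by (simp add: cspace_def vspace_def)

lemma vec_complexify: "vec_space V ==> vec_space (complexify V)"
 by (rule cspace.vec_VC[OF cspaceI])

context
 fixes V :: "(rat, 'v) module" and W :: "(rat, 'w) module" and f
 assumes V: "vec_space V" and W: "vec_space W" and f: "is_lin V W f"
begin

interpretation V: cspace V using V by (rule cspaceI)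
interpretation W: cspace W using W by (rule cspaceI)

lemma cmap_rat_lin: "is_lin V.T W.T (complexify_map V W f)"
 unfolding complexify_map_def by (rule tens_map_lin[OF V vec_field W vec_field f is_lin_id])

lemma cmap_pure: "x \<in> carrier V ==> complexify_map V W f (V.pr x z) = W.pr (f x) z"
 unfolding complexify_map_def by (rule tens_map_pure[OF V vec_field W vec_field f is_lin_id]) simp_all

lemma cmap_lin: "is_lin (complexify V) (complexify W) (complexify_map V W f)"
proof (rule is_linI)
 interpret VC: vspace V.VC by (rule vsI, rule V.vec_VC)
 interpret WC: vspace W.VC by (rule vsI, rule W.vec_VC)
 note l = cmap_rat_lin
 show c: "complexify_map V W f t \<in> carrier (complexify W)" if "t \<in> carrier (complexify V)" for t
  using lin_mem[OF l] that by (simp add: V.VC_simps W.VC_simps)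
 show a: "complexify_map V W f (s \<oplus>\<^bsub>complexify V\<^esub> t) = complexify_map V W f s \<oplus>\<^bsub>complexify W\<^esub> complexify_map V W f t"
  if "s \<in> carrier (complexify V)" "t \<in> carrier (complexify V)" for s t
  using is_lin_add[OF l] that by (simp add: V.VC_simps(1-3) W.VC_simps(1-3))
 show "complexify_map V W f (c \<odot>\<^bsub>complexify V\<^esub> t) = c \<odot>\<^bsub>complexify W\<^esub> complexify_map V W f t"
  if "t \<in> carrier (complexify V)" for c t
  using that
 proof (induction rule: V.VC_induct)
  case (pure x z)
  then show ?case using lin_mem[OF f] by (simp add: V.VC_smult_pure W.VC_smult_pure cmap_pure)
 next
  case (add s t)
  then show ?case
   using is_lin_add[OF l, of s t] is_lin_add[OF l, of "c \<odot>\<^bsub>complexify V\<^esub> s" "c \<odot>\<^bsub>complexify V\<^esub> t"]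
    lin_mem[OF V.VC_smult_lin[of c]] lin_mem[OF l]
    WC.smult_add_right[of "complexify_map V W f s" "complexify_map V W f t" c]
    is_lin_add[OF V.VC_smult_lin, of s t c]
   by (simp add: V.VC_simps(1-3) W.VC_simps(1-3))
 qed
qed

lemma cmap_conj: "t \<in> carrier (complexify V) ==> complexify_map V W f (conj_map V t) = conj_map W (complexify_map V W f t)"
proof (induction rule: V.VC_induct)
 case (pure x z)
 then show ?case using lin_mem[OF f] by (simp add: V.conj_map_pure W.conj_map_pure cmap_pure)
next
 case (add s t)
 then show ?case
  by (simp add: V.conj_map_add W.conj_map_add is_lin_add[OF cmap_lin] lin_mem[OF cmap_lin]
   V.conj_mem)
qed

end

text \<open>The composite is a separate \<open>h\<close> that agrees with it on the carrier, so that
  restricted composites are covered too.\<close>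

lemma cmap_comp:
 assumes v: "vec_space U" "vec_space V" "vec_space W" and f: "is_lin U V f" and g: "is_lin V W g"
  and h: "is_lin U W h" "\<And>x. x \<in> carrier U ==> h x = g (f x)" and t: "t \<in> carrier (complexify U)"
 shows "complexify_map V W g (complexify_map U V f t) = complexify_map U W h t"
 using lin_mem[OF f]
 by (intro cspace.VC_ext[OF cspaceI[OF v(1)] vec_complexify[OF v(3)]
   is_lin_comp[OF cmap_lin[OF v(1,2) f] cmap_lin[OF v(2,3) g]] cmap_lin[OF v(1,3) h(1)] _ t])
  (simp add: cmap_pure[OF v(1,2) f] cmap_pure[OF v(2,3) g] cmap_pure[OF v(1,3) h(1)] h(2))

lemma cmap_id:
 assumes v: "vec_space V" and h: "is_lin V V h" "\<And>x. x \<in> carrier V ==> h x = x" and t: "t \<in> carrier (complexify V)"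
 shows "complexify_map V V h t = t"
 by (rule cspace.VC_ext[OF cspaceI[OF v] vec_complexify[OF v] cmap_lin[OF v v h(1)] is_lin_id _ t])
  (simp add: cmap_pure[OF v v h(1)] h(2))

text \<open>A \<open>\<rat>\<close>-linear retraction of \<open>\<complex>\<close> onto \<open>\<rat>\<close> turns complex solutions of rational linear equations
 into rational ones.\<close>

lemma rational_retraction: "\<exists>r :: complex => rat. is_lin cfield field_space r \<and> r 1 = 1"
proof -
 interpret K: vspace cfield by (rule vsI, rule vec_field)
 have "subspace_of (range of_rat) cfield"
  by (rule K.subspaceI) (auto intro: range_eqI[of _ _ 0] simp flip: of_rat_add of_rat_mult)
 then obtain r where r: "is_lin cfield cfield r" "\<And>x. r x \<in> range of_rat" "\<And>x. x \<in> range of_rat ==> r x = x"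
  using K.retraction_exists[of "range of_rat"] by auto
 define s where "s z = (THE q. r z = of_rat q)" for z
 have s: "r z = of_rat (s z)" for z
 proof -
  obtain q where q: "r z = of_rat q" using r(2)[of z] by (rule rangeE)
  have "s z = q" unfolding s_def q by (rule the_equality) simp_all
  then show ?thesis by (simp only: q)
 qed
 have "is_lin cfield (field_space :: (rat, rat) module) s"
 proof (rule is_linI, simp_all)
  show "s (x + y) = s x + s y" for x y
   using is_lin_add[OF r(1), of x y] s[of x] s[of y] s[of "x + y"] by (simp flip: of_rat_add)
  show "s (of_rat c * x) = c * s x" for c x
   using is_lin_smult[OF r(1), of x c] s[of x] s[of "of_rat c * x"] by (simp flip: of_rat_mult)
 qed
 moreover have "s 1 = 1"
  using s[of 1] r(3)[of 1] by (metis of_rat_1 of_rat_eq_iff rangeI)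
 ultimately show ?thesis by blast
qed

section \<open>The rational retraction of a complexified space\<close>

text \<open>One retraction is fixed for all spaces. Naturality and compatibility with tensor
  products depend on the choice not varying with the space.\<close>

definition qret :: "complex => rat" where
 "qret = (SOME r. is_lin cfield field_space r \<and> r 1 = 1)"

lemma qret: "is_lin cfield field_space qret" "qret 1 = 1"
 using someI_ex[OF rational_retraction] by (simp_all add: qret_def)

text \<open>This is the identity of \<open>V\<close> tensored with \<open>qret\<close>. Despite the
  name it retracts the complexification onto the rational points and has nothing to do with real
  parts of complex numbers.\<close>

definition real_part :: "(rat, 'v) module => 'v cplx => 'v" where
 "real_part V = tlift V cfield (tens V cfield) (pure V cfield) V (\<lambda>x z. qret z \<odot>\<^bsub>V\<^esub> x)"

context cspace
begin

lemma real_part_bil: "bil V cfield V (\<lambda>x z. qret z \<odot>\<^bsub>V\<^esub> x)"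
 using is_lin_add[OF qret(1)] is_lin_smult[OF qret(1)]
 by (intro bilI is_linI) (simp_all add: smult_add_left smult_add_right smult_smult mult.commute)

lemma real_part_lin: "is_lin T V (real_part V)"
 unfolding real_part_def by (rule tprod.tlift_is_lin[OF tpT vs real_part_bil])

lemma real_part_pure: "x \<in> carrier V ==> real_part V (pr x z) = qret z \<odot>\<^bsub>V\<^esub> x"
 unfolding real_part_def by (rule tprod.tlift_pure[OF tpT vs real_part_bil]) simp_all

lemma real_part_closed: "t \<in> carrier VC ==> real_part V t \<in> carrier V"
 using lin_mem[OF real_part_lin] by (simp add: VC_simps)

lemma real_part_add: "s \<in> carrier VC ==> t \<in> carrier VC ==> real_part V (s \<oplus>\<^bsub>VC\<^esub> t) = real_part V s \<oplus>\<^bsub>V\<^esub> real_part V t"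
 using is_lin_add[OF real_part_lin] by (simp add: VC_simps(1-3))

lemma real_part_rat: "t \<in> carrier VC ==> real_part V (of_rat q \<odot>\<^bsub>VC\<^esub> t) = q \<odot>\<^bsub>V\<^esub> real_part V t"
 using is_lin_smult[OF real_part_lin, of t q] T_smult[of t q] by (simp add: VC_simps(1))

end

text \<open>\<open>f\<close> acts on the first tensor factor and \<open>qret\<close> on the second,
  so the two operations commute.\<close>

lemma real_part_natural:
 assumes V: "vec_space V" and W: "vec_space W" and f: "is_lin V W f" and t: "t \<in> carrier (complexify V)"
 shows "real_part W (complexify_map V W f t) = f (real_part V t)"
proof -
 interpret V: cspace V using V by (rule cspaceI)
 interpret W: cspace W using W by (rule cspaceI)
 show ?thesis using t
 proof (induction rule: V.VC_induct)
  case (pure x z)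
  then show ?case
   by (simp add: cmap_pure[OF V W f] W.real_part_pure V.real_part_pure lin_mem[OF f] is_lin_smult[OF f])
 next
  case (add s t)
  then show ?case
   using lin_mem[OF cmap_lin[OF V W f]]
   by (simp add: is_lin_add[OF cmap_lin[OF V W f]] W.real_part_add V.real_part_add V.real_part_closed is_lin_add[OF f])
 qed
qed

section \<open>Opposed filtrations\<close>

text \<open>\<open>U\<close> stands for \<open>V\<^sub>\<complex>\<close> with the Hodge filtration \<open>F\<close>, its conjugate \<open>C\<close> and the weight filtration
 \<open>W\<close>; the last two assumptions say that \<open>F\<close> and \<open>C\<close> are \<open>n\<close>-opposed on \<open>W\<^sub>n / W\<^sub>n\<^sub>-\<^sub>1\<close>.\<close>

locale hodge_core = vspace U for U :: "(complex, 'x) module" (structure) +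
 fixes F C W :: "int => 'x set"
 assumes sF: "\<And>p. subspace_of (F p) U" and sC: "\<And>p. subspace_of (C p) U" and sW: "\<And>n. subspace_of (W n) U"
  and F_dec: "\<And>p q. p \<le> q ==> F q <= F p" and C_dec: "\<And>p q. p \<le> q ==> C q <= C p"
  and W_inc: "\<And>m n. m \<le> n ==> W m <= W n"
  and F_full: "\<exists>p. F p = carrier U" and F_zero: "\<exists>p. F p = {\<zero>}"
  and C_full: "\<exists>p. C p = carrier U" and C_zero: "\<exists>p. C p = {\<zero>}"
  and W_full: "\<exists>n. W n = carrier U" and W_zero: "\<exists>n. W n = {\<zero>}"
  and opp_sum: "\<And>p q n x. p + q = n + 1 ==> x \<in> W n ==>
   \<exists>f\<in>F p \<inter> W n. \<exists>g\<in>C q \<inter> W n. \<exists>r\<in>W (n - 1). x = f \<oplus> g \<oplus> r"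
  and opp_int: "\<And>p q n f g. p + q = n + 1 ==> f \<in> F p \<inter> W n ==> g \<in> C q \<inter> W n ==> f \<ominus> g \<in> W (n - 1) ==> f \<in> W (n - 1)"
begin

lemmas cF = sub_mem[OF sF] and cC = sub_mem[OF sC] and cW = sub_mem[OF sW]

text \<open>On a space of pure weight \<open>n\<close> this is \<open>C (n - k)\<close>. In general
  it collects, weight by weight, the step of \<open>C\<close> that is complementary to
  \<open>F (k + 1)\<close> on the graded piece.\<close>

definition D :: "int => 'x set" where
 "D k = linear_span U (\<Union>n. W n \<inter> C (n - k))"

lemma D_gens: "(\<Union>n. W n \<inter> C (n - k)) <= carrier U"
 using cW by blast

lemma sD: "subspace_of (D k) U"
 unfolding D_def by (rule span_sub[OF D_gens])

lemma D_base: "x \<in> W n ==> x \<in> C (n - k) ==> x \<in> D k"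
 unfolding D_def by (rule span_base) blast

lemma D_inc: "k \<le> l ==> D k <= D l"
 unfolding D_def
proof (rule span_mono, rule UN_mono)
 fix n assume "k \<le> l"
 then show "W n \<inter> C (n - k) <= W n \<inter> C (n - l)" using C_dec[of "n - l" "n - k"] by auto
qed simp

text \<open>Generators of weight at least \<open>n\<close> lie in \<open>C (n - k)\<close> because
  \<open>C\<close> decreases; the remaining ones lie in \<open>W (n - 1)\<close>.\<close>

lemma D_split: assumes "x \<in> D k" shows "\<exists>h\<in>C (n - k). \<exists>l\<in>W (n - 1). x = h \<oplus> l"
 using assms[unfolded D_def] D_gens
proof (induction rule: span_induct)
 case zero
 show ?case
  by (rule bexI[OF _ sub_zero[OF sC]], rule bexI[OF _ sub_zero[OF sW]]) simp
next
 case (base x)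
 then obtain m where x: "x \<in> W m" "x \<in> C (m - k)" by blast
 show ?case
 proof (cases "n \<le> m")
  case True
  then have "x \<in> C (n - k)" using x C_dec[of "n - k" "m - k"] by auto
  then show ?thesis
   by (rule rev_bexI, intro bexI[OF _ sub_zero[OF sW]]) (simp add: cW[OF x(1)])
 next
  case False
  then have "x \<in> W (n - 1)" using x W_inc[of m "n - 1"] by auto
  then show ?thesis
   by (intro bexI[OF _ sub_zero[OF sC]] bexI[of _ x]) (simp_all add: cW)
 qed
next
 case (add x y)
 then obtain h l h' l' where "h \<in> C (n - k)" "l \<in> W (n - 1)" "x = h \<oplus> l" "h' \<in> C (n - k)" "l' \<in> W (n - 1)" "y = h' \<oplus> l'"
  by blast
 then show ?case
  by (intro bexI[of _ "h \<oplus> h'"] bexI[of _ "l \<oplus> l'"])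
   (simp_all add: cC cW add4 sub_add[OF sC] sub_add[OF sW])
next
 case (smult c x)
 then obtain h l where "h \<in> C (n - k)" "l \<in> W (n - 1)" "x = h \<oplus> l" by blast
 then show ?case
  by (intro bexI[of _ "c \<odot> h"] bexI[of _ "c \<odot> l"])
   (simp_all add: cC cW smult_add_right sub_smult[OF sC] sub_smult[OF sW])
qed

text \<open>Induction on the weight. Opposedness for \<open>p\<close> and
  \<open>n - (p - 1)\<close>, whose sum is \<open>n + 1\<close>, splits \<open>x\<close> modulo
  lower weight, and the second part belongs to \<open>D (p - 1)\<close>; the error is split by
  induction.\<close>

lemma W_split: assumes "x \<in> W n" shows "\<exists>f\<in>F p \<inter> W n. \<exists>d\<in>D (p - 1) \<inter> W n. x = f \<oplus> d"
proof -
 obtain n0 where n0: "W n0 = {\<zero>}" using W_zero by blast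
 have zero: "\<exists>f\<in>F p \<inter> W n. \<exists>d\<in>D (p - 1) \<inter> W n. x = f \<oplus> d" if "n \<le> n0" "x \<in> W n" for n x
 proof -
  have "x = \<zero>" using W_inc[OF that(1)] that(2) n0 by blast
  moreover have "\<zero> \<in> F p \<inter> W n" "\<zero> \<in> D (p - 1) \<inter> W n"
   using sub_zero[OF sF] sub_zero[OF sD] sub_zero[OF sW] by blast+
  ultimately show ?thesis by (intro bexI[of _ "\<zero>"]) simp_all
 qed
 have "x \<in> W n ==> \<exists>f\<in>F p \<inter> W n. \<exists>d\<in>D (p - 1) \<inter> W n. x = f \<oplus> d" if "n0 \<le> n" for x
  using that
 proof (induction n arbitrary: x rule: int_ge_induct)
  case base
  then show ?case by (intro zero) simp
 next
  case (step n)
  have s: "n + 1 - 1 = n" by simp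
  obtain f g r where f: "f \<in> F p" "f \<in> W (n + 1)" and g: "g \<in> C (n + 1 - (p - 1))" "g \<in> W (n + 1)"
   and r: "r \<in> W n" and x: "x = f \<oplus> g \<oplus> r"
   using opp_sum[of p "n + 1 - (p - 1)" "n + 1" x] step.prems by auto
  obtain f' d where f': "f' \<in> F p" "f' \<in> W n" and d: "d \<in> D (p - 1)" "d \<in> W n" and r': "r = f' \<oplus> d"
   using step.IH[OF r] by blast
  have up: "f' \<in> W (n + 1)" "d \<in> W (n + 1)" using f'(2) d(2) W_inc[of n "n + 1"] by auto
  show ?case
  proof (rule bexI[of _ "f \<oplus> f'"], rule bexI[of _ "g \<oplus> d"])
   show "x = f \<oplus> f' \<oplus> (g \<oplus> d)"
    unfolding x r' using cW[OF f(2)] cW[OF g(2)] cW[OF up(1)] cW[OF up(2)] by (simp add: add4)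
   show "g \<oplus> d \<in> D (p - 1) \<inter> W (n + 1)"
    by (rule IntI[OF sub_add[OF sD D_base[OF g(2,1)] d(1)] sub_add[OF sW g(2) up(2)]])
   show "f \<oplus> f' \<in> F p \<inter> W (n + 1)"
    by (rule IntI[OF sub_add[OF sF f(1) f'(1)] sub_add[OF sW f(2) up(1)]])
  qed
 qed
 then show ?thesis using zero assms by (cases "n0 \<le> n") auto
qed

text \<open>By \<open>D_split\<close> an element of \<open>W n\<close> in both spaces is congruent
  modulo \<open>W (n - 1)\<close> to one of \<open>C (n - (p - 1))\<close>; opposedness then pushes
  it into \<open>W (n - 1)\<close>, and so on down to zero. Together with \<open>W_split\<close>
  this makes \<open>D (p - 1)\<close> a complement of \<open>F p\<close>.\<close>

lemma F_D_zero: assumes x: "x \<in> F p" "x \<in> D (p - 1)" shows "x = \<zero>"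
proof -
 obtain n0 where n0: "W n0 = {\<zero>}" using W_zero by blast
 obtain n1 where n1: "W n1 = carrier U" using W_full by blast
 have step: "x \<in> W (n - 1)" if "x \<in> W n" for n
 proof -
  obtain h l where h: "h \<in> C (n - (p - 1))" and l: "l \<in> W (n - 1)" and eq: "x = h \<oplus> l"
   using D_split[OF x(2)] by blast
  have l': "l \<in> W n" using l W_inc[of "n - 1" n] by auto
  have hc: "h \<in> carrier U" by (rule cC[OF h])
  have "h \<in> W n" using that sub_add_cancel[OF sW hc l'] eq by simp
  moreover have "x \<ominus> h \<in> W (n - 1)" unfolding eq add_diff_cancel'[OF hc cW[OF l]] by (rule l)
  ultimately show ?thesis using opp_int[of p "n - (p - 1)" n x h] that x(1) h by auto
 qed
 have "x \<in> W (n1 - int k)" for k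
 proof (induction k)
  case 0 show ?case using cF[OF x(1)] n1 by simp
 next
  case (Suc k) then show ?case using step[of "n1 - int k"] by (simp add: algebra_simps)
 qed
 from this[of "nat (n1 - n0)"] have "x \<in> W n0" if "n0 \<le> n1" using that by simp
 moreover have "x \<in> W n0" if "n1 < n0" using that W_inc[of n1 n0] cF[OF x(1)] n1 by auto
 ultimately show ?thesis using n0 by (cases "n0 \<le> n1") auto
qed

text \<open>In pure weight \<open>n\<close> the component of type \<open>(p, n - p)\<close>; in
  general the sum of all components with first index \<open>p\<close> in Deligne's
  bigrading.\<close>

definition J :: "int => 'x set" where "J p = F p \<inter> D p"

lemma sJ: "subspace_of (J p) U"
 unfolding J_def by (rule Int_subspace[OF sF sD])

lemmas cJ = sub_mem[OF sJ]

lemma J_union_le: "(\<Union>r\<in>I. J r) <= carrier U"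
 using cJ by blast

text \<open>Downward induction from the zero step of \<open>F\<close>. An element of
  \<open>F p\<close> splits along \<open>F (p + 1)\<close> and \<open>D p\<close>; the second part
  is a difference of elements of \<open>F p\<close>, hence in \<open>J p\<close>.\<close>

lemma F_subset_span: "F p <= linear_span U (\<Union>r\<in>{p..}. J r)"
proof -
 obtain b where b: "F b = {\<zero>}" using F_zero by blast
 obtain n1 where n1: "W n1 = carrier U" using W_full by blast
 have N: "subspace_of (linear_span U (\<Union>r\<in>{p..}. J r)) U" for p by (rule span_sub[OF J_union_le])
 have "F (b - int k) <= linear_span U (\<Union>r\<in>{b - int k..}. J r)" for k
 proof (induction k)
  case 0
  show ?case using b sub_zero[OF N] by simp
 next
  case (Suc k)
  let ?p = "b - int (Suc k)"
  have p1: "?p + 1 = b - int k" by simp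
  show ?case
  proof
   fix x assume x: "x \<in> F ?p"
   have "x \<in> W n1" using cF[OF x] n1 by simp
   then obtain f d where f: "f \<in> F (?p + 1)" and d: "d \<in> D (?p + 1 - 1)" and eq: "x = f \<oplus> d"
    using W_split[of x n1 "?p + 1"] by blast
   have "linear_span U (\<Union>r\<in>{b - int k..}. J r) <= linear_span U (\<Union>r\<in>{?p..}. J r)"
    by (intro span_mono UN_mono) auto
   then have f': "f \<in> linear_span U (\<Union>r\<in>{?p..}. J r)" using f Suc.IH unfolding p1 by blast
   have "f \<in> F ?p" using f F_dec[of ?p "?p + 1"] by auto
   then have "d \<in> F ?p" using sub_add_cancel[OF sF, of d f ?p] x sub_mem[OF sD d] eq
    by (simp add: M.a_comm cF)
   then have "d \<in> J ?p" using d by (simp only: J_def Int_iff add_diff_cancel_right' conj_absorb simp_thms)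
   then have "d \<in> linear_span U (\<Union>r\<in>{?p..}. J r)" by (intro span_base) auto
   then show "x \<in> linear_span U (\<Union>r\<in>{?p..}. J r)" unfolding eq by (rule sub_add[OF N f'])
  qed
 qed
 from this[of "nat (b - p)"] have "F p <= linear_span U (\<Union>r\<in>{p..}. J r)" if "p \<le> b" using that by simp
 moreover have "F p <= linear_span U (\<Union>r\<in>{p..}. J r)" if "b < p"
  using that F_dec[of b p] b sub_zero[OF N] by auto
 ultimately show ?thesis by (cases "p \<le> b") auto
qed

lemma F_span: "F p = linear_span U (\<Union>r\<in>{p..}. J r)"
proof
 show "linear_span U (\<Union>r\<in>{p..}. J r) <= F p"
  by (rule span_least[OF sF]) (use F_dec in \<open>auto simp: J_def\<close>)
qed (rule F_subset_span)

lemma J_span: "linear_span U (\<Union>r. J r) = carrier U"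
proof
 obtain a where a: "F a = carrier U" using F_full by blast
 have "linear_span U (\<Union>r\<in>{a..}. J r) <= linear_span U (\<Union>r. J r)" by (rule span_mono) auto
 then show "carrier U <= linear_span U (\<Union>r. J r)" using F_span[of a] a by simp
 show "linear_span U (\<Union>r. J r) <= carrier U" by (rule sub_le[OF span_sub[OF J_union_le]])
qed

text \<open>In a relation with largest index \<open>b\<close> the other terms lie in
  \<open>D (b - 1)\<close>, hence so does the term in \<open>F b\<close>, which vanishes by
  \<open>F_D_zero\<close>.\<close>

lemma J_indep: "independent_family U J"
 unfolding independent_family_def
proof (intro allI impI)
 fix S and s :: "int => 'x"
 assume "finite S" "\<forall>i\<in>S. s i \<in> J i" "finsum U s S = \<zero>"
 then show "\<forall>i\<in>S. s i = \<zero>"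
 proof (induction rule: finite_linorder_max_induct)
  case (insert b S)
  have c: "s \<in> S \<rightarrow> carrier U" "s b \<in> carrier U" using insert.prems(1) cJ by auto
  have bS: "b \<notin> S" using insert.hyps by auto
  have eq: "s b \<oplus> finsum U s S = \<zero>"
   using insert.prems(2) M.finsum_insert[OF insert.hyps(1) bS c] by simp
  have "finsum U s S \<in> D (b - 1)"
  proof (rule sub_finsum[OF sD insert.hyps(1)])
   fix i assume "i \<in> S"
   then have "s i \<in> D i" "i \<le> b - 1" using insert.prems(1) insert.hyps(2) by (auto simp: J_def)
   then show "s i \<in> D (b - 1)" using D_inc by blast
  qed
  moreover have "s b = \<ominus> finsum U s S"
   using eq M.finsum_closed[OF c(1)] c(2) by (metis M.minus_equality)
  ultimately have "s b \<in> D (b - 1)" using sub_minus[OF sD] by simp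
  moreover have "s b \<in> F b" using insert.prems(1) by (simp add: J_def)
  ultimately have sb: "s b = \<zero>" by (rule F_D_zero[rotated])
  then have "finsum U s S = \<zero>" using eq M.finsum_closed[OF c(1)] by simp
  then show ?case using insert.IH insert.prems(1) sb by simp
 qed simp
qed

text \<open>The \<open>J i\<close> span, so the operator is determined on the carrier and the choice
  made by \<open>SOME\<close> cannot disturb naturality.\<close>

definition P :: "'x => 'x" where
 "P = (SOME T. is_lin U U T \<and> (\<forall>i. \<forall>x\<in>J i. T x = of_int i \<odot> x))"

lemma P_lin: "is_lin U U P" and P_J: "x \<in> J i ==> P x = of_int i \<odot> x"
 using someI_ex[OF operator_exists[OF vs sJ J_indep J_span, of of_int]] unfolding P_def by blast+

lemma P_closed: "x \<in> carrier U ==> P x \<in> carrier U"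
 by (rule lin_mem[OF P_lin])

text \<open>\<open>x\<close> represents an element of type \<open>(p, n - p)\<close> in \<open>W\<^sub>n / W\<^sub>n\<^sub>-\<^sub>1\<close>.\<close>

definition typed :: "int => int => 'x => 'x => bool" where
 "typed p n x y \<longleftrightarrow> x \<in> F p \<and> x \<in> W n \<and> y \<in> C (n - p) \<and> y \<in> W n \<and> x \<ominus> y \<in> W (n - 1)"

text \<open>Splitting the small difference \<open>x \<ominus> y\<close> as
  \<open>f \<oplus> d\<close> by \<open>W_split\<close> and subtracting \<open>f\<close> from
  \<open>x\<close> gives an element equal to \<open>y \<oplus> d\<close>, which therefore lies in
  \<open>F p\<close> and in \<open>D p\<close> at the same time.\<close>

lemma typed_J: assumes "typed p n x y" shows "\<exists>w\<in>J p \<inter> W n. x \<ominus> w \<in> W (n - 1)"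
proof -
 have x: "x \<in> F p" "x \<in> W n" and y: "y \<in> C (n - p)" "y \<in> W n" and xy: "x \<ominus> y \<in> W (n - 1)"
  using assms by (auto simp: typed_def)
 note xc = cW[OF x(2)] and yc = cW[OF y(2)]
 obtain f d where f: "f \<in> F p" "f \<in> W (n - 1)" and d: "d \<in> D (p - 1)" and eq: "x \<ominus> y = f \<oplus> d"
  using W_split[OF xy, of p] by blast
 note fc = cF[OF f(1)] and dc = sub_mem[OF sD d]
 have "x \<ominus> f = (x \<ominus> y) \<oplus> (y \<ominus> f)" by (rule diff_trans[OF xc yc fc])
 also have "\<dots> = y \<oplus> d"
  unfolding eq using fc dc yc by (simp add: a_minus_def M.a_ac M.r_neg2 M.r_neg1 M.r_neg)
 finally have w: "x \<ominus> f = y \<oplus> d" .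
 have "y \<in> D p" by (rule D_base[OF y(2,1)])
 moreover have "d \<in> D p" using d D_inc[of "p - 1" p] by auto
 ultimately have "x \<ominus> f \<in> D p" unfolding w by (rule sub_add[OF sD])
 moreover have "x \<ominus> f \<in> F p" by (rule sub_diff[OF sF x(1) f(1)])
 moreover have "x \<ominus> f \<in> W n" using sub_diff[OF sW x(2)] f(2) W_inc[of "n - 1" n] by auto
 moreover have "x \<ominus> (x \<ominus> f) \<in> W (n - 1)"
 proof -
  have "x \<ominus> (x \<ominus> f) = f" using xc fc by (simp add: a_minus_def M.minus_add M.r_neg2)
  then show ?thesis using f(2) by simp
 qed
 ultimately show ?thesis by (intro bexI[of _ "x \<ominus> f"]) (simp_all add: J_def)
qed

section \<open>Types, and the action of the operator on weights\<close>

text \<open>Together with \<open>W_subset_E\<close> this expresses that a graded piece is the sum of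
  its components of type \<open>(p, n - p)\<close>, in terms of representatives.\<close>

definition E :: "int => 'x set" where
 "E n = linear_span U ({x. \<exists>p y. typed p n x y} \<union> W (n - 1))"

lemma E_gens: "{x. \<exists>p y. typed p n x y} \<union> W (n - 1) <= carrier U"
 using cW by (auto simp: typed_def)

lemma sE: "subspace_of (E n) U"
 unfolding E_def by (rule span_sub[OF E_gens])

text \<open>Induction on the step of \<open>C\<close> containing \<open>v\<close>. Opposedness for
  \<open>p\<close> and \<open>n + 1 - p\<close> writes \<open>v\<close> as an element of type
  \<open>(p, n - p)\<close>, a term one step deeper in \<open>C\<close>, and an error of lower
  weight.\<close>

lemma W_subset_E: "W n <= E n"
proof
 fix v assume v: "v \<in> W n"
 obtain a where a: "C a = carrier U" using C_full by blast
 obtain b where b: "C b = {\<zero>}" using C_zero by blast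
 have *: "v \<in> E n" if "v \<in> W n" "v \<in> C (b - int k)" for v k
  using that
 proof (induction k arbitrary: v)
  case 0
  then show ?case using b sub_zero[OF sE] by simp
 next
  case (Suc k)
  \<comment> \<open>With this \<open>p\<close> the current step is \<open>C (n - p)\<close>, and
    \<open>C (n + 1 - p)\<close> is the step covered by the induction hypothesis.\<close>
  define p where "p = n - (b - int (Suc k))"
  have "n - p = b - int (Suc k)" by (simp add: p_def)
  then have vC: "v \<in> C (n - p)" and vW: "v \<in> W n" using Suc.prems by (simp_all only:)
  have n1: "b - int k = n + 1 - p" by (simp add: p_def)
  obtain f g r where f: "f \<in> F p" "f \<in> W n" and g: "g \<in> C (n + 1 - p)" "g \<in> W n" and r: "r \<in> W (n - 1)"
   and eq: "v = f \<oplus> g \<oplus> r"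
   using opp_sum[of p "n + 1 - p" n v] vW by auto
  note c = cW[OF f(2)] cW[OF g(2)] cW[OF r] cW[OF vW]
  have "v \<ominus> g \<in> C (n - p)" using sub_diff[OF sC vC] g(1) C_dec[of "n - p" "n + 1 - p"] by auto
  moreover have "f \<ominus> (v \<ominus> g) \<in> W (n - 1)"
  proof -
   have "v \<ominus> g = f \<oplus> r"
    unfolding eq using c add_diff_cancel[of "f \<oplus> r" g] by (simp add: M.a_ac)
   then have "f \<ominus> (v \<ominus> g) = \<ominus> r" using c by (simp add: a_minus_def M.minus_add M.r_neg2)
   then show ?thesis using sub_minus[OF sW r] by simp
  qed
  ultimately have "typed p n f (v \<ominus> g)" using f sub_diff[OF sW vW g(2)] by (simp add: typed_def)
  then have "f \<in> E n" unfolding E_def by (intro span_base) blast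
  moreover have "r \<in> E n" unfolding E_def using r by (intro span_base) blast
  moreover have "g \<in> E n" using g n1 by (intro Suc.IH) simp_all
  ultimately show ?case unfolding eq by (intro sub_add[OF sE])
 qed
 show "v \<in> E n"
 proof (cases "a \<le> b")
  case True
  then show ?thesis using *[OF v, of "nat (b - a)"] a cW[OF v] by simp
 next
  case False
  then have "C b = carrier U" using C_dec[of b a] a sub_le[OF sC] by auto
  then show ?thesis using *[OF v, of 0] cW[OF v] by simp
 qed
qed

text \<open>Induction on the weight: modulo lower weight a typed element lies in some
  \<open>J p\<close>, where the operator is a scalar, and typed elements generate by
  \<open>W_subset_E\<close>.\<close>

lemma P_W: assumes "x \<in> W n" shows "P x \<in> W n"
proof -
 interpret UU: vpair U U by (rule vpairI[OF vs vs])
 obtain n0 where n0: "W n0 = {\<zero>}" using W_zero by blast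
 have P0: "P \<zero> = \<zero>" by (rule UU.is_lin_zero[OF P_lin])
 have "x \<in> W n ==> P x \<in> W n" if "n0 \<le> n" for x
  using that
 proof (induction n arbitrary: x rule: int_ge_induct)
  case base
  then show ?case using n0 P0 by simp
 next
  case (step n)
  have up: "W n <= W (n + 1)" by (rule W_inc) simp
  have "P ` linear_span U ({x. \<exists>p y. typed p (n + 1) x y} \<union> W (n + 1 - 1)) <= W (n + 1)"
  proof (rule UU.span_image_sub[OF P_lin sW E_gens], rule image_subsetI)
   fix x assume "x \<in> {x. \<exists>p y. typed p (n + 1) x y} \<union> W (n + 1 - 1)"
   then consider p y where "typed p (n + 1) x y" | "x \<in> W n" by auto
   then show "P x \<in> W (n + 1)"
   proof cases
    case 1
    then obtain w where w: "w \<in> J p" "w \<in> W (n + 1)" "x \<ominus> w \<in> W (n + 1 - 1)" using typed_J by blast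
    have xc: "x \<in> carrier U" using 1 cW by (auto simp: typed_def)
    have "P (x \<ominus> w) \<in> W n" using w(3) step.IH by simp
    then have "P x \<ominus> P w \<in> W (n + 1)" using UU.is_lin_diff[OF P_lin xc cJ[OF w(1)]] up by auto
    moreover have "P w \<in> W (n + 1)" unfolding P_J[OF w(1)] by (rule sub_smult[OF sW w(2)])
    ultimately show ?thesis using sub_mod[OF sW P_closed[OF xc] P_closed[OF cJ[OF w(1)]]] by blast
   next
    case 2
    then show ?thesis using step.IH up by blast
   qed
  qed
  then show ?case using W_subset_E[of "n + 1"] step.prems unfolding E_def by blast
 qed
 moreover have "P x \<in> W n" if "n < n0"
  using assms W_inc[of n n0] that n0 P0 sub_zero[OF sW, of n] by auto
 ultimately show ?thesis using assms by (cases "n0 \<le> n") auto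
qed

text \<open>The element of \<open>J p\<close> congruent to \<open>x\<close> is an exact eigenvector,
  and the difference stays of lower weight by \<open>P_W\<close>.\<close>

lemma P_typed: assumes "typed p n x y" shows "P x \<ominus> of_int p \<odot> x \<in> W (n - 1)"
proof -
 interpret UU: vpair U U by (rule vpairI[OF vs vs])
 obtain w where w: "w \<in> J p" "x \<ominus> w \<in> W (n - 1)" using typed_J[OF assms] by blast
 have xc: "x \<in> carrier U" using assms cW by (auto simp: typed_def)
 note wc = cJ[OF w(1)]
 define L where "L z = P z \<ominus> of_int p \<odot> z" for z
 have L: "is_lin U U L" unfolding L_def by (rule UU.is_lin_minus_map[OF P_lin UU.is_lin_scale[OF is_lin_id]])
 have "L w = \<zero>" unfolding L_def P_J[OF w(1)] using wc by simp
 then have "L x = L (x \<ominus> w)"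
  using UU.is_lin_diff[OF L xc wc] lin_mem[OF L xc] by simp
 also have "\<dots> \<in> W (n - 1)" unfolding L_def by (intro sub_diff[OF sW] sub_smult[OF sW] P_W w(2))
 finally show ?thesis unfolding L_def .
qed

end

section \<open>The conjugate operator\<close>

locale hodge_core_conj = hodge_core U F C W for U :: "(complex, 'x) module" (structure) and F C W +
 fixes cj :: "'x => 'x"
 assumes cj_closed: "\<And>x. x \<in> carrier U ==> cj x \<in> carrier U"
  and cj_add: "\<And>x y. x \<in> carrier U ==> y \<in> carrier U ==> cj (x \<oplus> y) = cj x \<oplus> cj y"
  and cj_smult: "\<And>a x. x \<in> carrier U ==> cj (a \<odot> x) = cnj a \<odot> cj x"
  and cj_cj: "\<And>x. x \<in> carrier U ==> cj (cj x) = x"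
  and cj_W: "\<And>x n. x \<in> W n ==> cj x \<in> W n"
  and C_eq: "\<And>p. C p = cj ` F p"
begin

lemma cj_diff: "x \<in> carrier U ==> y \<in> carrier U ==> cj (x \<ominus> y) = cj x \<ominus> cj y"
 using cj_add[of x "(- 1) \<odot> y"] cj_smult[of y "- 1"] by (simp add: smult_m1 cj_closed a_minus_def)

lemma cj_C: "x \<in> C p ==> cj x \<in> F p"
 unfolding C_eq using cj_cj cF by auto

lemma cj_F: "x \<in> F p ==> cj x \<in> C p"
 unfolding C_eq by blast

definition Pbar :: "'x => 'x" where "Pbar x = cj (P (cj x))"

lemma Pbar_lin: "is_lin U U Pbar"
 unfolding Pbar_def
 by (rule is_linI) (simp_all add: cj_closed P_closed cj_add cj_smult is_lin_add[OF P_lin] is_lin_smult[OF P_lin])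

lemma Pbar_W: "x \<in> W n ==> Pbar x \<in> W n"
 unfolding Pbar_def by (intro cj_W P_W)

text \<open>Conjugation exchanges the two representatives and turns type \<open>(p, n - p)\<close>
  into \<open>(n - p, p)\<close>, so \<open>P_typed\<close> applies to \<open>cj y\<close>; passing
  from \<open>y\<close> back to \<open>x\<close> costs only lower weight.\<close>

lemma Pbar_typed: assumes "typed p n x y" shows "Pbar x \<ominus> of_int (n - p) \<odot> x \<in> W (n - 1)"
proof -
 interpret UU: vpair U U by (rule vpairI[OF vs vs])
 have x: "x \<in> F p" "x \<in> W n" and y: "y \<in> C (n - p)" "y \<in> W n" and xy: "x \<ominus> y \<in> W (n - 1)"
  using assms by (auto simp: typed_def)
 note xc = cW[OF x(2)] and yc = cW[OF y(2)]
 have "cj y \<ominus> cj x \<in> W (n - 1)"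
  using cj_W[OF sub_swap[OF sW xc yc xy]] cj_diff[OF yc xc] by simp
 then have "typed (n - p) n (cj y) (cj x)"
  using cj_C[OF y(1)] cj_F[OF x(1)] cj_W x(2) y(2) by (simp add: typed_def)
 from cj_W[OF P_typed[OF this]]
 have "Pbar y \<ominus> of_int (n - p) \<odot> y \<in> W (n - 1)"
  using yc by (simp add: Pbar_def cj_diff cj_smult cj_cj cj_closed P_closed)
 moreover define L where "L z = Pbar z \<ominus> of_int (n - p) \<odot> z" for z
 have L: "is_lin U U L" unfolding L_def by (rule UU.is_lin_minus_map[OF Pbar_lin UU.is_lin_scale[OF is_lin_id]])
 have "L (x \<ominus> y) \<in> W (n - 1)" unfolding L_def by (intro sub_diff[OF sW] sub_smult[OF sW] Pbar_W xy)
 ultimately show ?thesis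
  unfolding UU.is_lin_diff[OF L xc yc] using sub_mod[OF sW lin_mem[OF L xc] lin_mem[OF L yc]]
  unfolding L_def by blast
qed

text \<open>On type \<open>(p, n - p)\<close> the two operators contribute \<open>p\<close> and
  \<open>n - p\<close>, and the types generate \<open>W n\<close> modulo lower weight. The
  dependence on \<open>p\<close> cancels, which is what turns a Hodge operator into a weight
  operator.\<close>

lemma P_Pbar_W: assumes "x \<in> W n" shows "P x \<oplus> Pbar x \<ominus> of_int n \<odot> x \<in> W (n - 1)"
proof -
 interpret UU: vpair U U by (rule vpairI[OF vs vs])
 define L where "L z = P z \<oplus> Pbar z \<ominus> of_int n \<odot> z" for z
 have L: "is_lin U U L"
  unfolding L_def by (rule UU.is_lin_minus_map[OF UU.is_lin_plus[OF P_lin Pbar_lin] UU.is_lin_scale[OF is_lin_id]])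
 have "L ` linear_span U ({x. \<exists>p y. typed p n x y} \<union> W (n - 1)) <= W (n - 1)"
 proof (rule UU.span_image_sub[OF L sW E_gens], rule image_subsetI)
  fix x assume "x \<in> {x. \<exists>p y. typed p n x y} \<union> W (n - 1)"
  then consider p y where "typed p n x y" | "x \<in> W (n - 1)" by auto
  then show "L x \<in> W (n - 1)"
  proof cases
   case 1
   then have xc: "x \<in> carrier U" using cW by (auto simp: typed_def)
   have "of_int n \<odot> x = of_int p \<odot> x \<oplus> of_int (n - p) \<odot> x"
    by (simp flip: smult_add_left[OF xc])
   then have "L x = (P x \<ominus> of_int p \<odot> x) \<oplus> (Pbar x \<ominus> of_int (n - p) \<odot> x)"
    unfolding L_def using xc P_closed[OF xc] lin_mem[OF Pbar_lin xc]
    by (simp add: diff_add_diff)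
   then show ?thesis using sub_add[OF sW P_typed[OF 1] Pbar_typed[OF 1]] by simp
  next
   case 2
   then show ?thesis unfolding L_def by (intro sub_diff[OF sW] sub_add[OF sW] sub_smult[OF sW] P_W Pbar_W)
  qed
 qed
 then show ?thesis using W_subset_E assms unfolding E_def L_def by blast
qed

end

section \<open>Opposedness from an operator\<close>

text \<open>Conversely, an operator with the properties of \<open>P\<close> above forces \<open>F\<close> and its conjugate to be opposed on the
 graded pieces of \<open>W\<close>.  Unlike opposedness, the existence of such an operator visibly passes to tensor products.\<close>

locale hodge_operator = vspace U for U :: "(complex, 'x) module" (structure) +
 fixes F W J :: "int => 'x set" and cj P :: "'x => 'x"
 assumes sW: "\<And>n. subspace_of (W n) U" and sJ: "\<And>n. subspace_of (J n) U"
  and cj_closed: "\<And>x. x \<in> carrier U ==> cj x \<in> carrier U"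
  and cj_add: "\<And>x y. x \<in> carrier U ==> y \<in> carrier U ==> cj (x \<oplus> y) = cj x \<oplus> cj y"
  and cj_smult: "\<And>a x. x \<in> carrier U ==> cj (a \<odot> x) = cnj a \<odot> cj x"
  and cj_cj: "\<And>x. x \<in> carrier U ==> cj (cj x) = x"
  and cj_W: "\<And>x n. x \<in> W n ==> cj x \<in> W n"
  and P_lin: "is_lin U U P" and P_J: "\<And>r x. x \<in> J r ==> P x = of_int r \<odot> x"
  and F_span: "\<And>p. F p = linear_span U (\<Union>r\<in>{p..}. J r)"
  and J_span: "linear_span U (\<Union>r. J r) = carrier U"
  and P_W: "\<And>x n. x \<in> W n ==> P x \<in> W n"
  and P_W': "\<And>x n. x \<in> W n ==> P x \<oplus> cj (P (cj x)) \<ominus> of_int n \<odot> x \<in> W (n - 1)"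
  and W_step: "\<And>n. W (n - 1) <= W n"
begin

lemmas cW = sub_mem[OF sW] and cJ = sub_mem[OF sJ]

lemma P_closed: "x \<in> carrier U ==> P x \<in> carrier U"
 by (rule lin_mem[OF P_lin])

lemma cj_diff: "x \<in> carrier U ==> y \<in> carrier U ==> cj (x \<ominus> y) = cj x \<ominus> cj y"
 using cj_add[of x "(- 1) \<odot> y"] cj_smult[of y "- 1"] by (simp add: smult_m1 cj_closed a_minus_def)

sublocale family U J
 by (rule family.intro, rule vspace_axioms, rule family_axioms.intro, rule sJ)

text \<open>\<open>W n\<close> is stable under \<open>P\<close>, hence by
  \<open>eigen_components\<close> it contains the eigencomponents of its elements.\<close>

lemma components_in_W:
 assumes "dec S s x" "x \<in> W n"
 shows "s i \<in> W n"
proof (cases "i \<in> S")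
 case True
 have "\<forall>i\<in>S. s i \<in> W n"
  by (rule eigen_components[OF vs P_lin sW P_W]) (use assms dec_carrier[OF assms(1)] P_J in \<open>auto simp: dec_def\<close>)
 then show ?thesis using True by blast
next
 case False
 then show ?thesis using assms sub_zero[OF sW] by (simp add: dec_def)
qed

lemma span_W:
 assumes "x \<in> linear_span U (\<Union>r\<in>I. J r)" "x \<in> W n"
 shows "x \<in> linear_span U (\<Union>r\<in>I. J r \<inter> W n)"
proof -
 obtain S s where d: "dec S s x" "S <= I" using dec_exists[OF assms(1)] by blast
 have sub: "(\<Union>r\<in>I. J r \<inter> W n) <= carrier U" using cJ by blast
 have "finsum U s S \<in> linear_span U (\<Union>r\<in>I. J r \<inter> W n)"
 proof (rule sub_finsum[OF span_sub[OF sub]])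
  show "finite S" using d by (simp add: dec_def)
  fix i assume "i \<in> S"
  then show "s i \<in> linear_span U (\<Union>r\<in>I. J r \<inter> W n)"
   using d components_in_W[OF d(1) assms(2)] by (intro span_base) (auto simp: dec_def)
 qed
 then show ?thesis using d by (simp add: dec_def)
qed

text \<open>Modulo \<open>W (n - 1)\<close> the conjugate of a vector in \<open>J k\<close> is an
  eigenvector for \<open>n - k\<close>; its eigencomponents for other integers must therefore have
  lower weight. This recovers the symmetry of types from the operator.\<close>

lemma conj_component:
 assumes t: "t \<in> J k" "t \<in> W n"
 shows "\<exists>v\<in>J (n - k) \<inter> W n. cj t \<ominus> v \<in> W (n - 1)"
proof -
 interpret UU: vpair U U by (rule vpairI[OF vs vs])
 note tc = cJ[OF t(1)]
 define u where "u = cj t"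
 have u: "u \<in> W n" "u \<in> carrier U" unfolding u_def using cj_W[OF t(2)] cj_closed[OF tc] by auto
 obtain S s where d: "dec S s u" using dec_exists[of u UNIV] J_span u(2) by auto
 have sW': "s i \<in> W n" for i by (rule components_in_W[OF d u(1)])
 define L where "L z = P z \<ominus> of_int (n - k) \<odot> z" for z
 have L: "is_lin U U L" unfolding L_def by (rule UU.is_lin_minus_map[OF P_lin UU.is_lin_scale[OF is_lin_id]])
 have LJ: "L z = of_int (i - (n - k)) \<odot> z" if "z \<in> J i" for z i
  unfolding L_def P_J[OF that] using cJ[OF that] by (simp add: smult_diff_left)
 \<comment> \<open>Conjugation turns the relation for \<open>t\<close> into one for
   \<open>u\<close>. As \<open>P t\<close> contributes \<open>of_int k \<odot> u\<close>, the vector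
   \<open>P u\<close> is \<open>of_int (n - k) \<odot> u\<close> up to
   \<open>W (n - 1)\<close>.\<close>
 have "cj (P t \<oplus> cj (P (cj t)) \<ominus> of_int n \<odot> t) \<in> W (n - 1)" by (intro cj_W P_W' t(2))
 also have "cj (P t \<oplus> cj (P (cj t)) \<ominus> of_int n \<odot> t) = of_int k \<odot> u \<oplus> P u \<ominus> of_int n \<odot> u"
  using tc u(2) by (simp add: cj_diff cj_add P_closed cj_closed cj_smult cj_cj P_J[OF t(1)] u_def)
 also have "\<dots> = L u"
 proof -
  have "of_int n \<odot> u = of_int k \<odot> u \<oplus> of_int (n - k) \<odot> u" by (simp flip: smult_add_left[OF u(2)])
  then show ?thesis unfolding L_def using u(2) P_closed[OF u(2)] by (simp add: diff_add_diff)
 qed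
 finally have Lu: "L u \<in> W (n - 1)" .
 have fin: "finite S" and us: "u = finsum U s S" and sJ': "\<And>i. s i \<in> J i" using d by (auto simp: dec_def)
 have sc: "s \<in> A \<rightarrow> carrier U" for A using sJ' cJ by auto
 have "L u = finsum U (\<lambda>i. L (s i)) S"
  unfolding us by (rule UU.is_lin_finsum[OF L fin sc])
 then have sum: "finsum U (\<lambda>i. L (s i)) S \<in> W (n - 1)" using Lu by simp
 \<comment> \<open>The eigencomponents of \<open>L u\<close> are those of \<open>u\<close> scaled by
   \<open>i - (n - k)\<close>, a nonzero factor unless \<open>i = n - k\<close>.\<close>
 have "\<forall>i\<in>S. L (s i) \<in> W (n - 1)"
 proof (rule eigen_components[OF vs P_lin sW P_W fin _ _ sum])
  fix i
  show "L (s i) \<in> carrier U" using lin_mem[OF L] sc[of UNIV] by auto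
  have "L (s i) \<in> J i" unfolding LJ[OF sJ'] by (rule sub_smult[OF sJ sJ'])
  then show "P (L (s i)) = of_int i \<odot> L (s i)" by (rule P_J)
 qed
 then have small: "s i \<in> W (n - 1)" if "i \<in> S - {n - k}" for i
 proof -
  have "of_int (i - (n - k)) \<odot> s i \<in> W (n - 1)" using \<open>\<forall>i\<in>S. _\<close> that LJ[OF sJ'] by auto
  from sub_smult[OF sW this, of "inverse (of_int (i - (n - k)))"]
  moreover have "of_int (i - (n - k)) \<noteq> (0 :: complex)" unfolding of_int_eq_0_iff using that by simp
  ultimately show ?thesis using funcset_mem[OF sc UNIV_I, of i] by (simp only: smult_smult left_inverse smult_1 not_False_eq_True)
 qed
 have "u = s (n - k) \<oplus> finsum U s (S - {n - k})"
 proof (cases "n - k \<in> S")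
  case True
  have "finsum U s (insert (n - k) (S - {n - k})) = s (n - k) \<oplus> finsum U s (S - {n - k})"
   by (rule M.finsum_insert) (use fin sc in auto)
  then show ?thesis using True us by (simp add: insert_absorb)
 next
  case False
  then have "s (n - k) = \<zero>" using d by (simp add: dec_def)
  then show ?thesis using False us M.finsum_closed[OF sc] by simp
 qed
 moreover have r: "finsum U s (S - {n - k}) \<in> W (n - 1)"
  by (rule sub_finsum[OF sW]) (use fin small in auto)
 ultimately have "u \<ominus> s (n - k) \<in> W (n - 1)"
  using add_diff_cancel'[of "s (n - k)" "finsum U s (S - {n - k})"] cW[OF r] cJ[OF sJ'] by simp
 then show ?thesis using sJ' sW' unfolding u_def by blast
qed

lemma sF: "subspace_of (F p) U"
 unfolding F_span by (rule span_sub[OF J_subset])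

lemma J_F: "x \<in> J r ==> p \<le> r ==> x \<in> F p"
 unfolding F_span by (rule span_base) auto

lemma sCF: "subspace_of (cj ` F p) U"
proof (rule subspaceI)
 note cF = sub_mem[OF sF]
 show "cj ` F p <= carrier U" using cj_closed cF by auto
 have "cj \<zero> = cj (0 \<odot> \<zero>)" by simp
 also have "\<dots> = \<zero>" unfolding cj_smult[OF M.zero_closed] using cj_closed[OF M.zero_closed] by simp
 finally show "\<zero> \<in> cj ` F p" using sub_zero[OF sF] by (metis image_eqI)
 show "x \<oplus> y \<in> cj ` F p" if "x \<in> cj ` F p" "y \<in> cj ` F p" for x y
  using that sub_add[OF sF] by (auto simp flip: cj_add[OF cF cF])
 show "c \<odot> x \<in> cj ` F p" if x: "x \<in> cj ` F p" for c x
 proof -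
  obtain y where y: "y \<in> F p" "x = cj y" using x by blast
  have "c \<odot> x = cj (cnj c \<odot> y)" using cj_smult[OF cF[OF y(1)], of "cnj c"] y(2) by simp
  then show ?thesis using sub_smult[OF sF y(1)] by blast
 qed
qed

text \<open>On a vector of \<open>J r\<close> with \<open>r \<ge> p\<close> nothing is to be done,
  since it lies in \<open>F p\<close>. Otherwise \<open>n - r \<ge> q\<close>, and by
  \<open>conj_component\<close> the vector is, up to lower weight, the conjugate of one in
  \<open>F q\<close>.\<close>

lemma opposed_sum:
 assumes pq: "p + q = n + 1" and x: "x \<in> W n"
 shows "\<exists>f\<in>F p \<inter> W n. \<exists>g\<in>cj ` F q \<inter> W n. \<exists>r\<in>W (n - 1). x = f \<oplus> g \<oplus> r"
proof -
 have sA: "subspace_of (F p \<inter> W n) U" and sB: "subspace_of (cj ` F q \<inter> W n) U"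
  by (rule Int_subspace[OF sF sW] Int_subspace[OF sCF sW])+
 note cA = sub_mem[OF sA] and cB = sub_mem[OF sB]
 have "x \<in> linear_span U (\<Union>r\<in>UNIV. J r \<inter> W n)"
  by (rule span_W[OF _ x]) (use J_span cW[OF x] in auto)
 moreover have "(\<Union>r\<in>UNIV. J r \<inter> W n) <= carrier U" using cJ by blast
 ultimately show ?thesis
 proof (induction rule: span_induct)
  case zero
  show ?case
   by (rule bexI[OF _ sub_zero[OF sA]], rule bexI[OF _ sub_zero[OF sB]], rule bexI[OF _ sub_zero[OF sW]]) simp
 next
  case (base x)
  then obtain r where xr: "x \<in> J r" "x \<in> W n" by blast
  note xc = cJ[OF xr(1)]
  show ?case
  proof (cases "p \<le> r")
   case True
   then have "x \<in> F p \<inter> W n" using J_F xr by blast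
   then show ?thesis
    by (rule rev_bexI, intro bexI[OF _ sub_zero[OF sB]] bexI[OF _ sub_zero[OF sW]]) (simp add: xc)
  next
   case False
   obtain v where v: "v \<in> J (n - r)" "v \<in> W n" "cj x \<ominus> v \<in> W (n - 1)" using conj_component[OF xr] by blast
   have "v \<in> F q" using J_F[OF v(1), of q] False pq by simp
   then have "cj v \<in> cj ` F q \<inter> W n" using cj_W[OF v(2)] by blast
   moreover have "x \<ominus> cj v \<in> W (n - 1)"
    using cj_W[OF v(3)] cj_diff[OF cj_closed[OF xc] cJ[OF v(1)]] cj_cj[OF xc] by simp
   moreover have "x = \<zero> \<oplus> cj v \<oplus> (x \<ominus> cj v)"
    using xc cj_closed[OF cJ[OF v(1)]] by (simp add: add_diff_cancel_left)
   ultimately show ?thesis using sub_zero[OF sA] by blast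
  qed
 next
  case (add x y)
  then obtain f g r f' g' r' where *: "f \<in> F p \<inter> W n" "g \<in> cj ` F q \<inter> W n" "r \<in> W (n - 1)" "x = f \<oplus> g \<oplus> r"
   "f' \<in> F p \<inter> W n" "g' \<in> cj ` F q \<inter> W n" "r' \<in> W (n - 1)" "y = f' \<oplus> g' \<oplus> r'"
   by blast
  have "x \<oplus> y = (f \<oplus> f') \<oplus> (g \<oplus> g') \<oplus> (r \<oplus> r')"
   unfolding *(4,8) using cA[OF *(1)] cA[OF *(5)] cB[OF *(2)] cB[OF *(6)] cW[OF *(3)] cW[OF *(7)]
   by (simp add: M.a_ac)
  then show ?case using sub_add[OF sA *(1,5)] sub_add[OF sB *(2,6)] sub_add[OF sW *(3,7)] by blast
 next
  case (smult c x)
  then obtain f g r where *: "f \<in> F p \<inter> W n" "g \<in> cj ` F q \<inter> W n" "r \<in> W (n - 1)" "x = f \<oplus> g \<oplus> r"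
   by blast
  have "c \<odot> x = c \<odot> f \<oplus> c \<odot> g \<oplus> c \<odot> r"
   unfolding *(4) using cA[OF *(1)] cB[OF *(2)] cW[OF *(3)] by (simp add: smult_add_right)
  then show ?case using sub_smult[OF sA *(1)] sub_smult[OF sB *(2)] sub_smult[OF sW *(3)] by blast
 qed
qed

text \<open>For \<open>k \<ge> q\<close> the conjugate of \<open>J k\<close> falls into
  \<open>J (n - k)\<close> up to lower weight, and \<open>n - k < p\<close>.\<close>

lemma conj_F_low:
 assumes "y \<in> F q" "y \<in> W n" and pq: "p + q = n + 1"
 shows "\<exists>g'\<in>linear_span U (\<Union>r\<in>{..<p}. J r). cj y \<ominus> g' \<in> W (n - 1)"
proof -
 have N: "subspace_of (linear_span U (\<Union>r\<in>{..<p}. J r)) U" by (rule span_sub[OF J_subset])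
 note cN = sub_mem[OF N]
 have "y \<in> linear_span U (\<Union>r\<in>{q..}. J r \<inter> W n)" by (rule span_W) (use assms F_span in auto)
 moreover have "(\<Union>r\<in>{q..}. J r \<inter> W n) <= carrier U" using cJ by blast
 ultimately show ?thesis
 proof (induction rule: span_induct)
  case zero
  have "cj \<zero> = \<zero>"
   using cj_smult[OF M.zero_closed, of 0] cj_closed[OF M.zero_closed] by simp
  then show ?case by (intro bexI[OF _ sub_zero[OF N]]) (simp add: sub_zero[OF sW])
 next
  case (base y)
  then obtain k where k: "q \<le> k" "y \<in> J k" "y \<in> W n" by auto
  obtain v where v: "v \<in> J (n - k)" "cj y \<ominus> v \<in> W (n - 1)" using conj_component[OF k(2,3)] by blast
  have "v \<in> linear_span U (\<Union>r\<in>{..<p}. J r)" using v(1) k(1) pq by (intro span_base) auto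
  then show ?case using v(2) by blast
 next
  case (add x y)
  then obtain a b where ab: "a \<in> linear_span U (\<Union>r\<in>{..<p}. J r)" "cj x \<ominus> a \<in> W (n - 1)"
   "b \<in> linear_span U (\<Union>r\<in>{..<p}. J r)" "cj y \<ominus> b \<in> W (n - 1)" by blast
  have "cj (x \<oplus> y) \<ominus> (a \<oplus> b) = (cj x \<ominus> a) \<oplus> (cj y \<ominus> b)"
   using add cN[OF ab(1)] cN[OF ab(3)] by (simp add: cj_add cj_closed diff_add_diff)
  then show ?case using sub_add[OF N ab(1,3)] sub_add[OF sW ab(2,4)] by (intro bexI[of _ "a \<oplus> b"]) simp_all
 next
  case (smult c x)
  then obtain a where a: "a \<in> linear_span U (\<Union>r\<in>{..<p}. J r)" "cj x \<ominus> a \<in> W (n - 1)" by blast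
  have "cj (c \<odot> x) \<ominus> cnj c \<odot> a = cnj c \<odot> (cj x \<ominus> a)"
   using smult cN[OF a(1)] by (simp add: cj_smult cj_closed smult_diff_right)
  then show ?case using sub_smult[OF N a(1)] sub_smult[OF sW a(2)] by (intro bexI[of _ "cnj c \<odot> a"]) simp_all
 qed
qed

text \<open>Up to lower weight \<open>f\<close> has components with index at least \<open>p\<close>
  only and \<open>g\<close> with index below \<open>p\<close>. The components of their difference
  lie in \<open>W (n - 1)\<close> one by one, and those with index at least \<open>p\<close> are the
  components of \<open>f\<close>.\<close>

lemma opposed_int:
 assumes pq: "p + q = n + 1" and f: "f \<in> F p \<inter> W n" and g: "g \<in> cj ` F q \<inter> W n" and fg: "f \<ominus> g \<in> W (n - 1)"
 shows "f \<in> W (n - 1)"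
proof -
 obtain y where y: "y \<in> F q" "g = cj y" using g by blast
 have yc: "y \<in> carrier U" by (rule sub_mem[OF sF y(1)])
 have "y \<in> W n" using cj_W[of g n] g y(2) cj_cj[OF yc] by simp
 then obtain g' where g': "g' \<in> linear_span U (\<Union>r\<in>{..<p}. J r)" "g \<ominus> g' \<in> W (n - 1)"
  using conj_F_low[OF y(1) _ pq] y(2) by blast
 have c: "f \<in> carrier U" "g \<in> carrier U" "g' \<in> carrier U"
  using f g cW span_carrier[OF J_subset g'(1)] by auto
 have fg': "f \<ominus> g' \<in> W (n - 1)" by (rule sub_trans[OF sW c fg g'(2)])
 obtain S s where d: "dec S s f" "S <= {p..}" using f dec_exists[of f "{p..}"] F_span by blast
 obtain S' s' where d': "dec S' s' g'" "S' <= {..<p}" using dec_exists[OF g'(1)] by blast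
 \<comment> \<open>The supports on either side of \<open>p\<close> are disjoint, so the components
   of the difference are, up to sign, those of \<open>f\<close> and \<open>g'\<close>
   separately.\<close>
 have dd: "dec (S \<union> S') (\<lambda>i. s i \<oplus> (- 1) \<odot> s' i) (f \<oplus> (- 1) \<odot> g')"
  by (rule dec_add[OF d(1) dec_smult[OF d'(1)]])
 have "f \<oplus> (- 1) \<odot> g' \<in> W (n - 1)" using fg' c by (simp add: smult_m1 a_minus_def)
 from components_in_W[OF dd this]
 have all: "s i \<oplus> (- 1) \<odot> s' i \<in> W (n - 1)" for i .
 have "s i \<in> W (n - 1)" if "i \<in> S" for i
 proof -
  have "p \<le> i" using that d(2) by auto
  then have "i \<notin> S'" using d'(2) by auto
  then have "s' i = \<zero>" using d'(1) by (simp add: dec_def)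
  then show ?thesis using all[of i] dec_carrier[OF d(1), of i] by simp
 qed
 then show ?thesis using d(1) sub_finsum[OF sW, of S s] by (simp add: dec_def)
qed

end

section \<open>Complexified subspaces and tensor products\<close>

text \<open>The complexification of a subspace, realized inside that of \<open>V\<close> instead of
  as a space of its own.\<close>

definition cspan :: "(rat, 'v) module => 'v set => 'v cplx set" where
 "cspan V N = linear_span (complexify V) {pure V cfield x 1 | x. x \<in> N}"

context cspace
begin

context
 fixes N assumes N: "N <= carrier V"
begin

lemma cspan_gens: "{pr x 1 | x. x \<in> N} <= carrier VC"
 using pure_closed N by auto

lemma cspan_subspace: "subspace_of (cspan V N) VC"
 unfolding cspan_def using vec_VC by (intro vspace.span_sub cspan_gens) (simp add: vspace_def)

lemma cspan_pure: "x \<in> N ==> pr x z \<in> cspan V N"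
proof -
 interpret VC: vspace VC by (rule vsI, rule vec_VC)
 assume x: "x \<in> N"
 then have "pr x 1 \<in> cspan V N" unfolding cspan_def by (intro VC.span_base) blast
 from VC.sub_smult[OF cspan_subspace this, of z] show ?thesis
  using VC_smult_pure[of x z 1] x N by auto
qed

lemma cspan_least: "subspace_of M VC ==> (\<And>x. x \<in> N ==> pr x 1 \<in> M) ==> cspan V N <= M"
 unfolding cspan_def using vec_VC by (intro vspace.span_least) (auto simp: vspace_def)

lemma cspan_conj: "t \<in> cspan V N ==> conj_map V t \<in> cspan V N"
proof -
 interpret VC: vspace VC by (rule vsI, rule vec_VC)
 note s = cspan_subspace
 assume "t \<in> cspan V N"
 then show ?thesis unfolding cspan_def using cspan_gens
 proof (induction rule: VC.span_induct)
  case zero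
  have "conj_map V \<zero>\<^bsub>VC\<^esub> = \<zero>\<^bsub>VC\<^esub>"
   using conj_map_smult[OF VC.M.zero_closed, of 0] conj_mem[OF VC.M.zero_closed] by simp
  then show ?case using VC.sub_zero[OF s] by (simp add: cspan_def)
 next
  case (base t)
  then obtain x where x: "t = pr x 1" "x \<in> N" by blast
  then show ?case using conj_map_pure[of x 1] cspan_pure[of x 1] N by (auto simp: cspan_def)
 next
  case (add s t)
  then show ?case using VC.sub_add[OF cspan_subspace] by (simp add: conj_map_add cspan_def)
 next
  case (smult c t)
  then show ?case using VC.sub_smult[OF cspan_subspace] by (simp add: conj_map_smult cspan_def)
 qed
qed

end

lemma cspan_mono: "N <= M ==> cspan V N <= cspan V M"
 unfolding cspan_def using vec_VC by (intro vspace.span_mono) (auto simp: vspace_def)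

lemma cspan_carrier: "cspan V (carrier V) = carrier VC"
 unfolding cspan_def by (rule VC_span)

lemma cspan_zero: "cspan V {\<zero>\<^bsub>V\<^esub>} = {\<zero>\<^bsub>VC\<^esub>}"
proof
 interpret VC: vspace VC by (rule vsI, rule vec_VC)
 have z: "{\<zero>\<^bsub>V\<^esub>} <= carrier V" by simp
 show "cspan V {\<zero>\<^bsub>V\<^esub>} <= {\<zero>\<^bsub>VC\<^esub>}"
  by (rule cspan_least[OF z VC.zero_sub]) (simp add: pure_zero)
 show "{\<zero>\<^bsub>VC\<^esub>} <= cspan V {\<zero>\<^bsub>V\<^esub>}" using VC.sub_zero[OF cspan_subspace[OF z]] by simp
qed

end

lemma cmap_cspan:
 assumes V: "vec_space V" and W: "vec_space W" and f: "is_lin V W f" and N: "N <= carrier V" and M: "M <= carrier W"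
  and "f ` N <= M" and t: "t \<in> cspan V N"
 shows "complexify_map V W f t \<in> cspan W M"
proof -
 interpret V: cspace V using V by (rule cspaceI)
 interpret W: cspace W using W by (rule cspaceI)
 interpret VW: vpair V.VC W.VC by (rule vpairI[OF V.vec_VC W.vec_VC])
 have "complexify_map V W f ` linear_span V.VC {V.pr x 1 | x. x \<in> N} <= cspan W M"
 proof (rule VW.span_image_sub[OF cmap_lin[OF V W f] W.cspan_subspace[OF M] V.cspan_gens[OF N]], clarify)
  fix x assume "x \<in> N"
  then have x: "x \<in> carrier V" "f x \<in> M" using N assms(6) by auto
  show "complexify_map V W f (V.pr x 1) \<in> cspan W M"
   unfolding cmap_pure[OF V W f x(1)] by (rule W.cspan_pure[OF M x(2)])
 qed
 then show ?thesis using t unfolding cspan_def by blast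
qed

lemma is_lin_incl: "N <= carrier V ==> is_lin (sub V N) V (\<lambda>x. x)"
 by (auto simp: is_lin_def sub_def)

lemma sub_simps': "carrier (sub V N) = N" "x \<oplus>\<^bsub>sub V N\<^esub> y = x \<oplus>\<^bsub>V\<^esub> y" "\<zero>\<^bsub>sub V N\<^esub> = \<zero>\<^bsub>V\<^esub>" "c \<odot>\<^bsub>sub V N\<^esub> x = c \<odot>\<^bsub>V\<^esub> x"
 by (simp_all add: sub_def)

text \<open>The induced Hodge filtration is defined through \<open>complexify (sub V N)\<close>, the
  linear algebra is done with \<open>cspan\<close>; rational points show that they agree.\<close>

lemma cspan_image:
 assumes V: "vec_space V" and N: "subspace_of N V"
 shows "complexify_map (sub V N) V (\<lambda>x. x) ` carrier (complexify (sub V N)) = cspan V N"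
proof -
 interpret V: cspace V using V by (rule cspaceI)
 have sN: "vec_space (sub V N)" by (rule V.vspace_sub[OF N])
 interpret S: cspace "sub V N" using sN by (rule cspaceI)
 interpret SV: vpair S.VC V.VC by (rule vpairI[OF S.vec_VC V.vec_VC])
 note i = is_lin_incl[OF V.sub_le[OF N]]
 note l = cmap_lin[OF sN V i]
 show ?thesis
 proof
  have "t \<in> cspan (sub V N) N" if "t \<in> carrier S.VC" for t
   using that S.cspan_carrier by (simp add: sub_simps')
  then show "complexify_map (sub V N) V (\<lambda>x. x) ` carrier (complexify (sub V N)) <= cspan V N"
   using cmap_cspan[OF sN V i _ V.sub_le[OF N], of N] by (auto simp: sub_simps')
  show "cspan V N <= complexify_map (sub V N) V (\<lambda>x. x) ` carrier (complexify (sub V N))"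
  proof (rule V.cspan_least[OF V.sub_le[OF N] SV.image_sub[OF l SV.V.carrier_sub]])
   fix x assume "x \<in> N"
   then have "V.pr x 1 = complexify_map (sub V N) V (\<lambda>x. x) (S.pr x 1)" "S.pr x 1 \<in> carrier S.VC"
    using cmap_pure[OF sN V i, of x 1] S.pure_closed[of x 1] by (simp_all add: sub_simps')
   then show "V.pr x 1 \<in> complexify_map (sub V N) V (\<lambda>x. x) ` carrier (complexify (sub V N))" by blast
  qed
 qed
qed

text \<open>Naturality of \<open>real_part\<close> for the inclusion of \<open>N\<close>. Through
  this the retraction respects rational filtrations.\<close>

lemma real_part_cspan:
 assumes V: "vec_space V" and N: "subspace_of N V" and t: "t \<in> cspan V N"
 shows "real_part V t \<in> N"
proof -
 interpret V: vspace V by (rule vsI, rule V)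
 have sN: "vec_space (sub V N)" by (rule V.vspace_sub[OF N])
 note i = is_lin_incl[OF V.sub_le[OF N]]
 obtain s where s: "s \<in> carrier (complexify (sub V N))" "t = complexify_map (sub V N) V (\<lambda>x. x) s"
  using t cspan_image[OF V N] by blast
 have "real_part V t = real_part (sub V N) s"
  unfolding s(2) by (rule real_part_natural[OF sN V i s(1)])
 then show ?thesis using cspace.real_part_closed[OF cspaceI[OF sN] s(1)] by (simp add: sub_simps')
qed

subsection \<open>The complex bilinear map\<close>

context
 fixes A B :: "(rat, 'a) module" and X :: "(complex, 'x) module" and \<gamma>
 assumes A: "vec_space A" and B: "vec_space B" and X: "vec_space X" and \<gamma>: "bil A B (rscal X) \<gamma>"
begin

interpretation A: cspace A using A by (rule cspaceI)
interpretation B: cspace B using B by (rule cspaceI)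
interpretation AX: vpair A.VC X by (rule vpairI[OF A.vec_VC X])
interpretation BX: vpair B.VC X by (rule vpairI[OF B.vec_VC X])

text \<open>Extension of scalars in the two variables one after the other.\<close>

definition clift2 where "clift2 \<xi> = clift B X (\<lambda>y. clift A X (\<lambda>x. \<gamma> x y) \<xi>)"

lemma clift2_inner: "y \<in> carrier B ==> is_lin A.VC X (clift A X (\<lambda>x. \<gamma> x y))"
 by (rule A.clift_lin[OF X bil_left[OF \<gamma>]])

lemma clift2_inner_pure: "x \<in> carrier A ==> y \<in> carrier B ==> clift A X (\<lambda>x. \<gamma> x y) (A.pr x z) = z \<odot>\<^bsub>X\<^esub> \<gamma> x y"
 by (rule A.clift_pure[OF X bil_left[OF \<gamma>]])

text \<open>The inner extension is determined by rational points of the first factor, and there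
  linearity in \<open>y\<close> is that of \<open>\<gamma>\<close>.\<close>

lemma clift2_mid: assumes \<xi>: "\<xi> \<in> carrier A.VC" shows "is_lin B (rscal X) (\<lambda>y. clift A X (\<lambda>x. \<gamma> x y) \<xi>)"
proof (rule is_linI)
 have cl: "\<gamma> x y \<in> carrier X" if "x \<in> carrier A" "y \<in> carrier B" for x y using bil_closed[OF \<gamma> that] by simp
 fix y assume y: "y \<in> carrier B"
 show "clift A X (\<lambda>x. \<gamma> x y) \<xi> \<in> carrier (rscal X)"
  using lin_mem[OF clift2_inner[OF y] \<xi>] by simp
 have "clift A X (\<lambda>x. \<gamma> x (q \<odot>\<^bsub>B\<^esub> y)) \<xi> = of_rat q \<odot>\<^bsub>X\<^esub> clift A X (\<lambda>x. \<gamma> x y) \<xi>" for q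
  by (rule A.VC_ext[OF X clift2_inner AX.is_lin_scale[OF clift2_inner] _ \<xi>])
   (use y is_lin_smult[OF bil_right[OF \<gamma>]] cl in \<open>simp_all add: clift2_inner_pure\<close>)
 then show "clift A X (\<lambda>x. \<gamma> x (q \<odot>\<^bsub>B\<^esub> y)) \<xi> = q \<odot>\<^bsub>rscal X\<^esub> clift A X (\<lambda>x. \<gamma> x y) \<xi>" for q
  by simp
 fix y' assume y': "y' \<in> carrier B"
 have "clift A X (\<lambda>x. \<gamma> x (y \<oplus>\<^bsub>B\<^esub> y')) \<xi> = clift A X (\<lambda>x. \<gamma> x y) \<xi> \<oplus>\<^bsub>X\<^esub> clift A X (\<lambda>x. \<gamma> x y') \<xi>"
  by (rule A.VC_ext[OF X clift2_inner AX.is_lin_plus[OF clift2_inner clift2_inner] _ \<xi>])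
   (use y y' is_lin_add[OF bil_right[OF \<gamma>]] cl in \<open>simp_all add: clift2_inner_pure\<close>)
 then show "clift A X (\<lambda>x. \<gamma> x (y \<oplus>\<^bsub>B\<^esub> y')) \<xi>
   = clift A X (\<lambda>x. \<gamma> x y) \<xi> \<oplus>\<^bsub>rscal X\<^esub> clift A X (\<lambda>x. \<gamma> x y') \<xi>"
  by simp
qed

lemma clift2_right: "\<xi> \<in> carrier A.VC ==> is_lin B.VC X (clift2 \<xi>)"
 unfolding clift2_def by (rule B.clift_lin[OF X clift2_mid])

lemma clift2_right_pure: "\<xi> \<in> carrier A.VC ==> y \<in> carrier B ==> clift2 \<xi> (B.pr y w) = w \<odot>\<^bsub>X\<^esub> clift A X (\<lambda>x. \<gamma> x y) \<xi>"
 unfolding clift2_def by (rule B.clift_pure[OF X clift2_mid])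

lemma clift2_bil: "bil A.VC B.VC X clift2"
proof (rule bilI[OF clift2_right])
 fix \<eta> assume \<eta>: "\<eta> \<in> carrier B.VC"
 show "is_lin A.VC X (\<lambda>\<xi>. clift2 \<xi> \<eta>)"
 proof (rule is_linI)
  fix \<xi> assume \<xi>: "\<xi> \<in> carrier A.VC"
  show "clift2 \<xi> \<eta> \<in> carrier X" by (rule lin_mem[OF clift2_right[OF \<xi>] \<eta>])
  show "clift2 (c \<odot>\<^bsub>A.VC\<^esub> \<xi>) \<eta> = c \<odot>\<^bsub>X\<^esub> clift2 \<xi> \<eta>" for c
   by (rule B.VC_ext[OF X clift2_right BX.is_lin_scale[OF clift2_right] _ \<eta>])
    (use \<xi> in \<open>simp_all add: clift2_right_pure is_lin_smult[OF clift2_inner] lin_mem[OF clift2_inner]\<close>)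
  fix \<xi>' assume \<xi>': "\<xi>' \<in> carrier A.VC"
  show "clift2 (\<xi> \<oplus>\<^bsub>A.VC\<^esub> \<xi>') \<eta> = clift2 \<xi> \<eta> \<oplus>\<^bsub>X\<^esub> clift2 \<xi>' \<eta>"
   by (rule B.VC_ext[OF X clift2_right BX.is_lin_plus[OF clift2_right clift2_right] _ \<eta>])
    (use \<xi> \<xi>' in \<open>simp_all add: clift2_right_pure is_lin_add[OF clift2_inner] lin_mem[OF clift2_inner]\<close>)
 qed
qed

lemma clift2_pure: "x \<in> carrier A ==> y \<in> carrier B ==> clift2 (A.pr x z) (B.pr y w) = (z * w) \<odot>\<^bsub>X\<^esub> \<gamma> x y"
 using bil_closed[OF \<gamma>, of x y]
 by (simp add: clift2_right_pure[OF A.pure_closed] clift2_inner_pure AX.W.smult_smult mult.commute)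

end

lemma bilin_bil: assumes "vec_space V" and \<beta>: "\<beta> \<in> bilin V W X" shows "bil V W X \<beta>"
proof (rule bilI)
 show "is_lin W X (\<beta> x)" if "x \<in> carrier V" for x
 proof -
  have "\<beta> \<in> carrier V \<rightarrow>\<^sub>E lin W X" using \<beta> by (simp add: bilin_def)
  from PiE_mem[OF this that] show ?thesis by (rule lin_is_lin)
 qed
 show "is_lin V X (\<lambda>x. \<beta> x y)" if "y \<in> carrier W" for y
 proof (rule is_lin_cong[OF _ _ assms(1)])
  show "is_lin V X (\<lambda>x \<in> carrier V. \<beta> x y)" using \<beta> that by (auto simp: bilin_def lin_is_lin)
 qed simp
qed

context
 fixes A B :: "'u::infinite qvs"
 assumes A: "vec_space A" and B: "vec_space B"
begin

interpretation A: cspace A using A by (rule cspaceI)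
interpretation B: cspace B using B by (rule cspaceI)
interpretation AB: cspace "tensor A B" using vec_tensor[OF A B] by (rule cspaceI)
interpretation ABC: vspace AB.VC by (rule vsI, rule AB.vec_VC)

text \<open>Existence is \<open>clift2\<close>; uniqueness holds because rational points span both
  complexifications and the maps in \<open>bilin\<close> are extensional.\<close>

lemma cplx_tpure_ex1: "\<exists>!\<beta>. \<beta> \<in> bilin A.VC B.VC AB.VC \<and>
   (\<forall>x \<in> carrier A. \<forall>y \<in> carrier B. \<forall>z w. \<beta> (A.pr x z) (B.pr y w) = AB.pr (tpure A B x y) (z * w))"
proof -
 let ?\<gamma> = "\<lambda>x y. AB.pr (tpure A B x y) 1"
 have \<gamma>: "bil A B (rscal AB.VC) ?\<gamma>"
  by (rule bil_comp[OF bil_tpure[OF A B] AB.pure_rat_lin])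
 note X = AB.vec_VC
 define \<beta> where "\<beta> = (\<lambda>\<xi>\<in>carrier A.VC. \<lambda>\<eta>\<in>carrier B.VC. clift2 A B AB.VC ?\<gamma> \<xi> \<eta>)"
 note b = clift2_bil[OF A B X \<gamma>]
 have \<beta>1: "\<beta> \<in> bilin A.VC B.VC AB.VC"
 proof -
  have "\<beta> \<xi> \<in> lin B.VC AB.VC" if "\<xi> \<in> carrier A.VC" for \<xi>
   using lin_restrict[OF B.vec_VC bil_right[OF b that]] that by (simp add: \<beta>_def)
  moreover have "(\<lambda>\<xi>\<in>carrier A.VC. \<beta> \<xi> \<eta>) \<in> lin A.VC AB.VC" if "\<eta> \<in> carrier B.VC" for \<eta>
  proof -
   have "(\<lambda>\<xi>\<in>carrier A.VC. \<beta> \<xi> \<eta>) = (\<lambda>\<xi>\<in>carrier A.VC. clift2 A B AB.VC ?\<gamma> \<xi> \<eta>)"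
    by (rule restrict_ext) (use that in \<open>simp add: \<beta>_def\<close>)
   then show ?thesis using lin_restrict[OF A.vec_VC bil_left[OF b that]] by simp
  qed
  ultimately show ?thesis unfolding bilin_def by (auto simp: \<beta>_def)
 qed
 have \<beta>2: "\<beta> (A.pr x z) (B.pr y w) = AB.pr (tpure A B x y) (z * w)" if "x \<in> carrier A" "y \<in> carrier B" for x y z w
  using that clift2_pure[OF A B X \<gamma> that] AB.VC_smult_pure[OF tpure_closed[OF A B that]]
  by (simp add: \<beta>_def A.pure_closed B.pure_closed)
 show ?thesis
 proof (rule ex1I[of _ \<beta>])
  show "\<beta> \<in> bilin A.VC B.VC AB.VC \<and>
   (\<forall>x \<in> carrier A. \<forall>y \<in> carrier B. \<forall>z w. \<beta> (A.pr x z) (B.pr y w) = AB.pr (tpure A B x y) (z * w))"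
   using \<beta>1 \<beta>2 by blast
  fix \<beta>' assume \<beta>': "\<beta>' \<in> bilin A.VC B.VC AB.VC \<and>
   (\<forall>x \<in> carrier A. \<forall>y \<in> carrier B. \<forall>z w. \<beta>' (A.pr x z) (B.pr y w) = AB.pr (tpure A B x y) (z * w))"
  have e: "\<beta>' \<xi> \<eta> = \<beta> \<xi> \<eta>" if \<xi>: "\<xi> \<in> carrier A.VC" and \<eta>: "\<eta> \<in> carrier B.VC" for \<xi> \<eta>
  proof (rule bil_eq_on_span[OF bilin_bil[OF A.vec_VC conjunct1[OF \<beta>']] bilin_bil[OF A.vec_VC \<beta>1]
     A.vec_VC B.vec_VC X])
   show "{A.pr x 1 | x. x \<in> carrier A} <= carrier A.VC" "{B.pr x 1 | x. x \<in> carrier B} <= carrier B.VC"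
    using A.pure_closed B.pure_closed by auto
   show "\<xi> \<in> linear_span A.VC {A.pr x 1 | x. x \<in> carrier A}" "\<eta> \<in> linear_span B.VC {B.pr x 1 | x. x \<in> carrier B}"
    using A.VC_span B.VC_span \<xi> \<eta> by auto
   fix s t assume "s \<in> {A.pr x 1 | x. x \<in> carrier A}" "t \<in> {B.pr x 1 | x. x \<in> carrier B}"
   then show "\<beta>' s t = \<beta> s t" using \<beta>' \<beta>2 by auto
  qed
  have pe: "\<beta>' \<in> carrier A.VC \<rightarrow>\<^sub>E lin B.VC AB.VC" "\<beta> \<in> carrier A.VC \<rightarrow>\<^sub>E lin B.VC AB.VC"
   using \<beta>' \<beta>1 by (simp_all add: bilin_def)
  show "\<beta>' = \<beta>"
  proof (rule PiE_ext[OF pe])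
   fix \<xi> assume \<xi>: "\<xi> \<in> carrier A.VC"
   show "\<beta>' \<xi> = \<beta> \<xi>" using PiE_mem[OF pe(1) \<xi>] PiE_mem[OF pe(2) \<xi>] e[OF \<xi>] by (rule lin_eqI)
  qed
 qed
qed

abbreviation "ct \<equiv> cplx_tpure A B"

lemma ct_bil: "bil A.VC B.VC AB.VC ct"
 using theI'[OF cplx_tpure_ex1] by (intro bilin_bil[OF A.vec_VC]) (simp add: cplx_tpure_def)

lemma ct_pure: "x \<in> carrier A ==> y \<in> carrier B ==> ct (A.pr x z) (B.pr y w) = AB.pr (tpure A B x y) (z * w)"
 using theI'[OF cplx_tpure_ex1] by (simp add: cplx_tpure_def)

lemma ct_ext:
 assumes X: "vec_space X" and b: "bil A.VC B.VC X \<beta>" and c: "bil A.VC B.VC X \<gamma>"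
  and eq: "\<And>x y. x \<in> carrier A ==> y \<in> carrier B ==> \<beta> (A.pr x 1) (B.pr y 1) = \<gamma> (A.pr x 1) (B.pr y 1)"
  and \<xi>: "\<xi> \<in> carrier A.VC" and \<eta>: "\<eta> \<in> carrier B.VC"
 shows "\<beta> \<xi> \<eta> = \<gamma> \<xi> \<eta>"
proof (rule bil_eq_on_span[OF b c A.vec_VC B.vec_VC X])
 show "{A.pr x 1 | x. x \<in> carrier A} <= carrier A.VC" "{B.pr x 1 | x. x \<in> carrier B} <= carrier B.VC"
  using A.pure_closed B.pure_closed by auto
 show "\<xi> \<in> linear_span A.VC {A.pr x 1 | x. x \<in> carrier A}" "\<eta> \<in> linear_span B.VC {B.pr x 1 | x. x \<in> carrier B}"
  using A.VC_span B.VC_span \<xi> \<eta> by auto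
qed (use eq in auto)

text \<open>Both sides are conjugate-linear in each variable and so out of reach of
  \<open>ct_ext\<close>; the induction runs over pure tensors with arbitrary complex entry
  instead.\<close>

lemma ct_conj:
 assumes "\<xi> \<in> carrier A.VC" "\<eta> \<in> carrier B.VC"
 shows "conj_map (tensor A B) (ct \<xi> \<eta>) = ct (conj_map A \<xi>) (conj_map B \<eta>)"
 using assms(1)
proof (induction rule: A.VC_induct)
 case (pure x z)
 show ?case using assms(2)
 proof (induction rule: B.VC_induct)
  case (pure y w)
  then show ?case
   using \<open>x \<in> carrier A\<close> by (simp add: ct_pure A.conj_map_pure B.conj_map_pure AB.conj_map_pure tpure_closed[OF A B])
 next
  case (add s t)
  have c: "A.pr x z \<in> carrier A.VC" "conj_map A (A.pr x z) \<in> carrier A.VC"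
   using pure A.pure_closed A.conj_mem by auto
  show ?case
   using add by (simp add: is_lin_add[OF bil_right[OF ct_bil c(1)]] is_lin_add[OF bil_right[OF ct_bil c(2)]]
    AB.conj_map_add B.conj_map_add B.conj_mem bil_closed[OF ct_bil c(1)])
 qed
next
 case (add s t)
 note c = assms(2) B.conj_mem[OF assms(2)]
 show ?case
  using add by (simp add: is_lin_add[OF bil_left[OF ct_bil c(1)]] is_lin_add[OF bil_left[OF ct_bil c(2)]]
    AB.conj_map_add A.conj_map_add A.conj_mem bil_closed[OF ct_bil _ c(1)])
qed

lemma ct_span: "linear_span AB.VC {ct \<xi> \<eta> | \<xi> \<eta>. \<xi> \<in> carrier A.VC \<and> \<eta> \<in> carrier B.VC} = carrier AB.VC"
proof
 have sub: "{ct \<xi> \<eta> | \<xi> \<eta>. \<xi> \<in> carrier A.VC \<and> \<eta> \<in> carrier B.VC} <= carrier AB.VC"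
  using bil_closed[OF ct_bil] by blast
 note N = ABC.span_sub[OF sub]
 show "linear_span AB.VC {ct \<xi> \<eta> | \<xi> \<eta>. \<xi> \<in> carrier A.VC \<and> \<eta> \<in> carrier B.VC} <= carrier AB.VC"
  by (rule ABC.sub_le[OF N])
 show "carrier AB.VC <= linear_span AB.VC {ct \<xi> \<eta> | \<xi> \<eta>. \<xi> \<in> carrier A.VC \<and> \<eta> \<in> carrier B.VC}"
 proof
  fix t assume "t \<in> carrier AB.VC"
  then show "t \<in> linear_span AB.VC {ct \<xi> \<eta> | \<xi> \<eta>. \<xi> \<in> carrier A.VC \<and> \<eta> \<in> carrier B.VC}"
  proof (induction rule: AB.VC_induct)
   case (pure s z)
   then show ?case
   proof (induction rule: tprod.induct2[OF tprod_tensor[OF A B], consumes 1])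
    case (1 x y)
    have "AB.pr (tpure A B x y) z = ct (A.pr x z) (B.pr y 1)" using ct_pure[OF 1, of z 1] by simp
    then show ?case using A.pure_closed[OF 1(1)] B.pure_closed[OF 1(2)] by (intro ABC.span_base) blast
   next
    case (2 s t)
    then show ?case using ABC.sub_add[OF N] by (simp add: AB.pure_add(1))
   qed
  next
   case (add s t)
   then show ?case using ABC.sub_add[OF N] by blast
  qed
 qed
qed

text \<open>\<open>(A \<otimes> B)\<^sub>\<complex>\<close> is the complex tensor product of \<open>A\<^sub>\<complex>\<close> and \<open>B\<^sub>\<complex>\<close>.\<close>

lemma ct_lift:
 assumes X: "vec_space X" and b: "bil A.VC B.VC X \<beta>"
 obtains h where "is_lin AB.VC X h" "\<And>\<xi> \<eta>. \<xi> \<in> carrier A.VC ==> \<eta> \<in> carrier B.VC ==> h (ct \<xi> \<eta>) = \<beta> \<xi> \<eta>"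
proof -
 interpret X: vspace X by (rule vsI, rule X)
 have b0: "bil A B (rscal X) (\<lambda>x y. \<beta> (A.pr x 1) (B.pr y 1))"
 proof (rule bilI)
  show "is_lin B (rscal X) (\<lambda>y. \<beta> (A.pr x 1) (B.pr y 1))" if "x \<in> carrier A" for x
   by (rule is_lin_comp[OF B.pure_rat_lin B.clin_rat[OF bil_right[OF b A.pure_closed[OF that]]]])
  show "is_lin A (rscal X) (\<lambda>x. \<beta> (A.pr x 1) (B.pr y 1))" if "y \<in> carrier B" for y
   by (rule is_lin_comp[OF A.pure_rat_lin A.clin_rat[OF bil_left[OF b B.pure_closed[OF that]]]])
 qed
 note vX = vec_restrict_scalars[OF X]
 define h0 where "h0 = tlift A B (tensor A B) (tpure A B) (rscal X) (\<lambda>x y. \<beta> (A.pr x 1) (B.pr y 1))"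
 have h0: "is_lin (tensor A B) (rscal X) h0"
  unfolding h0_def by (rule tensor_lift_is_lin[OF A B vX b0])
 have h0p: "h0 (tpure A B x y) = \<beta> (A.pr x 1) (B.pr y 1)" if "x \<in> carrier A" "y \<in> carrier B" for x y
  unfolding h0_def by (rule tensor_lift_pure[OF A B vX b0 that])
 note h = AB.clift_lin[OF X h0] and hp = AB.clift_pure[OF X h0]
 show thesis
 proof (rule that[OF h])
  show "clift (tensor A B) X h0 (ct \<xi> \<eta>) = \<beta> \<xi> \<eta>" if "\<xi> \<in> carrier A.VC" "\<eta> \<in> carrier B.VC" for \<xi> \<eta>
  proof (rule ct_ext[OF X bil_comp[OF ct_bil h] b _ that])
   fix x y assume xy: "x \<in> carrier A" "y \<in> carrier B"
   show "clift (tensor A B) X h0 (ct (A.pr x 1) (B.pr y 1)) = \<beta> (A.pr x 1) (B.pr y 1)"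
    unfolding ct_pure[OF xy] hp[OF tpure_closed[OF A B xy]] h0p[OF xy]
    using bil_closed[OF b A.pure_closed[OF xy(1)] B.pure_closed[OF xy(2)]] by simp
  qed
 qed
qed

end

subsection \<open>Families of complex subspaces\<close>

text \<open>The complex analogue of \<open>tensor_family\<close>. It is applied to the Hodge
  filtrations, to the complexified weight filtrations and to the spaces \<open>J\<close>.\<close>

definition cfamily ::
 "'u::infinite qvs => 'u qvs => (int => 'u cplx set) => (int => 'u cplx set) => int => 'u cplx set" where
 "cfamily A B P Q p = linear_span (complexify (tensor A B))
   {cplx_tpure A B x y | i j x y. i + j = p \<and> x \<in> P i \<and> y \<in> Q j}"

lemma cfamily_pure:
 "x \<in> P i ==> y \<in> Q j ==> i + j = p ==> cplx_tpure A B x y \<in> cfamily A B P Q p"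
proof -
 assume "x \<in> P i" "y \<in> Q j" "i + j = p"
 then have "cplx_tpure A B x y \<in> {cplx_tpure A B x y | i j x y. i + j = p \<and> x \<in> P i \<and> y \<in> Q j}" by blast
 then show ?thesis unfolding cfamily_def linear_span_def by blast
qed

context
 fixes A B :: "'u::infinite qvs" and P Q :: "int => 'u cplx set"
 assumes A: "vec_space A" and B: "vec_space B"
  and P: "\<And>i. P i <= carrier (complexify A)" and Q: "\<And>i. Q i <= carrier (complexify B)"
begin

interpretation AB: vspace "complexify (tensor A B)"
 by (rule vsI, rule vec_complexify[OF vec_tensor[OF A B]])

lemma cfamily_gens:
 "{cplx_tpure A B x y | i j x y. i + j = p \<and> x \<in> P i \<and> y \<in> Q j} <= carrier (complexify (tensor A B))"
 using bil_closed[OF ct_bil[OF A B]] P Q by blast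

lemma cfamily_sub: "subspace_of (cfamily A B P Q p) (complexify (tensor A B))"
 unfolding cfamily_def by (rule AB.span_sub[OF cfamily_gens])

lemma cfamily_least:
 assumes "subspace_of N (complexify (tensor A B))"
  "\<And>i j x y. i + j = p ==> x \<in> P i ==> y \<in> Q j ==> cplx_tpure A B x y \<in> N"
 shows "cfamily A B P Q p <= N"
 unfolding cfamily_def by (rule AB.span_least[OF assms(1)]) (use assms(2) in blast)

lemma cfamily_image:
 assumes Z: "vec_space Z" and f: "is_lin (complexify (tensor A B)) Z f" and N: "subspace_of N Z"
  and "\<And>i j x y. i + j = p ==> x \<in> P i ==> y \<in> Q j ==> f (cplx_tpure A B x y) \<in> N"
  and t: "t \<in> cfamily A B P Q p"
 shows "f t \<in> N"
proof -
 interpret Z: vpair "complexify (tensor A B)" Z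
  using vec_complexify[OF vec_tensor[OF A B]] Z by (rule vpairI)
 have "cfamily A B P Q p <= {t \<in> carrier (complexify (tensor A B)). f t \<in> N}"
  by (rule cfamily_least[OF Z.preimage_sub[OF f N]])
   (use assms(4) bil_closed[OF ct_bil[OF A B]] P Q in blast)
 with t show ?thesis by blast
qed

end

text \<open>Both sides are generated by the products of rational points, since \<open>ct\<close>
  takes the points of \<open>x\<close> and \<open>y\<close> to the point of their tensor
  product.\<close>

lemma cspan_tensor_family:
 fixes A B :: "'u::infinite qvs"
 assumes A: "vec_space A" and B: "vec_space B" and P: "\<And>i. subspace_of (P i) A" and Q: "\<And>i. subspace_of (Q i) B"
 shows "cspan (tensor A B) (tensor_family A B P Q p) = cfamily A B (\<lambda>i. cspan A (P i)) (\<lambda>i. cspan B (Q i)) p"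
proof -
 interpret A: cspace A using A by (rule cspaceI)
 interpret B: cspace B using B by (rule cspaceI)
 interpret AB: cspace "tensor A B" using vec_tensor[OF A B] by (rule cspaceI)
 interpret ABC: vspace AB.VC by (rule vsI, rule AB.vec_VC)
 interpret AC: vspace A.VC by (rule vsI, rule A.vec_VC)
 interpret BC: vspace B.VC by (rule vsI, rule B.vec_VC)
 have PC: "cspan A (P i) <= carrier A.VC" for i by (rule AC.sub_le[OF A.cspan_subspace[OF A.sub_le[OF P]]])
 have QC: "cspan B (Q i) <= carrier B.VC" for i by (rule BC.sub_le[OF B.cspan_subspace[OF B.sub_le[OF Q]]])
 have tf: "subspace_of (tensor_family A B P Q p) (tensor A B)" by (rule tensor_family_sub[OF A B P Q])
 have cf: "subspace_of (cfamily A B (\<lambda>i. cspan A (P i)) (\<lambda>i. cspan B (Q i)) p) AB.VC"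
  by (rule cfamily_sub[OF A B PC QC])
 show ?thesis
 proof
  let ?N = "cfamily A B (\<lambda>i. cspan A (P i)) (\<lambda>i. cspan B (Q i)) p"
  have "subspace_of {s \<in> carrier (tensor A B). AB.pr s 1 \<in> ?N} (tensor A B)"
   by (rule AB.subspaceI)
    (auto simp: AB.pure_zero AB.pure_add AB.pure_rat ABC.sub_zero[OF cf] ABC.sub_add[OF cf] ABC.sub_smult[OF cf])
  then have "tensor_family A B P Q p <= {s \<in> carrier (tensor A B). AB.pr s 1 \<in> ?N}"
  proof (rule tensor_family_least[OF A B P Q])
   fix i j x y assume "i + j = p" and x: "x \<in> P i" and y: "y \<in> Q j"
   note xc = A.sub_mem[OF P x] and yc = B.sub_mem[OF Q y]
   have "ct A B (A.pr x 1) (B.pr y 1) \<in> ?N"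
    by (rule cfamily_pure[where P = "\<lambda>i. cspan A (P i)" and Q = "\<lambda>i. cspan B (Q i)" and i = i and j = j])
     (use A.cspan_pure[OF A.sub_le[OF P] x] B.cspan_pure[OF B.sub_le[OF Q] y] \<open>i + j = p\<close> in auto)
   then show "tpure A B x y \<in> {s \<in> carrier (tensor A B). AB.pr s 1 \<in> ?N}"
    unfolding ct_pure[OF A B xc yc] using tpure_closed[OF A B xc yc] by simp
  qed
  then show "cspan (tensor A B) (tensor_family A B P Q p) <= ?N"
   by (intro AB.cspan_least[OF AB.sub_le[OF tf] cf]) blast
  show "?N <= cspan (tensor A B) (tensor_family A B P Q p)"
  proof (rule cfamily_least[OF A B PC QC AB.cspan_subspace[OF AB.sub_le[OF tf]]])
   fix i j \<xi> \<eta> assume ij: "i + j = p" and \<xi>: "\<xi> \<in> cspan A (P i)" and \<eta>: "\<eta> \<in> cspan B (Q j)"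
   show "ct A B \<xi> \<eta> \<in> cspan (tensor A B) (tensor_family A B P Q p)"
   proof (rule bil_span_into[OF ct_bil[OF A B] A.vec_VC B.vec_VC AB.vec_VC
      AB.cspan_subspace[OF AB.sub_le[OF tf]] A.cspan_gens[OF A.sub_le[OF P]] B.cspan_gens[OF B.sub_le[OF Q]]
      _ \<xi>[unfolded cspan_def] \<eta>[unfolded cspan_def]])
    fix s t assume "s \<in> {A.pr x 1 | x. x \<in> P i}" "t \<in> {B.pr x 1 | x. x \<in> Q j}"
    then obtain x y where x: "s = A.pr x 1" "x \<in> P i" and y: "t = B.pr y 1" "y \<in> Q j" by blast
    have "tpure A B x y \<in> tensor_family A B P Q p"
     by (rule tensor_family_pure[where P = P and Q = Q, OF x(2) y(2) ij])
    then show "ct A B s t \<in> cspan (tensor A B) (tensor_family A B P Q p)"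
     unfolding x(1) y(1) ct_pure[OF A B A.sub_mem[OF P x(2)] B.sub_mem[OF Q y(2)]]
     by (rule AB.cspan_pure[OF AB.sub_le[OF tf]])
   qed
  qed
 qed
qed

section \<open>Pure Hodge structures on the graded pieces\<close>

locale hodge_filtered = filtered V W for V :: "'u::infinite qvs" and W +
 fixes F :: "int => 'u cplx set"
 assumes F: "dec_filtration (complexify V) F"
begin

sublocale CV: cspace V
 by (rule cspaceI[OF vs])

abbreviation "VC \<equiv> complexify V"

sublocale C: vspace VC
 by (rule vsI, rule CV.vec_VC)

abbreviation "cj \<equiv> conj_map V"
abbreviation "wc n \<equiv> cspan V (W n)"

lemma sF: "subspace_of (F p) VC"
 using F by (simp add: dec_filtration_def)

lemma F_dec: "p \<le> q ==> F q <= F p"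
 using F by (auto simp: dec_filtration_def dest: antimonoD)

lemma swc: "subspace_of (wc n) VC"
 by (rule CV.cspan_subspace[OF sub_le[OF sW]])

lemma wc_inc: "m \<le> n ==> wc m <= wc n"
 by (rule CV.cspan_mono[OF W_mono])

lemma wc_zero: "\<exists>n. wc n = {\<zero>\<^bsub>VC\<^esub>}"
proof -
 obtain n where "W n = {\<zero>\<^bsub>V\<^esub>}" using W unfolding inc_filtration_def by blast
 then show ?thesis using CV.cspan_zero by (intro exI[of _ n]) simp
qed

lemma wc_full: "\<exists>n. wc n = carrier VC"
proof -
 obtain n where "W n = carrier V" using W unfolding inc_filtration_def by blast
 then show ?thesis using CV.cspan_carrier by (intro exI[of _ n]) simp
qed

lemma cj_wc: "x \<in> wc n ==> cj x \<in> wc n"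
 by (rule CV.cspan_conj[OF sub_le[OF sW]])

lemma cj_zero: "cj \<zero>\<^bsub>VC\<^esub> = \<zero>\<^bsub>VC\<^esub>"
 using CV.conj_map_smult[OF C.M.zero_closed, of 0] CV.conj_mem[OF C.M.zero_closed] by simp

lemma scjF: "subspace_of (cj ` F p) VC"
proof (rule C.subspaceI)
 note cF = C.sub_mem[OF sF]
 show "cj ` F p <= carrier VC" using CV.conj_mem cF by auto
 show "\<zero>\<^bsub>VC\<^esub> \<in> cj ` F p" using C.sub_zero[OF sF] cj_zero by (metis image_eqI)
 show "x \<oplus>\<^bsub>VC\<^esub> y \<in> cj ` F p" if xy: "x \<in> cj ` F p" "y \<in> cj ` F p" for x y
 proof -
  obtain a b where "a \<in> F p" "b \<in> F p" "x = cj a" "y = cj b" using xy by blast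
  then have "x \<oplus>\<^bsub>VC\<^esub> y = cj (a \<oplus>\<^bsub>VC\<^esub> b)" "a \<oplus>\<^bsub>VC\<^esub> b \<in> F p"
   using cF CV.conj_map_add C.sub_add[OF sF] by auto
  then show ?thesis by blast
 qed
 show "c \<odot>\<^bsub>VC\<^esub> x \<in> cj ` F p" if x: "x \<in> cj ` F p" for c x
 proof -
  obtain y where y: "y \<in> F p" "x = cj y" using x by blast
  have "c \<odot>\<^bsub>VC\<^esub> x = cj (cnj c \<odot>\<^bsub>VC\<^esub> y)" using CV.conj_map_smult[OF cF[OF y(1)], of "cnj c"] y(2) by simp
  then show ?thesis using C.sub_smult[OF sF y(1)] by blast
 qed
qed

lemma cj_image: "g \<in> cj ` F q ==> cj g \<in> F q"
 using C.sub_mem[OF sF] CV.conj_map_conj by auto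

abbreviation "SW m \<equiv> sub V (W m)"
abbreviation "SC m \<equiv> complexify (SW m)"
abbreviation "GC m \<equiv> complexify (GrW m)"
definition inc :: "int => 'u cplx => 'u cplx" where "inc m = complexify_map (SW m) V (\<lambda>x. x)"
definition prj :: "int => 'u cplx => 'u set cplx" where "prj m = complexify_map (SW m) (GrW m) (\<lambda>x. W (m - 1) +>\<^bsub>V\<^esub> x)"

lemma incl_lin: "is_lin (SW m) V (\<lambda>x. x)"
 by (rule is_lin_incl[OF sub_le[OF sW]])

lemma inc_lin: "is_lin (SC m) VC (inc m)"
 unfolding inc_def by (rule cmap_lin[OF vec_sub vs incl_lin])

lemma prj_lin: "is_lin (SC m) (GC m) (prj m)"
 unfolding prj_def by (rule cmap_lin[OF vec_sub vec_GrW GrW_proj_lin])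

lemma SC_vec: "vec_space (SC m)"
 by (rule vec_complexify[OF vec_sub])

lemma GC_vec: "vec_space (GC m)"
 by (rule vec_complexify[OF vec_GrW])

sublocale IC: vpair "SC m" VC for m
 by (rule vpairI[OF SC_vec C.vs])

sublocale QC: vpair "SC m" "GC m" for m
 by (rule vpairI[OF SC_vec GC_vec])

lemma inc_image: "inc m ` carrier (SC m) = wc m"
 unfolding inc_def by (rule cspan_image[OF vs sW])

text \<open>A linear retraction onto \<open>W m\<close> complexifies to a left inverse.\<close>

lemma inc_inj: "inj_on (inc m) (carrier (SC m))"
proof -
 obtain r where r: "is_lin V V r" "\<And>x. x \<in> carrier V ==> r x \<in> W m" "\<And>x. x \<in> W m ==> r x = x"
  using retraction_exists[OF sW] by blast
 have r': "is_lin V (SW m) r" using r(1,2) unfolding is_lin_def by (auto simp: sub_simps)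
 have c: "is_lin (SW m) (SW m) (\<lambda>x. r x)" by (rule is_lin_comp[OF incl_lin r'])
 show ?thesis
 proof (rule inj_on_inverseI[where g = "complexify_map V (SW m) r"])
 fix t assume t: "t \<in> carrier (SC m)"
 have "complexify_map V (SW m) r (inc m t) = complexify_map (SW m) (SW m) (\<lambda>x. r x) t"
  unfolding inc_def by (rule cmap_comp[OF vec_sub vs vec_sub incl_lin r' c _ t]) simp
 also have "\<dots> = t" by (rule cmap_id[OF vec_sub c _ t]) (simp add: sub_simps r(3))
 finally show "complexify_map V (SW m) r (inc m t) = t" .
 qed
qed

lemma prj_surj: "prj m ` carrier (SC m) = carrier (GC m)"
proof
 interpret S: cspace "SW m" by (rule cspaceI[OF vec_sub])
 interpret G: cspace "GrW m" by (rule cspaceI[OF vec_GrW])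
 show "prj m ` carrier (SC m) <= carrier (GC m)" using lin_mem[OF prj_lin] by blast
 have "linear_span (GC m) {G.pr x 1 | x. x \<in> carrier (GrW m)} <= prj m ` carrier (SC m)"
 proof (rule QC.W.span_least[OF QC.image_sub[OF prj_lin IC.V.carrier_sub]], clarify)
  fix X assume "X \<in> carrier (GrW m)"
  then obtain x where x: "X = W (m - 1) +>\<^bsub>V\<^esub> x" "x \<in> W m" unfolding GrW_carrier by blast
  have xS: "x \<in> carrier (SW m)" using x(2) by (simp add: sub_simps)
  have "G.pr X 1 = prj m (S.pr x 1)"
   unfolding prj_def x(1) using cmap_pure[OF vec_sub vec_GrW GrW_proj_lin xS] by simp
  then show "G.pr X 1 \<in> prj m ` carrier (SC m)" using S.pure_closed[OF xS] by blast
 qed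
 then show "carrier (GC m) <= prj m ` carrier (SC m)" unfolding G.VC_span .
qed

text \<open>Right exactness, read inside \<open>VC\<close>. A retraction \<open>\<rho>\<close> onto
  \<open>W (m - 1)\<close> writes the identity of \<open>W m\<close> as \<open>\<rho>\<close> plus a
  map that factors through the graded piece; if the image of \<open>t\<close> there is zero,
  \<open>t\<close> is fixed by the complexified \<open>\<rho>\<close>.\<close>

lemma prj_zero_iff:
 assumes t: "t \<in> carrier (SC m)"
 shows "prj m t = \<zero>\<^bsub>GC m\<^esub> \<longleftrightarrow> inc m t \<in> wc (m - 1)"
proof
 interpret S: cspace "SW m" by (rule cspaceI[OF vec_sub])
 interpret G: cspace "GrW m" by (rule cspaceI[OF vec_GrW])
 interpret SS: vpair "SW m" "SW m" by (rule vpairI; rule vec_sub)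
 have sub1: "W (m - 1) <= carrier (SW m)" using W_mono[of "m - 1" m] by (simp add: sub_simps)
 {
  assume "inc m t \<in> wc (m - 1)"
  \<comment> \<open>The generators come from elements killed by \<open>prj m\<close>; injectivity of
    \<open>inc m\<close> then identifies \<open>t\<close> with such an element.\<close>
  have "wc (m - 1) <= inc m ` {s \<in> carrier (SC m). prj m s \<in> {\<zero>\<^bsub>GC m\<^esub>}}"
  proof (rule CV.cspan_least[OF sub_le[OF sW] IC.image_sub[OF inc_lin QC.preimage_sub[OF prj_lin QC.W.zero_sub]]])
   fix x assume x: "x \<in> W (m - 1)"
   have xS: "x \<in> carrier (SW m)" using x sub1 by blast
   have "prj m (S.pr x 1) = G.pr (W (m - 1) +>\<^bsub>V\<^esub> x) 1"
    unfolding prj_def by (rule cmap_pure[OF vec_sub vec_GrW GrW_proj_lin xS])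
   also have "W (m - 1) +>\<^bsub>V\<^esub> x = \<zero>\<^bsub>GrW m\<^esub>" using x GrW_proj_zero[OF sub_mem[OF sW x]] by simp
   finally have "prj m (S.pr x 1) = \<zero>\<^bsub>GC m\<^esub>" by (simp add: G.pure_zero)
   moreover have "CV.pr x 1 = inc m (S.pr x 1)"
    unfolding inc_def by (rule cmap_pure[OF vec_sub vs incl_lin xS, symmetric])
   ultimately show "CV.pr x 1 \<in> inc m ` {s \<in> carrier (SC m). prj m s \<in> {\<zero>\<^bsub>GC m\<^esub>}}"
    using S.pure_closed[OF xS] by blast
  qed
  then obtain s where s: "s \<in> carrier (SC m)" "prj m s = \<zero>\<^bsub>GC m\<^esub>" "inc m t = inc m s"
   using \<open>inc m t \<in> wc (m - 1)\<close> by blast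
  then show "prj m t = \<zero>\<^bsub>GC m\<^esub>" using inj_onD[OF inc_inj s(3) t s(1)] by simp
 }
 assume z: "prj m t = \<zero>\<^bsub>GC m\<^esub>"
 obtain \<rho> where \<rho>: "is_lin (SW m) (SW m) \<rho>" "\<And>x. x \<in> carrier (SW m) ==> \<rho> x \<in> W (m - 1)"
  "\<And>x. x \<in> W (m - 1) ==> \<rho> x = x"
  using S.retraction_exists[OF sub_sub] by blast
 have \<sigma>: "is_lin (SW m) (SW m) (\<lambda>x. x \<ominus>\<^bsub>SW m\<^esub> \<rho> x)"
  by (rule SS.is_lin_minus_map[OF is_lin_id \<rho>(1)])
 have k: "x \<ominus>\<^bsub>SW m\<^esub> \<rho> x = \<zero>\<^bsub>SW m\<^esub>" if "x \<in> W (m - 1)" for x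
  unfolding \<rho>(3)[OF that] using that sub1 by (intro S.diff_self) blast
 obtain \<tau> where \<tau>: "is_lin (GrW m) (SW m) \<tau>" "\<And>x. x \<in> carrier (SW m) ==> \<tau> (W (m - 1) +>\<^bsub>V\<^esub> x) = x \<ominus>\<^bsub>SW m\<^esub> \<rho> x"
  using S.quot_lift[OF sub_sub \<sigma> vec_sub k] unfolding coset_sub GrW_def by blast
 note \<rho>C = cmap_lin[OF vec_sub vec_sub \<rho>(1)] and \<tau>C = cmap_lin[OF vec_GrW vec_sub \<tau>(1)]
 interpret SCC: vpair "SC m" "SC m" by (rule vpairI[OF SC_vec SC_vec])
 \<comment> \<open>The decomposition of the identity of \<open>SW m\<close>, complexified and
   evaluated at \<open>t\<close>.\<close>
 have "t = complexify_map (GrW m) (SW m) \<tau> (prj m t) \<oplus>\<^bsub>SC m\<^esub> complexify_map (SW m) (SW m) \<rho> t"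
 proof (rule S.VC_ext[OF SC_vec is_lin_id SCC.is_lin_plus[OF is_lin_comp[OF prj_lin \<tau>C] \<rho>C] _ t])
  fix x assume x: "x \<in> carrier (SW m)"
  have "W (m - 1) +>\<^bsub>V\<^esub> x \<in> carrier (GrW m)" using x by (auto simp: GrW_carrier sub_simps)
  then have "complexify_map (GrW m) (SW m) \<tau> (prj m (S.pr x 1)) = S.pr (x \<ominus>\<^bsub>SW m\<^esub> \<rho> x) 1"
   unfolding prj_def cmap_pure[OF vec_sub vec_GrW GrW_proj_lin x]
   by (simp add: cmap_pure[OF vec_GrW vec_sub \<tau>(1)] \<tau>(2)[OF x])
  moreover have "complexify_map (SW m) (SW m) \<rho> (S.pr x 1) = S.pr (\<rho> x) 1"
   by (rule cmap_pure[OF vec_sub vec_sub \<rho>(1) x])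
  moreover have "S.pr (x \<ominus>\<^bsub>SW m\<^esub> \<rho> x) 1 \<oplus>\<^bsub>SC m\<^esub> S.pr (\<rho> x) 1 = S.pr ((x \<ominus>\<^bsub>SW m\<^esub> \<rho> x) \<oplus>\<^bsub>SW m\<^esub> \<rho> x) 1"
   by (rule S.pure_add(1)[symmetric]) (use x lin_mem[OF \<rho>(1) x] in simp_all)
  moreover have "(x \<ominus>\<^bsub>SW m\<^esub> \<rho> x) \<oplus>\<^bsub>SW m\<^esub> \<rho> x = x"
   by (rule S.diff_add_cancel[OF x lin_mem[OF \<rho>(1) x]])
  ultimately show "S.pr x 1 = complexify_map (GrW m) (SW m) \<tau> (prj m (S.pr x 1)) \<oplus>\<^bsub>SC m\<^esub> complexify_map (SW m) (SW m) \<rho> (S.pr x 1)"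
   by simp
 qed
 also have "complexify_map (GrW m) (SW m) \<tau> (prj m t) = \<zero>\<^bsub>SC m\<^esub>"
  unfolding z by (rule vpair.is_lin_zero[OF vpairI[OF GC_vec SC_vec] \<tau>C])
 finally have t\<rho>: "t = complexify_map (SW m) (SW m) \<rho> t" using lin_mem[OF \<rho>C t] by simp
 have "inc m t = inc m (complexify_map (SW m) (SW m) \<rho> t)" using t\<rho> by simp
 also have "\<dots> = complexify_map (SW m) V \<rho> t"
  unfolding inc_def by (rule cmap_comp[OF vec_sub vec_sub vs \<rho>(1) incl_lin _ _ t])
   (use is_lin_comp[OF \<rho>(1) incl_lin] in auto)
 also have "\<dots> \<in> wc (m - 1)"
  by (rule cmap_cspan[OF vec_sub vs is_lin_comp[OF \<rho>(1) incl_lin] _ sub_le[OF sW], where N = "carrier (SW m)"])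
   (use \<rho>(2) t S.cspan_carrier in auto)
 finally show "inc m t \<in> wc (m - 1)" .
qed

lemma inc_conj: "t \<in> carrier (SC m) ==> inc m (conj_map (SW m) t) = cj (inc m t)"
 unfolding inc_def by (rule cmap_conj[OF vec_sub vs incl_lin])

lemma prj_conj: "t \<in> carrier (SC m) ==> prj m (conj_map (SW m) t) = conj_map (GrW m) (prj m t)"
 unfolding prj_def by (rule cmap_conj[OF vec_sub vec_GrW GrW_proj_lin])

lemma conj_SC: "t \<in> carrier (SC m) ==> conj_map (SW m) t \<in> carrier (SC m)"
 by (rule cspace.conj_mem[OF cspaceI[OF vec_sub]])

lemma conj_SC2: "t \<in> carrier (SC m) ==> conj_map (SW m) (conj_map (SW m) t) = t"
 by (rule cspace.conj_map_conj[OF cspaceI[OF vec_sub]])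

lemma prj_eq_iff:
 assumes "s \<in> carrier (SC m)" "t \<in> carrier (SC m)"
 shows "prj m s = prj m t \<longleftrightarrow> inc m s \<ominus>\<^bsub>VC\<^esub> inc m t \<in> wc (m - 1)"
proof -
 have "prj m s = prj m t \<longleftrightarrow> prj m (s \<ominus>\<^bsub>SC m\<^esub> t) = \<zero>\<^bsub>GC m\<^esub>"
  using lin_mem[OF prj_lin] assms by (simp add: QC.is_lin_diff[OF prj_lin])
 also have "\<dots> \<longleftrightarrow> inc m s \<ominus>\<^bsub>VC\<^esub> inc m t \<in> wc (m - 1)"
  using assms by (simp add: prj_zero_iff IC.is_lin_diff[OF inc_lin])
 finally show ?thesis .
qed

definition hod :: "int => int => 'u set cplx set" where
 "hod m p = prj m ` {t \<in> carrier (SC m). inc m t \<in> F p}"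

text \<open>\<open>inc\<close> and \<open>prj\<close> are complexifications of rational maps, so
  both commute with conjugation.\<close>

lemma conj_hod: "conj_map (GrW m) ` hod m q = prj m ` {t \<in> carrier (SC m). inc m t \<in> cj ` F q}"
proof
 show "conj_map (GrW m) ` hod m q <= prj m ` {t \<in> carrier (SC m). inc m t \<in> cj ` F q}"
 proof
  fix Y assume "Y \<in> conj_map (GrW m) ` hod m q"
  then obtain t where t: "t \<in> carrier (SC m)" "inc m t \<in> F q" and Y: "Y = conj_map (GrW m) (prj m t)"
   unfolding hod_def by blast
  then have "conj_map (GrW m) (prj m t) = prj m (conj_map (SW m) t)" "inc m (conj_map (SW m) t) \<in> cj ` F q"
   by (simp_all add: prj_conj inc_conj)
  then show "Y \<in> prj m ` {t \<in> carrier (SC m). inc m t \<in> cj ` F q}"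
   unfolding Y using conj_SC[OF t(1)] by blast
 qed
 show "prj m ` {t \<in> carrier (SC m). inc m t \<in> cj ` F q} <= conj_map (GrW m) ` hod m q"
 proof
  fix Y assume "Y \<in> prj m ` {t \<in> carrier (SC m). inc m t \<in> cj ` F q}"
  then obtain t where t: "t \<in> carrier (SC m)" "inc m t \<in> cj ` F q" and Y: "Y = prj m t" by blast
  have "prj m t = conj_map (GrW m) (prj m (conj_map (SW m) t))"
   using prj_conj[OF conj_SC[OF t(1)]] conj_SC2[OF t(1)] by simp
  moreover have "inc m (conj_map (SW m) t) \<in> F q"
   unfolding inc_conj[OF t(1)] by (rule cj_image[OF t(2)])
  ultimately show "Y \<in> conj_map (GrW m) ` hod m q"
   using conj_SC[OF t(1)] unfolding hod_def Y by blast
 qed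
qed

text \<open>Opposedness on the graded piece, restated in \<open>VC\<close> modulo
  \<open>wc (n - 1)\<close>, so that quotients and their complexifications stay out of the linear
  algebra.\<close>

definition opposed_sum_at :: "int => bool" where
 "opposed_sum_at n \<longleftrightarrow> (\<forall>p q x. p + q = n + 1 --> x \<in> wc n -->
   (\<exists>f\<in>F p \<inter> wc n. \<exists>g\<in>cj ` F q \<inter> wc n. \<exists>r\<in>wc (n - 1). x = f \<oplus>\<^bsub>VC\<^esub> g \<oplus>\<^bsub>VC\<^esub> r))"

definition opposed_int_at :: "int => bool" where
 "opposed_int_at n \<longleftrightarrow> (\<forall>p q f g. p + q = n + 1 --> f \<in> F p \<inter> wc n --> g \<in> cj ` F q \<inter> wc n -->
   f \<ominus>\<^bsub>VC\<^esub> g \<in> wc (n - 1) --> f \<in> wc (n - 1))"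

lemma lift_wc: assumes "x \<in> wc m" obtains t where "t \<in> carrier (SC m)" "x = inc m t"
 using assms unfolding inc_image[symmetric] by blast

lemma inc_wc: "t \<in> carrier (SC m) ==> inc m t \<in> wc m"
 unfolding inc_image[symmetric] by blast

text \<open>Elements of the graded piece are lifted along \<open>prj\<close>; by
  \<open>prj_eq_iff\<close> equality there becomes congruence modulo
  \<open>wc (m - 1)\<close>.\<close>

lemma pure_hodgeD:
 assumes "pure_hodge m (GrW m) (hod m)"
 shows "opposed_sum_at m" "opposed_int_at m"
proof -
 have sum: "hod m p <+>\<^bsub>GC m\<^esub> (conj_map (GrW m) ` hod m q) = carrier (GC m)"
  and int: "hod m p \<inter> conj_map (GrW m) ` hod m q = {\<zero>\<^bsub>GC m\<^esub>}" if "p + q = m + 1" for p q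
  using assms that by (auto simp: pure_hodge_def)
 show "opposed_sum_at m" unfolding opposed_sum_at_def
 proof (intro allI impI)
  fix p q x assume pq: "p + q = m + 1" and x: "x \<in> wc m"
  obtain t where t: "t \<in> carrier (SC m)" "x = inc m t" using lift_wc[OF x] .
  have "prj m t \<in> hod m p <+>\<^bsub>GC m\<^esub> (conj_map (GrW m) ` hod m q)"
   unfolding sum[OF pq] by (rule lin_mem[OF prj_lin t(1)])
  then obtain a b where a: "a \<in> carrier (SC m)" "inc m a \<in> F p" and b: "b \<in> carrier (SC m)" "inc m b \<in> cj ` F q"
   and eq: "prj m t = prj m a \<oplus>\<^bsub>GC m\<^esub> prj m b"
   unfolding set_add_def' conj_hod unfolding hod_def by auto
  have ab: "a \<oplus>\<^bsub>SC m\<^esub> b \<in> carrier (SC m)" using a b by simp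
  have "prj m t = prj m (a \<oplus>\<^bsub>SC m\<^esub> b)" unfolding eq is_lin_add[OF prj_lin a(1) b(1)] ..
  then have r: "inc m t \<ominus>\<^bsub>VC\<^esub> inc m (a \<oplus>\<^bsub>SC m\<^esub> b) \<in> wc (m - 1)" unfolding prj_eq_iff[OF t(1) ab] .
  have "x = inc m (a \<oplus>\<^bsub>SC m\<^esub> b) \<oplus>\<^bsub>VC\<^esub> (inc m t \<ominus>\<^bsub>VC\<^esub> inc m (a \<oplus>\<^bsub>SC m\<^esub> b))"
   unfolding t(2) by (rule C.add_diff_cancel_left[OF lin_mem[OF inc_lin t(1)] lin_mem[OF inc_lin ab], symmetric])
  then have "x = inc m a \<oplus>\<^bsub>VC\<^esub> inc m b \<oplus>\<^bsub>VC\<^esub> (inc m t \<ominus>\<^bsub>VC\<^esub> inc m (a \<oplus>\<^bsub>SC m\<^esub> b))"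
   by (simp only: is_lin_add[OF inc_lin a(1) b(1)])
  then show "\<exists>f\<in>F p \<inter> wc m. \<exists>g\<in>cj ` F q \<inter> wc m. \<exists>r\<in>wc (m - 1). x = f \<oplus>\<^bsub>VC\<^esub> g \<oplus>\<^bsub>VC\<^esub> r"
   by (intro rev_bexI[OF IntI[OF a(2) inc_wc[OF a(1)]]] rev_bexI[OF IntI[OF b(2) inc_wc[OF b(1)]]] rev_bexI[OF r])
 qed
 show "opposed_int_at m" unfolding opposed_int_at_def
 proof (intro allI impI)
  fix p q f g assume pq: "p + q = m + 1" and f: "f \<in> F p \<inter> wc m" and g: "g \<in> cj ` F q \<inter> wc m"
   and fg: "f \<ominus>\<^bsub>VC\<^esub> g \<in> wc (m - 1)"
  obtain s where s: "s \<in> carrier (SC m)" "f = inc m s" using lift_wc[of f m] f by blast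
  obtain t where t: "t \<in> carrier (SC m)" "g = inc m t" using lift_wc[of g m] g by blast
  have "prj m s = prj m t" using fg unfolding s(2) t(2) prj_eq_iff[OF s(1) t(1)] .
  moreover have "prj m s \<in> hod m p" using s f unfolding hod_def by blast
  moreover have "prj m t \<in> conj_map (GrW m) ` hod m q" using t g unfolding conj_hod by blast
  ultimately have "prj m s = \<zero>\<^bsub>GC m\<^esub>" using int[OF pq] by auto
  then show "f \<in> wc (m - 1)" unfolding s(2) prj_zero_iff[OF s(1)] .
 qed
qed

lemma pure_hodgeI:
 assumes "opposed_sum_at m" "opposed_int_at m"
 shows "pure_hodge m (GrW m) (hod m)"
 unfolding pure_hodge_def
proof (intro conjI allI impI)
 have pre: "subspace_of {t \<in> carrier (SC m). inc m t \<in> F p} (SC m)" for p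
  by (rule IC.preimage_sub[OF inc_lin sF])
 have shod: "subspace_of (hod m p) (GC m)" for p
  unfolding hod_def by (rule QC.image_sub[OF prj_lin pre])
 have pre': "subspace_of {t \<in> carrier (SC m). inc m t \<in> cj ` F p} (SC m)" for p
  by (rule IC.preimage_sub[OF inc_lin scjF])
 have schod: "subspace_of (conj_map (GrW m) ` hod m p) (GC m)" for p
  unfolding conj_hod by (rule QC.image_sub[OF prj_lin pre'])
 obtain a b where a: "F a = carrier VC" and b: "F b = {\<zero>\<^bsub>VC\<^esub>}" using F unfolding dec_filtration_def by blast
 have "hod m a = carrier (GC m)"
  unfolding hod_def a prj_surj[symmetric] using lin_mem[OF inc_lin] by auto
 moreover have "hod m b = {\<zero>\<^bsub>GC m\<^esub>}"
 proof
  show "hod m b <= {\<zero>\<^bsub>GC m\<^esub>}"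
  proof
   fix Y assume "Y \<in> hod m b"
   then obtain t where t: "t \<in> carrier (SC m)" "inc m t = \<zero>\<^bsub>VC\<^esub>" "Y = prj m t" unfolding hod_def b by blast
   have "inc m t \<in> wc (m - 1)" unfolding t(2) by (rule C.sub_zero[OF swc])
   then show "Y \<in> {\<zero>\<^bsub>GC m\<^esub>}" using prj_zero_iff[OF t(1)] t(3) by simp
  qed
  show "{\<zero>\<^bsub>GC m\<^esub>} <= hod m b" using QC.W.sub_zero[OF shod] by blast
 qed
 moreover have "antimono (hod m)"
  by (rule antimonoI) (use F_dec in \<open>auto simp: hod_def\<close>)
 ultimately show "dec_filtration (complexify (GrW m)) (hod m)"
  unfolding dec_filtration_def using shod by blast
 fix p q :: int assume pq: "p + q = m + 1"
 show "hod m p <+>\<^bsub>complexify (GrW m)\<^esub> (conj_map (GrW m) ` hod m q) = carrier (complexify (GrW m))"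
 proof
  show "hod m p <+>\<^bsub>GC m\<^esub> (conj_map (GrW m) ` hod m q) <= carrier (GC m)"
  proof
   fix X assume "X \<in> hod m p <+>\<^bsub>GC m\<^esub> (conj_map (GrW m) ` hod m q)"
   then obtain a b where "a \<in> hod m p" "b \<in> conj_map (GrW m) ` hod m q" "X = a \<oplus>\<^bsub>GC m\<^esub> b"
    unfolding set_add_def' by blast
   then show "X \<in> carrier (GC m)"
    using QC.W.M.a_closed[OF QC.W.sub_mem[OF shod] QC.W.sub_mem[OF schod]] by blast
  qed
  show "carrier (GC m) <= hod m p <+>\<^bsub>GC m\<^esub> (conj_map (GrW m) ` hod m q)"
  proof
   fix X assume "X \<in> carrier (GC m)"
   then obtain t where t: "t \<in> carrier (SC m)" "X = prj m t" unfolding prj_surj[symmetric] by blast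
   obtain f g r where f: "f \<in> F p" "f \<in> wc m" and g: "g \<in> cj ` F q" "g \<in> wc m" and r: "r \<in> wc (m - 1)"
    and eq: "inc m t = f \<oplus>\<^bsub>VC\<^esub> g \<oplus>\<^bsub>VC\<^esub> r"
    using assms(1)[unfolded opposed_sum_at_def, rule_format, OF pq inc_wc[OF t(1)]] by blast
   obtain a where a: "a \<in> carrier (SC m)" "f = inc m a" using lift_wc[OF f(2)] .
   obtain b where b: "b \<in> carrier (SC m)" "g = inc m b" using lift_wc[OF g(2)] .
   have ab: "a \<oplus>\<^bsub>SC m\<^esub> b \<in> carrier (SC m)" using a b by simp
   have "inc m t = inc m (a \<oplus>\<^bsub>SC m\<^esub> b) \<oplus>\<^bsub>VC\<^esub> r"
    unfolding eq a(2) b(2) is_lin_add[OF inc_lin a(1) b(1)] ..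
   then have "inc m t \<ominus>\<^bsub>VC\<^esub> inc m (a \<oplus>\<^bsub>SC m\<^esub> b) = r"
    using C.add_diff_cancel'[OF lin_mem[OF inc_lin ab] C.sub_mem[OF swc r]] by simp
   then have "prj m t = prj m (a \<oplus>\<^bsub>SC m\<^esub> b)" unfolding prj_eq_iff[OF t(1) ab] using r by simp
   then have "X = prj m a \<oplus>\<^bsub>GC m\<^esub> prj m b" unfolding t(2) is_lin_add[OF prj_lin a(1) b(1)] .
   moreover have "prj m a \<in> hod m p" unfolding hod_def using a f by blast
   moreover have "prj m b \<in> conj_map (GrW m) ` hod m q" unfolding conj_hod using b g by blast
   ultimately show "X \<in> hod m p <+>\<^bsub>GC m\<^esub> (conj_map (GrW m) ` hod m q)" unfolding set_add_def' by blast
  qed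
 qed
 show "hod m p \<inter> conj_map (GrW m) ` hod m q = {\<zero>\<^bsub>complexify (GrW m)\<^esub>}"
 proof
  show "{\<zero>\<^bsub>GC m\<^esub>} <= hod m p \<inter> conj_map (GrW m) ` hod m q"
   using QC.W.sub_zero[OF shod] QC.W.sub_zero[OF schod] by blast
  show "hod m p \<inter> conj_map (GrW m) ` hod m q <= {\<zero>\<^bsub>GC m\<^esub>}"
  proof
   fix X assume X: "X \<in> hod m p \<inter> conj_map (GrW m) ` hod m q"
   then obtain s where s: "s \<in> carrier (SC m)" "inc m s \<in> F p" "X = prj m s" unfolding hod_def by blast
   obtain t where t: "t \<in> carrier (SC m)" "inc m t \<in> cj ` F q" "X = prj m t" using X unfolding conj_hod by blast
   have "inc m s \<ominus>\<^bsub>VC\<^esub> inc m t \<in> wc (m - 1)" using s t prj_eq_iff[OF s(1) t(1)] by simp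
   from assms(2)[unfolded opposed_int_at_def, rule_format, OF pq IntI[OF s(2) inc_wc[OF s(1)]]
     IntI[OF t(2) inc_wc[OF t(1)]] this]
   have "inc m s \<in> wc (m - 1)" .
   then show "X \<in> {\<zero>\<^bsub>GC m\<^esub>}" using prj_zero_iff[OF s(1)] s(3) by simp
  qed
 qed
qed

lemma core_conj:
 assumes "\<And>m. opposed_sum_at m" "\<And>m. opposed_int_at m"
 shows "hodge_core_conj VC F (\<lambda>p. cj ` F p) wc cj"
proof (intro hodge_core_conj.intro hodge_core.intro hodge_core_axioms.intro hodge_core_conj_axioms.intro)
 obtain a b where a: "F a = carrier VC" and b: "F b = {\<zero>\<^bsub>VC\<^esub>}" using F unfolding dec_filtration_def by blast
 show "vspace VC" by (rule C.vspace_axioms)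
 show "\<exists>p. F p = carrier VC" "\<exists>p. F p = {\<zero>\<^bsub>VC\<^esub>}" using a b by blast+
 have "cj ` carrier VC = carrier VC"
 proof
  show "cj ` carrier VC <= carrier VC" using CV.conj_mem by blast
  show "carrier VC <= cj ` carrier VC"
  proof
   fix x assume "x \<in> carrier VC"
   then show "x \<in> cj ` carrier VC" by (intro image_eqI[of x cj "cj x"] CV.conj_mem CV.conj_map_conj[symmetric])
  qed
 qed
 then show "\<exists>p. cj ` F p = carrier VC" unfolding a[symmetric] by blast
 have "cj ` F b = {\<zero>\<^bsub>VC\<^esub>}" using b cj_zero by simp
 then show "\<exists>p. cj ` F p = {\<zero>\<^bsub>VC\<^esub>}" by blast
 show "\<exists>n. wc n = carrier VC" "\<exists>n. wc n = {\<zero>\<^bsub>VC\<^esub>}" by (rule wc_full wc_zero)+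
 show "p \<le> q ==> cj ` F q <= cj ` F p" for p q using F_dec by blast
 show "\<exists>f\<in>F p \<inter> wc n. \<exists>g\<in>cj ` F q \<inter> wc n. \<exists>r\<in>wc (n - 1). x = f \<oplus>\<^bsub>VC\<^esub> g \<oplus>\<^bsub>VC\<^esub> r"
  if "p + q = n + 1" "x \<in> wc n" for p q n x
  by (rule assms(1)[unfolded opposed_sum_at_def, rule_format, OF that])
 show "f \<in> wc (n - 1)" if "p + q = n + 1" "f \<in> F p \<inter> wc n" "g \<in> cj ` F q \<inter> wc n" "f \<ominus>\<^bsub>VC\<^esub> g \<in> wc (n - 1)" for p q n f g
  by (rule assms(2)[unfolded opposed_int_at_def, rule_format, OF that])
qed (simp_all add: sF scjF swc F_dec wc_inc CV.conj_mem CV.conj_map_add CV.conj_map_smult CV.conj_map_conj cj_wc)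

lemma operator_pure_hodge:
 assumes "hodge_operator VC F wc J cj P"
 shows "pure_hodge m (GrW m) (hod m)"
proof (rule pure_hodgeI)
 interpret hodge_operator VC F wc J cj P by (rule assms)
 show "opposed_sum_at m" unfolding opposed_sum_at_def by (intro allI impI) (rule opposed_sum)
 show "opposed_int_at m" unfolding opposed_int_at_def by (intro allI impI) (rule opposed_int)
qed

end

section \<open>Mixed Hodge structures\<close>

text \<open>Two conjugate-linear maps around a linear one give a linear map again.\<close>

lemma (in cspace) conj_lin: "is_lin VC VC P ==> is_lin VC VC (\<lambda>x. conj_map V (P (conj_map V x)))"
 by (rule is_linI) (auto simp: conj_mem conj_map_add conj_map_smult lin_mem is_lin_add is_lin_smult)

locale mhs_object =
 fixes A :: "'u::infinite mhs"
 assumes mhs: "is_mhs A"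
begin

sublocale hodge_filtered "space A" "weight A" "hodge A"
 using mhs by (intro hodge_filtered.intro filtered.intro vspace.intro filtered_axioms.intro hodge_filtered_axioms.intro)
  (simp_all add: is_mhs_def)

lemma hodge_on_Gr_eq: "hodge_on_Gr A m p = hod m p"
 unfolding hodge_on_Gr_def hod_def inc_def prj_def Let_def
 by (simp add: Gr_eq_GrW[OF filtered_axioms])

sublocale K: hodge_core_conj "complexify (space A)" "hodge A" "\<lambda>p. conj_map (space A) ` hodge A p"
  "\<lambda>n. cspan (space A) (weight A n)" "conj_map (space A)"
proof (rule core_conj)
 have "pure_hodge m (GrW m) (hod m)" for m
  using mhs by (simp add: is_mhs_def Gr_eq_GrW[OF filtered_axioms] hodge_on_Gr_eq[abs_def])
 then show "opposed_sum_at m" "opposed_int_at m" for m by (rule pure_hodgeD)+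
qed

end

text \<open>The criterion by which tensor products and the unit are recognized: a suitable operator
  is exhibited in place of opposed filtrations.\<close>

lemma is_mhsI:
 fixes A :: "'u::infinite mhs"
 assumes "vec_space (space A)" "fin_dim (space A)" "inc_filtration (space A) (weight A)"
  and "dec_filtration (complexify (space A)) (hodge A)"
  and op: "hodge_operator (complexify (space A)) (hodge A) (\<lambda>n. cspan (space A) (weight A n)) J (conj_map (space A)) P"
 shows "is_mhs A"
proof -
 interpret hodge_filtered "space A" "weight A" "hodge A"
  using assms by (intro hodge_filtered.intro filtered.intro vspace.intro filtered_axioms.intro hodge_filtered_axioms.intro)
 have "hodge_on_Gr A m p = hod m p" for m p
  unfolding hodge_on_Gr_def hod_def inc_def prj_def Let_def by (simp add: Gr_eq_GrW[OF filtered_axioms])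
 then have "hodge_on_Gr A m = hod m" for m by (rule ext)
 then show ?thesis
  using assms operator_pure_hodge[OF op] by (simp add: is_mhs_def Gr_eq_GrW[OF filtered_axioms])
qed

section \<open>Tensor products and the unit of mixed Hodge structures\<close>

lemma fin_dim_tensor:
 fixes A B :: "'u::infinite qvs"
 assumes A: "vec_space A" "fin_dim A" and B: "vec_space B" "fin_dim B"
 shows "fin_dim (tensor A B)"
proof -
 interpret AB: vspace "tensor A B" by (rule vsI, rule vec_tensor[OF A(1) B(1)])
 obtain S T where S: "finite S" "S <= carrier A" "linear_span A S = carrier A"
  and T: "finite T" "T <= carrier B" "linear_span B T = carrier B"
  using A B unfolding fin_dim_def by blast
 let ?G = "(\<lambda>(x, y). tpure A B x y) ` (S \<times> T)"
 have G: "?G <= carrier (tensor A B)" using tpure_closed[OF A(1) B(1) subsetD[OF S(2)] subsetD[OF T(2)]] by auto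
 note N = AB.span_sub[OF G]
 have "tpure A B x y \<in> linear_span (tensor A B) ?G" if "x \<in> carrier A" "y \<in> carrier B" for x y
 proof (rule bil_span_into[OF bil_tpure[OF A(1) B(1)] A(1) B(1) AB.vs N S(2) T(2)])
  show "x \<in> linear_span A S" "y \<in> linear_span B T" using that S(3) T(3) by simp_all
  show "tpure A B s t \<in> linear_span (tensor A B) ?G" if "s \<in> S" "t \<in> T" for s t
   by (rule AB.span_base, rule image_eqI[of _ _ "(s, t)"]) (use that in simp_all)
 qed
 then have "carrier (tensor A B) <= linear_span (tensor A B) ?G"
  unfolding tensor_span[OF A(1) B(1), symmetric] by (intro AB.span_least[OF N]) blast
 then have "linear_span (tensor A B) ?G = carrier (tensor A B)" using AB.sub_le[OF N] by blast
 then show ?thesis unfolding fin_dim_def using G S(1) T(1) by (intro exI[of _ ?G]) simp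
qed

locale mhs_objects = A: mhs_object A + B: mhs_object B for A B :: "'u::infinite mhs"
begin

abbreviation "a \<equiv> space A"
abbreviation "b \<equiv> space B"
abbreviation "TC \<equiv> complexify (tensor a b)"
abbreviation "JT \<equiv> cfamily a b A.K.J B.K.J"
abbreviation "FT \<equiv> cfamily a b (hodge A) (hodge B)"

sublocale T: cspace "tensor a b"
 by (rule cspaceI[OF vec_tensor[OF A.vs B.vs]])

sublocale TC: vspace TC
 by (rule vsI, rule T.vec_VC)

lemmas hodge_sub = A.C.sub_le[OF A.sF] B.C.sub_le[OF B.sF]
lemmas J_sub = A.C.sub_le[OF A.K.sJ] B.C.sub_le[OF B.K.sJ]
lemmas wc_sub = A.C.sub_le[OF A.swc] B.C.sub_le[OF B.swc]
lemmas sFT = cfamily_sub[where P = "hodge A" and Q = "hodge B", OF A.vs B.vs hodge_sub]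
lemmas sJT = cfamily_sub[where P = A.K.J and Q = B.K.J, OF A.vs B.vs J_sub]
lemmas ctb = ct_bil[OF A.vs B.vs]
lemmas wcT = cspan_tensor_family[where P = "weight A" and Q = "weight B", OF A.vs B.vs A.sW B.sW]
lemmas swcT = cfamily_sub[where P = A.wc and Q = B.wc, OF A.vs B.vs wc_sub]
lemmas ct_closed = bil_closed[OF ctb]
lemmas ct_smult = is_lin_smult[OF bil_left[OF ctb]] is_lin_smult[OF bil_right[OF ctb]]
lemmas ct_add = is_lin_add[OF bil_left[OF ctb]] is_lin_add[OF bil_right[OF ctb]]

lemma ct_zero:
 assumes "\<xi> \<in> carrier A.VC" "\<eta> \<in> carrier B.VC"
 shows "ct a b \<zero>\<^bsub>A.VC\<^esub> \<eta> = \<zero>\<^bsub>TC\<^esub>" "ct a b \<xi> \<zero>\<^bsub>B.VC\<^esub> = \<zero>\<^bsub>TC\<^esub>"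
 using vpair.is_lin_zero[OF vpairI[OF A.C.vs TC.vs] bil_left[OF ctb assms(2)]]
  vpair.is_lin_zero[OF vpairI[OF B.C.vs TC.vs] bil_right[OF ctb assms(1)]] by simp_all

lemma FT_dec_filtration: "dec_filtration TC FT"
proof -
 obtain i0 i1 j0 j1 where 0: "hodge A i0 = {\<zero>\<^bsub>A.VC\<^esub>}" "hodge A i1 = carrier A.VC"
  "hodge B j0 = {\<zero>\<^bsub>B.VC\<^esub>}" "hodge B j1 = carrier B.VC"
  using A.F B.F unfolding dec_filtration_def by metis
 have "antimono FT"
 proof (rule antimonoI)
  fix p q :: int assume "p \<le> q"
  show "FT q \<le> FT p"
  proof (rule cfamily_least[OF A.vs B.vs hodge_sub sFT])
   fix i j x y assume "i + j = q" "x \<in> hodge A i" "y \<in> hodge B j"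
   moreover have "hodge A i <= hodge A (i - (q - p))" using \<open>p \<le> q\<close> by (intro A.F_dec) simp
   ultimately show "ct a b x y \<in> FT p"
    by (intro cfamily_pure[where P = "hodge A" and Q = "hodge B" and i = "i - (q - p)" and j = j]) auto
  qed
 qed
 moreover have "FT (i0 + j0) = {\<zero>\<^bsub>TC\<^esub>}"
 proof
  show "FT (i0 + j0) <= {\<zero>\<^bsub>TC\<^esub>}"
  proof (rule cfamily_least[OF A.vs B.vs hodge_sub TC.zero_sub])
   fix i j x y assume "i + j = i0 + j0" and x: "x \<in> hodge A i" and y: "y \<in> hodge B j"
   then have "i0 \<le> i \<or> j0 \<le> j" by linarith
   then have "x = \<zero>\<^bsub>A.VC\<^esub> \<or> y = \<zero>\<^bsub>B.VC\<^esub>" using A.F_dec[of i0 i] B.F_dec[of j0 j] x y 0 by blast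
   then show "ct a b x y \<in> {\<zero>\<^bsub>TC\<^esub>}"
    using ct_zero[OF A.C.sub_mem[OF A.sF x] B.C.sub_mem[OF B.sF y]] by auto
  qed
  show "{\<zero>\<^bsub>TC\<^esub>} <= FT (i0 + j0)" using TC.sub_zero[OF sFT] by blast
 qed
 moreover have "FT (i1 + j1) = carrier TC"
 proof
  show "FT (i1 + j1) <= carrier TC" by (rule TC.sub_le[OF sFT])
  show "carrier TC <= FT (i1 + j1)"
   unfolding ct_span[OF A.vs B.vs, symmetric]
  proof (rule TC.span_least[OF sFT], clarify)
   fix \<xi> \<eta> assume "\<xi> \<in> carrier A.VC" "\<eta> \<in> carrier B.VC"
   then show "ct a b \<xi> \<eta> \<in> FT (i1 + j1)"
    by (intro cfamily_pure[where P = "hodge A" and Q = "hodge B" and i = i1 and j = j1]) (simp_all add: 0)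
  qed
 qed
 ultimately show ?thesis unfolding dec_filtration_def using sFT by blast
qed

text \<open>\<open>F_span\<close> holds in both factors, and indices add under products.\<close>

lemma FT_span: "FT p = linear_span TC (\<Union>r\<in>{p..}. JT r)"
proof
 have c: "(\<Union>r\<in>{p..}. JT r) <= carrier TC" using TC.sub_le[OF sJT] by blast
 note N = TC.span_sub[OF c]
 show "FT p <= linear_span TC (\<Union>r\<in>{p..}. JT r)"
 proof (rule cfamily_least[OF A.vs B.vs hodge_sub N])
  fix i j x y assume ij: "i + j = p" and x: "x \<in> hodge A i" and y: "y \<in> hodge B j"
  show "ct a b x y \<in> linear_span TC (\<Union>r\<in>{p..}. JT r)"
  proof (rule bil_span_into[OF ctb A.C.vs B.C.vs TC.vs N A.K.J_union_le B.K.J_union_le _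
     subsetD[OF equalityD1[OF A.K.F_span] x] subsetD[OF equalityD1[OF B.K.F_span] y]])
   fix s t assume "s \<in> (\<Union>r\<in>{i..}. A.K.J r)" "t \<in> (\<Union>r\<in>{j..}. B.K.J r)"
   then obtain k l where kl: "i \<le> k" "j \<le> l" "s \<in> A.K.J k" "t \<in> B.K.J l" by auto
   have "ct a b s t \<in> JT (k + l)" by (rule cfamily_pure[where P = A.K.J and Q = B.K.J, OF kl(3,4) refl])
   then show "ct a b s t \<in> linear_span TC (\<Union>r\<in>{p..}. JT r)"
    using kl ij by (intro TC.span_base) force
  qed
 qed
 show "linear_span TC (\<Union>r\<in>{p..}. JT r) <= FT p"
 proof (rule TC.span_least[OF sFT], rule UN_least)
  fix r assume r: "r \<in> {p..}"
  have "JT r <= FT r"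
  proof (rule cfamily_least[OF A.vs B.vs J_sub sFT])
   fix i j x y assume "i + j = r" "x \<in> A.K.J i" "y \<in> B.K.J j"
   then show "ct a b x y \<in> FT r"
    by (intro cfamily_pure[where P = "hodge A" and Q = "hodge B" and i = i and j = j]) (simp_all add: A.K.J_def B.K.J_def)
  qed
  also have "\<dots> <= FT p" using FT_dec_filtration r by (auto simp: dec_filtration_def dest: antimonoD)
  finally show "JT r <= FT p" .
 qed
qed

lemma JT_span: "linear_span TC (\<Union>r. JT r) = carrier TC"
proof
 have c: "(\<Union>r. JT r) <= carrier TC" using TC.sub_le[OF sJT] by blast
 show "linear_span TC (\<Union>r. JT r) <= carrier TC" by (rule TC.sub_le[OF TC.span_sub[OF c]])
 obtain p where p: "FT p = carrier TC" using FT_dec_filtration unfolding dec_filtration_def by blast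
 have "linear_span TC (\<Union>r\<in>{p..}. JT r) <= linear_span TC (\<Union>r. JT r)" by (rule TC.span_mono) blast
 then show "carrier TC <= linear_span TC (\<Union>r. JT r)" using p FT_span[of p] by simp
qed

text \<open>The operator \<open>P \<otimes> 1 + 1 \<otimes> P\<close>, obtained from the universal
  property over the complex numbers; on a product of \<open>J i\<close> and \<open>J j\<close> the
  eigenvalues add.\<close>

lemma derivation:
 obtains D where "is_lin TC TC D"
  "\<And>\<xi> \<eta>. \<xi> \<in> carrier A.VC ==> \<eta> \<in> carrier B.VC ==>
   D (ct a b \<xi> \<eta>) = ct a b (A.K.P \<xi>) \<eta> \<oplus>\<^bsub>TC\<^esub> ct a b \<xi> (B.K.P \<eta>)"
  "\<And>r x. x \<in> JT r ==> D x = of_int r \<odot>\<^bsub>TC\<^esub> x"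
proof -
 have bl: "bil A.VC B.VC TC (\<lambda>\<xi> \<eta>. ct a b (A.K.P \<xi>) \<eta> \<oplus>\<^bsub>TC\<^esub> ct a b \<xi> (B.K.P \<eta>))"
  by (rule bil_plus[OF TC.vs A.C.vs B.C.vs bil_comp2[OF ctb A.K.P_lin is_lin_id] bil_comp2[OF ctb is_lin_id B.K.P_lin]])
 obtain D where D: "is_lin TC TC D" and Dp: "\<And>\<xi> \<eta>. \<xi> \<in> carrier A.VC ==> \<eta> \<in> carrier B.VC ==>
   D (ct a b \<xi> \<eta>) = ct a b (A.K.P \<xi>) \<eta> \<oplus>\<^bsub>TC\<^esub> ct a b \<xi> (B.K.P \<eta>)"
  using ct_lift[OF A.vs B.vs TC.vs bl] by blast
 interpret TT: vpair TC TC by (rule vpairI; rule TC.vs)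
 have "D x \<ominus>\<^bsub>TC\<^esub> of_int r \<odot>\<^bsub>TC\<^esub> x \<in> {\<zero>\<^bsub>TC\<^esub>}" if "x \<in> JT r" for r x
 proof (rule cfamily_image[OF A.vs B.vs J_sub TC.vs TT.is_lin_minus_map[OF D TT.is_lin_scale[OF is_lin_id]]
    TC.zero_sub _ that])
  fix i j \<xi> \<eta> assume ij: "i + j = r" and \<xi>: "\<xi> \<in> A.K.J i" and \<eta>: "\<eta> \<in> B.K.J j"
  note c = A.K.cJ[OF \<xi>] B.K.cJ[OF \<eta>]
  have "D (ct a b \<xi> \<eta>) = of_int r \<odot>\<^bsub>TC\<^esub> ct a b \<xi> \<eta>"
   unfolding Dp[OF c] A.K.P_J[OF \<xi>] B.K.P_J[OF \<eta>] ij[symmetric] of_int_add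
   using c by (simp add: ct_smult ct_closed TC.smult_add_left)
  then show "D (ct a b \<xi> \<eta>) \<ominus>\<^bsub>TC\<^esub> of_int r \<odot>\<^bsub>TC\<^esub> ct a b \<xi> \<eta> \<in> {\<zero>\<^bsub>TC\<^esub>}"
   using ct_closed[OF c] by simp
 qed
 then have "D x = of_int r \<odot>\<^bsub>TC\<^esub> x" if "x \<in> JT r" for r x
  using TC.diff_eq_zero[OF lin_mem[OF D TC.sub_mem[OF sJT that]] TC.smult_closed'[OF TC.sub_mem[OF sJT that]]] that
  by blast
 then show thesis using that[OF D Dp] by blast
qed

text \<open>The defect of the weight relation is itself a derivation: for weights \<open>i\<close>
  and \<open>j\<close> it is the sum of the defects of the two factors, each tensored with the other
  vector, and each factor's defect drops the weight by one.\<close>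

lemma derivation_weight:
 assumes D: "is_lin TC TC D"
  and Dp: "\<And>\<xi> \<eta>. \<xi> \<in> carrier A.VC ==> \<eta> \<in> carrier B.VC ==>
   D (ct a b \<xi> \<eta>) = ct a b (A.K.P \<xi>) \<eta> \<oplus>\<^bsub>TC\<^esub> ct a b \<xi> (B.K.P \<eta>)"
  and x: "x \<in> cfamily a b A.wc B.wc n"
 shows "D x \<in> cfamily a b A.wc B.wc n"
  and "D x \<oplus>\<^bsub>TC\<^esub> conj_map (tensor a b) (D (conj_map (tensor a b) x)) \<ominus>\<^bsub>TC\<^esub> of_int n \<odot>\<^bsub>TC\<^esub> x
   \<in> cfamily a b A.wc B.wc (n - 1)"
proof -
 let ?W = "cfamily a b A.wc B.wc"
 interpret TT: vpair TC TC by (rule vpairI; rule TC.vs)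
 show "D x \<in> ?W n"
 proof (rule cfamily_image[OF A.vs B.vs wc_sub TC.vs D swcT _ x])
  fix i j \<xi> \<eta> assume ij: "i + j = n" and \<xi>: "\<xi> \<in> A.wc i" and \<eta>: "\<eta> \<in> B.wc j"
  have "ct a b (A.K.P \<xi>) \<eta> \<in> ?W n" "ct a b \<xi> (B.K.P \<eta>) \<in> ?W n"
   using cfamily_pure[where P = A.wc and Q = B.wc, OF A.K.P_W[OF \<xi>] \<eta> ij]
    cfamily_pure[where P = A.wc and Q = B.wc, OF \<xi> B.K.P_W[OF \<eta>] ij] by auto
  then show "D (ct a b \<xi> \<eta>) \<in> ?W n"
   unfolding Dp[OF A.K.cW[OF \<xi>] B.K.cW[OF \<eta>]] by (rule TC.sub_add[OF swcT])
 qed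
 show "D x \<oplus>\<^bsub>TC\<^esub> conj_map (tensor a b) (D (conj_map (tensor a b) x)) \<ominus>\<^bsub>TC\<^esub> of_int n \<odot>\<^bsub>TC\<^esub> x \<in> ?W (n - 1)"
 proof (rule cfamily_image[OF A.vs B.vs wc_sub TC.vs
    TT.is_lin_minus_map[OF TT.is_lin_plus[OF D T.conj_lin[OF D]] TT.is_lin_scale[OF is_lin_id]] swcT _ x])
  fix i j \<xi> \<eta> assume ij: "i + j = n" and \<xi>: "\<xi> \<in> A.wc i" and \<eta>: "\<eta> \<in> B.wc j"
  note \<xi>c = A.K.cW[OF \<xi>] and \<eta>c = B.K.cW[OF \<eta>]
  note cl = \<xi>c \<eta>c lin_mem[OF A.K.P_lin \<xi>c] lin_mem[OF B.K.P_lin \<eta>c]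
   lin_mem[OF A.K.Pbar_lin \<xi>c] lin_mem[OF B.K.Pbar_lin \<eta>c]
  let ?t = "ct a b \<xi> \<eta>"
  let ?e = "A.K.P \<xi> \<oplus>\<^bsub>A.VC\<^esub> A.K.Pbar \<xi> \<ominus>\<^bsub>A.VC\<^esub> of_int i \<odot>\<^bsub>A.VC\<^esub> \<xi>"
  let ?f = "B.K.P \<eta> \<oplus>\<^bsub>B.VC\<^esub> B.K.Pbar \<eta> \<ominus>\<^bsub>B.VC\<^esub> of_int j \<odot>\<^bsub>B.VC\<^esub> \<eta>"
  have e: "?e \<in> A.wc (i - 1)" and f: "?f \<in> B.wc (j - 1)"
   by (rule A.K.P_Pbar_W[OF \<xi>], rule B.K.P_Pbar_W[OF \<eta>])
  have c2: "conj_map a \<xi> \<in> carrier A.VC" "conj_map b \<eta> \<in> carrier B.VC"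
   by (rule A.CV.conj_mem[OF \<xi>c], rule B.CV.conj_mem[OF \<eta>c])
  \<comment> \<open>Conjugating the derivation on both sides gives the derivation belonging to the
    conjugate operators.\<close>
  have cj: "conj_map (tensor a b) (D (conj_map (tensor a b) ?t))
    = ct a b (A.K.Pbar \<xi>) \<eta> \<oplus>\<^bsub>TC\<^esub> ct a b \<xi> (B.K.Pbar \<eta>)"
   unfolding ct_conj[OF A.vs B.vs \<xi>c \<eta>c] Dp[OF c2] A.K.Pbar_def B.K.Pbar_def
   using c2 cl by (simp add: T.conj_map_add ct_closed A.K.P_closed B.K.P_closed ct_conj[OF A.vs B.vs]
    A.CV.conj_map_conj B.CV.conj_map_conj)
  have l1: "ct a b ?e \<eta> = ct a b (A.K.P \<xi>) \<eta> \<oplus>\<^bsub>TC\<^esub> ct a b (A.K.Pbar \<xi>) \<eta> \<ominus>\<^bsub>TC\<^esub> of_int i \<odot>\<^bsub>TC\<^esub> ?t"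
   using cl by (simp add: vpair.is_lin_diff[OF vpairI[OF A.C.vs TC.vs] bil_left[OF ctb \<eta>c]] ct_add ct_smult)
  have l2: "ct a b \<xi> ?f = ct a b \<xi> (B.K.P \<eta>) \<oplus>\<^bsub>TC\<^esub> ct a b \<xi> (B.K.Pbar \<eta>) \<ominus>\<^bsub>TC\<^esub> of_int j \<odot>\<^bsub>TC\<^esub> ?t"
   using cl by (simp add: vpair.is_lin_diff[OF vpairI[OF B.C.vs TC.vs] bil_right[OF ctb \<xi>c]] ct_add ct_smult)
  have "D ?t \<oplus>\<^bsub>TC\<^esub> conj_map (tensor a b) (D (conj_map (tensor a b) ?t)) \<ominus>\<^bsub>TC\<^esub> of_int n \<odot>\<^bsub>TC\<^esub> ?t
    = ct a b ?e \<eta> \<oplus>\<^bsub>TC\<^esub> ct a b \<xi> ?f"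
   unfolding cj l1 l2 Dp[OF \<xi>c \<eta>c] ij[symmetric] of_int_add TC.smult_add_left[OF ct_closed[OF \<xi>c \<eta>c]]
    TC.add4[OF ct_closed[OF cl(3,2)] ct_closed[OF cl(1,4)] ct_closed[OF cl(5,2)] ct_closed[OF cl(1,6)]]
   by (rule TC.diff_add_diff) (use cl ct_closed in auto)
  also have "\<dots> \<in> ?W (n - 1)"
   by (rule TC.sub_add[OF swcT cfamily_pure[where P = A.wc and Q = B.wc, OF e \<eta>]
     cfamily_pure[where P = A.wc and Q = B.wc, OF \<xi> f]]) (use ij in auto)
  finally show "D ?t \<oplus>\<^bsub>TC\<^esub> conj_map (tensor a b) (D (conj_map (tensor a b) ?t)) \<ominus>\<^bsub>TC\<^esub> of_int n \<odot>\<^bsub>TC\<^esub> ?t \<in> ?W (n - 1)" .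
 qed
qed

lemma is_mhs_tensor: "is_mhs (mhs_tensor A B)"
proof -
 have s: "space (mhs_tensor A B) = tensor a b" "weight (mhs_tensor A B) = tensor_family a b (weight A) (weight B)"
  "hodge (mhs_tensor A B) = FT"
  by (simp_all add: mhs_tensor_def cfamily_def fun_eq_iff)
 note iW = inc_filtration_tensor[OF A.vs B.vs A.W B.W]
 note tsub = T.sub_le[OF inc_filtration_sub[OF iW]]
 obtain D where D: "is_lin TC TC D"
  and Dp: "\<And>\<xi> \<eta>. \<xi> \<in> carrier A.VC ==> \<eta> \<in> carrier B.VC ==>
   D (ct a b \<xi> \<eta>) = ct a b (A.K.P \<xi>) \<eta> \<oplus>\<^bsub>TC\<^esub> ct a b \<xi> (B.K.P \<eta>)"
  and DJ: "\<And>r x. x \<in> JT r ==> D x = of_int r \<odot>\<^bsub>TC\<^esub> x"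
  using derivation by blast
 have "hodge_operator TC FT (\<lambda>n. cspan (tensor a b) (tensor_family a b (weight A) (weight B) n)) JT (conj_map (tensor a b)) D"
 proof (intro hodge_operator.intro hodge_operator_axioms.intro)
  show "cspan (tensor a b) (tensor_family a b (weight A) (weight B) (n - 1))
    <= cspan (tensor a b) (tensor_family a b (weight A) (weight B) n)" for n
   by (rule T.cspan_mono[OF monoD[OF inc_filtration_mono[OF iW]]]) simp
  show "conj_map (tensor a b) x \<in> cspan (tensor a b) (tensor_family a b (weight A) (weight B) n)"
   if "x \<in> cspan (tensor a b) (tensor_family a b (weight A) (weight B) n)" for x n
   by (rule T.cspan_conj[OF tsub that])
 qed (simp_all add: wcT TC.vspace_axioms swcT sJT T.conj_mem T.conj_map_add T.conj_map_smult T.conj_map_conj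
   D DJ FT_span JT_span derivation_weight[OF D Dp])
 then show ?thesis
  using fin_dim_tensor[OF A.vs _ B.vs] A.mhs B.mhs iW FT_dec_filtration T.vs
  by (intro is_mhsI[where J = JT and P = D]) (simp_all add: s is_mhs_def)
qed

end

text \<open>The unit is pure of type \<open>(0, 0)\<close>: everything lies in \<open>J 0\<close>,
  so the zero operator serves.\<close>

lemma is_mhs_unit: "is_mhs (mhs_unit :: 'u::infinite mhs)"
proof -
 let ?U = "unit_space :: 'u qvs"
 interpret U: cspace ?U by (rule cspaceI[OF vec_unit])
 interpret C: vspace "complexify ?U" by (rule vsI, rule U.vec_VC)
 interpret CC: vpair "complexify ?U" "complexify ?U" by (rule vpairI; rule C.vs)
 let ?J = "\<lambda>r :: int. if r = 0 then carrier (complexify ?U) else {\<zero>\<^bsub>complexify ?U\<^esub>}"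
 let ?F = "\<lambda>p :: int. if p \<le> 0 then carrier (complexify ?U) else {\<zero>\<^bsub>complexify ?U\<^esub>}"
 have "linear_span ?U {rat_embed 1} = carrier ?U"
 proof
  have c: "{rat_embed 1} <= carrier ?U" by (auto simp: unit_carrier)
  note N = U.span_sub[OF c]
  show "linear_span ?U {rat_embed 1} <= carrier ?U" by (rule U.sub_le[OF N])
  show "carrier ?U <= linear_span ?U {rat_embed 1}"
  proof
   fix x assume "x \<in> carrier ?U"
   then obtain q where q: "x = rat_embed q" by (auto simp: unit_carrier)
   have "x = q \<odot>\<^bsub>?U\<^esub> rat_embed 1"
    using is_lin_smult[OF is_lin_rat_embed, of 1 q] by (simp add: q field_space_simps)
   then show "x \<in> linear_span ?U {rat_embed 1}" using U.sub_smult[OF N U.span_base] by simp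
  qed
 qed
 moreover have "rat_embed 1 \<in> carrier ?U" by (simp add: unit_carrier)
 ultimately have fd: "fin_dim ?U" unfolding fin_dim_def by (intro exI[of _ "{rat_embed 1}"]) simp
 have w: "cspan ?U (unit_weight n) = (if n < 0 then {\<zero>\<^bsub>complexify ?U\<^esub>} else carrier (complexify ?U))" for n
  by (simp add: unit_weight_def U.cspan_zero U.cspan_carrier)
 have sub: "subspace_of (if b then carrier (complexify ?U) else {\<zero>\<^bsub>complexify ?U\<^esub>}) (complexify ?U)" for b
  using C.carrier_sub C.zero_sub by simp
 have dF: "dec_filtration (complexify ?U) ?F"
  unfolding dec_filtration_def
 proof (intro conjI allI)
  show "subspace_of (?F p) (complexify ?U)" for p by (rule sub)
  show "antimono ?F" by (rule antimonoI) auto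
  show "\<exists>p. ?F p = carrier (complexify ?U)" by (rule exI[of _ 0]) simp
  show "\<exists>p. ?F p = {\<zero>\<^bsub>complexify ?U\<^esub>}" by (rule exI[of _ 1]) simp
 qed
 have cz: "conj_map ?U \<zero>\<^bsub>complexify ?U\<^esub> = \<zero>\<^bsub>complexify ?U\<^esub>"
  using U.conj_map_smult[OF C.M.zero_closed, of 0] U.conj_mem[OF C.M.zero_closed] by simp
 have un: "(\<Union>r\<in>{p..}. ?J r) = ?F p" for p
  by (cases "p \<le> 0") (auto intro: exI[of _ 0] exI[of _ p])
 have "hodge_operator (complexify ?U) ?F (\<lambda>n. cspan ?U (unit_weight n)) ?J (conj_map ?U) (\<lambda>x. \<zero>\<^bsub>complexify ?U\<^esub>)"
 proof (intro hodge_operator.intro hodge_operator_axioms.intro)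
  show "vspace (complexify ?U)" by (rule C.vspace_axioms)
  show "subspace_of (cspan ?U (unit_weight n)) (complexify ?U)" "subspace_of (?J n) (complexify ?U)" for n
   unfolding w using C.carrier_sub C.zero_sub by simp_all
  show "is_lin (complexify ?U) (complexify ?U) (\<lambda>x. \<zero>\<^bsub>complexify ?U\<^esub>)" by (rule CC.is_lin_zero_map)
  show "?F p = linear_span (complexify ?U) (\<Union>r\<in>{p..}. ?J r)" for p
   unfolding un by (rule C.span_id[OF sub, symmetric])
  have "(\<Union>r. ?J r) = carrier (complexify ?U)" by auto
  then show "linear_span (complexify ?U) (\<Union>r. ?J r) = carrier (complexify ?U)"
   using C.span_id[OF C.carrier_sub] by simp
  \<comment> \<open>For \<open>n < 0\<close> the vector is zero, for \<open>n = 0\<close> its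
    coefficient is, and for \<open>n > 0\<close> the target is the whole space.\<close>
  show "\<zero>\<^bsub>U.VC\<^esub> \<oplus>\<^bsub>U.VC\<^esub> conj_map ?U \<zero>\<^bsub>U.VC\<^esub> \<ominus>\<^bsub>U.VC\<^esub> of_int n \<odot>\<^bsub>U.VC\<^esub> x \<in> cspan ?U (unit_weight (n - 1))"
   if "x \<in> cspan ?U (unit_weight n)" for x n
   by (rule linorder_cases[of n 0]) (use that in \<open>auto simp: w cz C.M.minus_eq\<close>)
 qed (auto simp: w U.conj_mem U.conj_map_add U.conj_map_smult U.conj_map_conj cz C.M.minus_eq split: if_splits)
 then show ?thesis
  using fd inc_filtration_unit vec_unit dF
  by (intro is_mhsI[where J = ?J and P = "\<lambda>x. \<zero>\<^bsub>complexify ?U\<^esub>"]) (simp_all add: mhs_unit_def)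
qed

section \<open>Complexified structure maps\<close>

text \<open>With this and its analogues below, preservation of the Hodge filtration is read off on
  products \<open>ct A B \<xi> \<eta>\<close>.\<close>

lemma complexify_tensor_map:
 fixes A B A' B' :: "'u::infinite qvs"
 assumes v: "vec_space A" "vec_space B" "vec_space A'" "vec_space B'" and f: "is_lin A A' f" and g: "is_lin B B' g"
  and \<xi>: "\<xi> \<in> carrier (complexify A)" and \<eta>: "\<eta> \<in> carrier (complexify B)"
 shows "complexify_map (tensor A B) (tensor A' B') (tensor_map A B A' B' f g) (ct A B \<xi> \<eta>)
  = ct A' B' (complexify_map A A' f \<xi>) (complexify_map B B' g \<eta>)"
proof (rule ct_ext[OF v(1,2) _ bil_comp[OF ct_bil[OF v(1,2)] cmap_lin]
   bil_comp2[OF ct_bil[OF v(3,4)] cmap_lin[OF v(1,3) f] cmap_lin[OF v(2,4) g]] _ \<xi> \<eta>])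
 show t: "vec_space (tensor A B)" "vec_space (tensor A' B')" by (intro vec_tensor v)+
 show l: "is_lin (tensor A B) (tensor A' B') (tensor_map A B A' B' f g)" by (rule lin_is_lin[OF tensor_map_lin[OF v f g]])
 show "vec_space (complexify (tensor A' B'))" by (rule vec_complexify[OF t(2)])
 fix x y assume xy: "x \<in> carrier A" "y \<in> carrier B"
 show "complexify_map (tensor A B) (tensor A' B') (tensor_map A B A' B' f g) (ct A B (pure A cfield x 1) (pure B cfield y 1))
   = ct A' B' (complexify_map A A' f (pure A cfield x 1)) (complexify_map B B' g (pure B cfield y 1))"
  using xy v f g by (simp add: ct_pure cmap_pure[OF t l] cmap_pure tpure_closed lin_mem tensor_map_pure)
qed

lemma complexify_braid_map:
 fixes A B :: "'u::infinite qvs"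
 assumes v: "vec_space A" "vec_space B" and \<xi>: "\<xi> \<in> carrier (complexify A)" and \<eta>: "\<eta> \<in> carrier (complexify B)"
 shows "complexify_map (tensor A B) (tensor B A) (braid_map A B) (ct A B \<xi> \<eta>) = ct B A \<eta> \<xi>"
proof (rule ct_ext[OF v _ bil_comp[OF ct_bil[OF v] cmap_lin] bil_swap[OF ct_bil[OF v(2,1)]] _ \<xi> \<eta>])
 show t: "vec_space (tensor A B)" "vec_space (tensor B A)" by (intro vec_tensor v)+
 show l: "is_lin (tensor A B) (tensor B A) (braid_map A B)" by (rule lin_is_lin[OF braid_map_lin[OF v]])
 show "vec_space (complexify (tensor B A))" by (rule vec_complexify[OF t(2)])
 fix x y assume xy: "x \<in> carrier A" "y \<in> carrier B"
 show "complexify_map (tensor A B) (tensor B A) (braid_map A B) (ct A B (pure A cfield x 1) (pure B cfield y 1))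
   = ct B A (pure B cfield y 1) (pure A cfield x 1)"
  using xy v by (simp add: ct_pure cmap_pure[OF t l] tpure_closed braid_map_pure)
qed

context
 fixes A B C :: "'u::infinite qvs"
 assumes v: "vec_space A" "vec_space B" "vec_space C"
begin

interpretation A: cspace A by (rule cspaceI[OF v(1)])
interpretation B: cspace B by (rule cspaceI[OF v(2)])
interpretation C: cspace C by (rule cspaceI[OF v(3)])

private lemma t: "vec_space (tensor A B)" "vec_space (tensor B C)" "vec_space (tensor (tensor A B) C)" "vec_space (tensor A (tensor B C))"
 by (intro vec_tensor v)+

private lemma l: "is_lin (tensor (tensor A B) C) (tensor A (tensor B C)) (assoc_map A B C)"
 by (rule lin_is_lin[OF assoc_map_lin[OF v]])

text \<open>Both sides are complex-linear in each of the three arguments, so rational points may be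
  substituted one argument at a time.\<close>

lemma complexify_assoc_map:
 assumes \<xi>: "\<xi> \<in> carrier (complexify A)" and \<eta>: "\<eta> \<in> carrier (complexify B)" and \<zeta>: "\<zeta> \<in> carrier (complexify C)"
 shows "complexify_map (tensor (tensor A B) C) (tensor A (tensor B C)) (assoc_map A B C)
   (ct (tensor A B) C (ct A B \<xi> \<eta>) \<zeta>) = ct A (tensor B C) \<xi> (ct B C \<eta> \<zeta>)"
proof -
 let ?L = "ct (tensor A B) C" and ?R = "ct A (tensor B C)"
 let ?h = "complexify_map (tensor (tensor A B) C) (tensor A (tensor B C)) (assoc_map A B C)"
 note bL = ct_bil[OF t(1) v(3)] and bR = ct_bil[OF v(1) t(2)] and bAB = ct_bil[OF v(1,2)] and bBC = ct_bil[OF v(2,3)]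
 have pairs: "is_lin A.VC (complexify (tensor (tensor A B) C)) (\<lambda>\<xi>. ?L (ct A B \<xi> \<eta>) \<zeta>)"
   "is_lin B.VC (complexify (tensor (tensor A B) C)) (\<lambda>\<eta>. ?L (ct A B \<xi> \<eta>) \<zeta>)"
   "is_lin C.VC (complexify (tensor (tensor A B) C)) (\<lambda>\<zeta>. ?L (ct A B \<xi> \<eta>) \<zeta>)"
   "is_lin A.VC (complexify (tensor A (tensor B C))) (\<lambda>\<xi>. ?R \<xi> (ct B C \<eta> \<zeta>))"
   "is_lin B.VC (complexify (tensor A (tensor B C))) (\<lambda>\<eta>. ?R \<xi> (ct B C \<eta> \<zeta>))"
   "is_lin C.VC (complexify (tensor A (tensor B C))) (\<lambda>\<zeta>. ?R \<xi> (ct B C \<eta> \<zeta>))"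
  if "\<xi> \<in> carrier A.VC" "\<eta> \<in> carrier B.VC" "\<zeta> \<in> carrier C.VC" for \<xi> \<eta> \<zeta>
  by (rule is_lin_comp[OF bil_left[OF bAB that(2)] bil_left[OF bL that(3)]]
    is_lin_comp[OF bil_right[OF bAB that(1)] bil_left[OF bL that(3)]]
    bil_right[OF bL bil_closed[OF bAB that(1,2)]]
    bil_left[OF bR bil_closed[OF bBC that(2,3)]]
    is_lin_comp[OF bil_left[OF bBC that(3)] bil_right[OF bR that(1)]]
    is_lin_comp[OF bil_right[OF bBC that(2)] bil_right[OF bR that(1)]])+
 note cl = cmap_lin[OF t(3,4) l] and cv = vec_complexify[OF t(4)]
 have pure: "?L (ct A B (A.pr x 1) (B.pr y 1)) (C.pr z 1) = pure (tensor (tensor A B) C) cfield (tpure (tensor A B) C (tpure A B x y) z) 1"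
   "?R (A.pr x 1) (ct B C (B.pr y 1) (C.pr z 1)) = pure (tensor A (tensor B C)) cfield (tpure A (tensor B C) x (tpure B C y z)) 1"
  if "x \<in> carrier A" "y \<in> carrier B" "z \<in> carrier C" for x y z
  using that v t by (simp_all add: ct_pure tpure_closed)
 note p = A.pure_closed[of _ 1] B.pure_closed[of _ 1] C.pure_closed[of _ 1]
 show ?thesis
 proof (rule A.VC_ext[OF cv is_lin_comp[OF pairs(1)[OF \<xi> \<eta> \<zeta>] cl] pairs(4)[OF \<xi> \<eta> \<zeta>] _ \<xi>])
  fix x assume x: "x \<in> carrier A"
  show "?h (?L (ct A B (A.pr x 1) \<eta>) \<zeta>)
    = ?R (A.pr x 1) (ct B C \<eta> \<zeta>)"
  proof (rule B.VC_ext[OF cv is_lin_comp[OF pairs(2)[OF p(1)[OF x] \<eta> \<zeta>] cl] pairs(5)[OF p(1)[OF x] \<eta> \<zeta>] _ \<eta>])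
   fix y assume y: "y \<in> carrier B"
   show "?h (?L (ct A B (A.pr x 1) (B.pr y 1)) \<zeta>)
     = ?R (A.pr x 1) (ct B C (B.pr y 1) \<zeta>)"
   proof (rule C.VC_ext[OF cv is_lin_comp[OF pairs(3)[OF p(1)[OF x] p(2)[OF y] \<zeta>] cl] pairs(6)[OF p(1)[OF x] p(2)[OF y] \<zeta>] _ \<zeta>])
    fix z assume z: "z \<in> carrier C"
    show "?h (?L (ct A B (A.pr x 1) (B.pr y 1)) (C.pr z 1))
      = ?R (A.pr x 1) (ct B C (B.pr y 1) (C.pr z 1))"
     unfolding pure[OF x y z] using x y z v t by (simp add: cmap_pure[OF t(3,4) l] tpure_closed assoc_map_pure)
   qed
  qed
 qed
qed

end

context
 fixes A :: "'u::infinite qvs"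
 assumes A: "vec_space A"
begin

interpretation A: cspace A by (rule cspaceI[OF A])
interpretation AC: vspace "complexify A" by (rule vsI, rule A.vec_VC)
interpretation U: cspace "unit_space :: 'u qvs" by (rule cspaceI[OF vec_unit])

private lemma tU: "vec_space (tensor unit_space A)" by (rule vec_tensor[OF vec_unit A])
private lemma lU: "is_lin (tensor unit_space A) A (lunit_map A)" by (rule lin_is_lin[OF lunit_map_lin[OF A]])

text \<open>The complexified unit acts by scalars and hence preserves every complex subspace; in
  this form the scalar need not be named.\<close>

lemma complexify_lunit_map:
 assumes u: "u \<in> carrier (complexify unit_space)" and N: "subspace_of N (complexify A)" and \<xi>: "\<xi> \<in> N"
 shows "complexify_map (tensor unit_space A) A (lunit_map A) (ct unit_space A u \<xi>) \<in> N"
proof -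
 let ?h = "complexify_map (tensor unit_space A) A (lunit_map A)"
 note \<xi>c = AC.sub_mem[OF N \<xi>] and b = ct_bil[OF vec_unit A]
 interpret UA: vpair "complexify (unit_space :: 'u qvs)" "complexify A"
  by (rule vpairI[OF U.vec_VC A.vec_VC])
 interpret AA: vpair "complexify A" "complexify A"
  by (rule vpairI; rule A.vec_VC)
 have e: "?h (ct unit_space A (U.pr (rat_embed q) 1) \<xi>) = of_rat q \<odot>\<^bsub>A.VC\<^esub> \<xi>" for q
 proof (rule A.VC_ext[OF A.vec_VC is_lin_comp[OF bil_right[OF b] cmap_lin[OF tU A lU]] AA.is_lin_scale[OF is_lin_id] _ \<xi>c])
  have q: "rat_embed q \<in> carrier (unit_space :: 'u qvs)" by (simp add: unit_carrier)
  show "U.pr (rat_embed q) 1 \<in> carrier U.VC" by (rule U.pure_closed[OF q])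
  fix x assume x: "x \<in> carrier A"
  show "?h (ct unit_space A (U.pr (rat_embed q) 1) (A.pr x 1)) = of_rat q \<odot>\<^bsub>A.VC\<^esub> A.pr x 1"
   unfolding ct_pure[OF vec_unit A q x] cmap_pure[OF tU A lU tpure_closed[OF vec_unit A q x]]
    lunit_map_pure[OF A x] A.pure_rat[OF x] by simp
 qed
 have "?h (ct unit_space A s \<xi>) \<in> N" if "s \<in> {U.pr x 1 | x. x \<in> carrier unit_space}" for s
  using that e AC.sub_smult[OF N \<xi>] by (auto simp: unit_carrier)
 then have "(\<lambda>u. ?h (ct unit_space A u \<xi>)) ` linear_span U.VC {U.pr x 1 | x. x \<in> carrier unit_space} <= N"
  by (intro UA.span_image_sub[OF is_lin_comp[OF bil_left[OF b \<xi>c] cmap_lin[OF tU A lU]] N])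
   (use U.pure_closed in auto)
 then show ?thesis using u unfolding U.VC_span by blast
qed

lemma complexify_lunit_inv:
 assumes \<xi>: "\<xi> \<in> carrier (complexify A)"
 shows "complexify_map A (tensor unit_space A) (lunit_inv A) \<xi> = ct unit_space A (pure unit_space cfield (rat_embed 1) 1) \<xi>"
proof -
 have q: "rat_embed 1 \<in> carrier (unit_space :: 'u qvs)" by (simp add: unit_carrier)
 note l = lin_is_lin[OF lunit_inv_lin[OF A]] and b = ct_bil[OF vec_unit A]
 show ?thesis
 proof (rule A.VC_ext[OF vec_complexify[OF tU] cmap_lin[OF A tU l] bil_right[OF b U.pure_closed[OF q]] _ \<xi>])
  fix x assume x: "x \<in> carrier A"
  show "complexify_map A (tensor unit_space A) (lunit_inv A) (A.pr x 1) = ct unit_space A (U.pr (rat_embed 1) 1) (A.pr x 1)"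
   unfolding ct_pure[OF vec_unit A q x] cmap_pure[OF A tU l x] using x by (simp add: lunit_inv_def)
 qed
qed

end

section \<open>The category of mixed Hodge structures\<close>

lemma mhs_simps:
 "space (mhs_tensor A B) = tensor (space A) (space B)"
 "weight (mhs_tensor A B) = tensor_family (space A) (space B) (weight A) (weight B)"
 "hodge (mhs_tensor A B) = cfamily (space A) (space B) (hodge A) (hodge B)"
 "space mhs_unit = unit_space" "weight mhs_unit = unit_weight"
 by (simp_all add: mhs_tensor_def mhs_unit_def cfamily_def fun_eq_iff)

lemma mhs_tensor_closed: "is_mhs (A :: 'u::infinite mhs) ==> is_mhs B ==> is_mhs (mhs_tensor A B)"
 by (rule mhs_objects.is_mhs_tensor[OF mhs_objects.intro[OF mhs_object.intro mhs_object.intro]])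

lemma mhs_vec: "is_mhs A ==> vec_space (space A)"
 by (simp add: is_mhs_def)

lemma mhs_weight: "is_mhs A ==> inc_filtration (space A) (weight A)"
 by (simp add: is_mhs_def)

lemma mhs_F_sub: "is_mhs A ==> subspace_of (hodge A p) (complexify (space A))"
 by (simp add: is_mhs_def dec_filtration_def)

lemma mhs_F_le: "is_mhs A ==> hodge A p <= carrier (complexify (space A))"
 by (rule vspace.sub_le[OF vspace.intro[OF vec_complexify[OF mhs_vec]] mhs_F_sub])

lemma MHS_family: "family_spaces {A. is_mhs A} space weight mhs_tensor (mhs_unit :: 'u::infinite mhs)"
 by (rule family_spaces.intro)
  (auto simp: mhs_simps mhs_tensor_closed is_mhs_unit mhs_vec
   intro: unit_acts_filtration inc_filtration_sub inc_filtration_mono mhs_weight)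

section \<open>Preservation of the Hodge filtration by the structure maps\<close>

text \<open>Separated from the weight condition, to be joined with it by
  \<open>structured_spaces_conj\<close>.\<close>

definition preserves_hodge :: "'u::infinite mhs => 'u mhs => ('u => 'u) => bool" where
 "preserves_hodge A B f \<longleftrightarrow> (\<forall>p. complexify_map (space A) (space B) f ` hodge A p <= hodge B p)"

lemma pres_hodgeI:
 "(\<And>p x. x \<in> hodge A p ==> complexify_map (space A) (space B) f x \<in> hodge B p) ==> preserves_hodge A B f"
 by (auto simp: preserves_hodge_def)

lemma pres_hodgeD:
 "preserves_hodge A B f ==> x \<in> hodge A p ==> complexify_map (space A) (space B) f x \<in> hodge B p"
 by (auto simp: preserves_hodge_def)

lemma pres_hodge_comp:
 assumes m: "is_mhs A" "is_mhs B" "is_mhs C" and f: "is_lin (space A) (space B) f" and g: "is_lin (space B) (space C) g"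
  and h: "is_lin (space A) (space C) h" "\<And>x. x \<in> carrier (space A) ==> h x = g (f x)"
  and "preserves_hodge A B f" "preserves_hodge B C g"
 shows "preserves_hodge A C h"
proof (rule pres_hodgeI)
 fix p x assume x: "x \<in> hodge A p"
 have "complexify_map (space A) (space C) h x = complexify_map (space B) (space C) g (complexify_map (space A) (space B) f x)"
  by (rule cmap_comp[OF m[THEN mhs_vec] f g h subsetD[OF mhs_F_le[OF m(1)] x], symmetric])
 then show "complexify_map (space A) (space C) h x \<in> hodge C p" using assms x by (simp add: pres_hodgeD)
qed

lemma preserves_hodge_tensorI:
 assumes m: "is_mhs A" "is_mhs B" "is_mhs C" and f: "f \<in> lin (tensor (space A) (space B)) (space C)"
  and "\<And>i j x y. x \<in> hodge A i ==> y \<in> hodge B j ==>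
   complexify_map (tensor (space A) (space B)) (space C) f (ct (space A) (space B) x y) \<in> hodge C (i + j)"
 shows "preserves_hodge (mhs_tensor A B) C f"
proof (rule pres_hodgeI)
 fix p t assume t: "t \<in> hodge (mhs_tensor A B) p"
 show "complexify_map (space (mhs_tensor A B)) (space C) f t \<in> hodge C p"
  unfolding mhs_simps
  by (rule cfamily_image[OF mhs_vec[OF m(1)] mhs_vec[OF m(2)] mhs_F_le[OF m(1)] mhs_F_le[OF m(2)]
    vec_complexify[OF mhs_vec[OF m(3)]]
    cmap_lin[OF vec_tensor[OF mhs_vec[OF m(1)] mhs_vec[OF m(2)]] mhs_vec[OF m(3)] lin_is_lin[OF f]]
    mhs_F_sub[OF m(3)] _ t[unfolded mhs_simps]]) (use assms(5) in auto)
qed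

context
 fixes A B C :: "'u::infinite mhs"
 assumes m: "is_mhs A" "is_mhs B" "is_mhs C"
begin

private abbreviation "a \<equiv> space A"
private abbreviation "b \<equiv> space B"
private abbreviation "c \<equiv> space C"
private lemmas v = m[THEN mhs_vec]
private lemmas c = mhs_F_le[OF m(1), THEN subsetD] mhs_F_le[OF m(2), THEN subsetD] mhs_F_le[OF m(3), THEN subsetD]

lemma preserves_hodge_tensor_map:
 assumes D: "is_mhs D" and f: "f \<in> lin a c" "preserves_hodge A C f" and g: "g \<in> lin b (space D)" "preserves_hodge B D g"
 shows "preserves_hodge (mhs_tensor A B) (mhs_tensor C D) (tensor_map a b c (space D) f g)"
proof (rule preserves_hodge_tensorI[OF m(1,2) mhs_tensor_closed[OF m(3) D]])
 note l = lin_is_lin[OF f(1)] lin_is_lin[OF g(1)]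
 show "tensor_map a b c (space D) f g \<in> lin (tensor a b) (space (mhs_tensor C D))"
  unfolding mhs_simps by (rule tensor_map_lin[OF v(1,2,3) mhs_vec[OF D] l])
 show "complexify_map (tensor a b) (space (mhs_tensor C D)) (tensor_map a b c (space D) f g)
   (ct a b x y) \<in> hodge (mhs_tensor C D) (i + j)" if "x \<in> hodge A i" "y \<in> hodge B j" for i j x y
  unfolding mhs_simps complexify_tensor_map[OF v(1,2,3) mhs_vec[OF D] l c(1)[OF that(1)] c(2)[OF that(2)]]
  by (rule cfamily_pure[where P = "hodge C" and Q = "hodge D", OF pres_hodgeD[OF f(2) that(1)] pres_hodgeD[OF g(2) that(2)] refl])
qed

lemma preserves_hodge_braid: "preserves_hodge (mhs_tensor A B) (mhs_tensor B A) (braid_map a b)"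
proof (rule preserves_hodge_tensorI[OF m(1,2) mhs_tensor_closed[OF m(2,1)]])
 show "braid_map a b \<in> lin (tensor a b) (space (mhs_tensor B A))"
  unfolding mhs_simps by (rule braid_map_lin[OF v(1,2)])
 show "complexify_map (tensor a b) (space (mhs_tensor B A)) (braid_map a b)
   (ct a b x y) \<in> hodge (mhs_tensor B A) (i + j)" if "x \<in> hodge A i" "y \<in> hodge B j" for i j x y
  unfolding mhs_simps complexify_braid_map[OF v(1,2) c(1)[OF that(1)] c(2)[OF that(2)]]
  by (rule cfamily_pure[where P = "hodge B" and Q = "hodge A", OF that(2,1) add.commute])
qed

lemma preserves_hodge_assoc:
 "preserves_hodge (mhs_tensor (mhs_tensor A B) C) (mhs_tensor A (mhs_tensor B C)) (assoc_map a b c)"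
proof (rule preserves_hodge_tensorI[OF mhs_tensor_closed[OF m(1,2)] m(3) mhs_tensor_closed[OF m(1) mhs_tensor_closed[OF m(2,3)]]], unfold mhs_simps)
 let ?h = "complexify_map (tensor (tensor a b) c) (tensor a (tensor b c)) (assoc_map a b c)"
 let ?N = "cfamily a (tensor b c) (hodge A) (cfamily b c (hodge B) (hodge C))"
 note vAB = vec_tensor[OF v(1,2)] and N = mhs_F_sub[OF mhs_tensor_closed[OF m(1) mhs_tensor_closed[OF m(2,3)]], unfolded mhs_simps]
 show l: "assoc_map a b c \<in> lin (tensor (tensor a b) c) (tensor a (tensor b c))"
  by (rule assoc_map_lin[OF v])
 fix i j s z assume s: "s \<in> cfamily a b (hodge A) (hodge B) i" and z: "z \<in> hodge C j"
 note vT = vec_tensor[OF vAB v(3)] vec_tensor[OF v(1) vec_tensor[OF v(2,3)]]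
 show "?h (ct (tensor a b) c s z) \<in> ?N (i + j)"
 proof (rule cfamily_image[OF v(1,2) mhs_F_le[OF m(1)] mhs_F_le[OF m(2)] vec_complexify[OF vT(2)]
    is_lin_comp[OF bil_left[OF ct_bil[OF vAB v(3)] c(3)[OF z]] cmap_lin[OF vT lin_is_lin[OF l]]] N _ s])
  fix k n x y assume kn: "k + n = i" and x: "x \<in> hodge A k" and y: "y \<in> hodge B n"
  show "?h (ct (tensor a b) c (ct a b x y) z) \<in> ?N (i + j)"
   unfolding complexify_assoc_map[OF v c(1)[OF x] c(2)[OF y] c(3)[OF z]]
   by (rule cfamily_pure[where P = "hodge A" and Q = "cfamily b c (hodge B) (hodge C)", OF x
     cfamily_pure[where P = "hodge B" and Q = "hodge C", OF y z refl]]) (use kn in simp)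
 qed
qed

lemma preserves_hodge_lunit: "preserves_hodge (mhs_tensor mhs_unit A) A (lunit_map a)"
proof (rule preserves_hodge_tensorI[OF is_mhs_unit m(1,1)], unfold mhs_simps)
 show "lunit_map a \<in> lin (tensor unit_space a) a" by (rule lunit_map_lin[OF v(1)])
 fix i j u x assume u: "u \<in> hodge (mhs_unit :: 'u mhs) i" and x: "x \<in> hodge A j"
 let ?h = "complexify_map (tensor unit_space a) a (lunit_map a)"
 note uc = subsetD[OF mhs_F_le[OF is_mhs_unit] u, unfolded mhs_simps]
 interpret AC: vspace "complexify a" by (rule vsI, rule vec_complexify[OF v(1)])
 show "?h (ct unit_space a u x) \<in> hodge A (i + j)"
 \<comment> \<open>Up to index 0 the filtration of the unit is everything, and
   \<open>hodge A\<close> only grows when its index is lowered; beyond 0 it is zero.\<close>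
 proof (cases "i \<le> 0")
  case True
  have "antimono (hodge A)" using m(1) by (simp add: is_mhs_def dec_filtration_def)
  then have "hodge A j <= hodge A (i + j)" by (rule antimonoD) (use True in simp)
  then show ?thesis using complexify_lunit_map[OF v(1) uc mhs_F_sub[OF m(1)] x] by blast
 next
  case False
  then have u0: "u = \<zero>\<^bsub>complexify unit_space\<^esub>" using u by (simp add: mhs_unit_def)
  have "?h (ct unit_space a u x) = \<zero>\<^bsub>complexify a\<^esub>"
   unfolding u0
   by (rule vpair.is_lin_zero[OF vpairI is_lin_comp[OF bil_left[OF ct_bil[OF vec_unit v(1)] c(1)[OF x]]
      cmap_lin[OF _ v(1) lin_is_lin[OF lunit_map_lin[OF v(1)]]]]])
    (intro vec_complexify vec_unit vec_tensor v)+
  then show ?thesis using AC.sub_zero[OF mhs_F_sub[OF m(1)]] by simp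
 qed
qed

lemma preserves_hodge_lunit_inv: "preserves_hodge A (mhs_tensor mhs_unit A) (lunit_inv a)"
proof (rule pres_hodgeI, unfold mhs_simps)
 fix p x assume x: "x \<in> hodge A p"
 have "rat_embed 1 \<in> carrier (unit_space :: 'u qvs)" by (simp add: unit_carrier)
 then have "pure unit_space cfield (rat_embed 1) 1 \<in> carrier (complexify (unit_space :: 'u qvs))"
  by (rule cspace.pure_closed[OF cspaceI[OF vec_unit]])
 then have "pure unit_space cfield (rat_embed 1) 1 \<in> hodge (mhs_unit :: 'u mhs) 0" by (simp add: mhs_unit_def)
 from cfamily_pure[where P = "hodge mhs_unit" and Q = "hodge A", OF this x]
 show "complexify_map a (tensor unit_space a) (lunit_inv a) x
   \<in> cfamily unit_space a (hodge mhs_unit) (hodge A) p"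
  unfolding complexify_lunit_inv[OF v(1) c(1)[OF x]] by simp
qed

end

interpretation MW: structured_spaces "{A. is_mhs A}" space "\<lambda>A B f. \<forall>m. f ` weight A m <= weight B m"
  mhs_tensor "mhs_unit :: 'u::infinite mhs"
 by (rule family_spaces.structured[OF MHS_family])

lemma MHS_eq: "MHS = vs_smc {A. is_mhs A} space (\<lambda>A B f. (\<forall>m. f ` weight A m <= weight B m) \<and> preserves_hodge A B f) mhs_tensor mhs_unit"
 by (simp add: MHS_def preserves_hodge_def)

lemma MHS_hodge_structured: "structured_spaces {A. is_mhs A} space preserves_hodge mhs_tensor (mhs_unit :: 'u::infinite mhs)"
proof (rule structured_spaces.intro)
 let ?X = "{A :: 'u mhs. is_mhs A}"
 show "preserves_hodge A A (\<lambda>x\<in>carrier (space A). x)" if "A \<in> ?X" for A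
 proof (rule pres_hodgeI)
  fix p x assume x: "x \<in> hodge A p"
  have "complexify_map (space A) (space A) (\<lambda>x\<in>carrier (space A). x) x = x"
   using that x by (intro cmap_id[OF _ lin_is_lin[OF lin_id]]) (auto intro: mhs_vec subsetD[OF mhs_F_le])
  then show "complexify_map (space A) (space A) (\<lambda>x\<in>carrier (space A). x) x \<in> hodge A p" using x by simp
 qed
 show "preserves_hodge A C (compose (carrier (space A)) g f)"
  if "A \<in> ?X" "B \<in> ?X" "C \<in> ?X" "f \<in> lin (space A) (space B)" "g \<in> lin (space B) (space C)" "preserves_hodge A B f" "preserves_hodge B C g"
  for A B C f g
  using that by (intro pres_hodge_comp[where f = f and g = g, OF _ _ _ _ _ lin_is_lin[OF lin_compose]])
   (auto simp: compose_eq mhs_vec lin_is_lin)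
qed (use mhs_vec mhs_tensor_closed is_mhs_unit preserves_hodge_tensor_map preserves_hodge_assoc preserves_hodge_lunit
 preserves_hodge_lunit_inv preserves_hodge_braid in \<open>simp_all add: mhs_simps\<close>)

lemmas MHS_structured = structured_spaces_conj[OF family_spaces.structured[OF MHS_family] MHS_hodge_structured]

interpretation MH: structured_spaces "{A. is_mhs A}" space "\<lambda>A B f. (\<forall>m. f ` weight A m <= weight B m) \<and> preserves_hodge A B f"
  mhs_tensor "mhs_unit :: 'u::infinite mhs"
 by (rule MHS_structured)

lemma Pi_W_eq: "Pi_W = restructure mhs_tensor mhs_unit space fvs_tensor fvs_unit forget_hodge"
 by (simp add: Pi_W_def restructure_def)

lemma forget_hodge_simps:
 fixes A :: "'u::infinite mhs"
 shows "space (forget_hodge A) = space A" "weight (forget_hodge A) = weight A"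
 "forget_hodge (mhs_tensor A B) = fvs_tensor (forget_hodge A) (forget_hodge B)" "forget_hodge (mhs_unit :: 'u mhs) = fvs_unit"
 by (simp_all add: forget_hodge_def mhs_simps fvs_tensor_def fvs_unit_def)

lemma Pi_W_lax: "lax_symmetric_monoidal_functor (MHS :: 'u::infinite mhs_cat) FVect Pi_W"
 unfolding MHS_eq FVect_def Pi_W_eq
proof (intro restructuring.restructure_lax restructuring.intro restructuring_axioms.intro MH.structured_spaces_axioms FV.structured_spaces_axioms)
 fix A B :: "'u mhs"
 show "space (forget_hodge A) = space A" by (simp add: forget_hodge_simps)
 assume A: "A \<in> {A. is_mhs A}" and B: "B \<in> {A. is_mhs A}"
 then show "forget_hodge A \<in> {A. vec_space (space A) \<and> inc_filtration (space A) (weight A)}"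
  by (simp add: forget_hodge_simps is_mhs_def)
 show "\<forall>m. f ` weight (forget_hodge A) m <= weight (forget_hodge B) m"
  if "(\<forall>m. f ` weight A m <= weight B m) \<and> preserves_hodge A B f" for f
  using that by (simp add: forget_hodge_simps)
 show "\<forall>m. (\<lambda>x\<in>carrier (tensor (space A) (space B)). x) ` weight (fvs_tensor (forget_hodge A) (forget_hodge B)) m
   <= weight (forget_hodge (mhs_tensor A B)) m"
  using MW.pres_id[OF MW.T_closed[OF A B]] by (simp add: forget_hodge_simps flip: forget_hodge_simps(3)) (simp add: mhs_simps)
next
 show "\<forall>m. (\<lambda>x\<in>carrier (unit_space :: 'u qvs). x) ` weight fvs_unit m <= weight (forget_hodge mhs_unit) m"
  using FV.pres_id[OF FV.I_closed] by (simp add: forget_hodge_simps fvs_unit_def)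
qed

section \<open>The rational weight splitting\<close>

text \<open>The \<open>D\<close> of \<open>hodge_core\<close> belonging to the object
  \<open>A\<close>. Like \<open>hodge_op\<close> it is a function of \<open>A\<close>, so that
  statements can compare two objects.\<close>

definition conj_mixed :: "'u mhs => int => 'u cplx set" where
 "conj_mixed A k = linear_span (complexify (space A))
   (\<Union>n. cspan (space A) (weight A n) \<inter> conj_map (space A) ` hodge A (n - k))"

definition hodge_op :: "'u mhs => 'u cplx => 'u cplx" where
 "hodge_op A = hodge_core.P (complexify (space A)) (hodge A) (\<lambda>p. conj_map (space A) ` hodge A p)
   (\<lambda>n. cspan (space A) (weight A n))"

text \<open>The rational shadow of \<open>P + conj P conj\<close>. Rational linear relations survive
  \<open>real_part\<close>, and those are the relations used below.\<close>

definition weight_op :: "'u mhs => 'u => 'u" where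
 "weight_op A x = real_part (space A) (hodge_op A (pure (space A) cfield x 1)
   \<oplus>\<^bsub>complexify (space A)\<^esub> conj_map (space A) (hodge_op A (conj_map (space A) (pure (space A) cfield x 1))))"

definition weight_piece :: "'u mhs => int => 'u set" where
 "weight_piece A n = {x \<in> carrier (space A). weight_op A x = of_int n \<odot>\<^bsub>space A\<^esub> x}"

section \<open>Eigenspaces of the rational weight operator\<close>

context mhs_object
begin

abbreviation "V \<equiv> space A"
abbreviation "W \<equiv> weight A"
abbreviation "Y \<equiv> weight_op A"

lemma J_eq: "K.J p = hodge A p \<inter> conj_mixed A p"
 by (simp add: K.J_def K.D_def conj_mixed_def)

lemma conj_mixed_base: "x \<in> wc n ==> y \<in> hodge A (n - k) ==> x = cj y ==> x \<in> conj_mixed A k"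
 using K.D_base[of x n k] by (auto simp: K.D_def conj_mixed_def)

lemma conj_mixed_gens: "(\<Union>n. wc n \<inter> cj ` hodge A (n - k)) <= carrier VC"
 by (rule K.D_gens)

lemma conj_mixed_sub: "subspace_of (conj_mixed A k) VC"
 using K.sD by (simp add: K.D_def conj_mixed_def)

lemma hodge_op_lin: "is_lin VC VC (hodge_op A)"
 unfolding hodge_op_def by (rule K.P_lin)

lemma hodge_op_J: "x \<in> hodge A p ==> x \<in> conj_mixed A p ==> hodge_op A x = of_int p \<odot>\<^bsub>VC\<^esub> x"
 unfolding hodge_op_def using K.P_J[of x p] by (simp add: J_eq)

abbreviation "Q x \<equiv> hodge_op A x \<oplus>\<^bsub>VC\<^esub> cj (hodge_op A (cj x))"

lemma Q_lin: "is_lin VC VC (\<lambda>x. Q x)"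
proof -
 interpret CC: vpair VC VC by (rule vpairI; rule C.vs)
 show ?thesis by (rule CC.is_lin_plus[OF hodge_op_lin CV.conj_lin[OF hodge_op_lin]])
qed

lemma Q_closed: "x \<in> carrier VC ==> Q x \<in> carrier VC"
 by (rule lin_mem[OF Q_lin])

lemma Q_W: "x \<in> wc n ==> Q x \<ominus>\<^bsub>VC\<^esub> of_int n \<odot>\<^bsub>VC\<^esub> x \<in> wc (n - 1)"
 using K.P_Pbar_W[of x n] by (simp add: K.Pbar_def hodge_op_def)

lemma Y_lin: "is_lin V V Y"
proof (rule is_linI)
 fix x assume x: "x \<in> carrier V"
 note c = Q_closed[OF CV.pure_closed[OF x]]
 show "Y x \<in> carrier V" unfolding weight_op_def by (rule CV.real_part_closed[OF c])
 show "Y (q \<odot>\<^bsub>V\<^esub> x) = q \<odot>\<^bsub>V\<^esub> Y x" for q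
  unfolding weight_op_def CV.pure_rat[OF x] is_lin_smult[OF Q_lin CV.pure_closed[OF x]] by (rule CV.real_part_rat[OF c])
 fix y assume y: "y \<in> carrier V"
 show "Y (x \<oplus>\<^bsub>V\<^esub> y) = Y x \<oplus>\<^bsub>V\<^esub> Y y"
  unfolding weight_op_def CV.pure_add(1)[OF x y] is_lin_add[OF Q_lin CV.pure_closed[OF x] CV.pure_closed[OF y]]
  by (rule CV.real_part_add[OF c Q_closed[OF CV.pure_closed[OF y]]])
qed

lemma Y_closed: "x \<in> carrier V ==> Y x \<in> carrier V"
 by (rule lin_mem[OF Y_lin])

text \<open>\<open>real_part\<close> takes \<open>wc (n - 1)\<close> into \<open>W (n - 1)\<close>,
  and \<open>qret 1 = 1\<close> lets the integer \<open>n\<close> pass unchanged.\<close>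

lemma Y_W: assumes x: "x \<in> W n" shows "Y x \<ominus>\<^bsub>V\<^esub> of_int n \<odot>\<^bsub>V\<^esub> x \<in> W (n - 1)"
proof -
 note xc = sub_mem[OF sW x]
 let ?t = "CV.pr x 1"
 have t: "?t \<in> wc n" by (rule CV.cspan_pure[OF sub_le[OF sW] x])
 note tc = CV.pure_closed[OF xc, of 1]
 have q: "- of_int n = (of_rat (- of_int n) :: complex)" by (simp add: of_rat_minus)
 have "real_part V (Q ?t \<ominus>\<^bsub>VC\<^esub> of_int n \<odot>\<^bsub>VC\<^esub> ?t) = real_part V (Q ?t \<oplus>\<^bsub>VC\<^esub> of_rat (- of_int n) \<odot>\<^bsub>VC\<^esub> ?t)"
  unfolding q[symmetric] C.smult_neg[OF tc] C.M.minus_eq ..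
 also have "\<dots> = Y x \<oplus>\<^bsub>V\<^esub> (- of_int n) \<odot>\<^bsub>V\<^esub> real_part V ?t"
  unfolding CV.real_part_add[OF Q_closed[OF tc] C.smult_closed'[OF tc]] CV.real_part_rat[OF tc] weight_op_def ..
 also have "\<dots> = Y x \<ominus>\<^bsub>V\<^esub> of_int n \<odot>\<^bsub>V\<^esub> x"
  unfolding CV.real_part_pure[OF xc] qret(2) smult_1[OF xc] smult_neg[OF xc] M.minus_eq ..
 finally show ?thesis using real_part_cspan[OF vs sW Q_W[OF t]] by simp
qed

lemma is_lin_shift: "is_lin V V (\<lambda>x. Y x \<ominus>\<^bsub>V\<^esub> c \<odot>\<^bsub>V\<^esub> x)"
proof -
 interpret VV: vpair V V by (rule vpairI; rule vs)
 show ?thesis by (rule VV.is_lin_minus_map[OF Y_lin VV.is_lin_scale[OF is_lin_id]])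
qed

lemma weight_piece_sub: "subspace_of (weight_piece A n) V"
proof -
 interpret VV: vpair V V by (rule vpairI; rule vs)
 have "weight_piece A n = {x \<in> carrier V. Y x \<ominus>\<^bsub>V\<^esub> of_int n \<odot>\<^bsub>V\<^esub> x \<in> {\<zero>\<^bsub>V\<^esub>}}"
  unfolding weight_piece_def singleton_iff by (intro Collect_cong conj_cong refl) (simp add: Y_closed)
 then show ?thesis using VV.preimage_sub[OF is_lin_shift zero_sub] by simp
qed

lemmas piece_carrier = sub_mem[OF weight_piece_sub]

lemma shift_piece: "x \<in> weight_piece A n ==> Y x \<ominus>\<^bsub>V\<^esub> of_int m \<odot>\<^bsub>V\<^esub> x = (of_int n - of_int m) \<odot>\<^bsub>V\<^esub> x"
 using piece_carrier[of x n] by (simp add: weight_piece_def smult_diff_left)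

text \<open>On an eigenvector for \<open>n\<close> the shift of \<open>Y\<close> by \<open>k\<close>
  is a nonzero scalar, while on \<open>W k\<close> it lowers the weight.\<close>

lemma piece_step: assumes x: "x \<in> weight_piece A n" "x \<in> W k" and "n \<noteq> k" shows "x \<in> W (k - 1)"
proof -
 have "(of_int n - of_int k) \<odot>\<^bsub>V\<^esub> x \<in> W (k - 1)" using Y_W[OF x(2)] shift_piece[OF x(1)] by simp
 from sub_smult[OF sW this, of "1 / (of_int n - of_int k)"] show ?thesis
  using piece_carrier[OF x(1)] \<open>n \<noteq> k\<close> by (simp add: smult_smult)
qed

text \<open>The descent passes through the weights above \<open>l\<close> and up to
  \<open>k\<close>; the alternative on \<open>n\<close> says that the eigenvalue is not among them,
  so \<open>piece_step\<close> never stops.\<close>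

lemma piece_descend:
 assumes x: "x \<in> weight_piece A n" "x \<in> W k" and n: "n \<le> l \<or> k < n" and "l \<le> k"
 shows "x \<in> W l"
 using \<open>l \<le> k\<close> n
proof (induction l rule: int_le_induct)
 case base
 then show ?case using x by simp
next
 case (step i)
 then have "x \<in> W i" by (cases "n \<le> i - 1") auto
 then show ?case by (rule piece_step[OF x(1)]) (use step in auto)
qed

lemma W_bounds: obtains a b where "W a = {\<zero>\<^bsub>V\<^esub>}" "W b = carrier V" "a \<le> b"
proof -
 obtain a b where ab: "W a = {\<zero>\<^bsub>V\<^esub>}" "W b = carrier V" using W unfolding inc_filtration_def by blast
 have "W (max a b) = carrier V" using W_mono[of b "max a b"] ab(2) sub_le[OF sW, of "max a b"] by simp
 then show thesis using that[of a "max a b"] ab by simp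
qed

lemma piece_W: assumes x: "x \<in> weight_piece A n" shows "x \<in> W n"
proof -
 obtain a b where b: "W b = carrier V" using W_bounds .
 show ?thesis
 proof (cases "b \<le> n")
  case True then show ?thesis using W_mono[OF True] b piece_carrier[OF x] by auto
 next
  case False
  then show ?thesis using piece_descend[OF x, of b n] piece_carrier[OF x] b by simp
 qed
qed

lemma union_carrier: "(\<Union>n\<in>S. weight_piece A n) <= carrier V"
 using sub_le[OF weight_piece_sub] by blast

text \<open>Induction on the weight. The shift of \<open>Y\<close> by \<open>m + 1\<close> sends
  \<open>W (m + 1)\<close> into \<open>W m\<close> and is onto on the sum of the lower pieces, where
  it acts by the nonzero scalars \<open>n - (m + 1)\<close>. Subtracting a preimage turns any vector
  of \<open>W (m + 1)\<close> into an eigenvector.\<close>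

lemma W_split: "W m = linear_span V (\<Union>n\<in>{..m}. weight_piece A n)"
proof
 show "linear_span V (\<Union>n\<in>{..m}. weight_piece A n) <= W m"
  by (rule span_least[OF sW]) (use piece_W W_mono in blast)
 obtain a b where a: "W a = {\<zero>\<^bsub>V\<^esub>}" using W_bounds .
 have z: "W m <= linear_span V (\<Union>n\<in>{..m}. weight_piece A n)" if "m \<le> a" for m
  using W_mono[OF that] a sub_zero[OF span_sub[OF union_carrier]] by auto
 show "W m <= linear_span V (\<Union>n\<in>{..m}. weight_piece A n)"
 proof (cases "m \<le> a")
  case False
  then have "a \<le> m" by simp
  then show ?thesis
  proof (induction m rule: int_ge_induct)
   case base
   show ?case by (rule z) simp
  next
   case (step m)
   interpret VV: vpair V V by (rule vpairI; rule vs)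
   let ?S = "\<lambda>m. linear_span V (\<Union>n\<in>{..m}. weight_piece A n)"
   let ?f = "\<lambda>x. Y x \<ominus>\<^bsub>V\<^esub> of_int (m + 1) \<odot>\<^bsub>V\<^esub> x"
   note S = span_sub[OF union_carrier]
   \<comment> \<open>Each lower piece is reached by dividing by its nonzero scalar, and the division
     stays inside the piece.\<close>
   have surj: "?S m <= ?f ` ?S m"
   proof (rule span_least[OF VV.image_sub[OF is_lin_shift S]], rule UN_least, rule subsetI)
    fix n y assume n: "n \<in> {..m}" and y: "y \<in> weight_piece A n"
    let ?c = "of_int n - of_int (m + 1) :: rat"
    have c: "?c \<noteq> 0" using n unfolding right_minus_eq of_int_eq_iff by simp
    let ?z = "(1 / ?c) \<odot>\<^bsub>V\<^esub> y"
    have "?z \<in> weight_piece A n" by (rule sub_smult[OF weight_piece_sub y])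
    then have "?z \<in> (\<Union>n\<in>{..m}. weight_piece A n)" using n by blast
    then have zS: "?z \<in> ?S m" by (rule span_base)
    have "?f ?z = ?c \<odot>\<^bsub>V\<^esub> ?z" by (rule shift_piece) fact
    moreover have "?c \<odot>\<^bsub>V\<^esub> ?z = y" using c piece_carrier[OF y] by (simp add: smult_smult)
    ultimately have "y = ?f ?z" by simp
    then show "y \<in> ?f ` ?S m" using zS by (rule image_eqI)
   qed
   show ?case
   proof
    fix x assume x: "x \<in> W (m + 1)"
    note xc = sub_mem[OF sW x]
    have "?f x \<in> W m" using Y_W[OF x] by simp
    then obtain z where z: "z \<in> ?S m" "?f x = ?f z" using step surj by blast
    note zc = sub_mem[OF S z(1)]
    have "?f (x \<ominus>\<^bsub>V\<^esub> z) = ?f x \<ominus>\<^bsub>V\<^esub> ?f z" by (rule VV.is_lin_diff[OF is_lin_shift xc zc])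
    also have "\<dots> = \<zero>\<^bsub>V\<^esub>" unfolding z(2) by (rule diff_self[OF lin_mem[OF is_lin_shift zc]])
    finally have "Y (x \<ominus>\<^bsub>V\<^esub> z) = of_int (m + 1) \<odot>\<^bsub>V\<^esub> (x \<ominus>\<^bsub>V\<^esub> z)" using xc zc Y_closed by simp
    then have "x \<ominus>\<^bsub>V\<^esub> z \<in> weight_piece A (m + 1)" using xc zc by (simp add: weight_piece_def)
    then have "x \<ominus>\<^bsub>V\<^esub> z \<in> ?S (m + 1)" by (intro span_base UN_I[of "m + 1"]) simp_all
    moreover have "?S m <= ?S (m + 1)" by (rule span_mono, rule UN_mono) auto
    then have "z \<in> ?S (m + 1)" using z(1) by blast
    ultimately have "(x \<ominus>\<^bsub>V\<^esub> z) \<oplus>\<^bsub>V\<^esub> z \<in> ?S (m + 1)" by (rule sub_add[OF S])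
    then show "x \<in> ?S (m + 1)" unfolding diff_add_cancel[OF xc zc] .
   qed
  qed
 qed (rule z)
qed

lemma grading: "is_grading V (weight_piece A)"
 unfolding is_grading_iff[OF vs]
proof (intro conjI allI)
 obtain a b where ab: "W a = {\<zero>\<^bsub>V\<^esub>}" "W b = carrier V" "a \<le> b" using W_bounds .
 have "{n. weight_piece A n \<noteq> {\<zero>\<^bsub>V\<^esub>}} <= {a..b}"
 proof (rule subsetI, rule ccontr)
  fix n assume n: "n \<in> {n. weight_piece A n \<noteq> {\<zero>\<^bsub>V\<^esub>}}" and "n \<notin> {a..b}"
  then have "weight_piece A n <= {\<zero>\<^bsub>V\<^esub>}"
   using piece_descend[of _ n b a] ab piece_carrier[of _ n] by auto
  then show False using n sub_zero[OF weight_piece_sub, of n] by blast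
 qed
 then show "finite {n. weight_piece A n \<noteq> {\<zero>\<^bsub>V\<^esub>}}" by (rule finite_subset) simp
 have "linear_span V (\<Union>n\<in>{..b}. weight_piece A n) <= linear_span V (\<Union>n. weight_piece A n)" by (rule span_mono) blast
 then show "linear_span V (\<Union>n. weight_piece A n) = carrier V"
  using ab(2) W_split[of b] sub_le[OF span_sub[OF union_carrier]] by blast
 show "independent_family V (weight_piece A)"
  by (rule independent_if_eigen[OF vs weight_piece_sub Y_lin]) (simp add: weight_piece_def)
qed (rule weight_piece_sub)

end

section \<open>Naturality of the operators\<close>

locale mhs_morphism = A: mhs_object A + B: mhs_object B for A B :: "'u::infinite mhs" +
 fixes f :: "'u => 'u"
 assumes f: "is_lin (space A) (space B) f" and fW: "f ` weight A m <= weight B m" and fF: "preserves_hodge A B f"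
begin

abbreviation "fC \<equiv> complexify_map (space A) (space B) f"

lemma fC_lin: "is_lin A.VC B.VC fC"
 by (rule cmap_lin[OF A.vs B.vs f])

sublocale VV: vpair A.VC B.VC
 by (rule vpairI[OF A.C.vs B.C.vs])

lemma fC_cj: "x \<in> carrier A.VC ==> fC (A.cj x) = B.cj (fC x)"
 by (rule cmap_conj[OF A.vs B.vs f])

lemma fC_wc: "x \<in> A.wc n ==> fC x \<in> B.wc n"
 by (rule cmap_cspan[OF A.vs B.vs f A.sub_le[OF A.sW] B.sub_le[OF B.sW] fW])

text \<open>A morphism preserves \<open>W\<close> and \<open>F\<close> and, being rational, commutes
  with conjugation; it therefore respects what is built from these by sums and
  intersections.\<close>

lemma fC_conj_mixed: assumes "x \<in> conj_mixed A k" shows "fC x \<in> conj_mixed B k"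
proof -
 have "fC ` linear_span A.VC (\<Union>n. A.wc n \<inter> A.cj ` hodge A (n - k)) <= conj_mixed B k"
 proof (rule VV.span_image_sub[OF fC_lin B.conj_mixed_sub A.conj_mixed_gens], rule image_subsetI)
  fix x assume "x \<in> (\<Union>n. A.wc n \<inter> A.cj ` hodge A (n - k))"
  then obtain n y where x: "x \<in> A.wc n" "y \<in> hodge A (n - k)" "x = A.cj y" by blast
  show "fC x \<in> conj_mixed B k"
   by (rule B.conj_mixed_base[OF fC_wc[OF x(1)] pres_hodgeD[OF fF x(2)]])
    (simp add: x(3) fC_cj[OF A.C.sub_mem[OF A.sF x(2)]])
 qed
 then show ?thesis using assms unfolding conj_mixed_def by blast
qed

text \<open>Each \<open>J r\<close> is carried into its counterpart, and on both the operator is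
  multiplication by the same integer.\<close>

lemma fC_hodge_op: assumes "x \<in> carrier A.VC" shows "hodge_op B (fC x) = fC (hodge_op A x)"
proof (rule VV.lin_eq_on_span[OF is_lin_comp[OF fC_lin B.hodge_op_lin] is_lin_comp[OF A.hodge_op_lin fC_lin] A.K.J_union_le])
 show "x \<in> linear_span A.VC (\<Union>r. A.K.J r)" using assms A.K.J_span by simp
 fix x assume "x \<in> (\<Union>r. A.K.J r)"
 then obtain r where x: "x \<in> hodge A r" "x \<in> conj_mixed A r" unfolding A.J_eq by blast
 have "hodge_op B (fC x) = of_int r \<odot>\<^bsub>B.VC\<^esub> fC x"
  by (rule B.hodge_op_J[OF pres_hodgeD[OF fF x(1)] fC_conj_mixed[OF x(2)]])
 also have "\<dots> = fC (hodge_op A x)"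
  unfolding A.hodge_op_J[OF x] by (rule is_lin_smult[OF fC_lin A.C.sub_mem[OF A.sF x(1)], symmetric])
 finally show "hodge_op B (fC x) = fC (hodge_op A x)" .
qed

lemma weight_op_natural: assumes x: "x \<in> carrier (space A)" shows "weight_op B (f x) = f (weight_op A x)"
proof -
 let ?t = "A.CV.pr x 1"
 note t = A.CV.pure_closed[OF x, of 1]
 note h = lin_mem[OF A.hodge_op_lin]
 have "fC (A.Q ?t) = fC (hodge_op A ?t) \<oplus>\<^bsub>B.VC\<^esub> fC (A.cj (hodge_op A (A.cj ?t)))"
  by (rule is_lin_add[OF fC_lin h[OF t] A.CV.conj_mem[OF h[OF A.CV.conj_mem[OF t]]]])
 also have "\<dots> = B.Q (fC ?t)"
  unfolding fC_cj[OF h[OF A.CV.conj_mem[OF t]]] fC_cj[OF t, symmetric]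
   fC_hodge_op[OF t] fC_hodge_op[OF A.CV.conj_mem[OF t]] ..
 also have "fC ?t = B.CV.pr (f x) 1" by (rule cmap_pure[OF A.vs B.vs f x])
 finally have "weight_op B (f x) = real_part (space B) (fC (A.Q ?t))" unfolding weight_op_def by simp
 also have "\<dots> = f (weight_op A x)"
  unfolding weight_op_def by (rule real_part_natural[OF A.vs B.vs f A.Q_closed[OF t]])
 finally show ?thesis .
qed

lemma weight_piece_natural: "f ` weight_piece A n <= weight_piece B n"
 using lin_mem[OF f] is_lin_smult[OF f] by (auto simp: weight_piece_def weight_op_natural)

end

section \<open>The Leibniz rule on tensor products\<close>

context mhs_objects
begin

abbreviation "AB \<equiv> mhs_tensor A B"

lemma AB_object: "mhs_object AB"
 by (rule mhs_object.intro[OF is_mhs_tensor])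

lemmas AB_base = mhs_object.conj_mixed_base[OF AB_object, unfolded mhs_simps wcT]
lemmas AB_sub = mhs_object.conj_mixed_sub[OF AB_object, unfolded mhs_simps]
lemmas AB_op_lin = mhs_object.hodge_op_lin[OF AB_object, unfolded mhs_simps]
lemmas AB_op_J = mhs_object.hodge_op_J[OF AB_object, unfolded mhs_simps]

text \<open>Weights add, and so do the indices \<open>m - k\<close> and \<open>n - l\<close> of the
  conjugate filtrations, giving \<open>m + n - (k + l)\<close>.\<close>

lemma ct_conj_mixed:
 assumes x: "x \<in> conj_mixed A k" and y: "y \<in> conj_mixed B l"
 shows "ct a b x y \<in> conj_mixed AB (k + l)"
proof (rule bil_span_into[OF ctb A.C.vs B.C.vs TC.vs AB_sub A.conj_mixed_gens B.conj_mixed_gens _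
   x[unfolded conj_mixed_def] y[unfolded conj_mixed_def]])
 fix s t assume "s \<in> (\<Union>n. A.wc n \<inter> A.cj ` hodge A (n - k))" "t \<in> (\<Union>n. B.wc n \<inter> B.cj ` hodge B (n - l))"
 then obtain m n s' t' where s: "s \<in> A.wc m" "s' \<in> hodge A (m - k)" "s = A.cj s'"
  and t: "t \<in> B.wc n" "t' \<in> hodge B (n - l)" "t = B.cj t'" by blast
 show "ct a b s t \<in> conj_mixed AB (k + l)"
 proof (rule AB_base[where n = "m + n" and y = "ct a b s' t'"])
  show "ct a b s t \<in> cfamily a b A.wc B.wc (m + n)"
   by (rule cfamily_pure[where P = A.wc and Q = B.wc, OF s(1) t(1) refl])
  show "ct a b s' t' \<in> FT (m + n - (k + l))"
   by (rule cfamily_pure[where P = "hodge A" and Q = "hodge B", OF s(2) t(2)]) simp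
  show "ct a b s t = conj_map (tensor a b) (ct a b s' t')"
   unfolding s(3) t(3) by (rule ct_conj[OF A.vs B.vs A.C.sub_mem[OF A.sF s(2)] B.C.sub_mem[OF B.sF t(2)], symmetric])
 qed
qed

text \<open>The derivation served to establish the mixed Hodge structure on the tensor product,
  whereas \<open>hodge_op\<close> is defined from that structure. They coincide because
  \<open>JT r\<close> consists of eigenvectors of both for \<open>r\<close>, and the
  \<open>JT r\<close> span.\<close>

lemma hodge_op_tensor:
 assumes \<xi>: "\<xi> \<in> carrier A.VC" and \<eta>: "\<eta> \<in> carrier B.VC"
 shows "hodge_op AB (ct a b \<xi> \<eta>) = ct a b (hodge_op A \<xi>) \<eta> \<oplus>\<^bsub>TC\<^esub> ct a b \<xi> (hodge_op B \<eta>)"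
proof -
 interpret TT: vpair TC TC by (rule vpairI; rule TC.vs)
 have J: "JT r <= FT r \<inter> conj_mixed AB r" for r
 proof (rule cfamily_least[OF A.vs B.vs J_sub TC.Int_subspace[OF sFT AB_sub]], rule IntI)
  fix i j x y assume ij: "i + j = r" and x: "x \<in> A.K.J i" and y: "y \<in> B.K.J j"
  show "ct a b x y \<in> FT r"
   by (rule cfamily_pure[where P = "hodge A" and Q = "hodge B" and i = i and j = j])
    (use x y ij in \<open>auto simp: A.J_eq B.J_eq\<close>)
  show "ct a b x y \<in> conj_mixed AB r"
   unfolding ij[symmetric] by (rule ct_conj_mixed) (use x y in \<open>auto simp: A.J_eq B.J_eq\<close>)
 qed
 obtain D where D: "is_lin TC TC D"
  and Dp: "\<And>\<xi> \<eta>. \<xi> \<in> carrier A.VC ==> \<eta> \<in> carrier B.VC ==>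
   D (ct a b \<xi> \<eta>) = ct a b (A.K.P \<xi>) \<eta> \<oplus>\<^bsub>TC\<^esub> ct a b \<xi> (B.K.P \<eta>)"
  and DJ: "\<And>r x. x \<in> JT r ==> D x = of_int r \<odot>\<^bsub>TC\<^esub> x"
  using derivation by blast
 have c: "(\<Union>r. JT r) <= carrier TC" using TC.sub_le[OF sJT] by blast
 have "hodge_op AB t = D t" if "t \<in> carrier TC" for t
 proof (rule TT.lin_eq_on_span[OF AB_op_lin D c])
  show "t \<in> linear_span TC (\<Union>r. JT r)" using that JT_span by simp
  fix s assume "s \<in> (\<Union>r. JT r)"
  then obtain r where s: "s \<in> JT r" by blast
  show "hodge_op AB s = D s" unfolding DJ[OF s] by (rule AB_op_J) (use J s in blast)+
 qed
 from this[OF ct_closed[OF \<xi> \<eta>]] show ?thesis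
  unfolding Dp[OF \<xi> \<eta>] by (simp add: hodge_op_def)
qed

text \<open>When one factor is a rational point, multiplication by it is the complexification of a
  rational map, to which naturality of \<open>real_part\<close> applies.\<close>

lemma real_part_ct:
 assumes x: "x \<in> carrier a" and y: "y \<in> carrier b"
 shows "s \<in> carrier A.VC ==> real_part (tensor a b) (ct a b s (B.CV.pr y 1)) = tpure a b (real_part a s) y"
  and "t \<in> carrier B.VC ==> real_part (tensor a b) (ct a b (A.CV.pr x 1) t) = tpure a b x (real_part b t)"
proof -
 note l = tpure_left[OF A.vs B.vs y] and r = tpure_right[OF A.vs B.vs x]
 {
  assume s: "s \<in> carrier A.VC"
  have "ct a b s (B.CV.pr y 1) = complexify_map a (tensor a b) (\<lambda>x. tpure a b x y) s"
   by (rule A.CV.VC_ext[OF TC.vs bil_left[OF ctb B.CV.pure_closed[OF y]] cmap_lin[OF A.vs T.vs l] _ s])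
    (simp add: ct_pure[OF A.vs B.vs _ y] cmap_pure[OF A.vs T.vs l])
  then show "real_part (tensor a b) (ct a b s (B.CV.pr y 1)) = tpure a b (real_part a s) y"
   using real_part_natural[OF A.vs T.vs l s] by simp
 }
 assume t: "t \<in> carrier B.VC"
 have "ct a b (A.CV.pr x 1) t = complexify_map b (tensor a b) (tpure a b x) t"
  by (rule B.CV.VC_ext[OF TC.vs bil_right[OF ctb A.CV.pure_closed[OF x]] cmap_lin[OF B.vs T.vs r] _ t])
   (simp add: ct_pure[OF A.vs B.vs x] cmap_pure[OF B.vs T.vs r])
 then show "real_part (tensor a b) (ct a b (A.CV.pr x 1) t) = tpure a b x (real_part b t)"
  using real_part_natural[OF B.vs T.vs r t] by simp
qed

text \<open>At a tensor of rational vectors each term of the complex Leibniz rule contains a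
  rational factor, so \<open>real_part_ct\<close> applies to both terms. For two complex factors the
  retraction would not be multiplicative.\<close>

lemma weight_op_tensor:
 assumes x: "x \<in> carrier a" and y: "y \<in> carrier b"
 shows "weight_op AB (tpure a b x y) = tpure a b (weight_op A x) y \<oplus>\<^bsub>tensor a b\<^esub> tpure a b x (weight_op B y)"
proof -
 let ?x = "A.CV.pr x 1" and ?y = "B.CV.pr y 1"
 note xc = A.CV.pure_closed[OF x, of 1] and yc = B.CV.pure_closed[OF y, of 1]
 note cj = A.CV.conj_map_pure[OF x, of 1, simplified] B.CV.conj_map_pure[OF y, of 1, simplified]
 note hx = lin_mem[OF A.hodge_op_lin xc] and hy = lin_mem[OF B.hodge_op_lin yc]
 note hcx = A.CV.conj_mem[OF hx] and hcy = B.CV.conj_mem[OF hy]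
 have p: "T.pr (tpure a b x y) 1 = ct a b ?x ?y" using ct_pure[OF A.vs B.vs x y, of 1 1] by simp
 have c: "conj_map (tensor a b) (ct a b ?x ?y) = ct a b ?x ?y"
  unfolding ct_conj[OF A.vs B.vs xc yc] cj ..
 have "hodge_op AB (ct a b ?x ?y) \<oplus>\<^bsub>TC\<^esub> conj_map (tensor a b) (hodge_op AB (ct a b ?x ?y))
   = (ct a b (hodge_op A ?x) ?y \<oplus>\<^bsub>TC\<^esub> ct a b ?x (hodge_op B ?y))
    \<oplus>\<^bsub>TC\<^esub> (ct a b (A.cj (hodge_op A ?x)) ?y \<oplus>\<^bsub>TC\<^esub> ct a b ?x (B.cj (hodge_op B ?y)))"
  unfolding hodge_op_tensor[OF xc yc] T.conj_map_add[OF ct_closed[OF hx yc] ct_closed[OF xc hy]]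
   ct_conj[OF A.vs B.vs hx yc] ct_conj[OF A.vs B.vs xc hy] cj ..
 also have "\<dots> = ct a b (A.Q ?x) ?y \<oplus>\<^bsub>TC\<^esub> ct a b ?x (B.Q ?y)"
  unfolding cj TC.add4[OF ct_closed[OF hx yc] ct_closed[OF xc hy] ct_closed[OF hcx yc] ct_closed[OF xc hcy]]
   ct_add(1)[OF yc hx hcx] ct_add(2)[OF xc hy hcy] ..
 finally have e: "hodge_op AB (ct a b ?x ?y) \<oplus>\<^bsub>TC\<^esub> conj_map (tensor a b) (hodge_op AB (ct a b ?x ?y))
   = ct a b (A.Q ?x) ?y \<oplus>\<^bsub>TC\<^esub> ct a b ?x (B.Q ?y)" .
 show ?thesis
  unfolding weight_op_def mhs_simps p c e
   T.real_part_add[OF ct_closed[OF A.Q_closed[OF xc] yc] ct_closed[OF xc B.Q_closed[OF yc]]]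
   real_part_ct(1)[OF x y A.Q_closed[OF xc]] real_part_ct(2)[OF x y B.Q_closed[OF yc]] ..
qed

lemma weight_piece_tensor: "tensor_family a b (weight_piece A) (weight_piece B) n <= weight_piece AB n"
proof (rule tensor_family_least[OF A.vs B.vs A.weight_piece_sub B.weight_piece_sub])
 show "subspace_of (weight_piece AB n) (tensor a b)"
  using mhs_object.weight_piece_sub[OF AB_object] by (simp add: mhs_simps)
 fix i j x y assume ij: "i + j = n" and x: "x \<in> weight_piece A i" and y: "y \<in> weight_piece B j"
 note c = A.piece_carrier[OF x] B.piece_carrier[OF y]
 have e: "weight_op A x = of_int i \<odot>\<^bsub>a\<^esub> x" "weight_op B y = of_int j \<odot>\<^bsub>b\<^esub> y" using x y by (simp_all add: weight_piece_def)
 have "weight_op AB (tpure a b x y) = of_int n \<odot>\<^bsub>tensor a b\<^esub> tpure a b x y"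
  unfolding weight_op_tensor[OF c] e tpure_smult[OF A.vs B.vs c] ij[symmetric] of_int_add
  by (rule T.smult_add_left[OF tpure_closed[OF A.vs B.vs c], symmetric])
 then show "tpure a b x y \<in> weight_piece AB n"
  using tpure_closed[OF A.vs B.vs c] by (simp add: weight_piece_def mhs_simps)
qed

end

section \<open>The factorization\<close>

context mhs_object
begin

definition proj :: "int => 'u => 'u" where
 "proj p = (SOME T. is_lin V V T \<and> (\<forall>q. \<forall>x\<in>weight_piece A q. T x = (if q = p then 1 else 0) \<odot>\<^bsub>V\<^esub> x))"

lemma proj_lin: "is_lin V V (proj p)"
 and proj_piece: "x \<in> weight_piece A q ==> proj p x = (if q = p then x else \<zero>\<^bsub>V\<^esub>)"
proof -
 have "independent_family V (weight_piece A)" "linear_span V (\<Union>n. weight_piece A n) = carrier V"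
  using grading is_grading_iff[OF vs] by auto
 from someI_ex[OF operator_exists[OF vs weight_piece_sub this, of "\<lambda>q. if q = p then 1 else 0"]]
 have "is_lin V V (proj p)" "\<And>q x. x \<in> weight_piece A q ==> proj p x = (if q = p then 1 else 0) \<odot>\<^bsub>V\<^esub> x"
  unfolding proj_def by auto
 then show "is_lin V V (proj p)" "x \<in> weight_piece A q ==> proj p x = (if q = p then x else \<zero>\<^bsub>V\<^esub>)"
  using piece_carrier[of x q] by auto
qed

sublocale VV: vpair V V
 by (rule vpairI; rule vs)

lemma pieces_span: "linear_span V (\<Union>n. weight_piece A n) = carrier V"
 using grading is_grading_iff[OF vs] by auto

lemma proj_in_piece: assumes "x \<in> carrier V" shows "proj p x \<in> weight_piece A p"
proof -
 have "proj p ` linear_span V (\<Union>n. weight_piece A n) <= weight_piece A p"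
  by (rule VV.span_image_sub[OF proj_lin weight_piece_sub union_carrier])
   (auto simp: proj_piece sub_zero[OF weight_piece_sub])
 then show ?thesis using assms unfolding pieces_span by blast
qed

text \<open>The pieces of degree below \<open>p\<close> lie in \<open>W (p - 1)\<close>, so the
  projection represents the same class in the graded piece.\<close>

lemma proj_mod: assumes "x \<in> W p" shows "x \<ominus>\<^bsub>V\<^esub> proj p x \<in> W (p - 1)"
proof -
 have "(\<lambda>x. x \<ominus>\<^bsub>V\<^esub> proj p x) ` linear_span V (\<Union>n\<in>{..p}. weight_piece A n) <= W (p - 1)"
 proof (rule VV.span_image_sub[OF VV.is_lin_minus_map[OF is_lin_id proj_lin] sW union_carrier], rule image_subsetI)
  fix x assume "x \<in> (\<Union>n\<in>{..p}. weight_piece A n)"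
  then obtain n where n: "n \<le> p" "x \<in> weight_piece A n" by blast
  note xc = piece_carrier[OF n(2)]
  show "x \<ominus>\<^bsub>V\<^esub> proj p x \<in> W (p - 1)"
  proof (cases "n = p")
   case True
   then show ?thesis using sub_zero[OF sW] by (simp add: proj_piece[OF n(2)] xc)
  next
   case False
   then show ?thesis using W_mono[of n "p - 1"] n piece_W[OF n(2)] xc by (auto simp: proj_piece[OF n(2)])
  qed
 qed
 then show ?thesis using assms W_split by blast
qed

section \<open>Comparison with the associated graded space\<close>

text \<open>The isomorphism of \<open>V\<close> with its associated graded space that belongs to the
  splitting, before transport into the universe.\<close>

definition split_gr :: "'u => int => 'u set" where
 "split_gr x = (\<lambda>p. W (p - 1) +>\<^bsub>V\<^esub> proj p x)"

definition split_map :: "'u => 'u" where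
 "split_map x = embed (direct_sum GrW) (split_gr x)"

definition grS :: "'u qvs" where
 "grS = copy (direct_sum GrW)"

lemma vec_grS: "vec_space grS"
 unfolding grS_def by (rule copyable.vec_copy[OF GrW_copyable])

lemma split_comp_lin: "is_lin V (GrW p) (\<lambda>x. W (p - 1) +>\<^bsub>V\<^esub> proj p x)"
proof -
 have "is_lin V (sub V (W p)) (proj p)"
  using proj_lin[of p] piece_W[OF proj_in_piece] unfolding is_lin_def by (auto simp: sub_simps)
 from is_lin_comp[OF this GrW_proj_lin] show ?thesis .
qed

lemma split_gr_lin: "is_lin V (direct_sum GrW) split_gr"
proof (rule is_linI)
 fix x assume x: "x \<in> carrier V"
 have "{p. split_gr x p \<noteq> \<zero>\<^bsub>GrW p\<^esub>} <= {p. carrier (GrW p) \<noteq> {\<zero>\<^bsub>GrW p\<^esub>}}"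
  using lin_mem[OF split_comp_lin x] by (auto simp: split_gr_def)
 then show "split_gr x \<in> carrier (direct_sum GrW)"
  using lin_mem[OF split_comp_lin x] GrW_finite
  by (auto simp: direct_sum_simps split_gr_def elim: finite_subset)
 show "split_gr (c \<odot>\<^bsub>V\<^esub> x) = c \<odot>\<^bsub>direct_sum GrW\<^esub> split_gr x" for c
  by (simp add: direct_sum_simps split_gr_def is_lin_smult[OF split_comp_lin x])
 show "split_gr (x \<oplus>\<^bsub>V\<^esub> y) = split_gr x \<oplus>\<^bsub>direct_sum GrW\<^esub> split_gr y" if "y \<in> carrier V" for y
  by (simp add: direct_sum_simps split_gr_def is_lin_add[OF split_comp_lin x that])
qed

lemma split_map_lin: "is_lin V grS split_map"
 unfolding split_map_def grS_def
 by (rule is_lin_comp[OF split_gr_lin copyable.is_lin_embed[OF GrW_copyable]])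

lemma split_gr_piece: assumes x: "x \<in> weight_piece A n" shows "split_gr x \<in> summand GrW n"
 using lin_mem[OF split_gr_lin piece_carrier[OF x]] GrW_proj_zero[OF M.zero_closed] sub_zero[OF sW]
 by (auto simp: summand_def split_gr_def proj_piece[OF x])

text \<open>A class of degree \<open>n\<close> has a representative in \<open>W n\<close>, and by
  \<open>proj_mod\<close> its projection to the piece is a homogeneous representative of the same
  class.\<close>

lemma summand_lift: assumes s: "s \<in> summand GrW n" obtains x where "x \<in> weight_piece A n" "split_gr x = s"
proof -
 have "s n \<in> carrier (GrW n)" using s by (simp add: summand_def direct_sum_simps)
 then obtain x where x: "x \<in> W n" "s n = W (n - 1) +>\<^bsub>V\<^esub> x" unfolding GrW_carrier by blast
 note xc = sub_mem[OF sW x(1)]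
 note px = proj_in_piece[OF xc, of n]
 have "split_gr (proj n x) p = s p" for p
 proof (cases "p = n")
  case True
  have "x \<ominus>\<^bsub>V\<^esub> proj n x \<in> W (n - 1)" by (rule proj_mod[OF x(1)])
  then show ?thesis
   unfolding True split_gr_def x(2) proj_piece[OF px] if_P[OF refl]
   using coset_eq_iff[OF sW[of "n - 1"] xc piece_carrier[OF px]] by simp
 next
  case False
  then show ?thesis using split_gr_piece[OF px] s by (simp add: summand_def)
 qed
 then show thesis using that[OF px] by blast
qed

text \<open>If all graded components vanish, then \<open>proj p x\<close> lies in
  \<open>W (p - 1)\<close> for every \<open>p\<close>, and with \<open>proj_mod\<close> the vector
  descends through the weights to zero.\<close>

lemma split_map_inj: "inj_on split_map (carrier V)"
proof (rule vpair.inj_linI[OF vpairI[OF vs vec_grS] split_map_lin])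
 interpret D: vspace "direct_sum GrW" by (rule vsI, rule vec_direct_sum[where X = GrW, OF vec_GrW])
 fix x assume x: "x \<in> carrier V" and z: "split_map x = \<zero>\<^bsub>grS\<^esub>"
 note c = lin_mem[OF split_gr_lin x]
 have "embed (direct_sum GrW) (split_gr x) = (embed (direct_sum GrW) \<zero>\<^bsub>direct_sum GrW\<^esub> :: 'u)"
  using z by (simp add: split_map_def grS_def copy_def)
 from arg_cong[OF this, of "unembed (direct_sum GrW)"]
 have "split_gr x = \<zero>\<^bsub>direct_sum GrW\<^esub>"
  by (simp only: copyable.unembed_e[OF GrW_copyable c] copyable.unembed_e[OF GrW_copyable D.M.zero_closed])
 then have "split_gr x p = \<zero>\<^bsub>GrW p\<^esub>" for p by (simp add: direct_sum_simps)
 then have pW: "proj p x \<in> W (p - 1)" for p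
  using GrW_proj_zero[OF lin_mem[OF proj_lin x]] by (simp add: split_gr_def)
 obtain a b where ab: "W a = {\<zero>\<^bsub>V\<^esub>}" "W b = carrier V" "a \<le> b" using W_bounds .
 from \<open>a \<le> b\<close> have "x \<in> W a"
 proof (induction a rule: int_le_induct)
  case base
  then show ?case using x ab by simp
 next
  case (step i)
  show ?case using sub_mod[OF sW x lin_mem[OF proj_lin x] proj_mod[OF step(2)]] pW by simp
 qed
 then show "x = \<zero>\<^bsub>V\<^esub>" using ab by simp
qed

lemma split_map_bij: "bij_betw split_map (carrier V) (carrier grS)"
 unfolding bij_betw_def
proof (rule conjI[OF split_map_inj])
 interpret VD: vpair V "direct_sum GrW" by (rule vpairI[OF vs vec_direct_sum[OF vec_GrW]])
 have "carrier (direct_sum GrW) <= split_gr ` carrier V"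
  unfolding direct_sum_span[where X = GrW, OF vec_GrW, symmetric]
 proof (rule VD.W.span_least[OF VD.image_sub[OF split_gr_lin carrier_sub]], rule UN_least, rule subsetI)
  fix n s assume "s \<in> summand GrW n"
  then obtain x where "x \<in> weight_piece A n" "split_gr x = s" by (rule summand_lift)
  then show "s \<in> split_gr ` carrier V" using piece_carrier by blast
 qed
 then have "split_gr ` carrier V = carrier (direct_sum GrW)" using lin_mem[OF split_gr_lin] by blast
 then have "embed (direct_sum GrW) ` split_gr ` carrier V = carrier grS"
  by (simp add: grS_def copyable.copy_carrier[OF GrW_copyable])
 then show "split_map ` carrier V = carrier grS" by (simp add: split_map_def image_image)
qed

lemma Gr_forget: "Gr (forget_hodge A) = GrW"
 using Gr_eq_GrW[where A = "forget_hodge A"] filtered_axioms by (simp add: forget_hodge_simps)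

lemma graded_forget: "total (graded_of_filtered (forget_hodge A)) = grS"
 "piece (graded_of_filtered (forget_hodge A)) = (\<lambda>p. embed (direct_sum GrW) ` summand GrW p)"
 by (simp_all add: graded_of_filtered_simps Gr_forget grS_def)

text \<open>The inverse is the component of the natural isomorphism, which runs from the graded
  space to \<open>V\<close>.\<close>

definition unsplit :: "'u => 'u" where
 "unsplit = restrict (inv_into (carrier V) split_map) (carrier grS)"

lemma unsplit_lin: "unsplit \<in> lin grS V"
 unfolding unsplit_def by (rule lin_restrict[OF vec_grS vpair.inv_lin[OF vpairI[OF vs vec_grS] split_map_lin split_map_bij]])

lemma unsplit_split: "x \<in> carrier V ==> unsplit (split_map x) = x"
 using lin_mem[OF split_map_lin] by (simp add: unsplit_def inv_into_f_f[OF split_map_inj])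

lemma grS_cases: assumes "u \<in> carrier grS" obtains x where "x \<in> carrier V" "u = split_map x"
 using assms split_map_bij unfolding bij_betw_def by blast

abbreviation "gr_weight m \<equiv> linear_span grS (\<Union>n\<in>{..m}. embed (direct_sum GrW) ` summand GrW n)"

lemma gr_gens: "(\<Union>n\<in>S. embed (direct_sum GrW) ` summand GrW n) <= carrier grS"
 using copyable.copy_carrier[OF GrW_copyable] by (auto simp: grS_def summand_def)

lemma split_map_weight: "split_map ` W m <= gr_weight m"
 unfolding W_split[of m]
proof (rule vpair.span_image_sub[OF vpairI[OF vs vec_grS] split_map_lin
   vspace.span_sub[OF vspace.intro[OF vec_grS] gr_gens] union_carrier], rule image_subsetI)
 interpret S: vspace grS by (rule vsI, rule vec_grS)
 fix x assume "x \<in> (\<Union>n\<in>{..m}. weight_piece A n)"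
 then obtain n where n: "n \<le> m" "x \<in> weight_piece A n" by blast
 have "split_map x \<in> embed (direct_sum GrW) ` summand GrW n"
  unfolding split_map_def using split_gr_piece[OF n(2)] by blast
 then show "split_map x \<in> gr_weight m" using n(1) by (intro S.span_base) blast
qed

lemma unsplit_weight: "unsplit ` gr_weight m <= W m"
proof (rule vpair.span_image_sub[OF vpairI[OF vec_grS vs] lin_is_lin[OF unsplit_lin] sW gr_gens], rule image_subsetI)
 fix u :: 'u assume "u \<in> (\<Union>n\<in>{..m}. embed (direct_sum GrW) ` summand GrW n)"
 then obtain n s where n: "n \<le> m" "s \<in> summand GrW n" "u = embed (direct_sum GrW) s" by blast
 obtain x where x: "x \<in> weight_piece A n" "split_gr x = s" by (rule summand_lift[OF n(2)])
 have "unsplit u = x" using unsplit_split[OF piece_carrier[OF x(1)]] by (simp add: n(3) split_map_def x(2))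
 then show "unsplit u \<in> W m" using piece_W[OF x(1)] W_mono[OF n(1)] by blast
qed

lemma filtered_gr_forget: "space (filtered_of_graded (graded_of_filtered (forget_hodge A))) = grS"
 "weight (filtered_of_graded (graded_of_filtered (forget_hodge A))) = gr_weight"
 by (simp_all add: filtered_of_graded_def graded_forget fun_eq_iff)

end

section \<open>Naturality of the comparison\<close>

context mhs_morphism
begin

sublocale FM: filtered_map "space A" "weight A" "space B" "weight B" f
 by (intro filtered_map.intro A.filtered_axioms B.filtered_axioms filtered_map_axioms.intro f fW)

lemma proj_natural: assumes x: "x \<in> carrier (space A)" shows "B.proj p (f x) = f (A.proj p x)"
proof -
 note VP = vpairI[OF A.vs B.vs]
 show ?thesis
 proof (rule vpair.lin_eq_on_span[OF VP is_lin_comp[OF f B.proj_lin] is_lin_comp[OF A.proj_lin f] A.union_carrier])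
  show "x \<in> linear_span (space A) (\<Union>n. weight_piece A n)" using x unfolding A.pieces_span .
  fix y assume "y \<in> (\<Union>n. weight_piece A n)"
  then obtain n where y: "y \<in> weight_piece A n" by blast
  then have "f y \<in> weight_piece B n" using weight_piece_natural by blast
  then show "B.proj p (f y) = f (A.proj p y)" using vpair.is_lin_zero[OF VP f] by (simp add: A.proj_piece[OF y] B.proj_piece)
 qed
qed

lemma split_natural: assumes x: "x \<in> carrier (space A)" shows "FM.grtotal (A.split_map x) = B.split_map (f x)"
proof -
 have "FM.grmap p (A.split_gr x p) = B.split_gr (f x) p" for p
  unfolding A.split_gr_def B.split_gr_def proj_natural[OF x]
  by (rule FM.grmap_coset[OF A.piece_W[OF A.proj_in_piece[OF x]]])
 then show ?thesis
  unfolding A.split_map_def B.split_map_def FM.grtotal_embed[OF lin_mem[OF A.split_gr_lin x]] by simp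
qed

lemma unsplit_natural: assumes u: "u \<in> carrier A.grS" shows "B.unsplit (FM.grtotal u) = f (A.unsplit u)"
proof -
 obtain x where x: "x \<in> carrier (space A)" "u = A.split_map x" by (rule A.grS_cases[OF u])
 show ?thesis
  unfolding x(2) split_natural[OF x(1)] A.unsplit_split[OF x(1)] B.unsplit_split[OF lin_mem[OF f x(1)]] ..
qed

end

section \<open>The grading functor and the two isomorphisms\<close>

definition weight_graded :: "'u::infinite mhs => 'u gvs" where
 "weight_graded A = \<lparr>total = space A, piece = weight_piece A\<rparr>"

text \<open>The functor \<open>G\<close> of the factorization.\<close>

definition weight_grading :: "('u::infinite mhs, 'u gvs, 'u) vs_lax_functor" where
 "weight_grading = restructure mhs_tensor mhs_unit space gvs_tensor gvs_unit weight_graded"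

lemma total_weight_graded: "total (weight_graded A) = space A"
 by (simp add: weight_graded_def)

lemma mhs_morphismI:
 "is_mhs A ==> is_mhs B ==> f \<in> lin (space A) (space B) ==> (\<forall>m. f ` weight A m <= weight B m) \<and> preserves_hodge A B f
  ==> mhs_morphism (A :: 'u::infinite mhs) B f"
 by (intro mhs_morphism.intro mhs_object.intro mhs_morphism_axioms.intro lin_is_lin) auto

lemma filtered_weight_graded:
 assumes "is_mhs (A :: 'u::infinite mhs)" shows "filtered_of_graded (weight_graded A) = forget_hodge A"
 using mhs_object.W_split[OF mhs_object.intro[OF assms]]
 by (simp add: filtered_of_graded_def weight_graded_def forget_hodge_def fun_eq_iff)

lemma weight_grading_lax: "lax_symmetric_monoidal_functor (MHS :: 'u::infinite mhs_cat) GrVect weight_grading"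
 unfolding MHS_eq GrVect_def weight_grading_def
proof (intro restructuring.restructure_lax restructuring.intro restructuring_axioms.intro MH.structured_spaces_axioms GV.structured_spaces_axioms)
 fix A B :: "'u mhs"
 show "total (weight_graded A) = space A" by (simp add: weight_graded_def)
 assume A: "A \<in> {A. is_mhs A}"
 then interpret A: mhs_object A by (simp add: mhs_object.intro)
 show "weight_graded A \<in> {A. vec_space (total A) \<and> is_grading (total A) (piece A)}"
  by (simp add: weight_graded_def A.vs A.grading)
 assume B: "B \<in> {A. is_mhs A}"
 then interpret B: mhs_object B by (simp add: mhs_object.intro)
 note AB = mhs_objects.intro[OF A.mhs_object_axioms B.mhs_object_axioms]
 show "\<forall>m. f ` piece (weight_graded A) m <= piece (weight_graded B) m"
  if "f \<in> lin (space A) (space B)" "(\<forall>m. f ` weight A m <= weight B m) \<and> preserves_hodge A B f" for f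
  using mhs_morphism.weight_piece_natural[OF mhs_morphismI[OF _ _ that]] A B by (simp add: weight_graded_def)
 show "\<forall>m. (\<lambda>x\<in>carrier (tensor (space A) (space B)). x) ` piece (gvs_tensor (weight_graded A) (weight_graded B)) m
   <= piece (weight_graded (mhs_tensor A B)) m"
  unfolding weight_graded_def gvs_tensor_def gvs.simps
  by (rule preserves_family_id[OF vec_tensor[OF A.vs B.vs]
    tensor_family_sub[OF A.vs B.vs A.weight_piece_sub B.weight_piece_sub] mhs_objects.weight_piece_tensor[OF AB]])
next
 interpret I: mhs_object "mhs_unit :: 'u mhs" by (rule mhs_object.intro[OF is_mhs_unit])
 \<comment> \<open>The unit has weight 0 and \<open>unit_weight (- 1)\<close> is zero, so the
   congruence \<open>Y_W\<close> at weight 0 becomes an equality.\<close>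
 have "weight_op mhs_unit x = \<zero>\<^bsub>unit_space\<^esub>" if x: "x \<in> carrier (unit_space :: 'u qvs)" for x
 proof -
  have "weight_op mhs_unit x \<ominus>\<^bsub>unit_space\<^esub> of_int 0 \<odot>\<^bsub>unit_space\<^esub> x \<in> unit_weight (- 1)"
   using I.Y_W[of x 0] x by (simp add: mhs_simps unit_weight_def)
  then show ?thesis using x I.Y_closed[of x] I.M.minus_eq I.diff_zero I.smult_0 by (simp add: mhs_simps unit_weight_def)
 qed
 then have "(if n = 0 then carrier unit_space else {\<zero>\<^bsub>unit_space\<^esub>}) <= weight_piece (mhs_unit :: 'u mhs) n" for n
  using I.sub_zero[OF I.weight_piece_sub, of n] I.smult_0 by (auto simp: mhs_simps weight_piece_def)
 then show "\<forall>m. (\<lambda>x\<in>carrier (unit_space :: 'u qvs). x) ` piece gvs_unit m <= piece (weight_graded mhs_unit) m"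
  unfolding weight_graded_def gvs_unit_def gvs.simps
  by (intro preserves_family_id[OF vec_unit is_grading_sub[OF is_grading_unit]])
qed

text \<open>By \<open>W_split\<close> the two functors agree exactly on objects and arrows of
  \<open>MHS\<close>, and their lax structure maps agree too; identities are therefore an
  isomorphism.\<close>

lemma weight_grading_iso:
 "monoidal_natural_iso (MHS :: 'u::infinite mhs_cat) FVect (comp_lax FVect U_fil weight_grading) Pi_W
   (\<lambda>A. ident FVect (forget_hodge A))"
proof -
 interpret P: lax_symmetric_monoidal_functor "MHS :: 'u mhs_cat" FVect Pi_W by (rule Pi_W_lax)
 let ?F = "comp_lax FVect U_fil weight_grading :: ('u mhs, 'u fvs, 'u) vs_lax_functor"
 have Obj: "A \<in> Obj MHS \<longleftrightarrow> is_mhs A" for A :: "'u mhs" by (simp add: MHS_eq MH.CC_simps)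
 have hom: "is_mhs A \<and> is_mhs B \<and> Src f = A \<and> Trg f = B" if "f \<in> hom_set MHS A B" for f and A B :: "'u mhs"
  using that unfolding MHS_eq by (auto simp: MH.hom_iff)
 have Pobj: "on_obj Pi_W A = forget_hodge A" for A :: "'u mhs" by (simp add: Pi_W_def)
 have obj: "on_obj ?F A = forget_hodge A" if "is_mhs A" for A
  by (simp add: comp_lax_def U_fil_def weight_grading_def restructure_def filtered_weight_graded that)
 have arr: "on_arr ?F f = on_arr Pi_W f" if "f \<in> hom_set MHS A B" for f and A B :: "'u mhs"
  using hom[OF that] by (simp add: comp_lax_def U_fil_def weight_grading_def restructure_def filtered_weight_graded Pi_W_def)
 have mult: "lax_mult ?F A B = lax_mult Pi_W A B" if "is_mhs A" "is_mhs B" for A B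
  using that by (simp add: comp_lax_def U_fil_def weight_grading_def restructure_def filtered_weight_graded Pi_W_def
   mhs_tensor_closed FVect_def FV.CC_simps FV.us_T forget_hodge_simps compose_id_left[OF lin_id] vec_tensor mhs_vec total_weight_graded)
 have unit: "lax_unit ?F = lax_unit Pi_W"
  by (simp add: comp_lax_def U_fil_def weight_grading_def restructure_def filtered_weight_graded Pi_W_def
   is_mhs_unit FVect_def FV.CC_simps FV.us_I compose_id_left[OF lin_id] vec_unit)
 have iso: "iso_arr FVect (ident FVect (on_obj Pi_W A))" if "A \<in> Obj MHS" for A :: "'u mhs"
  unfolding iso_arr_def using P.D.ident_hom[OF P.on_obj[OF that]] P.D.ident_left[OF P.D.ident_hom[OF P.on_obj[OF that]]]
  by (auto simp: hom_set_def intro!: bexI[of _ "ident FVect (on_obj Pi_W A)"])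
 show ?thesis
  unfolding monoidal_natural_iso_def natural_iso_def Pobj[symmetric]
 proof (intro conjI ballI allI impI)
  fix A :: "'u mhs" assume A: "A \<in> Obj MHS"
  show "ident FVect (on_obj Pi_W A) \<in> hom_set FVect (on_obj ?F A) (on_obj Pi_W A)"
   using P.D.ident_hom[OF P.on_obj[OF A]] A by (simp add: obj Obj Pobj)
  show "iso_arr FVect (ident FVect (on_obj Pi_W A))" by (rule iso[OF A])
  fix B :: "'u mhs" assume B: "B \<in> Obj MHS"
  show "ident FVect (on_obj Pi_W (tens_obj MHS A B)) \<cdot>\<^bsub>FVect\<^esub> lax_mult ?F A B
    = lax_mult Pi_W A B \<cdot>\<^bsub>FVect\<^esub> tens_arr FVect (ident FVect (on_obj Pi_W A)) (ident FVect (on_obj Pi_W B))"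
   using A B mult[of A B] P.D.ident_left[OF P.mult_hom[OF A B]] P.D.ident_right[OF P.mult_hom[OF A B]]
    P.D.tens_ident[OF P.on_obj[OF A] P.on_obj[OF B]] by (simp add: Obj)
 next
  fix A B f assume f: "f \<in> hom_set (MHS :: 'u mhs_cat) A B"
  show "ident FVect (on_obj Pi_W B) \<cdot>\<^bsub>FVect\<^esub> on_arr ?F f = on_arr Pi_W f \<cdot>\<^bsub>FVect\<^esub> ident FVect (on_obj Pi_W A)"
   unfolding arr[OF f] P.D.ident_left[OF P.on_arr[OF f]] P.D.ident_right[OF P.on_arr[OF f]] ..
 next
  show "ident FVect (on_obj Pi_W (unit_obj (MHS :: 'u mhs_cat))) \<cdot>\<^bsub>FVect\<^esub> lax_unit ?F = lax_unit Pi_W"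
   unfolding unit by (rule P.D.ident_left[OF P.lax_unit_hom])
 qed
qed

definition gr_iso :: "'u::infinite mhs => ('u fvs, 'u => 'u) arrow" where
 "gr_iso A = \<lparr>Src = filtered_of_graded (graded_of_filtered (forget_hodge A)), Trg = forget_hodge A, Fun = mhs_object.unsplit A\<rparr>"

lemma gr_natural_iso:
 "natural_iso (MHS :: 'u::infinite mhs_cat) FVect (comp_functor U_fil (comp_functor gr_functor Pi_W)) Pi_W gr_iso"
 unfolding natural_iso_def
proof (intro conjI ballI allI impI)
 let ?F = "comp_functor U_fil (comp_functor gr_functor Pi_W) :: ('u mhs, 'u fvs, 'u) vs_functor"
 interpret P: lax_symmetric_monoidal_functor "MHS :: 'u mhs_cat" FVect Pi_W by (rule Pi_W_lax)
 interpret U: lax_symmetric_monoidal_functor "GrVect :: 'u gvs_cat" FVect U_fil by (rule U_fil_lax)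
 interpret R: functor_between "FVect :: 'u fvs_cat" GrVect gr_functor by (rule gr_functor)
 have Pobj: "on_obj Pi_W A = forget_hodge A" for A :: "'u mhs" by (simp add: Pi_W_def)
 have obj: "on_obj ?F A = filtered_of_graded (graded_of_filtered (forget_hodge A))" for A
  by (simp add: comp_functor_def U_fil_def gr_functor_def Pi_W_def)
 {
  fix A :: "'u mhs" assume AO: "A \<in> Obj MHS"
  then interpret A: mhs_object A by (simp add: MHS_eq MH.CC_simps mhs_object.intro)
  have FA: "filtered_of_graded (graded_of_filtered (forget_hodge A)) \<in> Obj FVect"
   using U.on_obj[OF R.on_obj[OF P.on_obj[OF AO]]] by (simp add: U_fil_def gr_functor_def Pi_W_def)
  have h: "gr_iso A \<in> hom_set FVect (on_obj ?F A) (forget_hodge A)"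
   using FA P.on_obj[OF AO] A.unsplit_lin A.unsplit_weight
   unfolding FVect_def FV.hom_iff by (simp add: FV.CC_simps obj Pobj gr_iso_def A.filtered_gr_forget forget_hodge_simps)
  then show "gr_iso A \<in> hom_set FVect (on_obj ?F A) (on_obj Pi_W A)" by (simp add: Pobj)
  \<comment> \<open>The inverse arrow is the splitting itself, restricted because arrows are
    extensional.\<close>
  let ?g = "\<lparr>Src = forget_hodge A, Trg = on_obj ?F A, Fun = restrict A.split_map (carrier (space A))\<rparr>"
  have g: "?g \<in> hom_set FVect (forget_hodge A) (on_obj ?F A)"
   using FA P.on_obj[OF AO] lin_restrict[OF A.vs A.split_map_lin] A.split_map_weight A.sub_mem[OF A.sW]
   unfolding FVect_def FV.hom_iff by (auto simp: FV.CC_simps obj Pobj A.filtered_gr_forget forget_hodge_simps)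
  show "iso_arr FVect (gr_iso A)"
   unfolding FVect_def
  proof (rule FV.iso_arrI[OF h[unfolded FVect_def] g[unfolded FVect_def]])
   show "compose (carrier (space (on_obj ?F A))) (Fun ?g) (Fun (gr_iso A)) = (\<lambda>x\<in>carrier (space (on_obj ?F A)). x)"
   proof (rule ext)
    fix u
    show "compose (carrier (space (on_obj ?F A))) (Fun ?g) (Fun (gr_iso A)) u = (\<lambda>x\<in>carrier (space (on_obj ?F A)). x) u"
    proof (cases "u \<in> carrier A.grS")
     case True
     then obtain x where "x \<in> carrier (space A)" "u = A.split_map x" by (rule A.grS_cases)
     then show ?thesis using True by (simp add: obj A.filtered_gr_forget compose_eq gr_iso_def A.unsplit_split)
    qed (simp add: obj A.filtered_gr_forget compose_def)
   qed
   show "compose (carrier (space (forget_hodge A))) (Fun (gr_iso A)) (Fun ?g) = (\<lambda>x\<in>carrier (space (forget_hodge A)). x)"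
    by (auto simp: compose_def fun_eq_iff forget_hodge_simps gr_iso_def A.unsplit_split)
  qed
 }
 fix A B f assume f: "f \<in> hom_set (MHS :: 'u mhs_cat) A B"
 then have fh: "is_mhs A" "is_mhs B" "Fun f \<in> lin (space A) (space B)"
  "(\<forall>m. Fun f ` weight A m <= weight B m) \<and> preserves_hodge A B (Fun f)" "Src f = A" "Trg f = B"
  unfolding MHS_eq MH.hom_iff by auto
 interpret M: mhs_morphism A B "Fun f" by (rule mhs_morphismI[OF fh(1-4)])
 have gf: "Fun (on_arr gr_functor (on_arr Pi_W f)) = M.FM.grtotal"
  using gr_functor_Fun[OF P.on_arr[OF f]] by (simp add: Pobj forget_hodge_simps) (simp add: Pi_W_def)
 have Ff: "on_arr ?F f = \<lparr>Src = filtered_of_graded (graded_of_filtered (forget_hodge A)),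
   Trg = filtered_of_graded (graded_of_filtered (forget_hodge B)), Fun = M.FM.grtotal\<rparr>"
  using gf by (simp add: comp_functor_def U_fil_def fh(5,6)) (simp add: gr_functor_def Pi_W_def fh(5,6))
 have "compose (carrier M.A.grS) M.B.unsplit M.FM.grtotal = compose (carrier M.A.grS) (Fun f) M.A.unsplit"
  by (auto simp: compose_def fun_eq_iff M.unsplit_natural)
 then show "gr_iso B \<cdot>\<^bsub>FVect\<^esub> on_arr ?F f = on_arr Pi_W f \<cdot>\<^bsub>FVect\<^esub> gr_iso A"
  unfolding Ff FVect_def FV.CC_simps by (simp add: gr_iso_def Pi_W_def fh(5,6) M.A.filtered_gr_forget)
qed

theorem lemma4p4:
 shows "lax_symmetric_monoidal_functor (MHS :: 'u::infinite mhs_cat) FVect Pi_W \<and>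
  lax_symmetric_monoidal_functor (GrVect :: 'u gvs_cat) FVect U_fil \<and>
  (\<exists>G :: ('u mhs, 'u gvs, 'u) vs_lax_functor.
    lax_symmetric_monoidal_functor MHS GrVect G \<and>
    (\<exists>\<alpha>. monoidal_natural_iso MHS FVect (comp_lax FVect U_fil G) Pi_W \<alpha>)) \<and>
  functor_between (FVect :: 'u fvs_cat) GrVect gr_functor \<and>
  (\<exists>\<alpha>. natural_iso (MHS :: 'u mhs_cat) FVect
    (comp_functor U_fil (comp_functor gr_functor Pi_W)) Pi_W \<alpha>)"
 using Pi_W_lax U_fil_lax weight_grading_lax weight_grading_iso gr_functor gr_natural_iso by blast

end
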